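(* Let $d\ge 2$, let $\Omega\subset\mathbb{R}^d$ be a bounded Lipschitz domain, let $1<p\le \frac{d}{d-1}$, $q=\frac{p}{p-1}$, and let $u\in L^p(\Omega)$, $u^*\in L^q(\Omega)$. Consider the total variation functional $\mathrm{TV}:L^p(\Omega)\to\mathbb{R}\cup\{\infty\}$. Then $u^*\in\partial\,\mathrm{TV}(u)$ if and only if $u\in \mathrm{BV}(\Omega)$ and there exists $g\in W^q_0(\mathrm{div};\Omega)$ with $\|g\|_\infty\le 1$ such that $u^*=-\mathrm{div}\, g$, $g$ belongs to the domain $D$ of the full trace operator $T$ (associated with $u$ and $q$), and $$Tg=\sigma_u\quad\text{in } L^1(\Omega,\mathbb{R}^d;|\mathrm{D}u|),$$ where $\sigma_u$ is the density of $\mathrm{D}u$ with respect to $|\mathrm{D}u|$, i.e. $\mathrm{D}u=\sigma_u|\mathrm{D}u|$.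
   Context: $\mathrm{TV}(u)=\sup\{\int_\Omega u\,\mathrm{div}\,\phi\,\mathrm{d}x : \phi\in C_c^\infty(\Omega,\mathbb{R}^d),\ \|\phi\|_\infty\le 1\}$ (possibly $+\infty$). Here $\|\cdot\|_\infty$ of a vector field is the essential supremum of its pointwise Euclidean norm. $\mathrm{BV}(\Omega)$ is the set of $u\in L^1(\Omega)$ whose distributional gradient is a finite $\mathbb{R}^d$-valued Radon measure $\mathrm{D}u$; $|\mathrm{D}u|$ is its variation measure. The subdifferential is taken with respect to the duality of $L^p(\Omega)$ and $L^q(\Omega)$: $u^*\in\partial\,\mathrm{TV}(u)$ iff $\mathrm{TV}(u)<\infty$ and $\int_\Omega (v-u)u^*\,\mathrm{d}x+\mathrm{TV}(u)\le \mathrm{TV}(v)$ for all $v\in L^p(\Omega)$. For $1\le q<\infty$, $W^q(\mathrm{div};\Omega)$ is the space of $g\in L^q(\Omega,\mathbb{R}^d)$ with weak divergence $\mathrm{div}\, g\in L^q(\Omega)$ (i.e. $\int_\Omega\nabla v\cdot g=-\int_\Omega v\,\mathrm{div}\, g$ for all $v\in C_c^\infty(\Omega)$), with norm $\|g\|_{W^q(\mathrm{div})}^q=\|g\|_{L^q}^q+\|\mathrm{div}\, g\|_{L^q}^q$. $W^q_0(\mathrm{div};\Omega)$ is the closure of $C_c^\infty(\Omega,\mathbb{R}^d)$ in this norm. $C^\infty(\overline\Omega,\mathbb{R}^d)$ denotes the restrictions to $\overline\Omega$ of functions in $C_c^\infty(\mathbb{R}^d,\mathbb{R}^d)$. A point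 $x\in\Omega$ is a Lebesgue point of $g$ if $\lim_{r\to0}\frac{1}{|B(x,r)|}\int_{B(x,r)}|g(y)-g(x)|\,\mathrm{d}y=0$, where $g(x)$ is the value of the fixed representative of $g$ (the continuous representative if $g$ is continuous). Convergence $\overset{\sim}{\to}$: for $g\in W^q(\mathrm{div};\Omega)\cap L^\infty(\Omega,\mathbb{R}^d)$ and $(g_n)\subset C(\overline\Omega,\mathbb{R}^d)\cap W^q(\mathrm{div};\Omega)$, write $g_n\overset{\sim}{\to}g$ if (1) $\|g_n-g\|_{W^q(\mathrm{div})}\to0$, (2) $\|g_n\|_\infty\le\|g\|_\infty$ for all $n$, (3) $g_n(x)\to g(x)$ for every Lebesgue point $x\in\Omega$ of $g$. (Every such $g$ admits a sequence in $C^\infty(\overline\Omega,\mathbb{R}^d)$ with $g_n\overset{\sim}{\to}g$.) Full trace operator: given $u\in\mathrm{BV}(\Omega)$, let $D$ be the set of $g\in W^q(\mathrm{div};\Omega)\cap L^\infty(\Omega,\mathbb{R}^d)$ for which there is $v\in L^1(\Omega,\mathbb{R}^d;|\mathrm{D}u|)$ such that for all sequences $(g_n)\subset C^\infty(\overline\Omega,\mathbb{R}^d)$ with $g_n\overset{\sim}{\to}g$ one has $\|g_n-v\|_{L^1(\Omega,\mathbb{R}^d;|\mathrm{D}u|)}\to0$. For $g\in D$ this $v$ is unique, and $Tg:=v$. So $T:D\to L^1(\Omega,\mathbb{R}^d;|\mathrm{D}u|)$. *)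

theory Defs
  imports "HOL-Analysis.Analysis" "HOL-Probability.Essential_Supremum"
begin

section \<open>Domains and smooth functions\<close>

text \<open>Near every boundary point, after the choice of a unit direction \<open>e\<close>, the set is the strict
  epigraph of a Lipschitz function on the hyperplane orthogonal to \<open>e\<close>.\<close>

definition bounded_lipschitz_domain :: "'a::euclidean_space set \<Rightarrow> bool" where
  "bounded_lipschitz_domain \<Omega> \<longleftrightarrow>
     open \<Omega> \<and> connected \<Omega> \<and> \<Omega> \<noteq> {} \<and> bounded \<Omega> \<and>
     (\<forall>x\<in>frontier \<Omega>. \<exists>e r L \<gamma>. norm e = 1 \<and> 0 < r \<and> L-lipschitz_on {z. z \<bullet> e = 0} \<gamma> \<and>
        (\<forall>y\<in>ball x r. y \<in> \<Omega> \<longleftrightarrow> \<gamma> (y - (y \<bullet> e) *\<^sub>R e) < y \<bullet> e))"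

definition partial_deriv :: "('a::euclidean_space \<Rightarrow> 'b::real_normed_vector) \<Rightarrow> 'a \<Rightarrow> 'a \<Rightarrow> 'b" where
  "partial_deriv f b x = frechet_derivative f (at x) b"

definition gradient :: "('a::euclidean_space \<Rightarrow> real) \<Rightarrow> 'a \<Rightarrow> 'a" where
  "gradient f x = (\<Sum>b\<in>Basis. partial_deriv f b x *\<^sub>R b)"

definition divergence :: "('a::euclidean_space \<Rightarrow> 'a) \<Rightarrow> 'a \<Rightarrow> real" where
  "divergence f x = (\<Sum>b\<in>Basis. partial_deriv f b x \<bullet> b)"

primrec k_smooth :: "nat \<Rightarrow> ('a::euclidean_space \<Rightarrow> 'b::real_normed_vector) \<Rightarrow> bool" where
  "k_smooth 0 f \<longleftrightarrow> continuous_on UNIV f"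
| "k_smooth (Suc k) f \<longleftrightarrow> (\<forall>x. f differentiable (at x)) \<and> (\<forall>b\<in>Basis. k_smooth k (partial_deriv f b))"

text \<open>\<open>C\<^sub>c\<^sup>\<infinity>(\<Omega>)\<close>, each function being extended by zero to the whole space.\<close>

definition test_functions :: "'a::euclidean_space set \<Rightarrow> ('a \<Rightarrow> 'b::real_normed_vector) set" where
  "test_functions \<Omega> =
     {f. (\<forall>k. k_smooth k f) \<and> compact (closure {x. f x \<noteq> 0}) \<and> closure {x. f x \<noteq> 0} \<subseteq> \<Omega>}"

definition smooth_up_to_boundary :: "'a::euclidean_space set \<Rightarrow> ('a \<Rightarrow> 'b::real_normed_vector) set" where
  "smooth_up_to_boundary \<Omega> = {f. \<exists>F\<in>test_functions UNIV. \<forall>x\<in>closure \<Omega>. f x = F x}"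


section \<open>Lebesgue spaces\<close>

text \<open>Elements of \<open>L\<^sup>p(\<Omega>)\<close> are represented by functions, and equality in \<open>L\<^sup>p(\<Omega>)\<close> is equality almost
  everywhere in \<open>\<Omega>\<close>. Values outside \<open>\<Omega>\<close> play no role.\<close>

definition Lp :: "real \<Rightarrow> 'a::euclidean_space set \<Rightarrow> ('a \<Rightarrow> 'b::euclidean_space) set" where
  "Lp p \<Omega> = {f. f \<in> borel_measurable (lebesgue_on \<Omega>) \<and>
                integrable (lebesgue_on \<Omega>) (\<lambda>x. norm (f x) powr p)}"

definition Lp_norm :: "real \<Rightarrow> 'a::euclidean_space set \<Rightarrow> ('a \<Rightarrow> 'b::euclidean_space) \<Rightarrow> real" where
  "Lp_norm p \<Omega> f = (LINT x|lebesgue_on \<Omega>. norm (f x) powr p) powr (1 / p)"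

definition Linf_norm :: "'a::euclidean_space set \<Rightarrow> ('a \<Rightarrow> 'b::euclidean_space) \<Rightarrow> ennreal" where
  "Linf_norm \<Omega> f = esssup (lebesgue_on \<Omega>) (\<lambda>x. ennreal (norm (f x)))"

definition Linf :: "'a::euclidean_space set \<Rightarrow> ('a \<Rightarrow> 'b::euclidean_space) set" where
  "Linf \<Omega> = {f. f \<in> borel_measurable (lebesgue_on \<Omega>) \<and> Linf_norm \<Omega> f < \<infinity>}"

definition locally_integrable :: "'a::euclidean_space set \<Rightarrow> ('a \<Rightarrow> 'b::euclidean_space) \<Rightarrow> bool" where
  "locally_integrable \<Omega> f \<longleftrightarrow> (\<forall>K. compact K \<and> K \<subseteq> \<Omega> \<longrightarrow> integrable (lebesgue_on K) f)"


section \<open>Total variation and its subdifferential\<close>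

definition TV :: "'a::euclidean_space set \<Rightarrow> ('a \<Rightarrow> real) \<Rightarrow> ereal" where
  "TV \<Omega> u = (SUP \<phi>\<in>{\<phi> \<in> test_functions \<Omega>. Linf_norm \<Omega> \<phi> \<le> 1}.
               ereal (LINT x|lebesgue_on \<Omega>. u x * divergence \<phi> x))"

definition subdifferential ::
  "real \<Rightarrow> real \<Rightarrow> 'a::euclidean_space set \<Rightarrow> (('a \<Rightarrow> real) \<Rightarrow> ereal) \<Rightarrow> ('a \<Rightarrow> real) \<Rightarrow> ('a \<Rightarrow> real) set" where
  "subdifferential p q \<Omega> F u =
     {w \<in> Lp q \<Omega>. F u < \<infinity> \<and>
        (\<forall>v\<in>Lp p \<Omega>. ereal (LINT x|lebesgue_on \<Omega>. (v x - u x) * w x) + F u \<le> F v)}"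


section \<open>Vector measures\<close>

text \<open>A countably additive set function with values in a Euclidean space, on the Borel subsets of
  \<open>\<Omega>\<close>; every such set function is a finite Radon measure when \<open>\<Omega>\<close> is open.\<close>

definition vector_measure :: "'a::euclidean_space set \<Rightarrow> ('a set \<Rightarrow> 'b::euclidean_space) \<Rightarrow> bool" where
  "vector_measure \<Omega> m \<longleftrightarrow>
     (\<forall>A :: nat \<Rightarrow> 'a set. range A \<subseteq> sets (restrict_space borel \<Omega>) \<and> disjoint_family A \<longrightarrow>
        (\<lambda>n. m (A n)) sums m (\<Union>n. A n))"

definition variation_measure :: "'a::euclidean_space set \<Rightarrow> ('a set \<Rightarrow> 'b::euclidean_space) \<Rightarrow> 'a measure" where
  "variation_measure \<Omega> m =
     measure_of \<Omega> (sets (restrict_space borel \<Omega>))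
       (\<lambda>E. SUP A\<in>{A :: nat \<Rightarrow> 'a set. range A \<subseteq> sets (restrict_space borel \<Omega>) \<and>
                     disjoint_family A \<and> (\<Union>n. A n) = E}.
              (\<Sum>n. ennreal (norm (m (A n)))))"

text \<open>The positive part of the Jordan decomposition of a real-valued measure.\<close>

definition positive_part :: "'a::euclidean_space set \<Rightarrow> ('a set \<Rightarrow> real) \<Rightarrow> 'a measure" where
  "positive_part \<Omega> m =
     measure_of \<Omega> (sets (restrict_space borel \<Omega>))
       (\<lambda>E. ennreal ((measure (variation_measure \<Omega> m) E + m E) / 2))"

definition signed_integral :: "'a::euclidean_space set \<Rightarrow> ('a set \<Rightarrow> real) \<Rightarrow> ('a \<Rightarrow> real) \<Rightarrow> real" where
  "signed_integral \<Omega> m f =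
     (LINT x|positive_part \<Omega> m. f x) - (LINT x|positive_part \<Omega> (\<lambda>E. - m E). f x)"


section \<open>Functions of bounded variation\<close>

definition has_gradient_measure ::
  "'a::euclidean_space set \<Rightarrow> ('a \<Rightarrow> real) \<Rightarrow> ('a set \<Rightarrow> 'a) \<Rightarrow> bool" where
  "has_gradient_measure \<Omega> u m \<longleftrightarrow> vector_measure \<Omega> m \<and>
     (\<forall>\<phi>\<in>test_functions \<Omega>. \<forall>b\<in>Basis.
        (LINT x|lebesgue_on \<Omega>. u x * partial_deriv \<phi> b x) = - signed_integral \<Omega> (\<lambda>E. m E \<bullet> b) \<phi>)"

definition BV :: "'a::euclidean_space set \<Rightarrow> ('a \<Rightarrow> real) set" where
  "BV \<Omega> = {u \<in> Lp 1 \<Omega>. \<exists>m. has_gradient_measure \<Omega> u m}"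

text \<open>For \<open>u \<in> BV \<Omega>\<close>, the measure \<open>Du\<close> is unique as a set function on the Borel subsets of \<open>\<Omega>\<close>, and
  its density \<open>\<sigma>\<^sub>u\<close> with respect to \<open>|Du|\<close> is unique \<open>|Du|\<close>-almost everywhere.\<close>

definition gradient_measure :: "'a::euclidean_space set \<Rightarrow> ('a \<Rightarrow> real) \<Rightarrow> 'a set \<Rightarrow> 'a" where
  "gradient_measure \<Omega> u = (SOME m. has_gradient_measure \<Omega> u m)"

definition total_variation_measure :: "'a::euclidean_space set \<Rightarrow> ('a \<Rightarrow> real) \<Rightarrow> 'a measure" where
  "total_variation_measure \<Omega> u = variation_measure \<Omega> (gradient_measure \<Omega> u)"

definition gradient_density :: "'a::euclidean_space set \<Rightarrow> ('a \<Rightarrow> real) \<Rightarrow> 'a \<Rightarrow> 'a" where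
  "gradient_density \<Omega> u =
     (SOME \<sigma>. integrable (total_variation_measure \<Omega> u) \<sigma> \<and>
        (\<forall>E\<in>sets (restrict_space borel \<Omega>).
           gradient_measure \<Omega> u E = (LINT x:E|total_variation_measure \<Omega> u. \<sigma> x)))"


section \<open>Fields with weak divergence\<close>

definition has_weak_div :: "'a::euclidean_space set \<Rightarrow> ('a \<Rightarrow> 'a) \<Rightarrow> ('a \<Rightarrow> real) \<Rightarrow> bool" where
  "has_weak_div \<Omega> g h \<longleftrightarrow> locally_integrable \<Omega> g \<and> locally_integrable \<Omega> h \<and>
     (\<forall>v\<in>test_functions \<Omega>.
        (LINT x|lebesgue_on \<Omega>. gradient v x \<bullet> g x) = - (LINT x|lebesgue_on \<Omega>. v x * h x))"

text \<open>Unique up to equality almost everywhere in the open set \<open>\<Omega>\<close>.\<close>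

definition weak_div :: "'a::euclidean_space set \<Rightarrow> ('a \<Rightarrow> 'a) \<Rightarrow> 'a \<Rightarrow> real" where
  "weak_div \<Omega> g = (SOME h. has_weak_div \<Omega> g h)"

definition Wdiv :: "real \<Rightarrow> 'a::euclidean_space set \<Rightarrow> ('a \<Rightarrow> 'a) set" where
  "Wdiv q \<Omega> = {g \<in> Lp q \<Omega>. \<exists>h\<in>Lp q \<Omega>. has_weak_div \<Omega> g h}"

definition Wdiv_norm :: "real \<Rightarrow> 'a::euclidean_space set \<Rightarrow> ('a \<Rightarrow> 'a) \<Rightarrow> real" where
  "Wdiv_norm q \<Omega> g = (Lp_norm q \<Omega> g powr q + Lp_norm q \<Omega> (weak_div \<Omega> g) powr q) powr (1 / q)"

definition Wdiv0 :: "real \<Rightarrow> 'a::euclidean_space set \<Rightarrow> ('a \<Rightarrow> 'a) set" where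
  "Wdiv0 q \<Omega> =
     {g \<in> Wdiv q \<Omega>. \<forall>\<epsilon>>0. \<exists>\<phi>\<in>test_functions \<Omega>. Wdiv_norm q \<Omega> (\<lambda>x. g x - \<phi> x) < \<epsilon>}"


section \<open>The full trace operator\<close>

text \<open>The notion of Lebesgue point refers to a fixed representative of each class of measurable
  fields modulo equality almost everywhere. The parameter \<open>R\<close> is such a choice: it sends every field
  to the fixed representative of its class, the continuous one if there is one.\<close>

definition representative_choice :: "'a::euclidean_space set \<Rightarrow> (('a \<Rightarrow> 'a) \<Rightarrow> 'a \<Rightarrow> 'a) \<Rightarrow> bool" where
  "representative_choice \<Omega> R \<longleftrightarrow>
     (\<forall>g\<in>borel_measurable (lebesgue_on \<Omega>).
        (AE x in lebesgue_on \<Omega>. R g x = g x) \<and>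
        (\<forall>h\<in>borel_measurable (lebesgue_on \<Omega>).
           (AE x in lebesgue_on \<Omega>. g x = h x) \<longrightarrow> (\<forall>x\<in>\<Omega>. R g x = R h x)) \<and>
        (continuous_on \<Omega> g \<longrightarrow> (\<forall>x\<in>\<Omega>. R g x = g x)))"

text \<open>If \<open>x\<close> lies in the open set \<open>\<Omega>\<close>, the balls are contained in \<open>\<Omega>\<close> for all small radii.\<close>

definition lebesgue_point :: "('a::euclidean_space \<Rightarrow> 'a) \<Rightarrow> 'a \<Rightarrow> bool" where
  "lebesgue_point g x \<longleftrightarrow>
     ((\<lambda>r. (1 / measure lebesgue (ball x r)) * (LINT y|lebesgue_on (ball x r). norm (g y - g x)))
        \<longlongrightarrow> 0) (at_right 0)"

definition tilde_converges ::
  "(('a \<Rightarrow> 'a) \<Rightarrow> 'a \<Rightarrow> 'a) \<Rightarrow> real \<Rightarrow> 'a::euclidean_space set \<Rightarrow> (nat \<Rightarrow> 'a \<Rightarrow> 'a) \<Rightarrow> ('a \<Rightarrow> 'a) \<Rightarrow> bool" where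
  "tilde_converges R q \<Omega> gs g \<longleftrightarrow>
     g \<in> Wdiv q \<Omega> \<inter> Linf \<Omega> \<and>
     (\<forall>n. continuous_on (closure \<Omega>) (gs n) \<and> gs n \<in> Wdiv q \<Omega>) \<and>
     (\<lambda>n. Wdiv_norm q \<Omega> (\<lambda>x. gs n x - g x)) \<longlonglongrightarrow> 0 \<and>
     (\<forall>n. Linf_norm \<Omega> (gs n) \<le> Linf_norm \<Omega> g) \<and>
     (\<forall>x\<in>\<Omega>. lebesgue_point (R g) x \<longrightarrow> (\<lambda>n. gs n x) \<longlonglongrightarrow> R g x)"

definition is_full_trace ::
  "(('a \<Rightarrow> 'a) \<Rightarrow> 'a \<Rightarrow> 'a) \<Rightarrow> real \<Rightarrow> 'a::euclidean_space set \<Rightarrow> ('a \<Rightarrow> real) \<Rightarrow> ('a \<Rightarrow> 'a) \<Rightarrow> ('a \<Rightarrow> 'a) \<Rightarrow> bool" where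
  "is_full_trace R q \<Omega> u g v \<longleftrightarrow>
     integrable (total_variation_measure \<Omega> u) v \<and>
     (\<forall>gs. (\<forall>n. gs n \<in> smooth_up_to_boundary \<Omega>) \<and> tilde_converges R q \<Omega> gs g \<longrightarrow>
        (\<lambda>n. LINT x|total_variation_measure \<Omega> u. norm (gs n x - v x)) \<longlonglongrightarrow> 0)"

definition full_trace_domain ::
  "(('a \<Rightarrow> 'a) \<Rightarrow> 'a \<Rightarrow> 'a) \<Rightarrow> real \<Rightarrow> 'a::euclidean_space set \<Rightarrow> ('a \<Rightarrow> real) \<Rightarrow> ('a \<Rightarrow> 'a) set" where
  "full_trace_domain R q \<Omega> u = {g \<in> Wdiv q \<Omega> \<inter> Linf \<Omega>. \<exists>v. is_full_trace R q \<Omega> u g v}"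

text \<open>Unique up to equality \<open>|Du|\<close>-almost everywhere for \<open>g\<close> in the domain.\<close>

definition full_trace ::
  "(('a \<Rightarrow> 'a) \<Rightarrow> 'a \<Rightarrow> 'a) \<Rightarrow> real \<Rightarrow> 'a::euclidean_space set \<Rightarrow> ('a \<Rightarrow> real) \<Rightarrow> ('a \<Rightarrow> 'a) \<Rightarrow> 'a \<Rightarrow> 'a" where
  "full_trace R q \<Omega> u g = (SOME v. is_full_trace R q \<Omega> u g v)"

end

theory Submission
  imports Defs "HOL-Computational_Algebra.Polynomial"
begin

text \<open>
  The functional TV is positively homogeneous, so \<open>u*\<close> is a subgradient at \<open>u\<close> iff
  \<open>TV(u) = \<integral> u u*\<close> and \<open>\<integral> v u* \<le> TV(v)\<close> for all \<open>v\<close>. The second condition says that \<open>u*\<close> is the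
  limit of \<open>- div \<phi>\<close> for test fields with \<open>\<bar>\<phi>\<bar> \<le> 1\<close>: the \<open>L\<^sup>2\<close> projection of \<open>- u*\<close> onto the closed convex set of
  their divergences leaves a residual \<open>s\<close> with \<open>TV(s) \<le> \<integral> s u* - \<integral> s\<^sup>2\<close>, hence \<open>s = 0\<close> (here \<open>p \<le> 2 \<le> q\<close>).
  Choosing fields of almost minimal norm makes them converge strongly to some \<open>g\<close>. On a Lipschitz domain
  \<open>g\<close> is then approximated by test fields, mollifying with kernels shifted out of the domain near the boundary.

  For test fields \<open>\<phi>\<^sub>n\<close> tending to \<open>g\<close> the first condition reads \<open>\<integral> (1 - \<phi>\<^sub>n \<bullet> \<sigma>) d|Du| \<longlonglongrightarrow> 0\<close>, and
  \<open>\<bar>\<phi>\<^sub>n - \<sigma>\<bar>\<^sup>2 \<le> 2 (1 - \<phi>\<^sub>n \<bullet> \<sigma>)\<close> turns it into convergence of \<open>\<phi>\<^sub>n\<close> to \<open>\<sigma>\<close>. Multiplying by cutoff functions carries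
  this over to all sequences converging to \<open>g\<close>, because \<open>\<integral> \<theta> F\<^sub>n \<bullet> \<sigma> d|Du|\<close> depends only on \<open>F\<^sub>n\<close> and \<open>div F\<^sub>n\<close> in \<open>L\<^sup>q\<close>.
\<close>

section \<open>Smooth functions\<close>

text \<open>Separation and weak compactness are replaced throughout by minimisation in L^2, where
  the parallelogram law makes minimising sequences converge strongly; the measure Du is obtained in
  this way as well. On a bounded domain L^q lies in L^2 and L^2 in L^p, since d >= 2 gives p <= 2.
  The first inclusion allows \<open>ustar\<close> to be projected, the second admits the residual as
  a competitor for TV. The approximating fields have compact support, so their limit g satisfies
  integration by parts even against functions that do not vanish on the boundary. Equivalently, g
  and its divergence, both extended by zero, are still a field and its divergence on the whole
  space. Mollification across the boundary rests on this. The obstacle on the side of the trace is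
  that |Du| may charge Lebesgue null sets, so closeness in L^q says nothing |Du|-almost everywhere.
  Only pairings with Du under a compactly supported cutoff are controlled; what the cutoff leaves
  out is small because |Du| is finite.\<close>

lemma k_smooth_continuous: "k_smooth k f ==> continuous_on UNIV f"
 by (cases k) (auto intro!: differentiable_imp_continuous_on simp: differentiable_on_def differentiable_at_withinI)

text \<open>The recursion of \<open>k_smooth\<close> speaks of continuity only at order 0, so lower
  orders are recovered by induction on the partial derivatives; at order 0 differentiability gives
  continuity.\<close>

lemma k_smooth_SucD: "k_smooth (Suc k) f ==> k_smooth k f"
proof (induction k arbitrary: f)
 case 0
 then show ?case using k_smooth_continuous[of "Suc 0" f] by simp
next
 case (Suc k)
 from Suc.prems have "\<forall>x. f differentiable at x" "\<forall>b\<in>Basis. k_smooth (Suc k) (partial_deriv f b)"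
  unfolding k_smooth.simps(2)[of "Suc k"] by blast+
 then have "\<forall>x. f differentiable at x" "\<forall>b\<in>Basis. k_smooth k (partial_deriv f b)"
  using Suc.IH by blast+
 then show ?case unfolding k_smooth.simps(2)[of k f] by blast
qed

lemma partial_deriv_eqI:
 assumes "(f has_derivative f') (at x)"
 shows "partial_deriv f b x = f' b"
 unfolding partial_deriv_def using frechet_derivative_at[OF assms] by simp

text \<open>Smoothness can be introduced through any derivative produced by the
  \<open>has_derivative\<close> rules, so \<open>frechet_derivative\<close> never has to be
  evaluated for a composed function.\<close>

lemma k_smooth_SucI:
 assumes "\<And>x. (f has_derivative f' x) (at x)"
  and "\<And>b. b \<in> Basis ==> k_smooth k (%x. f' x b)"
 shows "k_smooth (Suc k) f"
proof -
 have "partial_deriv f b = (%x. f' x b)" for b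
  using partial_deriv_eqI[OF assms(1)] by (auto simp: fun_eq_iff)
 then show ?thesis using assms by (auto simp: differentiable_def)
qed

lemma k_smooth_SucE:
 assumes "k_smooth (Suc k) f"
 obtains "\<And>x. (f has_derivative frechet_derivative f (at x)) (at x)"
  "\<And>b. b \<in> Basis ==> k_smooth k (%x. frechet_derivative f (at x) b)"
 using assms by (auto simp: frechet_derivative_works partial_deriv_def[abs_def])

lemma k_smooth_const: "k_smooth k (%x. c)"
proof (induction k arbitrary: c)
 case (Suc k)
 show ?case by (rule k_smooth_SucI[where f'="%x h. 0"]) (use Suc in auto)
qed auto

lemma k_smooth_add: "k_smooth k f ==> k_smooth k g ==> k_smooth k (%x. f x + g x)"
proof (induction k arbitrary: f g)
 case (Suc k)
 show ?case
  by (rule k_smooth_SucE[OF Suc.prems(1)], rule k_smooth_SucE[OF Suc.prems(2)],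
    rule k_smooth_SucI[OF has_derivative_add]) (auto intro!: Suc.IH)
qed (auto intro: continuous_intros)

lemma k_smooth_sum:
 fixes f :: "'i => 'a::euclidean_space => 'b::real_normed_vector"
 shows "(\<And>i. i \<in> I ==> k_smooth k (f i)) ==> k_smooth k (%x. \<Sum>i\<in>I. f i x)"
 by (induction I rule: infinite_finite_induct) (auto intro: k_smooth_const k_smooth_add)

lemma k_smooth_linear:
 assumes "bounded_linear L"
 shows "k_smooth k f ==> k_smooth k (%x. L (f x))"
proof (induction k arbitrary: f)
 case 0
 then show ?case using assms by (auto intro: linear_continuous_on_compose bounded_linear.continuous_on)
next
 case (Suc k)
 show ?case
  by (rule k_smooth_SucE[OF Suc.prems], rule k_smooth_SucI[OF bounded_linear.has_derivative[OF assms]])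
   (auto intro!: Suc.IH)
qed

lemma k_smooth_bilinear:
 assumes "bounded_bilinear pr"
 shows "k_smooth k f ==> k_smooth k g ==> k_smooth k (%x. pr (f x) (g x))"
proof (induction k arbitrary: f g)
 case 0
 then show ?case using assms by (auto intro: bounded_bilinear.continuous_on)
next
 case (Suc k)
 show ?case
  by (rule k_smooth_SucE[OF Suc.prems(1)], rule k_smooth_SucE[OF Suc.prems(2)],
    rule k_smooth_SucI[OF bounded_bilinear.FDERIV[OF assms]])
   (auto intro!: Suc.IH k_smooth_add k_smooth_SucD[OF Suc.prems(1)] k_smooth_SucD[OF Suc.prems(2)])
qed

lemma k_smooth_affine: "k_smooth k f ==> k_smooth k (%x. f (c *\<^sub>R x + a))"
proof (induction k arbitrary: f)
 case 0
 then show ?case by (auto intro!: continuous_on_compose2[of UNIV f] continuous_intros)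
next
 case (Suc k)
 show ?case
 proof (rule k_smooth_SucE[OF Suc.prems])
  assume d: "\<And>x. (f has_derivative frechet_derivative f (at x)) (at x)"
   "\<And>b. b \<in> Basis ==> k_smooth k (%x. frechet_derivative f (at x) b)"
  show ?thesis
  proof (rule k_smooth_SucI[where f'="%x h. frechet_derivative f (at (c *\<^sub>R x + a)) (c *\<^sub>R h)"])
   show "((%x. f (c *\<^sub>R x + a)) has_derivative (%h. frechet_derivative f (at (c *\<^sub>R x + a)) (c *\<^sub>R h))) (at x)" for x
    by (rule has_derivative_compose[OF _ d(1)]) (auto intro!: derivative_eq_intros)
   fix b :: 'a assume "b \<in> Basis"
   have "linear (frechet_derivative f (at x))" for x
    using d(1)[of x] by (rule has_derivative_linear)
   then have eq: "frechet_derivative f (at x) (c *\<^sub>R b) = c *\<^sub>R frechet_derivative f (at x) b" for x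
    by (simp add: linear_scale)
   show "k_smooth k (%x. frechet_derivative f (at (c *\<^sub>R x + a)) (c *\<^sub>R b))"
    unfolding eq using Suc.IH[OF d(2)[OF \<open>b \<in> Basis\<close>]]
    by (rule k_smooth_linear[OF bounded_linear_scaleR_right])
  qed
 qed
qed

lemma k_smooth_prod:
 fixes f :: "'i => 'a::euclidean_space => real"
 shows "(\<And>i. i \<in> I ==> k_smooth k (f i)) ==> k_smooth k (%x. \<Prod>i\<in>I. f i x)"
 by (induction I rule: infinite_finite_induct)
  (auto intro: k_smooth_const k_smooth_bilinear[OF bounded_bilinear_mult])

lemma frechet_derivative_partial:
 assumes "f differentiable (at x)"
 shows "frechet_derivative f (at x) h = (\<Sum>b\<in>Basis. (h \<bullet> b) *\<^sub>R partial_deriv f b x)"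
proof -
 have "linear (frechet_derivative f (at x))"
  using assms frechet_derivative_works has_derivative_linear by blast
 then show ?thesis
  unfolding partial_deriv_def
  by (subst (1) euclidean_representation[of h, symmetric]) (simp add: linear_sum linear_scale)
qed

text \<open>Any compact set off which the function vanishes can replace the closure of the nonzero
  set, so supports of sums, products and mollifications need not be determined exactly.\<close>

lemma test_functionsI:
 assumes "\<And>k. k_smooth k f" "compact S" "S \<subseteq> U" "\<And>x. x \<notin> S ==> f x = 0"
 shows "f \<in> test_functions U"
proof -
 have "closure {x. f x \<noteq> 0} \<subseteq> S"
  using assms by (intro closure_minimal compact_imp_closed) auto
 then show ?thesis
  using assms unfolding test_functions_def
  by (auto simp: compact_eq_bounded_closed intro: bounded_subset)
qed

lemma test_support:
 assumes "f \<in> test_functions U"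
 shows "\<exists>S. compact S \<and> S \<subseteq> U \<and> (\<forall>x. x \<notin> S --> f x = 0)"
 using assms closure_subset[of "{x. f x \<noteq> 0}"] unfolding test_functions_def
 by (intro exI[of _ "closure {x. f x \<noteq> 0}"]) blast

lemma test_smooth: "f \<in> test_functions U ==> k_smooth k f"
 by (simp add: test_functions_def)

lemma test_differentiable: "f \<in> test_functions U ==> f differentiable (at x)"
 using test_smooth[of f U "Suc 0"] by simp

lemma test_has_derivative:
 "f \<in> test_functions U ==> (f has_derivative frechet_derivative f (at x)) (at x)"
 using test_differentiable frechet_derivative_works by blast

lemma test_continuous: "f \<in> test_functions U ==> continuous_on S f"
 using k_smooth_continuous test_smooth continuous_on_subset by (metis subset_UNIV)

lemma test_measurable [measurable_dest]: "f \<in> test_functions U ==> f \<in> borel_measurable borel"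
 by (intro borel_measurable_continuous_onI test_continuous)

lemma test_mono: "f \<in> test_functions U ==> U \<subseteq> V ==> f \<in> test_functions V"
 by (auto simp: test_functions_def)

lemma test_outside: "f \<in> test_functions U ==> x \<notin> U ==> f x = 0"
 using test_support by blast

lemma test_zero: "(%x. 0) \<in> test_functions U"
 by (rule test_functionsI[of _ "{}"]) (auto intro: k_smooth_const)

lemma test_add:
 assumes "f \<in> test_functions U" "g \<in> test_functions U"
 shows "(%x. f x + g x) \<in> test_functions U"
proof -
 obtain S where S: "compact S" "S \<subseteq> U" "\<And>x. x \<notin> S ==> f x = 0" using test_support[OF assms(1)] by blast
 obtain T where T: "compact T" "T \<subseteq> U" "\<And>x. x \<notin> T ==> g x = 0" using test_support[OF assms(2)] by blast
 show ?thesis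
  by (rule test_functionsI[of _ "S \<union> T"])
   (use S T k_smooth_add[OF test_smooth[OF assms(1)] test_smooth[OF assms(2)]] in auto)
qed

lemma test_sum:
 "(\<And>i. i \<in> I ==> f i \<in> test_functions U) ==> (%x. \<Sum>i\<in>I. f i x) \<in> test_functions U"
 by (induction I rule: infinite_finite_induct) (auto intro: test_zero test_add)

lemma test_linear:
 assumes "bounded_linear L" "f \<in> test_functions U"
 shows "(%x. L (f x)) \<in> test_functions U"
proof -
 obtain S where "compact S" "S \<subseteq> U" "\<And>x. x \<notin> S ==> f x = 0" using test_support[OF assms(2)] by blast
 then show ?thesis
  by (intro test_functionsI[of _ S] k_smooth_linear[OF assms(1)] test_smooth[OF assms(2)])
   (simp_all add: linear_0[OF bounded_linear.linear[OF assms(1)]])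
qed

lemmas test_scaleR = test_linear[OF bounded_linear_scaleR_right]
lemmas test_minus = test_linear[OF bounded_linear_minus[OF bounded_linear_ident]]

lemma test_diff:
 "f \<in> test_functions U ==> g \<in> test_functions U ==> (%x. f x - g x) \<in> test_functions U"
 using test_add[OF _ test_minus, of f U g] by simp

lemma test_bilinear:
 assumes p: "bounded_bilinear pr" and "f \<in> test_functions U" "\<And>k. k_smooth k g"
 shows "(%x. pr (f x) (g x)) \<in> test_functions U"
proof -
 obtain S where "compact S" "S \<subseteq> U" "\<And>x. x \<notin> S ==> f x = 0" using test_support[OF assms(2)] by blast
 then show ?thesis
  by (intro test_functionsI[of _ S] k_smooth_bilinear[OF p] test_smooth[OF assms(2)] assms(3))
   (simp_all add: bounded_bilinear.zero_left[OF p])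
qed

lemma test_partial_deriv:
 assumes "f \<in> test_functions U" "b \<in> Basis"
 shows "partial_deriv f b \<in> test_functions U"
proof -
 obtain S where S: "compact S" "S \<subseteq> U" "\<And>x. x \<notin> S ==> f x = 0" using test_support[OF assms(1)] by blast
 show ?thesis
 proof (rule test_functionsI[OF _ S(1,2)])
  show "k_smooth k (partial_deriv f b)" for k
   using test_smooth[OF assms(1), of "Suc k"] assms(2) by simp
  fix x assume "x \<notin> S"
  have "((%x. 0) has_derivative (%h. 0)) (at x)" by simp
  then have "(f has_derivative (%h. 0)) (at x)"
   by (rule has_derivative_transform_within_open[of _ _ _ _ "- S"])
    (use S \<open>x \<notin> S\<close> in \<open>auto simp: compact_imp_closed open_Compl\<close>)
  then show "partial_deriv f b x = 0" by (rule partial_deriv_eqI)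
 qed
qed

lemma test_affine:
 assumes "f \<in> test_functions UNIV" "c \<noteq> 0"
 shows "(%x. f (c *\<^sub>R x + a)) \<in> test_functions UNIV"
proof -
 obtain S where S: "compact S" "\<And>x. x \<notin> S ==> f x = 0" using test_support[OF assms(1)] by blast
 let ?T = "(%y. (1/c) *\<^sub>R (y - a)) ` S"
 have "x \<in> ?T" if "c *\<^sub>R x + a \<in> S" for x
  using that assms(2) by (intro image_eqI[of _ _ "c *\<^sub>R x + a"]) auto
 then have "f (c *\<^sub>R x + a) = 0" if "x \<notin> ?T" for x
  using that S(2) by blast
 moreover have "compact ?T" by (intro compact_continuous_image S continuous_intros)
 ultimately show ?thesis
  by (intro test_functionsI[of _ ?T] k_smooth_affine test_smooth[OF assms(1)]) auto
qed

lemma test_inner: "f \<in> test_functions U ==> (%x. f x \<bullet> b) \<in> test_functions U"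
 by (rule test_linear[OF bounded_linear_inner_left])

lemma test_scaleR_const: "f \<in> test_functions U ==> (%x. f x *\<^sub>R b) \<in> test_functions U"
 by (rule test_linear[OF bounded_linear_scaleR_left])

lemma test_bounded:
 assumes "f \<in> test_functions U"
 obtains B where "B > 0" "\<And>x. norm (f x) <= B"
proof -
 obtain S where S: "compact S" "\<And>x. x \<notin> S ==> f x = 0" using test_support[OF assms(1)] by blast
 have "bounded (f ` S)"
  by (intro compact_imp_bounded compact_continuous_image test_continuous[OF assms] S)
 then obtain B where "B > 0" "\<And>x. x \<in> S ==> norm (f x) <= B" by (auto simp: bounded_pos)
 then have "norm (f x) <= B" for x using S(2)[of x] by (cases "x \<in> S") auto
 with \<open>B > 0\<close> that show ?thesis by blast
qed

lemma test_integrable: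
 fixes f :: "'a::euclidean_space => 'b::euclidean_space"
 assumes "f \<in> test_functions U"
 shows "integrable lborel f"
proof -
 obtain S where S: "compact S" "\<And>x. x \<notin> S ==> f x = 0" using test_support[OF assms(1)] by blast
 have "integrable lborel (%x. indicator S x *\<^sub>R f x)"
  by (rule borel_integrable_compact[OF S(1) test_continuous[OF assms]])
 also have "(%x. indicator S x *\<^sub>R f x) = f" using S(2) by (auto simp: indicator_def fun_eq_iff)
 finally show ?thesis .
qed

lemma compact_support_uniformly_continuous:
 assumes f: "continuous_on UNIV f" and S: "compact S" "\<And>x. x \<notin> S ==> f x = (0::'b::real_normed_vector)"
 shows "uniformly_continuous_on UNIV (f :: 'a::euclidean_space => 'b)"
proof -
 obtain r where r: "\<And>x. x \<in> S ==> norm x <= r"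
  using compact_imp_bounded[OF S(1)] unfolding bounded_iff by blast
 \<comment> \<open>The margin 1 ensures that two points at distance less than 1, one of them outside
   this ball, both lie outside \<open>S\<close>.\<close>
 have u: "uniformly_continuous_on (cball 0 (r+1)) f"
  by (rule compact_uniformly_continuous[OF continuous_on_subset[OF f] compact_cball]) (simp)
 show ?thesis
  unfolding uniformly_continuous_on_def
 proof (intro allI impI)
  fix e :: real assume "e > 0"
  then obtain d where d: "d > 0" "\<forall>x\<in>cball 0 (r+1). \<forall>y\<in>cball 0 (r+1). dist y x < d --> dist (f y) (f x) < e"
   using u unfolding uniformly_continuous_on_def by blast
  have "dist (f y) (f x) < e" if xy: "dist y x < min d 1" for x y
  proof (cases "norm x <= r + 1 \<and> norm y <= r + 1")
   case True then show ?thesis using d(2) xy by simp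
  next
   case False
   have "norm (y - x) < 1" using xy by (simp add: dist_norm)
   then have "norm x > r" "norm y > r"
    using norm_triangle_ineq2[of y x] norm_triangle_ineq2[of x y] norm_minus_commute[of x y] False
    by (smt (verit))+
   then have "x \<notin> S" "y \<notin> S" using r by (meson not_le)+
   then show ?thesis using S(2) \<open>e > 0\<close> by simp
  qed
  moreover have "min d 1 > 0" using d(1) by simp
  ultimately show "\<exists>d>0. \<forall>x\<in>UNIV. \<forall>x'\<in>UNIV. dist x' x < d --> dist (f x') (f x) < e"
   by blast
 qed
qed

lemma test_uniformly_continuous:
 assumes f: "f \<in> test_functions U"
 shows "uniformly_continuous_on UNIV f"
proof -
 obtain S where "compact S" "\<forall>x. x \<notin> S --> f x = 0"
  using test_support[OF f] by blast
 then show ?thesis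
  by (intro compact_support_uniformly_continuous[of f S] test_continuous[OF f]) auto
qed

section \<open>Flat exponentials and bump functions\<close>

definition flat_exp :: "real poly => real => real" where
 "flat_exp P t = (if t > 0 then poly P (1 / t) * exp (- (1 / t)) else 0)"

lemma poly_times_exp_tendsto_0: "((%s. poly P s * exp (- s)) \<longlongrightarrow> (0::real)) at_top"
proof -
 have "((%s. \<Sum>i\<le>degree P. coeff P i * (s ^ i / exp s)) \<longlongrightarrow> (\<Sum>i\<le>degree P. coeff P i * 0)) at_top"
  by (intro tendsto_sum tendsto_mult tendsto_const tendsto_power_div_exp_0)
 moreover have "(\<Sum>i\<le>degree P. coeff P i * (s ^ i / exp s)) = poly P s * exp (- s)" for s
  by (simp add: poly_altdef exp_minus sum_distrib_right divide_inverse mult.assoc)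
 ultimately show ?thesis by simp
qed

text \<open>The functions P(1/t) exp(-1/t), extended by 0, are closed under differentiation: with s
  = 1/t the derivative is s^2 (P - P')(s) exp(-s), and the two \<open>pCons 0\<close> are the factor
  s^2. Hence each of them is smooth. At t = 0 the difference quotient from the right is s P(s)
  exp(-s), which tends to 0.\<close>

lemma flat_exp_deriv:
 "(flat_exp P has_real_derivative flat_exp (pCons 0 (pCons 0 (P - pderiv P))) t) (at t)"
proof -
 consider "t > 0" | "t < 0" | "t = 0" by linarith
 then show ?thesis
 proof cases
  case 1
  have "((%t. poly P (1 / t) * exp (- (1 / t))) has_real_derivative
    flat_exp (pCons 0 (pCons 0 (P - pderiv P))) t) (at t)"
   using 1 by (auto intro!: derivative_eq_intros DERIV_chain2[OF poly_DERIV] simp: flat_exp_def)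
    (simp add: field_simps power2_eq_square)
  then show ?thesis
   by (rule has_field_derivative_transform_within_open[of _ _ _ "{0<..}"]) (use 1 in \<open>auto simp: flat_exp_def\<close>)
 next
  case 2
  have "((%t. 0) has_real_derivative flat_exp (pCons 0 (pCons 0 (P - pderiv P))) t) (at t)"
   using 2 by (auto simp: flat_exp_def)
  then show ?thesis
   by (rule has_field_derivative_transform_within_open[of _ _ _ "{..<0}"]) (use 2 in \<open>auto simp: flat_exp_def\<close>)
 next
  case 3
  have "((%h. flat_exp P h / h) \<longlongrightarrow> 0) (at_left 0)"
   by (rule Lim_transform_eventually[OF tendsto_const]) (auto simp: flat_exp_def eventually_at_left_field intro!: exI[of _ "-1"])
  moreover have "((%h. flat_exp P h / h) \<longlongrightarrow> 0) (at_right 0)"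
  proof -
   have "((%h. poly (pCons 0 P) (inverse h) * exp (- inverse h)) \<longlongrightarrow> 0) (at_right (0::real))"
    by (rule filterlim_compose[OF poly_times_exp_tendsto_0 filterlim_inverse_at_top_right])
   then show ?thesis
    by (rule Lim_transform_eventually)
     (auto simp: flat_exp_def eventually_at_right_field field_simps intro!: exI[of _ 1])
  qed
  ultimately have "((%h. flat_exp P h / h) \<longlongrightarrow> 0) (at 0)"
   by (simp add: filterlim_at_split)
  then show ?thesis using 3 by (simp add: DERIV_def flat_exp_def)
 qed
qed

lemma k_smooth_flat_exp: "k_smooth k (%x::'a::euclidean_space. flat_exp P (x \<bullet> v + c))"
proof (induction k arbitrary: P)
 case 0
 have "continuous_on UNIV (flat_exp P)"
  using flat_exp_deriv by (intro continuous_at_imp_continuous_on) (blast intro: DERIV_isCont)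
 then show ?case by (auto intro!: continuous_on_compose2[of UNIV "flat_exp P"] continuous_intros)
next
 case (Suc k)
 let ?Q = "pCons 0 (pCons 0 (P - pderiv P))"
 show ?case
 proof (rule k_smooth_SucI)
  show "((%x. flat_exp P (x \<bullet> v + c)) has_derivative (%h. (h \<bullet> v) *\<^sub>R flat_exp ?Q (x \<bullet> v + c))) (at x)" for x
  proof -
   have "((%x. x \<bullet> v + c) has_derivative (%h. h \<bullet> v)) (at x)"
    by (auto intro!: derivative_eq_intros)
   moreover have "(flat_exp P has_derivative (%h. h * flat_exp ?Q (x \<bullet> v + c))) (at (x \<bullet> v + c))"
    using flat_exp_deriv[of P "x \<bullet> v + c"] by (simp add: has_field_derivative_def mult_commute_abs)
   ultimately show ?thesis
    using has_derivative_compose[of "%x. x \<bullet> v + c" "%h. h \<bullet> v" x UNIV "flat_exp P"] by simp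
  qed
 qed (auto intro: k_smooth_linear[OF bounded_linear_scaleR_right Suc, unfolded real_scaleR_def])
qed

text \<open>The centre \<open>a\<close> is free because the approximation near the boundary needs
  kernels concentrated away from the origin.\<close>

lemma ex_bump:
 obtains \<rho> :: "'a::euclidean_space => real"
 where "\<rho> \<in> test_functions UNIV" "\<And>x. \<rho> x \<ge> 0" "(LBINT x. \<rho> x) = 1" "\<And>x. \<rho> x \<noteq> 0 ==> norm (x - a) <= 1"
proof -
 \<comment> \<open>With half-width 1/d the cube carrying \<open>\<psi>\<close> lies in the unit
   ball, since the Euclidean norm is at most the l^1 norm.\<close>
 define r where "r = 1 / real DIM('a)"
 define \<psi> :: "'a => real" where "\<psi> x = (\<Prod>b\<in>Basis. flat_exp 1 (x \<bullet> b + r) * flat_exp 1 (x \<bullet> (- b) + r))" for x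
 have r: "r > 0" unfolding r_def by simp
 have sm: "k_smooth k \<psi>" for k unfolding \<psi>_def
  by (intro k_smooth_prod k_smooth_bilinear[OF bounded_bilinear_mult] k_smooth_flat_exp)
 have supp: "norm x <= 1" if "\<psi> x \<noteq> 0" for x
 proof -
  have "\<bar>x \<bullet> b\<bar> <= r" if "b \<in> Basis" for b
   using \<open>\<psi> x \<noteq> 0\<close> that by (fastforce simp: \<psi>_def flat_exp_def split: if_splits)
  then have "(\<Sum>b\<in>Basis. \<bar>x \<bullet> b\<bar>) <= (\<Sum>b\<in>(Basis::'a set). r)" by (intro sum_mono)
  also have "... = 1" unfolding r_def by simp
  finally show ?thesis using norm_le_l1[of x] by linarith
 qed
 have test: "\<psi> \<in> test_functions UNIV"
  by (rule test_functionsI[of _ "cball 0 1"]) (use sm supp in \<open>auto\<close>)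
 have nn: "\<psi> x \<ge> 0" for x unfolding \<psi>_def by (intro prod_nonneg) (auto simp: flat_exp_def)
 have pos: "\<psi> 0 > 0" unfolding \<psi>_def by (intro prod_pos) (use r in \<open>auto simp: flat_exp_def\<close>)
 have "(LBINT x. \<psi> x) \<noteq> 0"
 proof
  assume "(LBINT x. \<psi> x) = 0"
  then have "AE x in lborel. \<psi> x = 0"
   using integral_nonneg_eq_0_iff_AE[OF test_integrable[OF test]] nn by auto
  then have "AE x in lborel. x \<notin> {x. \<psi> x \<noteq> 0}" by simp
  moreover have op: "open {x. \<psi> x \<noteq> 0}"
   using test_continuous[OF test] by (intro open_Collect_neq continuous_intros)
  ultimately have "emeasure lborel {x. \<psi> x \<noteq> 0} = 0"
   by (subst (asm) AE_iff_measurable[of "{x. \<psi> x \<noteq> 0}"]) auto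
  then have "{x. \<psi> x \<noteq> 0} = {}"
   using op by (metis negligible_iff_null_sets null_setsI open_not_negligible null_sets_completionI borel_open sets_lborel)
  with pos show False by auto
 qed
 moreover have "(LBINT x. \<psi> x) \<ge> 0" using nn by simp
 ultimately have I: "(LBINT x. \<psi> x) > 0" by simp
 define \<rho> where "\<rho> x = (1 / (LBINT x. \<psi> x)) *\<^sub>R \<psi> (1 *\<^sub>R x + (- a))" for x
 have tr: "(LBINT x. \<psi> (1 *\<^sub>R x + (- a))) = (LBINT x. \<psi> x)"
  by (subst lborel_distr_plus[of "-a", symmetric], subst integral_distr)
   (use test in \<open>auto simp: add.commute intro: test_measurable\<close>)
 show ?thesis
 proof
  show "\<rho> \<in> test_functions UNIV" unfolding \<rho>_def
   by (intro test_scaleR test_affine test) auto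
  show "\<rho> x \<ge> 0" for x unfolding \<rho>_def using nn I by simp
  show "(LBINT x. \<rho> x) = 1" unfolding \<rho>_def using tr I by simp
  show "norm (x - a) <= 1" if "\<rho> x \<noteq> 0" for x
   using that supp[of "x - a"] unfolding \<rho>_def by auto
 qed
qed

section \<open>Mollification\<close>

lemma lborel_integral_affine:
 fixes f :: "'a::euclidean_space => 'b::{banach, second_countable_topology}"
 assumes [measurable]: "f \<in> borel_measurable borel" and c: "c \<noteq> 0"
 shows "(LBINT x. f (t + c *\<^sub>R x)) = (1 / \<bar>c\<bar> ^ DIM('a)) *\<^sub>R (LBINT x. f x)"
proof -
 have "(LBINT x. f x) = (LINT x|(density (distr lborel borel (%x. t + c *\<^sub>R x)) (%_. ennreal (\<bar>c\<bar> ^ DIM('a)))). f x)"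
  by (rule arg_cong[where f="%M. integral\<^sup>L M f"]) (rule lborel_affine[OF c])
 also have "... = \<bar>c\<bar> ^ DIM('a) *\<^sub>R (LBINT x. f (t + c *\<^sub>R x))"
  by (subst integral_density) (auto simp: integral_distr)
 finally show ?thesis using c by simp
qed

lemma lborel_integrable_affine:
 fixes f :: "'a::euclidean_space => 'b::{banach, second_countable_topology}"
 assumes "integrable lborel f" and c: "c \<noteq> 0"
 shows "integrable lborel (%x. f (t + c *\<^sub>R x))"
proof -
 have [measurable]: "f \<in> borel_measurable borel" using assms(1) by auto
 have "integrable (density (distr lborel borel (%x. t + c *\<^sub>R x)) (%_. ennreal (\<bar>c\<bar> ^ DIM('a)))) f"
  using assms lborel_affine[OF c, of t] by simp
 then have "integrable lborel (%x. \<bar>c\<bar> ^ DIM('a) *\<^sub>R f (t + c *\<^sub>R x))"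
  by (subst (asm) integrable_density) (auto simp: integrable_distr_eq)
 then have "integrable lborel (%x. (1 / \<bar>c\<bar> ^ DIM('a)) *\<^sub>R (\<bar>c\<bar> ^ DIM('a) *\<^sub>R f (t + c *\<^sub>R x)))"
  by (rule integrable_scaleR_right)
 then show ?thesis using c by simp
qed

lemma integrable_bounded_mult:
 fixes f :: "'a => 'b::{banach, second_countable_topology}" and k :: "'a => real"
 assumes "integrable M f" "k \<in> borel_measurable M" "\<And>x. \<bar>k x\<bar> <= B"
 shows "integrable M (%x. k x *\<^sub>R f x)"
proof (rule Bochner_Integration.integrable_bound[of M "%x. B *\<^sub>R f x"])
 have "\<bar>k x\<bar> <= \<bar>B\<bar>" for x using assms(3)[of x] by linarith
 then show "AE x in M. norm (k x *\<^sub>R f x) <= norm (B *\<^sub>R f x)" by (simp add: mult_right_mono)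
qed (use assms in auto)

section \<open>Convolution with test functions\<close>

definition conv :: "('a::euclidean_space => real) => ('a => 'b::euclidean_space) => 'a => 'b" where
 "conv k f x = (LBINT y. k (x - y) *\<^sub>R f y)"

lemma conv_integrable:
 fixes f :: "'a::euclidean_space => 'b::euclidean_space"
 assumes k: "k \<in> test_functions U" and f: "integrable lborel f"
 shows "integrable lborel (%y. k (x - y) *\<^sub>R f y)"
proof -
 obtain B where "\<And>x. norm (k x) <= B" using test_bounded[OF k] by metis
 then show ?thesis
  using test_measurable[OF k] by (intro integrable_bounded_mult[OF f, of _ B]) auto
qed

text \<open>The linearisation error is uniform in the base point because the partial derivatives are
  uniformly continuous. With this uniformity, differentiation under the integral sign becomes a
  plain estimate of the remainder.\<close>

lemma test_uniform_derivative:
 fixes f :: "'a::euclidean_space => 'b::real_normed_vector"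
 assumes f: "f \<in> test_functions U" and e: "e > 0"
 shows "\<exists>d>0. \<forall>z h. norm h < d --> norm (f (z + h) - f z - frechet_derivative f (at z) h) <= e * norm h"
proof -
 let ?e = "e / real DIM('a)"
 have "?e > 0" using e by simp
 have "\<exists>d>0. \<forall>x y. dist y x < d --> dist (partial_deriv f b y) (partial_deriv f b x) < ?e" if "b \<in> Basis" for b
  using test_uniformly_continuous[OF test_partial_deriv[OF f that],
    unfolded uniformly_continuous_on_def, rule_format, OF \<open>?e > 0\<close>] by simp
 then have "\<forall>b\<in>Basis. \<exists>d. d > 0 \<and> (\<forall>x y. dist y x < d --> dist (partial_deriv f b y) (partial_deriv f b x) < ?e)"
  by blast
 from bchoice[OF this] obtain d where
  "\<forall>b\<in>Basis. d b > 0 \<and> (\<forall>x y. dist y x < d b --> dist (partial_deriv f b y) (partial_deriv f b x) < ?e)"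
  by blast
 then have d: "\<And>b. b \<in> Basis ==> d b > 0"
  "\<And>b x y. b \<in> Basis ==> dist y x < d b ==> dist (partial_deriv f b y) (partial_deriv f b x) < ?e"
  by blast+
 define r where "r = Min (d ` Basis)"
 have r: "r > 0" "\<And>b. b \<in> Basis ==> r <= d b" unfolding r_def using d(1) by auto
 have "norm (f (z + h) - f z - frechet_derivative f (at z) h) <= e * norm h" if h: "norm h < r" for z h
 proof -
  have on: "onorm (%i. frechet_derivative f (at x) i - frechet_derivative f (at z) i) <= e" if x: "x \<in> ball z r" for x
  proof (rule onorm_le)
   fix v :: 'a
   have "norm (frechet_derivative f (at x) v - frechet_derivative f (at z) v)
     = norm (\<Sum>b\<in>Basis. (v \<bullet> b) *\<^sub>R (partial_deriv f b x - partial_deriv f b z))"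
    by (simp add: frechet_derivative_partial[OF test_differentiable[OF f]] sum_subtractf scaleR_diff_right)
   also have "... <= (\<Sum>b\<in>(Basis::'a set). norm v * ?e)"
   proof (rule sum_norm_le)
    fix b :: 'a assume b: "b \<in> Basis"
    have "dist x z < d b" using x r(2)[OF b] by (simp add: dist_commute)
    then have "norm (partial_deriv f b x - partial_deriv f b z) <= ?e"
     using d(2)[OF b] by (simp add: dist_norm less_imp_le)
    then show "norm ((v \<bullet> b) *\<^sub>R (partial_deriv f b x - partial_deriv f b z)) <= norm v * ?e"
     unfolding norm_scaleR using Basis_le_norm[OF b, of v] by (intro mult_mono) auto
   qed
   also have "... = e * norm v" by simp
   finally show "norm (frechet_derivative f (at x) v - frechet_derivative f (at z) v) <= e * norm v" .
  qed
  have "norm (f (z + h) - f z - frechet_derivative f (at z) (z + h - z)) <= norm (z + h - z) * e"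
  proof (rule differentiable_bound_linearization[where S="ball z r"])
   show "z + t *\<^sub>R (z + h - z) \<in> ball z r" if "t \<in> {0..1}" for t
    using h that mult_left_le_one_le[of "norm h" t] by (auto simp: dist_norm)
   show "(f has_derivative frechet_derivative f (at x)) (at x within ball z r)" for x
    using test_has_derivative[OF f] by (rule has_derivative_at_withinI)
   show "onorm (frechet_derivative f (at x) - frechet_derivative f (at z)) <= e" if "x \<in> ball z r" for x
    unfolding fun_diff_def by (rule on[OF that])
   show "z \<in> ball z r" using r(1) by simp
  qed
  then show ?thesis by (simp add: mult.commute)
 qed
 with r(1) show ?thesis by blast
qed

text \<open>The derivative falls on the kernel, so integrability of \<open>f\<close> is enough: the
  uniform linearisation error of \<open>k\<close> at the points \<open>x - w\<close> is integrated
  against |f|.\<close>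

lemma conv_has_derivative:
 fixes f :: "'a::euclidean_space => 'b::euclidean_space"
 assumes k: "k \<in> test_functions U" and f: "integrable lborel f"
 shows "(conv k f has_derivative (%h. \<Sum>b\<in>Basis. (h \<bullet> b) *\<^sub>R conv (partial_deriv k b) f x)) (at x)"
 unfolding has_derivative_within_alt
proof (intro conjI allI impI)
 show "bounded_linear (%h. \<Sum>b\<in>Basis. (h \<bullet> b) *\<^sub>R conv (partial_deriv k b) f x)"
  by (intro bounded_linear_sum bounded_linear_scaleR_const bounded_linear_inner_left)
 fix e :: real assume e: "0 < e"
 define I where "I = (LBINT y. norm (f y))"
 have I: "I \<ge> 0" unfolding I_def by simp
 \<comment> \<open>The \<open>+ 1\<close> keeps the quotient meaningful when \<open>f\<close>
   vanishes almost everywhere and still leaves \<open>e' * I\<close> at most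
   \<open>e\<close>.\<close>
 define e' where "e' = e / (I + 1)"
 have e': "e' > 0" "e' * I <= e" unfolding e'_def using e I by (auto simp: field_simps)
 obtain d where d: "d > 0" "\<And>z h. norm h < d ==> norm (k (z + h) - k z - frechet_derivative k (at z) h) <= e' * norm h"
  using test_uniform_derivative[OF k e'(1)] by blast
 have "norm (conv k f y - conv k f x - (\<Sum>b\<in>Basis. ((y - x) \<bullet> b) *\<^sub>R conv (partial_deriv k b) f x)) <= e * norm (y - x)"
  if y: "norm (y - x) < d" for y
 proof -
  let ?h = "y - x"
  let ?r = "%w. k (x - w + ?h) - k (x - w) - frechet_derivative k (at (x - w)) ?h"
  have int: "integrable lborel (%w. k (x - w) *\<^sub>R f w)" "integrable lborel (%w. k (y - w) *\<^sub>R f w)"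
   by (rule conv_integrable[OF k f])+
  have intp: "integrable lborel (%w. (?h \<bullet> b) *\<^sub>R (partial_deriv k b (x - w) *\<^sub>R f w))" if "b \<in> Basis" for b
   by (intro integrable_scaleR_right conv_integrable[OF test_partial_deriv[OF k that] f])
  have eq: "?r w *\<^sub>R f w = k (y - w) *\<^sub>R f w - k (x - w) *\<^sub>R f w
    - (\<Sum>b\<in>Basis. (?h \<bullet> b) *\<^sub>R (partial_deriv k b (x - w) *\<^sub>R f w))" for w
   by (simp add: frechet_derivative_partial[OF test_differentiable[OF k]] scaleR_diff_left
     scaleR_sum_left algebra_simps)
  have intr: "integrable lborel (%w. ?r w *\<^sub>R f w)"
   unfolding eq by (intro Bochner_Integration.integrable_diff int Bochner_Integration.integrable_sum intp)
  let ?C = "%w. \<Sum>b\<in>Basis. (?h \<bullet> b) *\<^sub>R (partial_deriv k b (x - w) *\<^sub>R f w)"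
  have C: "(LBINT w. ?C w) = (\<Sum>b\<in>Basis. (?h \<bullet> b) *\<^sub>R conv (partial_deriv k b) f x)"
   unfolding conv_def by (subst Bochner_Integration.integral_sum[OF intp])
    (simp_all only: Bochner_Integration.integral_scaleR_right)
  have "(LBINT w. ?r w *\<^sub>R f w) = (LBINT w. k (y - w) *\<^sub>R f w - k (x - w) *\<^sub>R f w - ?C w)"
   by (simp only: eq)
  also have "... = (LBINT w. k (y - w) *\<^sub>R f w - k (x - w) *\<^sub>R f w) - (LBINT w. ?C w)"
   by (intro Bochner_Integration.integral_diff Bochner_Integration.integrable_diff int Bochner_Integration.integrable_sum intp)
  also have "(LBINT w. k (y - w) *\<^sub>R f w - k (x - w) *\<^sub>R f w) = conv k f y - conv k f x"
   unfolding conv_def by (rule Bochner_Integration.integral_diff[OF int(2,1)])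
  also note C
  finally have "conv k f y - conv k f x - (\<Sum>b\<in>Basis. (?h \<bullet> b) *\<^sub>R conv (partial_deriv k b) f x)
    = (LBINT w. ?r w *\<^sub>R f w)"
   by (rule sym)
  then have "norm (conv k f y - conv k f x - (\<Sum>b\<in>Basis. (?h \<bullet> b) *\<^sub>R conv (partial_deriv k b) f x))
    = norm (LBINT w. ?r w *\<^sub>R f w)"
   by (rule arg_cong)
  also have "... <= (LBINT w. norm (?r w *\<^sub>R f w))"
   by (rule integral_norm_bound)
  also have "... <= (LBINT w. (e' * norm ?h) * norm (f w))"
  proof (rule integral_mono)
   show "norm (?r w *\<^sub>R f w) <= (e' * norm ?h) * norm (f w)" for w
    unfolding norm_scaleR using d(2)[OF y, of "x - w"] by (intro mult_right_mono) auto
   show "integrable lborel (%w. norm (?r w *\<^sub>R f w))" by (rule integrable_norm[OF intr])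
  qed (use f in auto)
  also have "... = (e' * I) * norm ?h" unfolding I_def by simp
  also have "... <= e * norm ?h" using e' by (intro mult_right_mono) auto
  finally show ?thesis .
 qed
 with d(1) show "\<exists>d>0. \<forall>y\<in>UNIV. norm (y - x) < d -->
   norm (conv k f y - conv k f x - (\<Sum>b\<in>Basis. ((y - x) \<bullet> b) *\<^sub>R conv (partial_deriv k b) f x)) <= e * norm (y - x)"
  by blast
qed

lemma conv_partial_deriv:
 fixes f :: "'a::euclidean_space => 'b::euclidean_space"
 assumes "k \<in> test_functions U" "integrable lborel f" "b \<in> Basis"
 shows "partial_deriv (conv k f) b x = conv (partial_deriv k b) f x"
proof -
 have "partial_deriv (conv k f) b x = (\<Sum>c\<in>Basis. (b \<bullet> c) *\<^sub>R conv (partial_deriv k c) f x)"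
  by (rule partial_deriv_eqI[OF conv_has_derivative[OF assms(1,2)]])
 also have "... = (\<Sum>c\<in>Basis. if b = c then conv (partial_deriv k c) f x else 0)"
  by (intro sum.cong) (auto simp: inner_Basis assms(3))
 finally show ?thesis using assms(3) by simp
qed

lemma conv_k_smooth:
 fixes f :: "'a::euclidean_space => 'b::euclidean_space"
 assumes f: "integrable lborel f"
 shows "k \<in> test_functions U ==> k_smooth n (conv k f)"
proof (induction n arbitrary: k)
 case 0
 then show ?case
  using has_derivative_continuous[OF conv_has_derivative[OF _ f]]
  by (auto intro: continuous_at_imp_continuous_on)
next
 case (Suc n)
 show ?case
  by (rule k_smooth_SucI[OF conv_has_derivative[OF Suc.prems f]])
   (intro k_smooth_sum k_smooth_linear[OF bounded_linear_scaleR_right] Suc.IH test_partial_deriv Suc.prems)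
qed

text \<open>\<open>\<rho>\<close> is a probability density, but it need not be centred at the origin.\<close>

definition mollifier :: "('a::euclidean_space => real) => real => bool" where
 "mollifier \<rho> R \<longleftrightarrow> \<rho> \<in> test_functions UNIV \<and> (\<forall>x. \<rho> x \<ge> 0) \<and> (LBINT x. \<rho> x) = 1 \<and>
  (\<forall>x. \<rho> x \<noteq> 0 --> norm x <= R) \<and> 0 < R"

text \<open>The scale acts on the argument of \<open>f\<close> rather than on the kernel: bounds and
  vanishing at \<open>x\<close> are read off from the values of \<open>f\<close> at
  \<open>x - e *\<^sub>R z\<close>. The equal form with the kernel \<open>scaled\<close> gives
  smoothness.\<close>

definition mollify :: "('a::euclidean_space => real) => real => ('a => 'b::euclidean_space) => 'a => 'b" where
 "mollify \<rho> e f x = (LBINT z. \<rho> z *\<^sub>R f (x - e *\<^sub>R z))"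

definition scaled :: "('a::euclidean_space => real) => real => 'a => real" where
 "scaled \<rho> e z = (1 / e ^ DIM('a)) * \<rho> ((1 / e) *\<^sub>R z)"

lemma scaled_test: "\<rho> \<in> test_functions UNIV ==> e > 0 ==> scaled \<rho> e \<in> test_functions UNIV"
 unfolding scaled_def[abs_def]
 using test_scaleR[OF test_affine[of \<rho> "1/e" 0], of "1 / e ^ DIM('a)"] by simp

lemma mollifierD:
 assumes "mollifier \<rho> R"
 shows "\<rho> \<in> test_functions UNIV" "\<rho> x \<ge> 0" "(LBINT x. \<rho> x) = 1" "\<rho> x \<noteq> 0 ==> norm x <= R" "0 < R"
  "integrable lborel \<rho>" "\<rho> \<in> borel_measurable borel"
 using assms by (auto simp: mollifier_def intro: test_integrable test_measurable)

lemma ex_mollifier: "\<exists>\<rho> :: 'a::euclidean_space => real. mollifier \<rho> 1"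
proof -
 obtain \<rho> :: "'a => real" where "\<rho> \<in> test_functions UNIV" "\<And>x. \<rho> x \<ge> 0" "(LBINT x. \<rho> x) = 1"
  "\<And>x. \<rho> x \<noteq> 0 ==> norm (x - 0) <= 1" by (rule ex_bump[of 0], rule that)
 then show ?thesis unfolding mollifier_def by auto
qed

lemma mollify_eq_conv:
 fixes f :: "'a::euclidean_space => 'b::euclidean_space"
 assumes [measurable]: "\<rho> \<in> borel_measurable borel" "f \<in> borel_measurable borel" and e: "r > 0"
 shows "mollify \<rho> r f = conv (scaled \<rho> r) f"
proof
 fix x
 have "mollify \<rho> r f x = (LBINT z. r ^ DIM('a) *\<^sub>R (scaled \<rho> r (x - (x + (- r) *\<^sub>R z)) *\<^sub>R f (x + (- r) *\<^sub>R z)))"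
  unfolding mollify_def scaled_def using e by simp
 also have "... = r ^ DIM('a) *\<^sub>R (LBINT z. (scaled \<rho> r (x - (x + (- r) *\<^sub>R z)) *\<^sub>R f (x + (- r) *\<^sub>R z)))"
  by (simp only: Bochner_Integration.integral_scaleR_right)
 also have "... = conv (scaled \<rho> r) f x"
  unfolding conv_def scaled_def using e by (subst lborel_integral_affine) auto
 finally show "mollify \<rho> r f x = conv (scaled \<rho> r) f x" .
qed

lemma mollify_k_smooth:
 fixes f :: "'a::euclidean_space => 'b::euclidean_space"
 assumes "\<rho> \<in> test_functions UNIV" "e > 0" "integrable lborel f"
 shows "k_smooth n (mollify \<rho> e f)"
 using assms by (subst mollify_eq_conv) (auto intro: conv_k_smooth scaled_test test_measurable)

lemma mollify_integrable:
 fixes f :: "'a::euclidean_space => 'b::euclidean_space"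
 assumes "\<rho> \<in> test_functions UNIV" "e > 0" "integrable lborel f"
 shows "integrable lborel (%z. \<rho> z *\<^sub>R f (x - e *\<^sub>R z))"
proof -
 obtain B where B: "\<And>x. norm (\<rho> x) <= B" using test_bounded[OF assms(1)] by metis
 have "integrable lborel (%z. f (x + (- e) *\<^sub>R z))"
  by (rule lborel_integrable_affine) (use assms in auto)
 then show ?thesis
  using test_measurable[OF assms(1)] B
  by (intro integrable_bounded_mult[of _ _ _ B]) auto
qed

text \<open>A weighted mean of the values of \<open>f\<close> near \<open>x\<close> stays in every
  closed ball that contains these values. The centre 0 gives the sup bound, the centre
  \<open>f x\<close> uniform convergence, and the centre 1 the constancy of cutoff
  functions.\<close>

lemma mollify_diff_le:
 fixes f :: "'a::euclidean_space => 'b::euclidean_space"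
 assumes m: "mollifier \<rho> R" and f: "integrable lborel f" "r > 0"
  and e: "\<And>z. norm z <= R ==> norm (f (x - r *\<^sub>R z) - c) <= e"
 shows "norm (mollify \<rho> r f x - c) <= e"
proof -
 have i: "integrable lborel (%z. \<rho> z *\<^sub>R f (x - r *\<^sub>R z))" "integrable lborel (%z. \<rho> z *\<^sub>R c)"
  using mollify_integrable[OF mollifierD(1)[OF m] f(2,1)] mollifierD(6)[OF m] by auto
 have "mollify \<rho> r f x - c = (LBINT z. \<rho> z *\<^sub>R f (x - r *\<^sub>R z) - \<rho> z *\<^sub>R c)"
  unfolding mollify_def using i mollifierD(3,6)[OF m] by (simp add: Bochner_Integration.integral_diff)
 also have "norm ... <= (LBINT z. norm (\<rho> z *\<^sub>R f (x - r *\<^sub>R z) - \<rho> z *\<^sub>R c))"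
  by (rule integral_norm_bound)
 also have "... <= (LBINT z. \<rho> z * e)"
 proof (rule integral_mono)
  fix z
  have "norm (\<rho> z *\<^sub>R f (x - r *\<^sub>R z) - \<rho> z *\<^sub>R c) = \<rho> z * norm (f (x - r *\<^sub>R z) - c)"
   using mollifierD(2)[OF m, of z] by (simp flip: scaleR_diff_right)
  also have "... <= \<rho> z * e"
   using e[of z] mollifierD(2,4)[OF m, of z] by (cases "\<rho> z = 0") (auto intro: mult_left_mono)
  finally show "norm (\<rho> z *\<^sub>R f (x - r *\<^sub>R z) - \<rho> z *\<^sub>R c) <= \<rho> z * e" .
 qed (use i mollifierD(6)[OF m] in auto)
 also have "... = e" using mollifierD(3)[OF m] by simp
 finally show ?thesis .
qed

lemma mollify_norm_le:
 fixes f :: "'a::euclidean_space => 'b::euclidean_space"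
 assumes m: "mollifier \<rho> R" and f: "integrable lborel f" "r > 0" and e: "\<And>z. norm (f z) <= e"
 shows "norm (mollify \<rho> r f x) <= e"
 using mollify_diff_le[OF m f, of x 0 e] e by simp

lemma mollify_eq_0:
 fixes f :: "'a::euclidean_space => 'b::euclidean_space"
 assumes m: "mollifier \<rho> R" and f: "\<And>z. \<rho> z \<noteq> 0 ==> f (x - e *\<^sub>R z) = 0"
 shows "mollify \<rho> e f x = 0"
proof -
 have "(%z. \<rho> z *\<^sub>R f (x - e *\<^sub>R z)) = (%z. 0)" using f by (auto simp: fun_eq_iff)
 then show ?thesis unfolding mollify_def by simp
qed

lemma mollify_test_function:
 fixes f :: "'a::euclidean_space => 'b::euclidean_space"
 assumes m: "mollifier \<rho> R" and f: "integrable lborel f" "e > 0"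
  and K: "compact K" "\<And>x. x \<notin> K ==> f x = 0" and U: "\<And>y z. y \<in> K ==> norm z <= e * R ==> y + z \<in> U"
 shows "mollify \<rho> e f \<in> test_functions U"
proof (rule test_functionsI[OF mollify_k_smooth[OF mollifierD(1)[OF m] f(2,1)]])
 let ?S = "{y + z |y z. y \<in> K \<and> z \<in> cball 0 (e * R)}"
 show "compact ?S" by (rule compact_sums[OF K(1) compact_cball])
 show "?S \<subseteq> U" using U by auto
 fix x assume x: "x \<notin> ?S"
 show "mollify \<rho> e f x = 0"
 proof (rule mollify_eq_0[OF m])
  fix z assume "\<rho> z \<noteq> 0"
  then have "norm (e *\<^sub>R z) <= e * R" using mollifierD(4)[OF m, of z] f(2) by simp
  then have "x - e *\<^sub>R z \<notin> K" using x by (force simp: algebra_simps)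
  then show "f (x - e *\<^sub>R z) = 0" by (rule K(2))
 qed
qed

lemma mollify_uniform_limit:
 fixes f :: "'a::euclidean_space => 'b::euclidean_space"
 assumes m: "mollifier \<rho> R" and f: "continuous_on UNIV f" and K: "compact K" "\<And>x. x \<notin> K ==> f x = 0" and e: "e > 0"
 shows "\<exists>d>0. \<forall>r x. 0 < r \<and> r < d --> norm (mollify \<rho> r f x - f x) <= e"
proof -
 have int: "integrable lborel f"
 proof -
  have "integrable lborel (%x. indicator K x *\<^sub>R f x)"
   by (rule borel_integrable_compact[OF K(1) continuous_on_subset[OF f]]) simp
  also have "(%x. indicator K x *\<^sub>R f x) = f" using K(2) by (auto simp: indicator_def fun_eq_iff)
  finally show ?thesis .
 qed
 obtain d where d: "d > 0" "\<And>x y. dist y x < d ==> dist (f y) (f x) < e"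
  using compact_support_uniformly_continuous[OF f K, unfolded uniformly_continuous_on_def, rule_format, OF _ e]
  by auto
 note R = mollifierD(5)[OF m]
 have "norm (mollify \<rho> r f x - f x) <= e" if "0 < r" "r < d / R" for r x
 proof (rule mollify_diff_le[OF m int that(1)])
  fix z :: 'a assume "norm z <= R"
  then have "norm (r *\<^sub>R z) <= r * R" using that by simp
  also have "... < d" using that R by (simp add: field_simps)
  finally show "norm (f (x - r *\<^sub>R z) - f x) <= e"
   using d(2)[of "x - r *\<^sub>R z" x] by (simp add: dist_norm)
 qed
 then show ?thesis using d(1) R by (intro exI[of _ "d / R"]) auto
qed

lemma ex_cutoff:
 fixes K U :: "'a::euclidean_space set"
 assumes K: "compact K" and U: "open U" "K \<subseteq> U"
 obtains \<eta> V where "\<eta> \<in> test_functions U" "\<And>x. 0 <= \<eta> x" "\<And>x. \<eta> x <= (1::real)"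
  "open V" "K \<subseteq> V" "\<And>x. x \<in> V ==> \<eta> x = 1"
proof (cases "K = {}")
 case True
 then show ?thesis using that[of "%x. 0" "{}"] test_zero by auto
next
 case False
 obtain e where e: "e > 0" "(\<Union>x\<in>K. ball x e) \<subseteq> U"
  using compact_subset_open_imp_ball_epsilon_subset[OF K U] by blast
 \<comment> \<open>The indicator of the closed 2s-neighbourhood of \<open>K\<close>, mollified at
   scale s, is 1 within distance s of \<open>K\<close> and vanishes beyond 3s, and 3s < e.\<close>
 define s where "s = e / 4"
 have s: "s > 0" using e unfolding s_def by simp
 obtain \<rho> :: "'a => real" where m: "mollifier \<rho> 1" using ex_mollifier by blast
 let ?C = "{x + y |x y. x \<in> K \<and> y \<in> cball 0 (2 * s)}"
 have C: "compact ?C" by (rule compact_sums[OF K compact_cball])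
 let ?f = "indicator ?C :: 'a => real"
 have int: "integrable lborel ?f"
  by (intro integrable_real_indicator emeasure_bounded_finite[OF compact_imp_bounded[OF C]]) (use C in \<open>auto simp del: Collect_mem_eq simp: compact_imp_closed intro: emeasure_bounded_finite[OF compact_imp_bounded[OF C]]\<close>)
 show ?thesis
 proof
  show "mollify \<rho> s ?f \<in> test_functions U"
  proof (rule mollify_test_function[OF m int s C])
   fix y z :: 'a assume "y \<in> ?C" "norm z <= s * 1"
   then obtain x v where xv: "y = x + v" "x \<in> K" "norm v <= 2 * s" by auto
   then have "norm (v + z) < e"
    using norm_triangle_ineq[of v z] \<open>norm z <= s * 1\<close> s by (simp add: s_def)
   then have "y + z \<in> ball x e" unfolding xv(1) by (simp add: dist_norm norm_minus_commute algebra_simps)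
   then show "y + z \<in> U" using e(2) xv(2) by blast
  qed (auto simp: indicator_def)
  show "open (\<Union>x\<in>K. ball x s)" "K \<subseteq> (\<Union>x\<in>K. ball x s)" using s by auto
  show "0 <= mollify \<rho> s ?f x" for x
   unfolding mollify_def by (rule Bochner_Integration.integral_nonneg) (simp add: mollifierD(2)[OF m])
  show "mollify \<rho> s ?f x <= 1" for x
   using mollify_norm_le[OF m int s, of 1 x] by (simp add: indicator_def)
  show "mollify \<rho> s ?f x = 1" if x: "x \<in> (\<Union>x\<in>K. ball x s)" for x
  proof -
   obtain y where y: "y \<in> K" "dist y x < s" using x by auto
   have "x - s *\<^sub>R z \<in> ?C" if "norm z <= 1" for z
   proof -
    have "norm (x - y) < s" using y(2) by (simp add: dist_norm norm_minus_commute)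
    moreover have "norm (s *\<^sub>R z) <= s" using that s by (simp add: mult_left_le)
    ultimately have "norm (x - y - s *\<^sub>R z) <= 2 * s"
     using norm_triangle_ineq4[of "x - y" "s *\<^sub>R z"] by linarith
    then have "x - s *\<^sub>R z = y + (x - y - s *\<^sub>R z) \<and> x - y - s *\<^sub>R z \<in> cball 0 (2 * s)" by simp
    then show ?thesis using y(1) by blast
   qed
   then have "norm (mollify \<rho> s ?f x - 1) <= 0"
    by (intro mollify_diff_le[OF m int s]) simp
   then show ?thesis by simp
  qed
 qed
qed

section \<open>Density of test functions in L^1\<close>

lemma finite_measure_regular:
 fixes M :: "'a::euclidean_space measure"
 assumes M: "finite_measure M" "sets M = sets borel" and B: "B \<in> sets borel" and e: "e > (0::real)"
 obtains K U where "compact K" "open U" "K \<subseteq> B" "B \<subseteq> U" "measure M (U - K) < e"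
proof -
 interpret finite_measure M by (rule M(1))
 have fin: "emeasure M (space M) \<noteq> \<infinity>" by simp
 have BM: "B \<in> sets M" using B M by simp
 have "ennreal (measure M B) < ennreal (measure M B + e / 2)" using e by (simp add: ennreal_lessI)
 then have "(INF U \<in> {U. B \<subseteq> U \<and> open U}. emeasure M U) < ennreal (measure M B + e / 2)"
  using outer_regular[OF M(2) fin B] by (simp add: emeasure_eq_measure)
 then obtain U where U: "B \<subseteq> U" "open U" "emeasure M U < ennreal (measure M B + e / 2)"
  by (auto simp: INF_less_iff)
 have U': "measure M U < measure M B + e / 2"
  using U(3) e by (simp add: emeasure_eq_measure ennreal_less_iff del: ennreal_plus)
 have "\<exists>K. compact K \<and> K \<subseteq> B \<and> measure M B - e / 2 < measure M K"
 \<comment> \<open>\<open>ennreal\<close> truncates negative numbers to 0, so the case of a negative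
   \<open>measure M B - e / 2\<close> is settled separately, by the empty set.\<close>
 proof (cases "measure M B < e / 2")
  case True
  then show ?thesis by (intro exI[of _ "{}"]) auto
 next
  case False
  then have "ennreal (measure M B - e / 2) < emeasure M B"
   using e by (simp add: emeasure_eq_measure ennreal_lessI)
  then have "ennreal (measure M B - e / 2) < (SUP K \<in> {K. K \<subseteq> B \<and> compact K}. emeasure M K)"
   using inner_regular[OF M(2) fin B] by simp
  then obtain K where "K \<subseteq> B" "compact K" "ennreal (measure M B - e / 2) < emeasure M K"
   by (auto simp: less_SUP_iff)
  then show ?thesis using False by (intro exI[of _ K]) (simp add: emeasure_eq_measure ennreal_less_iff)
 qed
 then obtain K where K: "compact K" "K \<subseteq> B" "measure M B - e / 2 < measure M K" by blast
 have "K \<in> sets M" "U \<in> sets M" using K U M by (auto simp: compact_imp_closed)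
 then have "measure M (U - K) = measure M U - measure M K"
  using K U by (intro finite_measure_Diff) auto
 then have "measure M (U - K) < e" using K(3) U' by simp
 then show ?thesis using that K U by blast
qed

lemma test_integrable_finite:
 fixes f :: "'a::euclidean_space => 'b::euclidean_space"
 assumes "finite_measure M" "sets M = sets borel" "f \<in> test_functions U"
 shows "integrable M f"
proof -
 interpret finite_measure M by (rule assms(1))
 obtain B where "\<And>x. norm (f x) <= B" using test_bounded[OF assms(3)] by metis
 then show ?thesis
  using test_measurable[OF assms(3)] assms(2)
  by (intro integrable_const_bound[of _ B]) (auto cong: measurable_cong_sets)
qed

text \<open>For an indicator, regularity gives a compact set inside and an open set outside, and a
  cutoff function between them is wrong only on their small difference. Since \<open>- W\<close> is
  a null set, both sets may be chosen for the part inside \<open>W\<close>, which keeps the support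
  there.\<close>

lemma test_dense_L1:
 fixes f :: "'a::euclidean_space => 'b::euclidean_space"
 assumes M: "finite_measure M" "sets M = sets borel" and W: "open W" "emeasure M (- W) = 0"
  and f: "integrable M f"
 shows "\<forall>e>0. \<exists>\<phi>\<in>test_functions W. (LINT x|M. norm (\<phi> x - f x)) < e"
 using f
proof (induction f rule: integrable_induct)
 case (base A c)
 show ?case
 proof (intro allI impI)
  fix e :: real assume e: "e > 0"
  let ?e = "e / (norm c + 1)"
  have e': "?e > 0" using e by (intro divide_pos_pos) (auto simp: add_nonneg_pos)
  have A: "A \<inter> W \<in> sets borel" using base M W by auto
  obtain K U where KU: "compact K" "open U" "K \<subseteq> A \<inter> W" "A \<inter> W \<subseteq> U" "measure M (U - K) < ?e"
   by (rule finite_measure_regular[OF M A e'])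
  obtain \<eta> V where \<eta>: "\<eta> \<in> test_functions (U \<inter> W)" "\<And>x. 0 <= \<eta> x" "\<And>x. \<eta> x <= (1::real)"
   "open V" "K \<subseteq> V" "\<And>x. x \<in> V ==> \<eta> x = 1"
  proof -
   have o: "open (U \<inter> W)" "K \<subseteq> U \<inter> W" using KU W by auto
   show ?thesis by (rule ex_cutoff[OF KU(1) o], rule that)
  qed
  have t: "(%x. \<eta> x *\<^sub>R c) \<in> test_functions W"
   by (rule test_scaleR_const[OF test_mono[OF \<eta>(1)]]) simp
  interpret finite_measure M by (rule M(1))
  have UK: "U - K \<in> sets M" using KU M by (auto simp: compact_imp_closed)
  have iUK: "integrable M (indicat_real (U - K))"
   using UK by (intro integrable_real_indicator) (auto simp: emeasure_eq_measure)
  have bd: "AE x in M. norm (\<eta> x *\<^sub>R c - indicator A x *\<^sub>R c) <= indicator (U - K) x * norm c"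
  proof -
   have "AE x in M. x \<in> W"
    using W M by (intro AE_I[of _ _ "- W"]) auto
   then show ?thesis
   proof eventually_elim
    case (elim x)
    have "\<bar>\<eta> x - indicator A x\<bar> <= indicator (U - K) x"
     using \<eta>(2,3)[of x] \<eta>(5,6) KU(3,4) elim test_outside[OF \<eta>(1), of x]
     by (cases "x \<in> K"; cases "x \<in> U"; cases "x \<in> A") (auto simp: indicator_def)
    then show ?case
     by (simp flip: scaleR_diff_left) (simp add: mult_right_mono)
   qed
  qed
  have "(LINT x|M. norm (\<eta> x *\<^sub>R c - indicator A x *\<^sub>R c)) <= (LINT x|M. indicator (U - K) x * norm c)"
   using bd test_integrable_finite[OF M t] base iUK by (intro integral_mono_AE) (auto intro!: integrable_norm)
  also have "... = measure M (U - K) * norm c" using UK by simp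
  also have "... <= ?e * norm c" using KU(5) by (intro mult_right_mono) auto
  also have "... < e" using e by (simp add: divide_less_eq add_nonneg_pos)
  finally show "\<exists>\<phi>\<in>test_functions W. (LINT x|M. norm (\<phi> x - indicator A x *\<^sub>R c)) < e"
   using t by (intro bexI[of _ "%x. \<eta> x *\<^sub>R c"])
 qed
next
 case (add f g)
 show ?case
 proof (intro allI impI)
  fix e :: real assume "e > 0"
  then have "e / 2 > 0" by simp
  then obtain \<phi> \<psi> where p: "\<phi> \<in> test_functions W" "(LINT x|M. norm (\<phi> x - f x)) < e / 2"
   "\<psi> \<in> test_functions W" "(LINT x|M. norm (\<psi> x - g x)) < e / 2"
   using add.IH by blast
  note i = test_integrable_finite[OF M p(1)] test_integrable_finite[OF M p(3)] add.hyps
  have "(LINT x|M. norm (\<phi> x + \<psi> x - (f x + g x))) <= (LINT x|M. norm (\<phi> x - f x) + norm (\<psi> x - g x))"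
   by (rule integral_mono) (use i norm_diff_triangle_ineq in auto)
  also have "... = (LINT x|M. norm (\<phi> x - f x)) + (LINT x|M. norm (\<psi> x - g x))"
   using i by simp
  also have "... < e" using p by simp
  finally show "\<exists>\<phi>\<in>test_functions W. (LINT x|M. norm (\<phi> x - (f x + g x))) < e"
   using test_add[OF p(1,3)] by (intro bexI[of _ "%x. \<phi> x + \<psi> x"])
 qed
next
 case (lim f s)
 show ?case
 proof (intro allI impI)
  fix e :: real assume e: "e > 0"
  have "(%i. (LINT x|M. norm (s i x - f x))) \<longlonglongrightarrow> (LINT x|M. 0)"
  proof (rule integral_dominated_convergence[where w="%x. 3 * norm (f x)"])
   show "AE x in M. norm (norm (s i x - f x)) <= 3 * norm (f x)" for i
    using lim.hyps(3)[of _ i] norm_triangle_ineq4[of "s i _" "f _"] by (intro AE_I2) (smt (verit) norm_ge_zero real_norm_def)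
   show "AE x in M. (%i. norm (s i x - f x)) \<longlonglongrightarrow> 0"
    using lim.hyps(2) by (intro AE_I2) (simp add: LIM_zero tendsto_norm_zero)
  qed (use lim.hyps in auto)
  then have "\<forall>\<^sub>F i in sequentially. (LINT x|M. norm (s i x - f x)) < e / 2"
   using e by (intro order_tendstoD(2)[where y=0]) auto
  then obtain i where i: "(LINT x|M. norm (s i x - f x)) < e / 2"
   unfolding eventually_sequentially by auto
  obtain \<phi> where p: "\<phi> \<in> test_functions W" "(LINT x|M. norm (\<phi> x - s i x)) < e / 2"
   using lim.IH[of i, rule_format, OF half_gt_zero[OF e]] by auto
  note int = test_integrable_finite[OF M p(1)] lim.hyps
  have "(LINT x|M. norm (\<phi> x - f x)) <= (LINT x|M. norm (\<phi> x - s i x) + norm (s i x - f x))"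
  proof (rule integral_mono)
   show "norm (\<phi> x - f x) <= norm (\<phi> x - s i x) + norm (s i x - f x)" for x
    using norm_triangle_ineq[of "\<phi> x - s i x" "s i x - f x"] by simp
  qed (intro integrable_norm Bochner_Integration.integrable_add Bochner_Integration.integrable_diff int)+
  also have "... = (LINT x|M. norm (\<phi> x - s i x)) + (LINT x|M. norm (s i x - f x))"
   using int by simp
  also have "... < e" using p i by simp
  finally show "\<exists>\<phi>\<in>test_functions W. (LINT x|M. norm (\<phi> x - f x)) < e"
   using p(1) by (intro bexI[of _ \<phi>])
 qed
qed

lemma mollify_test_functions_eventually:
 fixes f :: "'a::euclidean_space => 'b::euclidean_space"
 assumes m: "mollifier \<rho> R" and f: "integrable lborel f"
  and K: "compact K" "\<And>x. x \<notin> K ==> f x = 0" and U: "open U" "K \<subseteq> U"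
 shows "\<exists>d>0. \<forall>r. 0 < r \<and> r < d --> mollify \<rho> r f \<in> test_functions U"
proof -
 obtain e where e: "e > 0" "(\<Union>x\<in>K. ball x e) \<subseteq> U"
  using compact_subset_open_imp_ball_epsilon_subset[OF K(1) U] by blast
 note R = mollifierD(5)[OF m]
 have "mollify \<rho> r f \<in> test_functions U" if r: "0 < r" "r < e / R" for r
 proof (rule mollify_test_function[OF m f r(1) K])
  fix y z :: 'a assume yz: "y \<in> K" "norm z <= r * R"
  moreover have "r * R < e" using r R by (simp add: field_simps)
  ultimately have "y + z \<in> ball y e" by (simp add: dist_norm)
  then show "y + z \<in> U" using yz e by blast
 qed
 then show ?thesis using e R by (intro exI[of _ "e / R"]) auto
qed

text \<open>Projecting an approximation onto the ball keeps it close; mollifying makes it smooth again.\<close>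

lemma test_dense_L1_bounded:
 fixes f :: "'a::euclidean_space => 'b::euclidean_space"
 assumes M: "finite_measure M" "sets M = sets borel" and U: "open U" "emeasure M (- U) = 0"
  and f: "integrable M f" "AE x in M. norm (f x) <= c" "c \<ge> 0" and e: "e > 0"
 shows "\<exists>\<phi>\<in>test_functions U. (\<forall>x. norm (\<phi> x) <= c) \<and> (LINT x|M. norm (\<phi> x - f x)) < e"
proof -
 interpret finite_measure M by (rule M(1))
 obtain \<phi> where p: "\<phi> \<in> test_functions U" "(LINT x|M. norm (\<phi> x - f x)) < e / 2"
  using test_dense_L1[OF M U f(1)] e by (meson half_gt_zero)
 define P where "P = closest_point (cball (0::'b) c)"
 have cb: "convex (cball (0::'b) c)" "closed (cball (0::'b) c)" "cball (0::'b) c \<noteq> {}" using f(3) by auto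
 have lip: "dist (P x) (P y) <= dist x y" for x y
  unfolding P_def by (rule closest_point_lipschitz[OF cb])
 have Pid: "P x = x" if "norm x <= c" for x
  unfolding P_def using that by (intro closest_point_self) auto
 have Pc: "norm (P x) <= c" for x
  using closest_point_in_set[OF cb(2,3), of x] unfolding P_def by simp
 have contP: "continuous_on UNIV P"
  unfolding P_def by (rule continuous_on_closest_point[OF cb])
 define \<psi> where "\<psi> x = P (\<phi> x)" for x
 have \<psi>: "continuous_on UNIV \<psi>" unfolding \<psi>_def
  by (intro continuous_on_compose2[OF contP test_continuous[OF p(1)]]) auto
 obtain K where K: "compact K" "K \<subseteq> U" "\<forall>x. x \<notin> K --> \<phi> x = 0"
  using test_support[OF p(1)] by blast
 have K0: "\<psi> x = 0" if "x \<notin> K" for x using K(3) that Pid[of 0] f(3) by (simp add: \<psi>_def)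
 have int: "integrable lborel \<psi>"
 proof -
  have "integrable lborel (%x. indicator K x *\<^sub>R \<psi> x)"
   by (rule borel_integrable_compact[OF K(1) continuous_on_subset[OF \<psi>]]) simp
  also have "(%x. indicator K x *\<^sub>R \<psi> x) = \<psi>" using K0 by (auto simp: indicator_def fun_eq_iff)
  finally show ?thesis .
 qed
 have \<psi>M: "integrable M \<psi>"
  using \<psi> Pc M(2) by (intro integrable_const_bound[of _ c])
   (auto simp: \<psi>_def cong: measurable_cong_sets intro!: borel_measurable_continuous_onI)
 obtain \<rho> :: "'a => real" where m: "mollifier \<rho> 1" using ex_mollifier by blast
 define d where "d = e / (4 * (measure M (space M) + 1))"
 have d: "d > 0" unfolding d_def using e by (intro divide_pos_pos) (auto simp: add_nonneg_pos)
 have d': "d * measure M (space M) < e / 2"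
 proof -
  have "d * measure M (space M) <= d * (measure M (space M) + 1)" using d by (intro mult_left_mono) auto
  also have "... = e / 4"
  proof -
   have "e / (4 * k) * k = e / 4" if "k > 0" for k :: real using that by simp
   from this[of "measure M (space M) + 1"] show ?thesis unfolding d_def using measure_nonneg[of M "space M"] by linarith
  qed
  finally show ?thesis using e by simp
 qed
 obtain d1 where d1: "d1 > 0" "\<And>r x. 0 < r ==> r < d1 ==> norm (mollify \<rho> r \<psi> x - \<psi> x) <= d"
  using mollify_uniform_limit[OF m \<psi> K(1) K0 d] by blast
 obtain d2 where d2: "d2 > 0" "\<And>r. 0 < r ==> r < d2 ==> mollify \<rho> r \<psi> \<in> test_functions U"
  using mollify_test_functions_eventually[OF m int K(1) K0 U(1) K(2)] by blast
 define r where "r = min d1 d2 / 2"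
 have r: "0 < r" "r < d1" "r < d2" using d1 d2 unfolding r_def by (auto simp: min_def)
 let ?\<theta> = "mollify \<rho> r \<psi>"
 have t: "?\<theta> \<in> test_functions U" using d2 r by blast
 note intM = test_integrable_finite[OF M p(1)] test_integrable_finite[OF M t] f(1) \<psi>M
 have "(LINT x|M. norm (?\<theta> x - f x)) <= (LINT x|M. d + norm (\<phi> x - f x))"
 proof (rule integral_mono_AE)
  show "AE x in M. norm (?\<theta> x - f x) <= d + norm (\<phi> x - f x)"
   using f(2)
  proof eventually_elim
   case (elim x)
   have "norm (?\<theta> x - f x) <= norm (?\<theta> x - \<psi> x) + norm (\<psi> x - f x)"
    by (rule norm_diff_triangle_le) auto
   moreover have "norm (\<psi> x - f x) <= norm (\<phi> x - f x)"
    using lip[of "\<phi> x" "f x"] Pid[OF elim] by (simp add: \<psi>_def dist_norm)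
   moreover have "norm (?\<theta> x - \<psi> x) <= d" using d1(2) r by blast
   ultimately show ?case by linarith
  qed
 qed (use intM in auto)
 also have "... = d * measure M (space M) + (LINT x|M. norm (\<phi> x - f x))"
  using intM by (subst Bochner_Integration.integral_add) auto
 also have "... < e" using p(2) d' by simp
 finally show ?thesis
  using t mollify_norm_le[OF m int r(1), of c] Pc by (intro bexI[of _ ?\<theta>]) (auto simp: \<psi>_def)
qed

text \<open>The sum is at most twice the larger norm. The constant 2^q obtained in this way is
  cruder than the one from convexity, but it holds for every positive exponent.\<close>

lemma norm_add_powr_le:
 fixes a b :: "'b::real_normed_vector"
 assumes "q > 0"
 shows "norm (a + b) powr q <= 2 powr q * (norm a powr q + norm b powr q)"
proof -
 let ?m = "max (norm a) (norm b)"
 have "norm (a + b) <= 2 * ?m" using norm_triangle_ineq[of a b] by linarith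
 then have "norm (a + b) powr q <= (2 * ?m) powr q" using assms by (intro powr_mono2) auto
 also have "... = 2 powr q * ?m powr q" by (rule powr_mult)
 also have "?m powr q <= norm a powr q + norm b powr q" by (auto simp: max_def)
 finally show ?thesis by simp
qed

section \<open>Mollification and density in L^q\<close>

lemma mollify_real_integral:
 fixes g :: "'a::euclidean_space => real"
 assumes m: "mollifier \<rho> R" and g: "integrable lborel g" "\<And>x. g x \<ge> 0" and e: "r > 0"
 shows "integrable lborel (mollify \<rho> r g)" "(LBINT x. mollify \<rho> r g x) = (LBINT x. g x)"
proof -
 have [measurable]: "g \<in> borel_measurable borel" "\<rho> \<in> borel_measurable borel"
  using g mollifierD(7)[OF m] by auto
 have mm [measurable]: "mollify \<rho> r g \<in> borel_measurable borel"
  by (rule borel_measurable_continuous_onI[OF k_smooth_continuous[OF mollify_k_smooth[OF mollifierD(1)[OF m] e g(1), of 0]]])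
 have nn: "mollify \<rho> r g x \<ge> 0" for x
  unfolding mollify_def by (rule Bochner_Integration.integral_nonneg) (simp add: g mollifierD(2)[OF m])
 have eq: "ennreal (mollify \<rho> r g x) = (\<integral>\<^sup>+z. ennreal (\<rho> z * g (x - r *\<^sub>R z)) \<partial>lborel)" for x
  unfolding mollify_def
  using mollify_integrable[OF mollifierD(1)[OF m] e g(1), of x] g(2) mollifierD(2)[OF m]
  by (subst nn_integral_eq_integral) auto
 have tr: "(\<integral>\<^sup>+x. ennreal (g (x - w)) \<partial>lborel) = (\<integral>\<^sup>+x. ennreal (g x) \<partial>lborel)" for w
  by (subst (2) lborel_distr_plus[of "- w", symmetric], subst nn_integral_distr) auto
 have "(\<integral>\<^sup>+x. ennreal (mollify \<rho> r g x) \<partial>lborel) = (\<integral>\<^sup>+x. \<integral>\<^sup>+z. ennreal (\<rho> z * g (x - r *\<^sub>R z)) \<partial>lborel \<partial>lborel)"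
  by (simp add: eq)
 also have "... = (\<integral>\<^sup>+z. \<integral>\<^sup>+x. ennreal (\<rho> z * g (x - r *\<^sub>R z)) \<partial>lborel \<partial>lborel)"
  by (rule lborel_pair.Fubini'[symmetric]) measurable
 also have "... = (\<integral>\<^sup>+z. ennreal (\<rho> z) * (\<integral>\<^sup>+x. ennreal (g x) \<partial>lborel) \<partial>lborel)"
  using mollifierD(2)[OF m] g(2) by (simp add: ennreal_mult nn_integral_cmult tr)
 also have "... = (\<integral>\<^sup>+z. ennreal (\<rho> z) \<partial>lborel) * (\<integral>\<^sup>+x. ennreal (g x) \<partial>lborel)"
  by (rule nn_integral_multc) measurable
 also have "(\<integral>\<^sup>+z. ennreal (\<rho> z) \<partial>lborel) = 1"
  using mollifierD(2,3,6)[OF m] by (subst nn_integral_eq_integral) auto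
 also have "(\<integral>\<^sup>+x. ennreal (g x) \<partial>lborel) = ennreal (LBINT x. g x)"
  using g by (intro nn_integral_eq_integral) auto
 finally have fin: "(\<integral>\<^sup>+x. ennreal (mollify \<rho> r g x) \<partial>lborel) = ennreal (LBINT x. g x)" by simp
 show "integrable lborel (mollify \<rho> r g)"
  by (rule integrableI_nn_integral_finite[OF _ _ fin]) (use nn g in auto)
 show "(LBINT x. mollify \<rho> r g x) = (LBINT x. g x)"
  using integral_eq_nn_integral[of "mollify \<rho> r g" lborel] fin nn g by (simp add: integral_nonneg)
qed

text \<open>Jensen's inequality for the q-th power. With t the norm of the mollification, t^q = t *
  t^(q-1) is at most the mean of |f| t^(q-1). Young's inequality splits off t^q / p, which is
  absorbed on the left, and 1 - 1/p = 1/q cancels the remaining factor.\<close>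

lemma mollify_powr_le:
 fixes f :: "'a::euclidean_space => 'b::euclidean_space"
 assumes m: "mollifier \<rho> R" and f: "integrable lborel f" "integrable lborel (%x. norm (f x) powr q)"
  and e: "r > 0" and q: "q > 1"
 shows "norm (mollify \<rho> r f x) powr q <= mollify \<rho> r (%x. norm (f x) powr q) x"
proof -
 define t where "t = norm (mollify \<rho> r f x)"
 define p where "p = q / (q - 1)"
 have p: "p > 1" "1 / q + 1 / p = 1" "(q - 1) * p = q" unfolding p_def using q by (auto simp: field_simps)
 have int: "integrable lborel (%z. \<rho> z *\<^sub>R f (x - r *\<^sub>R z))"
  "integrable lborel (%z. \<rho> z *\<^sub>R norm (f (x - r *\<^sub>R z)) powr q)"
  by (rule mollify_integrable[OF mollifierD(1)[OF m] e f(1)], rule mollify_integrable[OF mollifierD(1)[OF m] e f(2)])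
 have int': "integrable lborel (%z. \<rho> z * norm (f (x - r *\<^sub>R z)))"
  using integrable_norm[OF int(1)] mollifierD(2)[OF m] by simp
 have t0: "t \<ge> 0" unfolding t_def by simp
 have "t <= (LBINT z. norm (\<rho> z *\<^sub>R f (x - r *\<^sub>R z)))"
  unfolding t_def mollify_def by (rule integral_norm_bound)
 also have "... = (LBINT z. \<rho> z * norm (f (x - r *\<^sub>R z)))"
  using mollifierD(2)[OF m] by simp
 finally have "t * t powr (q - 1) <= (LBINT z. \<rho> z * norm (f (x - r *\<^sub>R z))) * t powr (q - 1)"
  by (rule mult_right_mono) simp
 also have "... = (LBINT z. \<rho> z * norm (f (x - r *\<^sub>R z)) * t powr (q - 1))" by simp
 also have "... <= (LBINT z. (\<rho> z *\<^sub>R norm (f (x - r *\<^sub>R z)) powr q) / q + \<rho> z * (t powr q / p))"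
 proof (rule integral_mono)
  fix z
  have "norm (f (x - r *\<^sub>R z)) * t powr (q - 1) <= norm (f (x - r *\<^sub>R z)) powr q / q + (t powr (q - 1)) powr p / p"
   by (rule Youngs_inequality) (use p q in auto)
  then have "norm (f (x - r *\<^sub>R z)) * t powr (q - 1) <= norm (f (x - r *\<^sub>R z)) powr q / q + t powr q / p"
   by (simp add: powr_powr p)
  from mult_left_mono[OF this mollifierD(2)[OF m, of z]]
  show "\<rho> z * norm (f (x - r *\<^sub>R z)) * t powr (q - 1) <= (\<rho> z *\<^sub>R norm (f (x - r *\<^sub>R z)) powr q) / q + \<rho> z * (t powr q / p)"
   by (simp add: algebra_simps)
 qed (use int int' mollifierD(6)[OF m] in auto)
 also have "... = mollify \<rho> r (%x. norm (f x) powr q) x / q + t powr q / p"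
  using int mollifierD(3,6)[OF m] unfolding mollify_def by (subst Bochner_Integration.integral_add) auto
 finally have *: "t * t powr (q - 1) <= mollify \<rho> r (%x. norm (f x) powr q) x / q + t powr q / p" .
 have "t * t powr (q - 1) = t powr q" using t0 q by (simp add: powr_mult_base)
 with * have "t powr q * (1 - 1 / p) <= mollify \<rho> r (%x. norm (f x) powr q) x / q" by (simp add: algebra_simps)
 moreover have "1 - 1 / p = 1 / q" using p by linarith
 ultimately show ?thesis using q by (simp add: t_def field_simps)
qed

lemma mollify_Lq_bound:
 fixes f :: "'a::euclidean_space => 'b::euclidean_space"
 assumes m: "mollifier \<rho> R" and f: "integrable lborel f" "integrable lborel (%x. norm (f x) powr q)"
  and e: "s > 0" and q: "q > 1"
 shows "integrable lborel (%x. norm (mollify \<rho> s f x) powr q)"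
  "(LBINT x. norm (mollify \<rho> s f x) powr q) <= (LBINT x. norm (f x) powr q)"
proof -
 have [measurable]: "mollify \<rho> s f \<in> borel_measurable borel"
  by (rule borel_measurable_continuous_onI[OF k_smooth_continuous[OF mollify_k_smooth[OF mollifierD(1)[OF m] e f(1), of 0]]])
 note r = mollify_real_integral[OF m f(2) _ e]
 show i: "integrable lborel (%x. norm (mollify \<rho> s f x) powr q)"
 proof (rule Bochner_Integration.integrable_bound[OF r(1)])
  show "AE x in lborel. norm (norm (mollify \<rho> s f x) powr q) <= norm (mollify \<rho> s (%x. norm (f x) powr q) x)"
   using mollify_powr_le[OF assms] by (auto intro: order_trans[OF _ abs_ge_self])
 qed auto
 have "(LBINT x. norm (mollify \<rho> s f x) powr q) <= (LBINT x. mollify \<rho> s (%x. norm (f x) powr q) x)"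
  by (rule integral_mono[OF i r(1) mollify_powr_le[OF assms]]) simp
 then show "(LBINT x. norm (mollify \<rho> s f x) powr q) <= (LBINT x. norm (f x) powr q)"
  using r(2) by simp
qed

text \<open>Truncation at height n reduces the claim to bounded functions, and between functions
  bounded by n the L^q distance is controlled by the L^1 distance. For this the L^1 approximation
  has to keep the sup bound.\<close>

lemma test_dense_Lq:
 fixes f :: "'a::euclidean_space => 'b::euclidean_space"
 assumes U: "open U" "bounded U" and f [measurable]: "f \<in> borel_measurable borel"
  and f0: "\<And>x. x \<notin> U ==> f x = 0" and int: "integrable lborel (%x. norm (f x) powr q)" and q: "q > 1" and e: "e > 0"
 shows "\<exists>\<phi>\<in>test_functions U. integrable lborel (%x. norm (\<phi> x - f x) powr q) \<and> (LBINT x. norm (\<phi> x - f x) powr q) < e"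
proof -
 define e1 where "e1 = e / (2 * 2 powr q)"
 have e1: "e1 > 0" "2 powr q * (e1 + e1) = e" unfolding e1_def using e by auto
 define T where "T n x = (if norm (f x) <= real n then f x else 0)" for n x
 have T [measurable]: "T n \<in> borel_measurable borel" for n unfolding T_def by measurable
 have Tq: "norm (T n x - f x) powr q <= norm (f x) powr q" for n x unfolding T_def by simp
 have iT: "integrable lborel (%x. norm (T n x - f x) powr q)" for n
  by (rule Bochner_Integration.integrable_bound[OF int]) (use Tq in auto)
 have "(%n. (LBINT x. norm (T n x - f x) powr q)) \<longlonglongrightarrow> (LINT x|(lborel :: 'a measure). (0::real))"
 proof (rule integral_dominated_convergence[where w="%x. norm (f x) powr q"])
  show "AE x in lborel. (%n. norm (T n x - f x) powr q) \<longlonglongrightarrow> 0"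
  proof (intro AE_I2 tendsto_eventually)
   fix x
   obtain N where "norm (f x) <= real N" using real_arch_simple by blast
   then show "\<forall>\<^sub>F n in sequentially. norm (T n x - f x) powr q = 0"
    by (intro eventually_sequentiallyI[of N]) (auto simp: T_def)
  qed
 qed (use Tq int in auto)
 then have "\<forall>\<^sub>F n in sequentially. (LBINT x. norm (T n x - f x) powr q) < e1"
  using e1(1) by (intro order_tendstoD(2)[where y=0]) auto
 then obtain n where n: "(LBINT x. norm (T n x - f x) powr q) < e1"
  unfolding eventually_sequentially by auto
 let ?c = "real n"
 let ?M = "density lborel (%x. ennreal (indicator U x))"
 have Ub [measurable]: "U \<in> sets borel" using U(1) by simp
 have Ufin: "emeasure lborel U < \<infinity>" using emeasure_bounded_finite[OF U(2)] by simp
 have M: "finite_measure ?M" "sets ?M = sets borel"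
  using Ufin by (auto intro!: finite_measureI simp: emeasure_density nn_integral_indicator ennreal_indicator)
 have M0: "emeasure ?M (- U) = 0"
  by (subst emeasure_density) (auto simp: ennreal_indicator indicator_def nn_integral_0_iff_AE)
 interpret M: finite_measure ?M by (rule M(1))
 have Tc: "norm (T n x) <= ?c" for x unfolding T_def by simp
 have iTM: "integrable ?M (T n)" using Tc by (intro M.integrable_const_bound[of _ ?c]) auto
 \<comment> \<open>The difference of two functions bounded by n satisfies |y|^q <= (2n + 1)^(q-1)
   |y|; the \<open>+ 1\<close> keeps the factor positive when n = 0.\<close>
 define e2 where "e2 = e1 / (2 * ?c + 1) powr (q - 1)"
 have e2: "e2 > 0" "(2 * ?c + 1) powr (q - 1) * e2 = e1" unfolding e2_def using e1 by (auto simp: add_nonneg_pos)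
 obtain \<phi> where p: "\<phi> \<in> test_functions U" "\<And>x. norm (\<phi> x) <= ?c" "(LINT x|?M. norm (\<phi> x - T n x)) < e2"
  using test_dense_L1_bounded[OF M U(1) M0 iTM _ _ e2(1), of ?c] Tc by auto
 have [measurable]: "\<phi> \<in> borel_measurable borel" by (rule test_measurable[OF p(1)])
 have "(LINT x|?M. norm (\<phi> x - T n x)) = (LBINT x. indicator U x *\<^sub>R norm (\<phi> x - T n x))"
  by (rule integral_density) auto
 also have "... = (LBINT x. norm (\<phi> x - T n x))"
  using f0 test_outside[OF p(1)] by (intro Bochner_Integration.integral_cong) (auto simp: indicator_def T_def)
 finally have L1: "(LBINT x. norm (\<phi> x - T n x)) < e2" using p(3) by simp
 have i1: "integrable lborel (%x. norm (\<phi> x - T n x))"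
 proof -
  have "integrable ?M (%x. norm (\<phi> x - T n x))"
   using test_integrable_finite[OF M p(1)] iTM by auto
  then have "integrable lborel (%x. indicator U x *\<^sub>R norm (\<phi> x - T n x))"
   by (subst (asm) integrable_density) auto
  also have "(%x. indicator U x *\<^sub>R norm (\<phi> x - T n x)) = (%x. norm (\<phi> x - T n x))"
   using f0 test_outside[OF p(1)] by (auto simp: indicator_def T_def fun_eq_iff)
  finally show ?thesis .
 qed
 have b: "norm (\<phi> x - T n x) powr q <= (2 * ?c + 1) powr (q - 1) * norm (\<phi> x - T n x)" for x
 proof -
  have "norm (\<phi> x - T n x) powr (q - 1) <= (2 * ?c + 1) powr (q - 1)"
   using norm_triangle_ineq4[of "\<phi> x" "T n x"] p(2)[of x] Tc[of x] q by (intro powr_mono2) auto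
  from mult_right_mono[OF this norm_ge_zero[of "\<phi> x - T n x"]] show ?thesis
   using q by (simp add: powr_mult_base mult.commute)
 qed
 have i2: "integrable lborel (%x. norm (\<phi> x - T n x) powr q)"
  by (rule Bochner_Integration.integrable_bound[OF integrable_mult_right[OF i1, of "(2 * ?c + 1) powr (q - 1)"]])
   (use b in auto)
 have "(LBINT x. norm (\<phi> x - T n x) powr q) <= (LBINT x. (2 * ?c + 1) powr (q - 1) * norm (\<phi> x - T n x))"
  by (rule integral_mono[OF i2 _ b]) (use i1 in auto)
 also have "... = (2 * ?c + 1) powr (q - 1) * (LBINT x. norm (\<phi> x - T n x))" by simp
 also have "... <= (2 * ?c + 1) powr (q - 1) * e2" using L1 by (intro mult_left_mono) auto
 finally have L2: "(LBINT x. norm (\<phi> x - T n x) powr q) <= e1" using e2 by simp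
 have t: "norm (\<phi> x - f x) powr q <= 2 powr q * (norm (\<phi> x - T n x) powr q + norm (T n x - f x) powr q)" for x
  using norm_add_powr_le[of q "\<phi> x - T n x" "T n x - f x"] q by simp
 have i3: "integrable lborel (%x. 2 powr q * (norm (\<phi> x - T n x) powr q + norm (T n x - f x) powr q))"
  using i2 iT by (intro integrable_mult_right Bochner_Integration.integrable_add)
 have i4: "integrable lborel (%x. norm (\<phi> x - f x) powr q)"
  by (rule Bochner_Integration.integrable_bound[OF i3]) (use t in \<open>auto intro: order_trans[OF _ abs_ge_self]\<close>)
 have "(LBINT x. norm (\<phi> x - f x) powr q)
   <= (LBINT x. 2 powr q * (norm (\<phi> x - T n x) powr q + norm (T n x - f x) powr q))"
  by (rule integral_mono[OF i4 i3 t])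
 also have "... = 2 powr q * ((LBINT x. norm (\<phi> x - T n x) powr q) + (LBINT x. norm (T n x - f x) powr q))"
  using i2 iT by simp
 also have "... < 2 powr q * (e1 + e1)" using L2 n by (intro mult_strict_left_mono) auto
 finally show ?thesis using p(1) i4 e1(2) by auto
qed

lemma mollify_diff:
 fixes f g :: "'a::euclidean_space => 'b::euclidean_space"
 assumes "mollifier \<rho> R" "e > 0" "integrable lborel f" "integrable lborel g"
 shows "mollify \<rho> e (%x. f x - g x) x = mollify \<rho> e f x - mollify \<rho> e g x"
 unfolding mollify_def scaleR_diff_right
 by (intro Bochner_Integration.integral_diff mollify_integrable mollifierD(1)[OF assms(1)] assms)

text \<open>Mollification does not increase the L^q norm, so it suffices to treat a test function
  close to \<open>f\<close>, for which convergence is uniform.\<close>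

lemma mollify_tendsto_Lq:
 fixes f :: "'a::euclidean_space => 'b::euclidean_space"
 assumes m: "mollifier \<rho> R" and U: "open U" "bounded U" and f: "integrable lborel f"
  and f0: "\<And>x. x \<notin> U ==> f x = 0" and int: "integrable lborel (%x. norm (f x) powr q)" and q: "q > 1"
 shows "((%s. (LBINT x. norm (mollify \<rho> s f x - f x) powr q)) \<longlongrightarrow> 0) (at_right 0)"
proof (rule tendstoI)
 fix e :: real assume e: "e > 0"
 define k where "k = 2 powr q"
 have k: "k > 0" unfolding k_def by simp
 define e1 where "e1 = e / (4 * k * (k + 1))"
 have e1: "e1 > 0" unfolding e1_def using e k by simp
 have e1': "k * (e1 + k * (e1 + e1)) < e"
 proof -
  have "k * (e1 + k * (e1 + e1)) <= k * (2 * e1 + k * (2 * e1))" using k e1 by simp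
  also have "... = e / 2"
  proof -
   have "4 * k * (k + 1) \<noteq> 0" using k by simp
   then have "e1 * (4 * k * (k + 1)) = e" using nonzero_eq_divide_eq[of _ e1 e] e1_def by blast
   then show ?thesis by (simp add: algebra_simps)
  qed
  finally show ?thesis using e by simp
 qed
 have [measurable]: "f \<in> borel_measurable borel" using f by auto
 obtain \<phi> where p: "\<phi> \<in> test_functions U" "integrable lborel (%x. norm (\<phi> x - f x) powr q)"
  "(LBINT x. norm (\<phi> x - f x) powr q) < e1"
  using test_dense_Lq[OF U _ f0 int q e1] by auto
 note \<phi>i = test_integrable[OF p(1)]
 have p': "integrable lborel (%x. norm (f x - \<phi> x) powr q)" "(LBINT x. norm (f x - \<phi> x) powr q) < e1"
  using p by (simp_all add: norm_minus_commute)
 obtain K where K: "compact K" "\<forall>x. x \<notin> K --> \<phi> x = 0"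
  using test_support[OF p(1)] by blast
 then obtain r where r: "\<And>x. x \<in> K ==> norm x <= r" using compact_imp_bounded[OF K(1)] unfolding bounded_iff by blast
 note R = mollifierD(5)[OF m]
 \<comment> \<open>For scales below 1 both \<open>\<phi>\<close> and its mollification vanish
   outside this ball, so uniform closeness integrates to an L^q estimate.\<close>
 let ?B = "cball (0::'a) (r + R)"
 have B [measurable]: "?B \<in> sets lborel" by simp
 have Bfin: "emeasure lborel ?B < \<infinity>" by (rule emeasure_bounded_finite) simp
 define \<delta> where "\<delta> = (e1 / (measure lborel ?B + 1)) powr (1 / q)"
 have \<delta>q: "\<delta> > 0" "\<delta> powr q * measure lborel ?B <= e1"
 proof -
  have pos: "measure lborel ?B + 1 > 0" by (simp add: add_nonneg_pos)
  then show "\<delta> > 0" unfolding \<delta>_def using e1 by simp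
  have "\<delta> powr q = e1 / (measure lborel ?B + 1)" unfolding \<delta>_def using e1 pos q by (simp add: powr_powr)
  then have "\<delta> powr q * (measure lborel ?B + 1) = e1" using pos by simp
  moreover have "\<delta> powr q * measure lborel ?B <= \<delta> powr q * (measure lborel ?B + 1)"
   by (intro mult_left_mono) auto
  ultimately show "\<delta> powr q * measure lborel ?B <= e1" by linarith
 qed
 obtain d where d: "d > 0" "\<And>s x. 0 < s ==> s < d ==> norm (mollify \<rho> s \<phi> x - \<phi> x) <= \<delta>"
  using mollify_uniform_limit[OF m test_continuous[OF p(1)] K(1) _ \<delta>q(1)] K(2) by blast
 have "(LBINT x. norm (mollify \<rho> s f x - f x) powr q) < e" if s: "0 < s" "s < min d 1" for s
 proof -
  have [measurable]: "mollify \<rho> s g \<in> borel_measurable borel" if "integrable lborel g" for g :: "'a => 'b"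
   by (rule borel_measurable_continuous_onI[OF k_smooth_continuous[OF mollify_k_smooth[OF mollifierD(1)[OF m] s(1) that, of 0]]])
  have b: "norm (mollify \<rho> s \<phi> x - \<phi> x) powr q <= indicator ?B x * \<delta> powr q" for x
  proof (cases "x \<in> ?B")
   case True
   then show ?thesis using d(2)[of s x] s q by (auto intro: powr_mono2)
  next
   case False
   have "\<phi> (x - s *\<^sub>R z) = 0" if "\<rho> z \<noteq> 0" for z
   proof -
    have "norm z <= R" using mollifierD(4)[OF m that] .
    then have "norm (s *\<^sub>R z) <= R" using s R by (simp add: mult_le_one mult_left_le_one_le order_trans[OF mult_left_le_one_le])
    then have "norm (x - s *\<^sub>R z) > r" using False norm_triangle_ineq2[of x "s *\<^sub>R z"] by simp
    then show ?thesis using r K(2) by (meson not_le)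
   qed
   then have "mollify \<rho> s \<phi> x = 0" by (rule mollify_eq_0[OF m])
   moreover have "\<phi> x = 0" using False r R K(2) by (force simp: not_le)
   ultimately show ?thesis by simp
  qed
  have iB: "integrable lborel (%x. indicator ?B x * \<delta> powr q)"
   using Bfin by simp
  have i1: "integrable lborel (%x. norm (mollify \<rho> s \<phi> x - \<phi> x) powr q)"
   by (rule Bochner_Integration.integrable_bound[OF iB]) (use b \<phi>i in auto)
  have "(LBINT x. norm (mollify \<rho> s \<phi> x - \<phi> x) powr q) <= (LBINT x. indicator ?B x * \<delta> powr q)"
   by (rule integral_mono[OF i1 iB b])
  also have "... <= e1" using \<delta>q Bfin by (simp add: mult.commute)
  finally have I1: "(LBINT x. norm (mollify \<rho> s \<phi> x - \<phi> x) powr q) <= e1" .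
  have fp: "integrable lborel (%x. f x - \<phi> x)" using f \<phi>i by auto
  note i2 = mollify_Lq_bound[OF m fp p'(1) s(1) q]
  let ?a = "%x. norm (mollify \<rho> s (%x. f x - \<phi> x) x) powr q"
  let ?b = "%x. norm (mollify \<rho> s \<phi> x - \<phi> x) powr q"
  let ?c = "%x. norm (\<phi> x - f x) powr q"
  have t: "norm (mollify \<rho> s f x - f x) powr q <= k * (?a x + k * (?b x + ?c x))" for x
  proof -
   have "mollify \<rho> s f x - f x = mollify \<rho> s (%x. f x - \<phi> x) x + ((mollify \<rho> s \<phi> x - \<phi> x) + (\<phi> x - f x))"
    using mollify_diff[OF m s(1) f \<phi>i] by simp
   then have "norm (mollify \<rho> s f x - f x) powr q <= k * (?a x + norm ((mollify \<rho> s \<phi> x - \<phi> x) + (\<phi> x - f x)) powr q)"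
    unfolding k_def using q by (simp only:) (rule norm_add_powr_le, simp)
   also have "... <= k * (?a x + k * (?b x + ?c x))"
    using norm_add_powr_le[of q "mollify \<rho> s \<phi> x - \<phi> x" "\<phi> x - f x"] q k unfolding k_def
    by (intro mult_left_mono add_left_mono) auto
   finally show ?thesis .
  qed
  have i3: "integrable lborel (%x. k * (?a x + k * (?b x + ?c x)))"
   by (intro integrable_mult_right Bochner_Integration.integrable_add i1 i2(1) p(2))
  have "(LBINT x. norm (mollify \<rho> s f x - f x) powr q) <= (LBINT x. k * (?a x + k * (?b x + ?c x)))"
   by (rule integral_mono'[OF i3 t]) (use k in \<open>intro mult_nonneg_nonneg add_nonneg_nonneg, auto\<close>)
  also have "... = k * ((LBINT x. ?a x) + k * ((LBINT x. ?b x) + (LBINT x. ?c x)))"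
   using i1 i2(1) p(2) by simp
  also have "... <= k * (e1 + k * (e1 + e1))"
   using I1 i2(2) p'(2) p(3) k by (intro mult_left_mono add_mono) auto
  finally show ?thesis using e1' by simp
 qed
 then have "\<forall>s>0. s < min d 1 --> dist (LBINT x. norm (mollify \<rho> s f x - f x) powr q) 0 < e"
  by (auto simp: dist_real_def)
 then show "\<forall>\<^sub>F s in at_right 0. dist (LBINT x. norm (mollify \<rho> s f x - f x) powr q) 0 < e"
  using d(1) unfolding eventually_at_right_field by (intro exI[of _ "min d 1"]) auto
qed

section \<open>Vector measures\<close>

abbreviation borel_on :: "'a::euclidean_space set => 'a set set" where
 "borel_on U \<equiv> sets (restrict_space borel U)"

lemma borel_on_sigma_algebra: "sigma_algebra U (borel_on U)"
 using sets.sigma_algebra_axioms[of "restrict_space borel U"] by (simp add: space_restrict_space)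

lemma borel_on_sigma_sets [simp]: "sigma_sets U (borel_on U) = borel_on U"
 by (rule sigma_algebra.sigma_sets_eq[OF borel_on_sigma_algebra])

lemma borel_on_Pow: "borel_on U \<subseteq> Pow U"
 using sets.space_closed[of "restrict_space borel U"] by (simp add: space_restrict_space)

lemma borel_on_top [simp]: "U \<in> borel_on U"
 using sets.top[of "restrict_space borel U"] by (simp add: space_restrict_space)

lemma space_borel_on: "sets M = borel_on U ==> space M = U"
 using sets_eq_imp_space_eq[of M "restrict_space borel U"] by (simp add: space_restrict_space)

lemma vector_measureD:
 assumes "vector_measure U m" "range A \<subseteq> borel_on U" "disjoint_family A"
 shows "(%n. m (A n)) sums m (\<Union>n. A n)"
 using assms unfolding vector_measure_def by blast

lemma vector_measure_empty:
 assumes "vector_measure U m"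
 shows "m {} = 0"
proof -
 have "(%n::nat. m {}) sums m (\<Union>n::nat. {})"
  by (rule vector_measureD[OF assms, of "%_. {}"]) (auto simp: disjoint_family_on_def)
 then have "(%n::nat. m {}) \<longlonglongrightarrow> 0" using sums_summable summable_LIMSEQ_zero by blast
 then show ?thesis using LIMSEQ_const_iff by blast
qed

lemma vector_measure_Un:
 assumes m: "vector_measure U m" and "A \<in> borel_on U" "B \<in> borel_on U" "A \<inter> B = {}"
 shows "m (A \<union> B) = m A + m B"
proof -
 have "(%n. m (binaryset A B n)) sums m (\<Union>n. binaryset A B n)"
  by (rule vector_measureD[OF m]) (use assms in \<open>auto simp: binaryset_def disjoint_family_on_def\<close>)
 moreover have "(%n. m (binaryset A B n)) sums (m A + m B)"
  by (rule binaryset_sums[of m, OF vector_measure_empty[OF m]])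
 ultimately show ?thesis using sums_unique2 by (metis UN_binaryset_eq)
qed

lemma vector_measure_Diff:
 assumes m: "vector_measure U m" and "A \<in> borel_on U" "B \<in> borel_on U" "B \<subseteq> A"
 shows "m (A - B) = m A - m B"
proof -
 have "A - B \<in> borel_on U" "(A - B) \<inter> B = {}" "(A - B) \<union> B = A" using assms by auto
 then show ?thesis using vector_measure_Un[OF m, of "A - B" B] assms by simp
qed

lemma vector_measureI:
 assumes "\<And>A. range A \<subseteq> borel_on U ==> disjoint_family A ==> (%n::nat. m (A n)) sums m (\<Union>n. A n)"
 shows "vector_measure U m"
 unfolding vector_measure_def using assms by simp

lemma vector_measure_inner: "vector_measure U m ==> vector_measure U (%E. m E \<bullet> b)"
 by (rule vector_measureI) (rule bounded_linear.sums[OF bounded_linear_inner_left]; rule vector_measureD)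

text \<open>If \<open>n\<close> is unbounded on the subsets of a set, it is unbounded on one of two
  suitable parts, while the discarded part has a value of modulus at least 1. Iteration produces
  disjoint differences whose values do not tend to 0, against the convergence of their
  series.\<close>

lemma real_vector_measure_bounded:
 fixes n :: "'a::euclidean_space set => real"
 assumes n: "vector_measure W n"
 shows "\<exists>C. \<forall>E\<in>borel_on W. \<bar>n E\<bar> <= C"
proof (rule ccontr)
 define B where "B = borel_on W"
 define U where "U E \<longleftrightarrow> E \<in> B \<and> (\<forall>C. \<exists>F\<in>B. F \<subseteq> E \<and> \<bar>n F\<bar> > C)" for E
 assume "\<nexists>C. \<forall>E\<in>borel_on W. \<bar>n E\<bar> <= C"
 then have ub: "\<exists>F\<in>B. \<not> \<bar>n F\<bar> <= C" for C unfolding B_def by blast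
 have "\<exists>F\<in>B. F \<subseteq> W \<and> \<bar>n F\<bar> > C" for C
 proof -
  obtain F where "F \<in> B" "\<not> \<bar>n F\<bar> <= C" using ub by blast
  then show ?thesis using borel_on_Pow[of W] by (intro bexI[of _ F]) (auto simp: B_def)
 qed
 then have U0: "U W" unfolding U_def by (simp add: B_def)
 have step: "\<exists>E'. U E' \<and> E' \<subseteq> E \<and> \<bar>n (E - E')\<bar> \<ge> 1" if UE: "U E" for E
 proof -
  have E: "E \<in> B" using UE unfolding U_def by blast
  \<comment> \<open>The excess over |n E| + 1 gives both \<open>F\<close> and \<open>E - F\<close> a
    value of modulus greater than 1, so either of them may be the discarded part.\<close>
  obtain F where F: "F \<in> B" "F \<subseteq> E" "\<bar>n F\<bar> > \<bar>n E\<bar> + 1" using UE unfolding U_def by blast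
  have d: "n (E - F) = n E - n F" "n (E - (E - F)) = n F"
  proof -
   show "n (E - F) = n E - n F" using vector_measure_Diff[OF n, of E F] F E unfolding B_def by blast
   have "E - (E - F) = F" using F by blast
   then show "n (E - (E - F)) = n F" by simp
  qed
  have EF: "E - F \<in> B" using E F(1) unfolding B_def by (rule sets.Diff)
  have "U F \<or> U (E - F)"
  proof (rule ccontr)
   assume "\<not> ?thesis"
   then obtain C1 C2 where C: "\<And>G. G \<in> B ==> G \<subseteq> F ==> \<bar>n G\<bar> <= C1" "\<And>G. G \<in> B ==> G \<subseteq> E - F ==> \<bar>n G\<bar> <= C2"
   proof -
    have bd: "\<exists>C. \<forall>G\<in>B. G \<subseteq> H --> \<not> \<bar>n G\<bar> > C" if "H \<in> B" "\<not> U H" for H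
     using that unfolding U_def by simp
    from \<open>\<not> (U F \<or> U (E - F))\<close> have nU: "\<not> U F" "\<not> U (E - F)" by simp_all
    obtain C1 where C1: "\<forall>G\<in>B. G \<subseteq> F --> \<not> \<bar>n G\<bar> > C1" using bd[OF F(1) nU(1)] by (rule exE)
    obtain C2 where C2: "\<forall>G\<in>B. G \<subseteq> E - F --> \<not> \<bar>n G\<bar> > C2" using bd[OF EF nU(2)] by (rule exE)
    show ?thesis by (rule that[of C1 C2]) (use C1 C2 in \<open>simp_all add: not_less\<close>)
   qed
   obtain G where G: "G \<in> B" "G \<subseteq> E" "\<bar>n G\<bar> > C1 + C2" using UE unfolding U_def by blast
   have GG: "G \<inter> F \<in> B" "G - F \<in> B" using G F unfolding B_def by auto
   have "n G = n (G \<inter> F) + n (G - F)"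
    using vector_measure_Un[OF n, of "G \<inter> F" "G - F"] GG unfolding B_def by (simp add: Int_Diff_Un Int_Diff_disjoint)
   moreover have "\<bar>n (G \<inter> F)\<bar> <= C1" "\<bar>n (G - F)\<bar> <= C2" using C GG G by auto
   ultimately show False using G(3) by linarith
  qed
  then show ?thesis
  proof
   assume "U F"
   then show ?thesis using F d by (intro exI[of _ F]) auto
  next
   assume "U (E - F)"
   then show ?thesis using F d by (intro exI[of _ "E - F"]) auto
  qed
 qed
 have "\<exists>E. \<forall>k. U (E k) \<and> (E (Suc k) \<subseteq> E k \<and> \<bar>n (E k - E (Suc k))\<bar> \<ge> 1)"
  by (rule dependent_nat_choice[where P="%_. U" and Q="%_ E E'. E' \<subseteq> E \<and> \<bar>n (E - E')\<bar> \<ge> 1"])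
   (use U0 step in blast)+
 then obtain E where E: "\<And>k. U (E k)" "\<And>k. E (Suc k) \<subseteq> E k" "\<And>k. \<bar>n (E k - E (Suc k))\<bar> \<ge> 1" by blast
 have dec: "E j \<subseteq> E i" if "i <= j" for i j by (rule lift_Suc_antimono_le[of E, OF E(2) that])
 have "disjoint_family (%k. E k - E (Suc k))"
 proof -
  have "(E i - E (Suc i)) \<inter> (E j - E (Suc j)) = {}" if "i < j" for i j
   using dec[of "Suc i" j] that by auto
  note lt = this
  show ?thesis unfolding disjoint_family_on_def
  proof (intro ballI impI)
   fix i j :: nat assume "i \<noteq> j"
   then show "(E i - E (Suc i)) \<inter> (E j - E (Suc j)) = {}"
    using lt[of i j] lt[of j i] by (cases "i < j") (auto simp: not_less)
  qed
 qed
 then have "(%k. n (E k - E (Suc k))) sums n (\<Union>k. E k - E (Suc k))"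
  using E(1) unfolding U_def B_def by (intro vector_measureD[OF n]) auto
 then have "(%k. n (E k - E (Suc k))) \<longlonglongrightarrow> 0" using sums_summable summable_LIMSEQ_zero by blast
 from order_tendstoD(2)[OF tendsto_norm_zero[OF this], of 1]
 have "\<forall>\<^sub>F k in sequentially. norm (n (E k - E (Suc k))) < 1" by simp
 then obtain k where "\<bar>n (E k - E (Suc k))\<bar> < 1" unfolding eventually_sequentially by auto
 with E(3)[of k] show False by simp
qed

lemma nonneg_vector_measure:
 fixes f :: "'a::euclidean_space set => real"
 assumes f: "vector_measure U f" and nn: "\<And>E. E \<in> borel_on U ==> f E \<ge> 0"
 obtains M where "finite_measure M" "sets M = borel_on U" "\<And>E. E \<in> borel_on U ==> emeasure M E = ennreal (f E)"
proof -
 let ?M = "measure_of U (borel_on U) (%E. ennreal (f E))"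
 have s: "sets ?M = borel_on U" "space ?M = U"
  using sets_measure_of[OF borel_on_Pow, of U] space_measure_of[OF borel_on_Pow, of U] by simp_all
 have e: "emeasure ?M E = ennreal (f E)" if "E \<in> borel_on U" for E
 proof (rule emeasure_measure_of[OF refl borel_on_Pow])
  show "positive (sets ?M) (%E. ennreal (f E))" by (simp add: positive_def vector_measure_empty[OF f])
  show "countably_additive (sets ?M) (%E. ennreal (f E))"
  proof (rule countably_additiveI)
   fix A :: "nat => 'a set" assume A: "range A \<subseteq> sets ?M" "disjoint_family A" "\<Union>(range A) \<in> sets ?M"
   have "(%n. f (A n)) sums f (\<Union>n. A n)" using A s by (intro vector_measureD[OF f]) auto
   moreover have "f (A n) \<ge> 0" for n using A s nn by auto
   ultimately show "(\<Sum>i. ennreal (f (A i))) = ennreal (f (\<Union>(range A)))"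
    by (simp add: suminf_ennreal2 sums_iff)
  qed
 qed (use that s in auto)
 have "finite_measure ?M" by (rule finite_measureI) (use s e[OF borel_on_top] in simp)
 then show ?thesis using that s e by blast
qed

text \<open>Take for \<open>p E\<close> the supremum of \<open>n\<close> over the measurable subsets
  of \<open>E\<close>, which is finite because \<open>n\<close> is bounded. Superadditivity bounds
  the partial sums by \<open>p\<close> of the union, and cutting a subset of the union along the
  pieces gives the converse inequality.\<close>

lemma real_vector_measure_positive_variation:
 fixes n :: "'a::euclidean_space set => real"
 assumes n: "vector_measure U n"
 obtains p where "vector_measure U p" "\<And>E. E \<in> borel_on U ==> p E \<ge> 0" "\<And>E. E \<in> borel_on U ==> p E \<ge> n E"
proof -
 define B where "B = borel_on U"
 obtain C where C: "\<And>E. E \<in> B ==> n E <= C"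
  using real_vector_measure_bounded[OF n] unfolding B_def by (meson abs_le_D1)
 define S where "S E = {n F |F. F \<in> B \<and> F \<subseteq> E}" for E
 define p where "p E = Sup (S E)" for E
 have bdd: "bdd_above (S E)" for E unfolding S_def using C by (intro bdd_aboveI[of _ C]) auto
 have e0: "0 \<in> S E" for E unfolding S_def B_def using vector_measure_empty[OF n] by (auto intro!: exI[of _ "{}"])
 have up: "n F <= p E" if "F \<in> B" "F \<subseteq> E" for E F
  unfolding p_def by (rule cSup_upper[OF _ bdd]) (use that in \<open>auto simp: S_def\<close>)
 have le: "p E <= c" if "\<And>F. F \<in> B ==> F \<subseteq> E ==> n F <= c" for E c
  unfolding p_def by (rule cSup_least) (use that e0[of E] in \<open>auto simp: S_def\<close>)
 have p0: "p E \<ge> 0" for E unfolding p_def by (rule cSup_upper[OF e0 bdd])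
 have super: "p E + p F <= p (E \<union> F)" if "E \<in> B" "F \<in> B" "E \<inter> F = {}" for E F
 proof -
  have "p E <= p (E \<union> F) - p F"
  proof (rule le)
   fix G assume G: "G \<in> B" "G \<subseteq> E"
   have "p F <= p (E \<union> F) - n G"
   proof (rule le)
    fix H assume H: "H \<in> B" "H \<subseteq> F"
    have "n (G \<union> H) = n G + n H"
     using G H that unfolding B_def by (intro vector_measure_Un[OF n]) auto
    moreover have "n (G \<union> H) <= p (E \<union> F)" using G H unfolding B_def by (intro up) (auto simp: B_def)
    ultimately show "n H <= p (E \<union> F) - n G" by simp
   qed
   then show "n G <= p (E \<union> F) - p F" by simp
  qed
  then show ?thesis by simp
 qed
 have mono: "p E <= p F" if "E \<subseteq> F" for E F by (rule le) (use that up in blast)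
 have "vector_measure U p"
  unfolding vector_measure_def
 proof (intro allI impI, elim conjE)
  fix A :: "nat => 'a set" assume A: "range A \<subseteq> borel_on U" "disjoint_family A"
  have AB: "A i \<in> B" for i using A unfolding B_def by auto
  have fin: "(\<Sum>i<k. p (A i)) <= p (\<Union>i<k. A i)" for k
  proof (induction k)
   case (Suc k)
   have "p (\<Union>i<k. A i) + p (A k) <= p ((\<Union>i<k. A i) \<union> A k)"
   proof (rule super)
    show "(\<Union>i<k. A i) \<in> B" using A unfolding B_def by auto
    have "A i \<inter> A k = {}" if "i < k" for i using that by (intro disjoint_family_onD[OF A(2)]) auto
    then show "(\<Union>i<k. A i) \<inter> A k = {}" by blast
   qed (rule AB)
   with Suc show ?case by (simp add: lessThan_Suc Un_commute)
  qed (simp add: p0)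
  then have fin': "(\<Sum>i<k. p (A i)) <= p (\<Union>n. A n)" for k
   by (rule order_trans) (auto intro: mono)
  have sm: "summable (%i. p (A i))"
  proof (rule bounded_imp_summable[OF p0])
   show "(\<Sum>i\<le>k. p (A i)) <= p (\<Union>n. A n)" for k
    using fin'[of "Suc k"] by (simp only: lessThan_Suc_atMost)
  qed
  have "(\<Sum>i. p (A i)) <= p (\<Union>n. A n)" by (rule suminf_le_const[OF sm fin'])
  moreover have "p (\<Union>n. A n) <= (\<Sum>i. p (A i))"
  proof (rule le)
   fix F assume F: "F \<in> B" "F \<subseteq> (\<Union>n. A n)"
   have "(%i. n (F \<inter> A i)) sums n (\<Union>i. F \<inter> A i)"
   proof (rule vector_measureD[OF n])
    show "range (%i. F \<inter> A i) \<subseteq> borel_on U" using F AB by (auto simp: B_def)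
    show "disjoint_family (%i. F \<inter> A i)" by (rule disjoint_family_subset[OF A(2)]) auto
   qed
   moreover have "(\<Union>i. F \<inter> A i) = F" using F by auto
   ultimately have s: "(%i. n (F \<inter> A i)) sums n F" by simp
   have "n (F \<inter> A i) <= p (A i)" for i using F AB by (intro up) (auto simp: B_def)
   then show "n F <= (\<Sum>i. p (A i))" using s sm suminf_le[of "%i. n (F \<inter> A i)" "%i. p (A i)"] by (auto simp: sums_iff)
  qed
  ultimately show "(%i. p (A i)) sums p (\<Union>i. A i)" using sm by (simp add: sums_iff)
 qed
 then show ?thesis using that p0 up B_def by blast
qed

lemma vector_measure_add: "vector_measure U m ==> vector_measure U n ==> vector_measure U (%E. m E + n E)"
 by (rule vector_measureI) (rule sums_add; rule vector_measureD)

lemma vector_measure_diff: "vector_measure U m ==> vector_measure U n ==> vector_measure U (%E. m E - n E)"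
 by (rule vector_measureI) (rule sums_diff; rule vector_measureD)

lemma vector_measure_sum:
 assumes "\<And>b. b \<in> I ==> vector_measure U (m b)"
 shows "vector_measure U (%E. \<Sum>b\<in>I. m b E)"
 by (rule vector_measureI) (rule sums_sum; rule vector_measureD[OF assms])

section \<open>Densities and polar decomposition\<close>

lemma real_density_exists:
 assumes M: "finite_measure M" "finite_measure N" "sets N = sets M" and le: "\<And>E. E \<in> sets M ==> emeasure N E <= emeasure M E"
 obtains D :: "'a => real" where "integrable M D" "\<And>E. E \<in> sets M ==> measure N E = (LINT x:E|M. D x)"
proof -
 interpret M: finite_measure M by (rule M(1))
 interpret N: finite_measure N by (rule M(2))
 have ac: "absolutely_continuous M N"
  unfolding absolutely_continuous_def
 proof
  fix E assume "E \<in> null_sets M"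
  then have "E \<in> sets M" "emeasure N E <= 0" using le[of E] by (auto simp: null_sets_def)
  then show "E \<in> null_sets N" using M(3) by (auto intro!: null_setsI)
 qed
 obtain D where D: "D \<in> borel_measurable M" "AE x in M. RN_deriv M N x = ennreal (D x)" "\<And>x. 0 <= D x"
  by (rule M.real_RN_deriv[OF M(2) ac M(3)], rule that)
 have e: "emeasure N E = (\<integral>\<^sup>+x\<in>E. ennreal (D x) \<partial>M)" if "E \<in> sets M" for E
 proof -
  have "emeasure N E = emeasure (density M (RN_deriv M N)) E" using M.density_RN_deriv[OF ac M(3)] by simp
  also have "... = (\<integral>\<^sup>+x\<in>E. RN_deriv M N x \<partial>M)" using that by (intro emeasure_density) auto
  also have "... = (\<integral>\<^sup>+x\<in>E. ennreal (D x) \<partial>M)" using D(2) by (intro nn_integral_cong_AE) auto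
  finally show ?thesis .
 qed
 have "(\<integral>\<^sup>+x. ennreal (D x) \<partial>M) = (\<integral>\<^sup>+x\<in>space M. ennreal (D x) \<partial>M)"
  by (intro nn_integral_cong) auto
 also have "... = emeasure N (space M)" using e by simp
 also have "... < \<infinity>" using N.emeasure_finite top.not_eq_extremum by (metis infinity_ennreal_def)
 finally have iD: "integrable M D" using D by (intro integrableI_nonneg) auto
 have "measure N E = (LINT x:E|M. D x)" if E: "E \<in> sets M" for E
 proof -
  have iE: "integrable M (%x. indicator E x *\<^sub>R D x)" using iD E by (rule integrable_mult_indicator[rotated])
  have "ennreal (measure N E) = (\<integral>\<^sup>+x. ennreal (indicator E x *\<^sub>R D x) \<partial>M)"
   unfolding N.emeasure_eq_measure[symmetric] e[OF E] by (intro nn_integral_cong) (auto simp: indicator_def)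
  also have "... = ennreal (LINT x|M. indicator E x *\<^sub>R D x)"
   using iE D(3) by (intro nn_integral_eq_integral) auto
  finally have "measure N E = (LINT x|M. indicator E x *\<^sub>R D x)"
   using D(3) by (subst (asm) ennreal_inj) (auto intro!: Bochner_Integration.integral_nonneg)
  then show ?thesis by (simp add: set_lebesgue_integral_def)
 qed
 then show ?thesis by (rule that[OF iD])
qed

text \<open>Each coordinate of \<open>m\<close> is a difference of two nonnegative measures, and the
  sum \<open>\<mu>\<close> of all of these dominates them; Radon-Nikodym with respect to this sum
  gives the coordinates of \<open>\<sigma>\<close>. Statements about variation measures thereby
  become statements about integrals.\<close>

lemma vector_measure_density:
 fixes m :: "'a::euclidean_space set => 'b::euclidean_space"
 assumes m: "vector_measure U m"
 obtains M \<sigma> where "finite_measure M" "sets M = borel_on U" "integrable M \<sigma>"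
  "\<And>E. E \<in> borel_on U ==> m E = (LINT x:E|M. \<sigma> x)"
proof -
 have "\<forall>b\<in>Basis. \<exists>p. vector_measure U p \<and> (\<forall>E\<in>borel_on U. p E \<ge> 0) \<and> (\<forall>E\<in>borel_on U. p E \<ge> m E \<bullet> b)"
 proof
  fix b :: 'b
  obtain p where "vector_measure U p" "\<And>E. E \<in> borel_on U ==> p E \<ge> 0" "\<And>E. E \<in> borel_on U ==> p E \<ge> m E \<bullet> b"
   by (rule real_vector_measure_positive_variation[OF vector_measure_inner[OF m, of b]], rule that)
  then show "\<exists>p. vector_measure U p \<and> (\<forall>E\<in>borel_on U. p E \<ge> 0) \<and> (\<forall>E\<in>borel_on U. p E \<ge> m E \<bullet> b)"
   by blast
 qed
 from bchoice[OF this] obtain p where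
  "\<forall>b\<in>Basis. vector_measure U (p b) \<and> (\<forall>E\<in>borel_on U. p b E \<ge> 0) \<and> (\<forall>E\<in>borel_on U. p b E \<ge> m E \<bullet> b)" ..
 then have p: "\<And>b. b \<in> Basis ==> vector_measure U (p b)"
  "\<And>b E. b \<in> Basis ==> E \<in> borel_on U ==> p b E \<ge> 0"
  "\<And>b E. b \<in> Basis ==> E \<in> borel_on U ==> p b E \<ge> m E \<bullet> b" by simp_all
 define n where "n b E = p b E - m E \<bullet> b" for b E
 have n: "vector_measure U (n b)" "\<And>E. E \<in> borel_on U ==> n b E \<ge> 0" if "b \<in> Basis" for b
  unfolding n_def using vector_measure_diff[OF p(1)[OF that] vector_measure_inner[OF m]] p(3)[OF that] by auto
 define \<mu> where "\<mu> E = (\<Sum>b\<in>Basis. p b E + n b E)" for E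
 have \<mu>: "vector_measure U \<mu>"
  unfolding \<mu>_def by (intro vector_measure_sum vector_measure_add p(1) n(1))
 have \<mu>0: "\<mu> E \<ge> 0" if "E \<in> borel_on U" for E
  unfolding \<mu>_def using p(2) n(2) that by (intro sum_nonneg add_nonneg_nonneg) auto
 obtain M where M: "finite_measure M" "sets M = borel_on U" "\<And>E. E \<in> borel_on U ==> emeasure M E = ennreal (\<mu> E)"
  by (rule nonneg_vector_measure[OF \<mu> \<mu>0], assumption, rule that)
 have dens: "\<exists>D. integrable M D \<and> (\<forall>E\<in>borel_on U. f E = (LINT x:E|M. D x))"
  if f: "vector_measure U f" "\<And>E. E \<in> borel_on U ==> f E \<ge> 0" "\<And>E. E \<in> borel_on U ==> f E <= \<mu> E" for f :: "'a set => real"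
 proof -
  obtain N where N: "finite_measure N" "sets N = borel_on U" "\<And>E. E \<in> borel_on U ==> emeasure N E = ennreal (f E)"
   by (rule nonneg_vector_measure[OF f(1,2)], assumption, rule that)
  have NM: "sets N = sets M" using N(2) M(2) by simp
  have le: "emeasure N E <= emeasure M E" if "E \<in> sets M" for E
   using that M(2,3) N(3) f(3)[of E] by (simp add: ennreal_leI)
  obtain D where D: "integrable M D" "\<And>E. E \<in> sets M ==> measure N E = (LINT x:E|M. D x)"
   by (rule real_density_exists[OF M(1) N(1) NM le], assumption, rule that)
  have "f E = (LINT x:E|M. D x)" if "E \<in> borel_on U" for E
   using D(2)[of E] N(3)[OF that] f(2)[OF that] that M(2) by (simp add: measure_def)
  with D(1) show ?thesis by blast
 qed
 have "\<exists>D. integrable M D \<and> (\<forall>E\<in>borel_on U. m E \<bullet> b = (LINT x:E|M. D x))" if b: "b \<in> Basis" for b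
 proof -
  have le: "p b E + n b E <= \<mu> E" if "E \<in> borel_on U" for E
   unfolding \<mu>_def by (rule member_le_sum[OF b]) (use p(2) n(2) that in \<open>auto intro: add_nonneg_nonneg\<close>)
  obtain D1 where D1: "integrable M D1" "\<And>E. E \<in> borel_on U ==> p b E = (LINT x:E|M. D1 x)"
  proof -
   have "p b E <= \<mu> E" if "E \<in> borel_on U" for E using le[OF that] n(2)[OF b that] by linarith
   from dens[OF p(1)[OF b] p(2)[OF b] this] show ?thesis using that by blast
  qed
  obtain D2 where D2: "integrable M D2" "\<And>E. E \<in> borel_on U ==> n b E = (LINT x:E|M. D2 x)"
  proof -
   have "n b E <= \<mu> E" if "E \<in> borel_on U" for E using le[OF that] p(2)[OF b that] by linarith
   from dens[OF n(1)[OF b] n(2)[OF b] this] show ?thesis using that by blast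
  qed
  have "m E \<bullet> b = (LINT x:E|M. D1 x - D2 x)" if E: "E \<in> borel_on U" for E
  proof -
   have "set_integrable M E D1" "set_integrable M E D2"
   proof -
    have EM: "E \<in> sets M" using E M(2) by simp
    show "set_integrable M E D1" "set_integrable M E D2" unfolding set_integrable_def
     by (rule integrable_mult_indicator[OF EM D1(1)], rule integrable_mult_indicator[OF EM D2(1)])
   qed
   then have "(LINT x:E|M. D1 x - D2 x) = p b E - n b E" using D1(2) D2(2) E by (simp add: set_integral_diff)
   then show ?thesis unfolding n_def by simp
  qed
  then show ?thesis using D1(1) D2(1) by (intro exI[of _ "%x. D1 x - D2 x"]) auto
 qed
 then have "\<forall>b\<in>Basis. \<exists>D. integrable M D \<and> (\<forall>E\<in>borel_on U. m E \<bullet> b = (LINT x:E|M. D x))" by blast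
 from bchoice[OF this] obtain D where
  "\<forall>b\<in>Basis. integrable M (D b) \<and> (\<forall>E\<in>borel_on U. m E \<bullet> b = (LINT x:E|M. D b x))" ..
 then have D: "\<And>b. b \<in> Basis ==> integrable M (D b)"
  "\<And>b E. b \<in> Basis ==> E \<in> borel_on U ==> m E \<bullet> b = (LINT x:E|M. D b x)" by simp_all
 define \<sigma> where "\<sigma> x = (\<Sum>b\<in>Basis. D b x *\<^sub>R b)" for x
 have i: "integrable M \<sigma>" unfolding \<sigma>_def using D(1) by (intro Bochner_Integration.integrable_sum integrable_scaleR_left)
 have "m E = (LINT x:E|M. \<sigma> x)" if E: "E \<in> borel_on U" for E
 proof (rule euclidean_eqI)
  fix b :: 'b assume b: "b \<in> Basis"
  have iE: "integrable M (%x. indicator E x *\<^sub>R \<sigma> x)" using i E M(2) by (intro integrable_mult_indicator) auto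
  have "(LINT x:E|M. \<sigma> x) \<bullet> b = (LINT x|M. (indicator E x *\<^sub>R \<sigma> x) \<bullet> b)"
   unfolding set_lebesgue_integral_def using iE by (subst integral_inner_left) auto
  also have "... = (LINT x:E|M. D b x)"
   unfolding set_lebesgue_integral_def \<sigma>_def by (simp add: inner_sum_left_Basis[OF b])
  finally show "m E \<bullet> b = (LINT x:E|M. \<sigma> x) \<bullet> b" using D(2)[OF b E] by simp
 qed
 then show ?thesis by (rule that[OF M(1,2) i])
qed

lemma set_lebesgue_integral_nonneg_density:
 assumes M: "integrable M (f :: 'a => real)" "\<And>x. f x \<ge> 0" and E: "E \<in> sets M"
 shows "emeasure (density M (%x. ennreal (f x))) E = ennreal (LINT x:E|M. f x)"
proof -
 have "emeasure (density M (%x. ennreal (f x))) E = (\<integral>\<^sup>+x. ennreal (indicator E x *\<^sub>R f x) \<partial>M)"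
  using M E by (subst emeasure_density) (auto intro!: nn_integral_cong simp: indicator_def)
 also have "... = ennreal (LINT x|M. indicator E x *\<^sub>R f x)"
  using M by (intro nn_integral_eq_integral integrable_mult_indicator[OF E]) auto
 finally show ?thesis by (simp add: set_lebesgue_integral_def)
qed

lemma dense_sequence:
 assumes "r > 0"
 shows "\<exists>d :: nat => 'b::euclidean_space. (\<Union>k. ball (d k) r) = UNIV"
proof -
 obtain D :: "'b set" where D: "countable D" "\<And>X. open X ==> X \<noteq> {} ==> \<exists>d\<in>D. d \<in> X"
  using countable_dense_exists by blast
 have "D \<noteq> {}" using D(2)[of UNIV] by auto
 have "\<exists>k. y \<in> ball (from_nat_into D k) r" for y
 proof -
  obtain z where z: "z \<in> D" "z \<in> ball y r" using D(2)[of "ball y r"] assms by auto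
  obtain k where "from_nat_into D k = z" using from_nat_into_surj[OF D(1) z(1)] by blast
  then show ?thesis using z(2) by (intro exI[of _ k]) (simp add: dist_commute)
 qed
 then show ?thesis by (intro exI[of _ "from_nat_into D"]) auto
qed

text \<open>The triangle inequality gives one bound. For the other, \<open>E\<close> is cut into
  countably many pieces \<open>A k\<close> on which \<open>\<sigma>\<close> stays within r of a
  constant vector \<open>d k\<close>. There the norm of the integral and the integral of the norm
  each differ from |d k| M(A k) by at most r M(A k), so the total loss is at most 2 r M(E).\<close>

lemma variation_measure_density:
 fixes \<sigma> :: "'a::euclidean_space => 'b::euclidean_space"
 assumes M: "finite_measure M" "sets M = borel_on U" and \<sigma>: "integrable M \<sigma>"
  and m: "\<And>E. E \<in> borel_on U ==> m E = (LINT x:E|M. \<sigma> x)"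
 shows "variation_measure U m = density M (%x. ennreal (norm (\<sigma> x)))"
proof -
 interpret finite_measure M by (rule M(1))
 let ?N = "density M (%x. ennreal (norm (\<sigma> x)))"
 have sp: "space M = U" by (rule space_borel_on[OF M(2)])
 have [measurable]: "\<sigma> \<in> borel_measurable M" using \<sigma> by auto
 have i\<sigma>: "integrable M (%x. indicator E x *\<^sub>R \<sigma> x)" "integrable M (%x. indicator E x *\<^sub>R norm (\<sigma> x))" if "E \<in> sets M" for E
  by (rule integrable_mult_indicator[OF that \<sigma>], rule integrable_mult_indicator[OF that integrable_norm[OF \<sigma>]])
 have N: "emeasure ?N E = ennreal (LINT x:E|M. norm (\<sigma> x))" if "E \<in> sets M" for E
  by (rule set_lebesgue_integral_nonneg_density[OF integrable_norm[OF \<sigma>] norm_ge_zero that])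
 have le: "ennreal (norm (m E)) <= emeasure ?N E" if E: "E \<in> sets M" for E
 proof -
  have mE: "m E = (LINT x|M. indicator E x *\<^sub>R \<sigma> x)"
   using m[of E] E M(2) unfolding set_lebesgue_integral_def by simp
  have "norm (m E) <= (LINT x|M. norm (indicator E x *\<^sub>R \<sigma> x))"
   unfolding mE by (rule integral_norm_bound)
  also have "... = (LINT x:E|M. norm (\<sigma> x))" by (simp add: set_lebesgue_integral_def)
  finally show ?thesis unfolding N[OF E] by (rule ennreal_leI)
 qed
 have "(SUP A\<in>{A :: nat => 'a set. range A \<subseteq> borel_on U \<and> disjoint_family A \<and> (\<Union>n. A n) = E}.
       (\<Sum>n. ennreal (norm (m (A n))))) = emeasure ?N E" (is "?S = _") if E: "E \<in> borel_on U" for E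
 proof (rule antisym)
  show "?S <= emeasure ?N E"
  proof (rule SUP_least)
   fix A :: "nat => 'a set"
   assume "A \<in> {A. range A \<subseteq> borel_on U \<and> disjoint_family A \<and> (\<Union>n. A n) = E}"
   then have A: "range A \<subseteq> sets ?N" "disjoint_family A" "(\<Union>n. A n) = E" using M(2) by auto
   have "(\<Sum>n. ennreal (norm (m (A n)))) <= (\<Sum>n. emeasure ?N (A n))"
    by (intro suminf_le le) (use A in auto)
   also have "... = emeasure ?N E" using suminf_emeasure[OF A(1,2)] A(3) by simp
   finally show "(\<Sum>n. ennreal (norm (m (A n)))) <= emeasure ?N E" .
  qed
  show "emeasure ?N E <= ?S"
  proof (rule ennreal_le_epsilon)
   fix e :: real assume e: "e > 0"
   define r where "r = e / (2 * (measure M U + 1))"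
   have pos: "measure M U + 1 > 0" by (simp add: add_nonneg_pos)
   have r: "r > 0" unfolding r_def using e pos by simp
   have re: "2 * r * measure M E <= e"
   proof -
    have "2 * r * measure M E <= 2 * r * (measure M U + 1)"
     using r finite_measure_mono[of E U] E M(2) sets.sets_into_space[of E M] sp
     by (intro mult_left_mono) (auto intro: order_trans)
    also have "... = e"
    proof -
     have "2 * (measure M U + 1) \<noteq> 0" using pos by simp
     then have "r * (2 * (measure M U + 1)) = e" using nonzero_eq_divide_eq[of _ r e] r_def by blast
     then show ?thesis by (simp add: algebra_simps)
    qed
    finally show ?thesis .
   qed
   obtain d :: "nat => 'b" where d: "(\<Union>k. ball (d k) r) = UNIV" using dense_sequence[OF r] by blast
   define C where "C = disjointed (%k. ball (d k) r)"
   have C [measurable]: "C k \<in> sets borel" for k unfolding C_def disjointed_def by auto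
   have Cd: "disjoint_family C" unfolding C_def by (rule disjoint_family_disjointed)
   have CU: "(\<Union>k. C k) = UNIV" unfolding C_def using d by (simp add: UN_disjointed_eq)
   have Cb: "y \<in> C k ==> norm (y - d k) < r" for y k
    unfolding C_def disjointed_def by (auto simp: dist_norm norm_minus_commute)
   define A where "A k = E \<inter> (\<sigma> -` C k \<inter> space M)" for k
   have EM: "E \<in> sets M" using E M(2) by simp
   have A: "A k \<in> sets M" for k
    unfolding A_def by (rule sets.Int[OF EM measurable_sets[of \<sigma> M borel]]) auto
   have Ad: "disjoint_family A"
    unfolding disjoint_family_on_def A_def
   proof (intro ballI impI)
    fix i j :: nat assume "i \<noteq> j"
    then have "C i \<inter> C j = {}" using Cd by (intro disjoint_family_onD[OF Cd]) auto
    then show "E \<inter> (\<sigma> -` C i \<inter> space M) \<inter> (E \<inter> (\<sigma> -` C j \<inter> space M)) = {}" by auto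
   qed
   have AE: "(\<Union>k. A k) = E"
   proof -
    have "(\<Union>k. A k) = E \<inter> (\<sigma> -` (\<Union>k. C k) \<inter> space M)" by (auto simp: A_def)
    then show ?thesis using CU sets.sets_into_space[OF EM] by auto
   qed
   have key: "emeasure ?N (A k) <= ennreal (norm (m (A k))) + ennreal (2 * r) * emeasure M (A k)" for k
   proof -
    have iA: "integrable M (%x. indicator (A k) x *\<^sub>R c)" for c :: 'b
     using A[of k] by (intro integrable_scaleR_left integrable_real_indicator) (auto simp: emeasure_eq_measure)
    have iAr: "integrable M (%x. indicator (A k) x *\<^sub>R c)" for c :: real
     using A[of k] by (intro integrable_scaleR_left integrable_real_indicator) (auto simp: emeasure_eq_measure)
    have inA: "x \<in> A k ==> norm (\<sigma> x - d k) <= r" for x unfolding A_def using Cb[of "\<sigma> x" k] by auto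
    have "(LINT x:A k|M. norm (\<sigma> x)) <= (LINT x|M. indicator (A k) x *\<^sub>R (norm (d k) + r))"
     unfolding set_lebesgue_integral_def
    proof (rule integral_mono[OF i\<sigma>(2)[OF A] iAr])
     show "indicator (A k) x *\<^sub>R norm (\<sigma> x) <= indicator (A k) x *\<^sub>R (norm (d k) + r)" for x
      using inA[of x] norm_triangle_sub[of "\<sigma> x" "d k"] by (auto simp: indicator_def)
    qed
    also have "... = measure M (A k) * (norm (d k) + r)"
     using A[of k] by simp
    also have "... = norm (d k) * measure M (A k) + r * measure M (A k)"
     by (simp add: algebra_simps)
    finally have 1: "(LINT x:A k|M. norm (\<sigma> x)) <= norm (d k) * measure M (A k) + r * measure M (A k)" .
    have "norm ((LINT x|M. indicator (A k) x *\<^sub>R d k) - (LINT x|M. indicator (A k) x *\<^sub>R \<sigma> x))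
      = norm (LINT x|M. indicator (A k) x *\<^sub>R d k - indicator (A k) x *\<^sub>R \<sigma> x)"
     by (simp only: Bochner_Integration.integral_diff[OF iA i\<sigma>(1)[OF A]])
    also have "... <= (LINT x|M. norm (indicator (A k) x *\<^sub>R d k - indicator (A k) x *\<^sub>R \<sigma> x))"
     by (rule integral_norm_bound)
    also have "... <= (LINT x|M. indicator (A k) x *\<^sub>R r)"
    proof (rule integral_mono[OF integrable_norm[OF Bochner_Integration.integrable_diff[OF iA i\<sigma>(1)[OF A]]] iAr])
     show "norm (indicator (A k) x *\<^sub>R d k - indicator (A k) x *\<^sub>R \<sigma> x) <= indicator (A k) x *\<^sub>R r" for x
      using inA[of x] by (auto simp: indicator_def norm_minus_commute)
    qed
    also have "... = r * measure M (A k)" using A[of k] by simp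
    finally have "norm ((LINT x|M. indicator (A k) x *\<^sub>R d k) - (LINT x|M. indicator (A k) x *\<^sub>R \<sigma> x)) <= r * measure M (A k)" .
    moreover have "(LINT x|M. indicator (A k) x *\<^sub>R d k) = measure M (A k) *\<^sub>R d k"
    proof -
     have "integrable M (indicat_real (A k))"
      using A[of k] by (intro integrable_real_indicator) (auto simp: emeasure_eq_measure)
     then show ?thesis using integral_scaleR_left[of "d k" M "indicat_real (A k)"] A[of k] by simp
    qed
    moreover have "(LINT x|M. indicator (A k) x *\<^sub>R \<sigma> x) = m (A k)"
     using m[of "A k"] A[of k] M(2) by (simp add: set_lebesgue_integral_def)
    ultimately have "norm (measure M (A k) *\<^sub>R d k - m (A k)) <= r * measure M (A k)" by simp
    then have 2: "norm (d k) * measure M (A k) <= norm (m (A k)) + r * measure M (A k)"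
     using norm_triangle_sub[of "measure M (A k) *\<^sub>R d k" "m (A k)"] by (simp add: mult.commute)
    have "emeasure ?N (A k) <= ennreal (norm (m (A k)) + 2 * r * measure M (A k))"
     unfolding N[OF A] using 1 2 by (intro ennreal_leI) linarith
    also have "... = ennreal (norm (m (A k))) + ennreal (2 * r) * emeasure M (A k)"
     using r by (simp add: emeasure_eq_measure ennreal_plus ennreal_mult)
    finally show ?thesis .
   qed
   have AR: "range A \<subseteq> sets M" using A by auto
   then have AR': "range A \<subseteq> sets ?N" by simp
   have "emeasure ?N E = (\<Sum>k. emeasure ?N (A k))"
    using suminf_emeasure[OF AR' Ad] AE by simp
   also have "... <= (\<Sum>k. ennreal (norm (m (A k))) + ennreal (2 * r) * emeasure M (A k))"
    by (intro suminf_le key) auto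
   also have "... = (\<Sum>k. ennreal (norm (m (A k)))) + ennreal (2 * r) * (\<Sum>k. emeasure M (A k))"
    by (simp add: suminf_add[symmetric] ennreal_suminf_cmult)
   also have "(\<Sum>k. emeasure M (A k)) = emeasure M E"
    using suminf_emeasure[OF AR Ad] AE by simp
   finally have le1: "emeasure ?N E <= (\<Sum>k. ennreal (norm (m (A k)))) + ennreal (2 * r) * emeasure M E" .
   have le2: "ennreal (2 * r) * emeasure M E <= ennreal e"
    using re r by (simp add: emeasure_eq_measure ennreal_mult[symmetric] ennreal_leI)
   have le3: "(\<Sum>k. ennreal (norm (m (A k)))) <= ?S"
   proof (rule SUP_upper)
    show "A \<in> {A. range A \<subseteq> borel_on U \<and> disjoint_family A \<and> (\<Union>n. A n) = E}"
     using AR M(2) Ad AE by simp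
   qed
   show "emeasure ?N E <= ?S + ennreal e" by (rule order_trans[OF le1 add_mono[OF le3 le2]])
  qed
 qed
 then have "variation_measure U m = measure_of U (borel_on U) (emeasure ?N)"
  unfolding variation_measure_def by (intro measure_of_eq[OF borel_on_Pow]) simp
 also have "... = ?N" using measure_of_of_measure[of ?N] M(2) sp by simp
 finally show ?thesis .
qed

lemma positive_part_density:
 fixes s :: "'a::euclidean_space => real"
 assumes M: "finite_measure M" "sets M = borel_on U" and s: "integrable M s"
  and n: "\<And>E. E \<in> borel_on U ==> n E = (LINT x:E|M. s x)"
 shows "positive_part U n = density M (%x. ennreal (max 0 (s x)))"
proof -
 let ?N = "density M (%x. ennreal (max 0 (s x)))"
 have sp: "space M = U" by (rule space_borel_on[OF M(2)])
 have im: "integrable M (%x. max 0 (s x))" using s by auto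
 have "ennreal ((measure (variation_measure U n) E + n E) / 2) = emeasure ?N E" if E: "E \<in> borel_on U" for E
 proof -
  have EM: "E \<in> sets M" using E M(2) by simp
  note si = integrable_mult_indicator[OF EM, folded set_integrable_def]
  have var: "variation_measure U n = density M (%x. ennreal (norm (s x)))"
   by (rule variation_measure_density[OF M s n])
  have "measure (variation_measure U n) E = (LINT x:E|M. \<bar>s x\<bar>)"
   unfolding var measure_def
   using set_lebesgue_integral_nonneg_density[OF integrable_norm[OF s] norm_ge_zero EM]
   by (simp add: set_lebesgue_integral_def Bochner_Integration.integral_nonneg)
  then have "(measure (variation_measure U n) E + n E) / 2 = (LINT x:E|M. \<bar>s x\<bar> + s x) / 2"
   using n[OF E] set_integral_add(2)[OF si[OF integrable_abs[OF s]] si[OF s]] by simp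
  also have "... = (LINT x:E|M. (\<bar>s x\<bar> + s x) / 2)" by simp
  also have "... = (LINT x:E|M. max 0 (s x))"
   unfolding set_lebesgue_integral_def by (intro Bochner_Integration.integral_cong) (auto simp: max_def)
  finally show ?thesis
   using set_lebesgue_integral_nonneg_density[OF im _ EM] by simp
 qed
 then have "positive_part U n = measure_of U (borel_on U) (emeasure ?N)"
  unfolding positive_part_def by (intro measure_of_eq[OF borel_on_Pow]) simp
 also have "... = ?N" using measure_of_of_measure[of ?N] M(2) sp by simp
 finally show ?thesis .
qed

lemma signed_integral_density:
 fixes s :: "'a::euclidean_space => real"
 assumes M: "finite_measure M" "sets M = borel_on U" and s: "integrable M s"
  and n: "\<And>E. E \<in> borel_on U ==> n E = (LINT x:E|M. s x)"
  and f: "f \<in> borel_measurable M" "\<And>x. \<bar>f x\<bar> <= B"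
 shows "signed_integral U n f = (LINT x|M. f x * s x)"
proof -
 have [measurable]: "f \<in> borel_measurable M" "s \<in> borel_measurable M" using f s by auto
 have n': "- n E = (LINT x:E|M. - s x)" if "E \<in> borel_on U" for E
  using n[OF that] by (simp add: set_lebesgue_integral_def)
 have p: "(LINT x|positive_part U n. f x) = (LINT x|M. max 0 (s x) * f x)"
 proof -
  have e: "positive_part U n = density M (%x. ennreal (max 0 (s x)))"
   by (rule positive_part_density[OF M s n])
  have "(LINT x|density M (%x. ennreal (max 0 (s x))). f x) = (LINT x|M. max 0 (s x) *\<^sub>R f x)"
   by (rule integral_density) auto
  then show ?thesis unfolding e by simp
 qed
 have q: "(LINT x|positive_part U (%E. - n E). f x) = (LINT x|M. max 0 (- s x) * f x)"
 proof -
  have e: "positive_part U (%E. - n E) = density M (%x. ennreal (max 0 (- s x)))"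
   by (rule positive_part_density[OF M Bochner_Integration.integrable_minus[OF s] n'])
  have "(LINT x|density M (%x. ennreal (max 0 (- s x))). f x) = (LINT x|M. max 0 (- s x) *\<^sub>R f x)"
   by (rule integral_density) auto
  then show ?thesis unfolding e by simp
 qed
 have "integrable M (%x. max 0 (s x))" "integrable M (%x. max 0 (- s x))" using s by auto
 then have i: "integrable M (%x. max 0 (s x) * f x)" "integrable M (%x. max 0 (- s x) * f x)"
  using integrable_bounded_mult[OF _ f, of "%x. max 0 (s x)"] integrable_bounded_mult[OF _ f, of "%x. max 0 (- s x)"]
  by (simp_all only: real_scaleR_def mult.commute[of "f _"])
 have "signed_integral U n f = (LINT x|M. max 0 (s x) * f x - max 0 (- s x) * f x)"
  unfolding signed_integral_def p q by (rule Bochner_Integration.integral_diff[OF i, symmetric])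
 also have "... = (LINT x|M. f x * s x)"
  by (intro Bochner_Integration.integral_cong) (auto simp: max_def algebra_simps)
 finally show ?thesis .
qed

text \<open>The last claim provides a density with respect to the variation itself: if
  \<open>m\<close> has the density \<open>\<sigma>\<close> with respect to M, the normalised field
  is a density with respect to |\<open>\<sigma>\<close>| M.\<close>

lemma vector_measure_variation:
 fixes m :: "'a::euclidean_space set => 'b::euclidean_space"
 assumes m: "vector_measure U m"
 shows "finite_measure (variation_measure U m)" "sets (variation_measure U m) = borel_on U"
  "\<exists>\<sigma>. integrable (variation_measure U m) \<sigma> \<and>
   (\<forall>E\<in>borel_on U. m E = (LINT x:E|variation_measure U m. \<sigma> x))"
proof -
 obtain M \<sigma> where M: "finite_measure M" "sets M = borel_on U" "integrable M \<sigma>"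
  "\<And>E. E \<in> borel_on U ==> m E = (LINT x:E|M. \<sigma> x)"
  by (rule vector_measure_density[OF m], rule that)
 have eq: "variation_measure U m = density M (%x. ennreal (norm (\<sigma> x)))"
  by (rule variation_measure_density[OF M])
 have [measurable]: "\<sigma> \<in> borel_measurable M" using M(3) by auto
 show s: "sets (variation_measure U m) = borel_on U" unfolding eq using M(2) by simp
 show "finite_measure (variation_measure U m)"
 proof (rule finite_measureI)
  have "space M \<in> sets M" by simp
  from set_lebesgue_integral_nonneg_density[OF integrable_norm[OF M(3)] norm_ge_zero this]
  show "emeasure (variation_measure U m) (space (variation_measure U m)) \<noteq> \<infinity>"
   unfolding eq by simp
 qed
 \<comment> \<open>As the inverse of 0 is 0, the normalised field is 0 at zeros of
   \<open>\<sigma>\<close>.\<close>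
 have c: "norm (\<sigma> x) *\<^sub>R (inverse (norm (\<sigma> x)) *\<^sub>R \<sigma> x) = \<sigma> x" for x by (cases "\<sigma> x = 0") simp_all
 let ?\<tau> = "%x. inverse (norm (\<sigma> x)) *\<^sub>R \<sigma> x"
 have i: "integrable (variation_measure U m) ?\<tau>"
  unfolding eq using M(3) by (subst integrable_density) (auto simp: c simp del: scaleR_scaleR)
 have eqE: "m E = (LINT x:E|variation_measure U m. ?\<tau> x)" if E: "E \<in> borel_on U" for E
 proof -
  have [measurable]: "E \<in> sets M" using E M(2) by simp
  have "(LINT x:E|variation_measure U m. ?\<tau> x) = (LINT x|M. norm (\<sigma> x) *\<^sub>R (indicator E x *\<^sub>R ?\<tau> x))"
   unfolding eq set_lebesgue_integral_def by (rule integral_density) auto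
  also have "... = (LINT x:E|M. \<sigma> x)"
   unfolding set_lebesgue_integral_def by (intro Bochner_Integration.integral_cong refl) (auto simp: indicator_def)
  finally show ?thesis using M(4)[OF E] by simp
 qed
 show "\<exists>\<sigma>. integrable (variation_measure U m) \<sigma> \<and>
   (\<forall>E\<in>borel_on U. m E = (LINT x:E|variation_measure U m. \<sigma> x))"
 proof (rule exI[of _ ?\<tau>], intro conjI ballI)
  show "integrable (variation_measure U m) ?\<tau>" by (rule i)
  show "m E = (LINT x:E|variation_measure U m. ?\<tau> x)" if "E \<in> borel_on U" for E by (rule eqE[OF that])
 qed
qed

text \<open>With the variation measure itself as reference measure, the formula for variations says
  that it equals |\<open>\<sigma>\<close>| times itself; uniqueness of densities forces
  |\<open>\<sigma>\<close>| = 1.\<close>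

lemma polar_density_norm:
 fixes m :: "'a::euclidean_space set => 'b::euclidean_space"
 assumes m: "vector_measure U m" and \<sigma>: "integrable (variation_measure U m) \<sigma>"
  "\<And>E. E \<in> borel_on U ==> m E = (LINT x:E|variation_measure U m. \<sigma> x)"
 shows "AE x in variation_measure U m. norm (\<sigma> x) = 1"
proof -
 let ?M = "variation_measure U m"
 interpret finite_measure ?M by (rule vector_measure_variation(1)[OF m])
 have [measurable]: "\<sigma> \<in> borel_measurable ?M" using \<sigma>(1) by auto
 have "?M = density ?M (%x. ennreal (norm (\<sigma> x)))"
  by (rule variation_measure_density[OF vector_measure_variation(1,2)[OF m] \<sigma>])
 then have "density ?M (%x. 1) = density ?M (%x. ennreal (norm (\<sigma> x)))" by (simp add: density_1)
 then have "AE x in ?M. 1 = ennreal (norm (\<sigma> x))"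
  by (subst (asm) density_unique_iff) auto
 then show ?thesis
 proof eventually_elim
  case (elim x)
  from this[symmetric] show ?case by simp
 qed
qed

section \<open>Approximation in mean square\<close>

text \<open>A form of Hoelder's inequality with a free parameter: either t <= r, or (t / r)^(q-1) >=
  1 and therefore t <= r^(1-q) t^q. In applications r is made small first and the L^q norm
  afterwards.\<close>

lemma L1_le_Lq:
 fixes h :: "'a => 'b::euclidean_space"
 assumes M: "finite_measure M" and h [measurable]: "h \<in> borel_measurable M"
  and int: "integrable M (%x. norm (h x) powr q)" and q: "q > 1" and d: "r > 0"
 shows "integrable M h" "(LINT x|M. norm (h x)) <= r * measure M (space M) + r powr (1 - q) * (LINT x|M. norm (h x) powr q)"
proof -
 interpret finite_measure M by (rule M)
 have b: "t <= r + r powr (1 - q) * t powr q" if "t \<ge> 0" for t :: real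
 proof (cases "t <= r")
  case True
  moreover have "r powr (1 - q) * t powr q \<ge> 0" by simp
  ultimately show ?thesis by linarith
 next
  case False
  then have t: "t > 0" using d by simp
  have "1 = r powr (1 - q) * r powr (q - 1)" using d by (simp flip: powr_add)
  also have "... <= r powr (1 - q) * t powr (q - 1)"
   using False d q by (intro mult_left_mono powr_mono2) auto
  finally have "t * 1 <= t * (r powr (1 - q) * t powr (q - 1))" using t by (intro mult_left_mono) auto
  also have "... = r powr (1 - q) * t powr q" using t by (simp add: powr_diff)
  finally show ?thesis using d by simp
 qed
 have ib: "integrable M (%x. r + r powr (1 - q) * norm (h x) powr q)" using int by simp
 show i: "integrable M h"
 proof (rule Bochner_Integration.integrable_bound[OF ib h], rule AE_I2)
  show "norm (h x) <= norm (r + r powr (1 - q) * norm (h x) powr q)" for x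
   using b[OF norm_ge_zero, of "h x"] by simp
 qed
 have "(LINT x|M. norm (h x)) <= (LINT x|M. r + r powr (1 - q) * norm (h x) powr q)"
  by (rule integral_mono[OF integrable_norm[OF i] ib b]) simp
 also have "... = r * measure M (space M) + r powr (1 - q) * (LINT x|M. norm (h x) powr q)"
  using int by simp
 finally show "(LINT x|M. norm (h x)) <= r * measure M (space M) + r powr (1 - q) * (LINT x|M. norm (h x) powr q)" .
qed

lemma Lq_tendsto_imp_L1:
 fixes h :: "nat => 'a => 'b::euclidean_space"
 assumes M: "finite_measure M" and h: "\<And>n. h n \<in> borel_measurable M"
  and int: "\<And>n. integrable M (%x. norm (h n x) powr q)" and q: "q > 1"
  and lim: "(%n. (LINT x|M. norm (h n x) powr q)) \<longlonglongrightarrow> 0"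
 shows "(%n. (LINT x|M. norm (h n x))) \<longlonglongrightarrow> 0"
proof (rule tendstoI)
 fix e :: real assume e: "e > 0"
 define r where "r = e / (2 * (measure M (space M) + 1))"
 have pos: "measure M (space M) + 1 > 0" by (simp add: add_nonneg_pos)
 have d: "r > 0" unfolding r_def using e pos by simp
 have "2 * (measure M (space M) + 1) \<noteq> 0" using pos by simp
 then have "r * (2 * (measure M (space M) + 1)) = e" using nonzero_eq_divide_eq[of _ r e] r_def by blast
 then have d2: "r * measure M (space M) < e / 2" using d by (simp add: algebra_simps)
 have "(%n. r powr (1 - q) * (LINT x|M. norm (h n x) powr q)) \<longlonglongrightarrow> r powr (1 - q) * 0"
  by (intro tendsto_mult tendsto_const lim)
 then have "\<forall>\<^sub>F n in sequentially. r powr (1 - q) * (LINT x|M. norm (h n x) powr q) < e / 2"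
  using e by (intro order_tendstoD(2)[where y="r powr (1 - q) * 0"]) auto
 then show "\<forall>\<^sub>F n in sequentially. dist (LINT x|M. norm (h n x)) 0 < e"
 proof eventually_elim
  case (elim n)
  have "(LINT x|M. norm (h n x)) \<ge> 0" by simp
  then show ?case using L1_le_Lq(2)[OF M h int q d, of n] elim d2 by (simp add: dist_real_def)
 qed
qed

lemma norm_powr_2: "norm x powr 2 = (norm x)\<^sup>2"
 by (cases "norm x = 0") (auto simp: powr_numeral)

lemma norm_add_square_le:
 fixes a b :: "'b::real_inner"
 shows "(norm (a + b))\<^sup>2 <= 2 * (norm a)\<^sup>2 + 2 * (norm b)\<^sup>2"
proof -
 have "(norm (a + b))\<^sup>2 + (norm (a - b))\<^sup>2 = 2 * (norm a)\<^sup>2 + 2 * (norm b)\<^sup>2"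
  by (simp add: power2_norm_eq_inner inner_simps inner_commute)
 then show ?thesis using zero_le_power2[of "norm (a - b)"] by linarith
qed

lemma integrable_square_add:
 fixes f g :: "'a => 'b::euclidean_space"
 assumes [measurable]: "f \<in> borel_measurable M" "g \<in> borel_measurable M"
  and "integrable M (%x. (norm (f x))\<^sup>2)" "integrable M (%x. (norm (g x))\<^sup>2)"
 shows "integrable M (%x. (norm (f x + g x))\<^sup>2)"
 by (rule Bochner_Integration.integrable_bound[of M "%x. 2 * (norm (f x))\<^sup>2 + 2 * (norm (g x))\<^sup>2"])
  (use assms norm_add_square_le in \<open>auto intro: order_trans[OF _ abs_ge_self]\<close>)

lemma integrable_square_diff:
 fixes f g :: "'a => 'b::euclidean_space"
 assumes "f \<in> borel_measurable M" "g \<in> borel_measurable M"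
  and "integrable M (%x. (norm (f x))\<^sup>2)" "integrable M (%x. (norm (g x))\<^sup>2)"
 shows "integrable M (%x. (norm (f x - g x))\<^sup>2)"
 using integrable_square_add[of f M "%x. - g x"] assms by simp

text \<open>Riesz-Fischer: on a finite measure space the sequence is also Cauchy in L^1 and has an
  almost everywhere convergent subsequence, whose limit is the L^2 limit by Fatou's lemma. The
  subsequence is part of the conclusion because pointwise bounds have to pass to the limit
  later.\<close>

lemma L2_complete:
 fixes f :: "nat => 'a => 'b::euclidean_space"
 assumes M: "finite_measure M" and f [measurable]: "\<And>n. f n \<in> borel_measurable M"
  and int: "\<And>n. integrable M (%x. (norm (f n x))\<^sup>2)"
  and cauchy: "\<And>e. e > 0 ==> \<exists>N. \<forall>m\<ge>N. \<forall>n\<ge>N. (LINT x|M. (norm (f m x - f n x))\<^sup>2) < e"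
 obtains s where "s \<in> borel_measurable M" "integrable M (%x. (norm (s x))\<^sup>2)"
  "\<And>n. integrable M (%x. (norm (f n x - s x))\<^sup>2)"
  "(%n. (LINT x|M. (norm (f n x - s x))\<^sup>2)) \<longlonglongrightarrow> 0"
  "\<exists>r::nat => nat. strict_mono r \<and> (AE x in M. (%k. f (r k) x) \<longlonglongrightarrow> s x)"
proof -
 interpret finite_measure M by (rule M)
 have id: "integrable M (%x. (norm (f m x - f n x))\<^sup>2)" for m n
  by (rule integrable_square_diff[OF f f int int])
 have i1: "integrable M (f n)" for n
  using L1_le_Lq(1)[OF M f, of n 2 1] int[of n] by (simp add: norm_powr_2)
 have c1: "\<exists>N. \<forall>m\<ge>N. \<forall>n\<ge>N. (LINT x|M. norm (f m x - f n x)) < e" if e: "e > 0" for e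
 proof -
  define \<delta> where "\<delta> = e / (2 * (measure M (space M) + 1))"
  have pos: "measure M (space M) + 1 > 0" by (simp add: add_nonneg_pos)
  have d: "\<delta> > 0" unfolding \<delta>_def using e pos by simp
  have "2 * (measure M (space M) + 1) \<noteq> 0" using pos by simp
  then have "\<delta> * (2 * (measure M (space M) + 1)) = e" using nonzero_eq_divide_eq[of _ \<delta> e] \<delta>_def by blast
  then have d2: "\<delta> * measure M (space M) < e / 2" using d by (simp add: algebra_simps)
  have "\<delta> * e / 2 > 0" using d e by simp
  then obtain N where N: "\<forall>m\<ge>N. \<forall>n\<ge>N. (LINT x|M. (norm (f m x - f n x))\<^sup>2) < \<delta> * e / 2"
   using cauchy by blast
  have "(LINT x|M. norm (f m x - f n x)) < e" if "m \<ge> N" "n \<ge> N" for m n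
  proof -
   have "\<delta> powr (1 - 2) * (LINT x|M. (norm (f m x - f n x))\<^sup>2) < \<delta> powr (1 - 2) * (\<delta> * e / 2)"
    using N that d by (intro mult_strict_left_mono) auto
   also have "... = e / 2" using d by (simp add: powr_minus_divide)
   finally have "\<delta> powr (1 - 2) * (LINT x|M. (norm (f m x - f n x))\<^sup>2) < e / 2" .
   moreover have "(LINT x|M. norm (f m x - f n x))
     <= \<delta> * measure M (space M) + \<delta> powr (1 - 2) * (LINT x|M. (norm (f m x - f n x))\<^sup>2)"
    using L1_le_Lq(2)[OF M borel_measurable_diff[OF f f], of m n 2 \<delta>] id[of m n] d
    unfolding norm_powr_2 by simp
   ultimately show ?thesis using d2 by linarith
  qed
  then show ?thesis by blast
 qed
 obtain r where r: "strict_mono r" "AE x in M. Cauchy (%k. f (r k) x)"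
  by (rule cauchy_L1_AE_cauchy_subseq[OF i1 c1], assumption, rule that)
 define s where "s x = lim (%k. f (r k) x)" for x
 have s [measurable]: "s \<in> borel_measurable M" unfolding s_def by (rule borel_measurable_lim_metric) auto
 have conv: "AE x in M. (%k. f (r k) x) \<longlonglongrightarrow> s x"
  using r(2) by eventually_elim (simp add: s_def Cauchy_convergent_iff convergent_LIMSEQ_iff)
 have fatou: "(\<integral>\<^sup>+x. ennreal ((norm (f n x - s x))\<^sup>2) \<partial>M) <= ennreal e"
  if e: "e > 0" and N: "\<forall>m\<ge>N. \<forall>n\<ge>N. (LINT x|M. (norm (f m x - f n x))\<^sup>2) < e" and n: "n \<ge> N" for e N n
 proof -
  have "(\<integral>\<^sup>+x. ennreal ((norm (f n x - s x))\<^sup>2) \<partial>M)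
    = (\<integral>\<^sup>+x. liminf (%k. ennreal ((norm (f n x - f (r k) x))\<^sup>2)) \<partial>M)"
  proof (rule nn_integral_cong_AE)
   show "AE x in M. ennreal ((norm (f n x - s x))\<^sup>2) = liminf (%k. ennreal ((norm (f n x - f (r k) x))\<^sup>2))"
    using conv
   proof eventually_elim
    case (elim x)
    have "(%k. ennreal ((norm (f n x - f (r k) x))\<^sup>2)) \<longlonglongrightarrow> ennreal ((norm (f n x - s x))\<^sup>2)"
     by (intro tendsto_ennrealI tendsto_power tendsto_norm tendsto_diff tendsto_const elim)
    from lim_imp_Liminf[OF _ this] show ?case by simp
   qed
  qed
  also have "... <= liminf (%k. \<integral>\<^sup>+x. ennreal ((norm (f n x - f (r k) x))\<^sup>2) \<partial>M)"
   by (rule nn_integral_liminf) measurable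
  also have "... <= limsup (%k. \<integral>\<^sup>+x. ennreal ((norm (f n x - f (r k) x))\<^sup>2) \<partial>M)"
   by (rule Liminf_le_Limsup) simp
  also have "... <= ennreal e"
  proof (rule Limsup_bounded)
   show "\<forall>\<^sub>F k in sequentially. (\<integral>\<^sup>+x. ennreal ((norm (f n x - f (r k) x))\<^sup>2) \<partial>M) <= ennreal e"
   proof (rule eventually_sequentiallyI[of N])
    fix k assume "N <= k"
    then have "N <= r k" using strict_mono_imp_increasing[OF r(1), of k] by linarith
    then show "(\<integral>\<^sup>+x. ennreal ((norm (f n x - f (r k) x))\<^sup>2) \<partial>M) <= ennreal e"
     using N n id[of n "r k"] by (subst nn_integral_eq_integral) (auto intro: ennreal_leI less_imp_le)
   qed
  qed
  finally show ?thesis .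
 qed
 obtain N1 where N1: "\<forall>m\<ge>N1. \<forall>n\<ge>N1. (LINT x|M. (norm (f m x - f n x))\<^sup>2) < 1" using cauchy[of 1] by auto
 have "(\<integral>\<^sup>+x. ennreal ((norm (f N1 x - s x))\<^sup>2) \<partial>M) < \<infinity>"
  using fatou[OF _ N1, of N1] by (simp add: le_less_trans)
 then have iN: "integrable M (%x. (norm (f N1 x - s x))\<^sup>2)" by (intro integrableI_nonneg) auto
 have is2: "integrable M (%x. (norm (s x))\<^sup>2)"
  using integrable_square_diff[of "f N1" M "%x. f N1 x - s x"] int iN by simp
 have ifs: "integrable M (%x. (norm (f n x - s x))\<^sup>2)" for n
  by (rule integrable_square_diff[OF f s int is2])
 have lim: "(%n. (LINT x|M. (norm (f n x - s x))\<^sup>2)) \<longlonglongrightarrow> 0"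
 proof (rule tendstoI)
  fix e :: real assume e: "e > 0"
  then obtain N where N: "\<forall>m\<ge>N. \<forall>n\<ge>N. (LINT x|M. (norm (f m x - f n x))\<^sup>2) < e / 2"
   using cauchy[of "e / 2"] by auto
  show "\<forall>\<^sub>F n in sequentially. dist (LINT x|M. (norm (f n x - s x))\<^sup>2) 0 < e"
  proof (rule eventually_sequentiallyI[of N])
   fix n assume "N <= n"
   then have "ennreal (LINT x|M. (norm (f n x - s x))\<^sup>2) <= ennreal (e / 2)"
    using fatou[OF _ N, of n] e ifs[of n] by (subst nn_integral_eq_integral[symmetric]) auto
   then have "(LINT x|M. (norm (f n x - s x))\<^sup>2) <= e / 2" using e by (subst (asm) ennreal_le_iff) auto
   moreover have "(LINT x|M. (norm (f n x - s x))\<^sup>2) \<ge> 0" by simp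
   ultimately show "dist (LINT x|M. (norm (f n x - s x))\<^sup>2) 0 < e" using e by (simp add: dist_real_def)
  qed
 qed
 show ?thesis by (rule that[OF s is2 ifs lim]) (use r(1) conv in blast)
qed

text \<open>\<open>mid\<close> is strong convexity at midpoints. Since the value at \<open>w\<close>
  is at least the infimum, two almost minimal values bound the L^2 distance of the images under
  \<open>T\<close>, and a minimising sequence has a Cauchy image.\<close>

lemma minimizing_sequence_L2:
 fixes T :: "'i => 'a => 'b::euclidean_space" and J :: "'i => real"
 assumes M: "finite_measure M" and X: "X \<noteq> {}" and T: "\<And>x. x \<in> X ==> T x \<in> borel_measurable M"
  "\<And>x. x \<in> X ==> integrable M (%y. (norm (T x y))\<^sup>2)"
  and J: "\<And>x. x \<in> X ==> b <= J x"
  and mid: "\<And>x y. x \<in> X ==> y \<in> X ==> \<exists>w\<in>X. J w + c * (LINT z|M. (norm (T x z - T y z))\<^sup>2) <= (J x + J y) / 2"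
  and c: "c > 0"
 obtains xs s where "\<And>n. xs n \<in> X" "(%n. J (xs n)) \<longlonglongrightarrow> Inf (J ` X)" "\<And>x. x \<in> X ==> Inf (J ` X) <= J x"
  "s \<in> borel_measurable M" "integrable M (%x. (norm (s x))\<^sup>2)"
  "\<And>n. integrable M (%x. (norm (T (xs n) x - s x))\<^sup>2)"
  "(%n. (LINT x|M. (norm (T (xs n) x - s x))\<^sup>2)) \<longlonglongrightarrow> 0"
proof -
 let ?I = "Inf (J ` X)"
 have bdd: "bdd_below (J ` X)" using J by (intro bdd_belowI2[of X b J])
 have low: "?I <= J x" if "x \<in> X" for x using that bdd by (intro cInf_lower) auto
 have "\<exists>x. x \<in> X \<and> J x < ?I + 1 / real (Suc n)" for n
 proof -
  have "\<exists>y\<in>J ` X. y < ?I + 1 / real (Suc n)" by (rule cInf_lessD) (use X in auto)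
  then show ?thesis by auto
 qed
 then have "\<exists>xs. \<forall>n. xs n \<in> X \<and> J (xs n) < ?I + 1 / real (Suc n)" by (intro choice) simp
 then obtain xs where xs: "\<And>n. xs n \<in> X" "\<And>n. J (xs n) < ?I + 1 / real (Suc n)" by auto
 have lim: "(%n. J (xs n)) \<longlonglongrightarrow> ?I"
 proof (rule tendsto_sandwich[of "%n. ?I" _ _ "%n. ?I + 1 / real (Suc n)"])
  have "(%n. ?I + 1 / real (Suc n)) \<longlonglongrightarrow> ?I + 0"
   by (intro tendsto_add tendsto_const LIMSEQ_Suc[OF lim_1_over_n])
  then show "(%n. ?I + 1 / real (Suc n)) \<longlonglongrightarrow> ?I" by simp
 qed (use low xs in \<open>auto intro!: always_eventually less_imp_le\<close>)
 have cauchy: "\<exists>N. \<forall>m\<ge>N. \<forall>n\<ge>N. (LINT x|M. (norm (T (xs m) x - T (xs n) x))\<^sup>2) < e" if e: "e > 0" for e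
 proof -
  have ce: "c * e > 0" using c e by simp
  then obtain N where N: "N > 0" "1 / real N < c * e" using reals_Archimedean2[of "1 / (c * e)"]
   by (metis divide_less_eq gr0I inverse_eq_divide less_imp_inverse_less of_nat_0 of_nat_0_less_iff order_less_asym ex_inverse_of_nat_less)
  have "(LINT x|M. (norm (T (xs m) x - T (xs n) x))\<^sup>2) < e" if mn: "m \<ge> N" "n \<ge> N" for m n
  proof -
   obtain w where w: "w \<in> X" "J w + c * (LINT z|M. (norm (T (xs m) z - T (xs n) z))\<^sup>2) <= (J (xs m) + J (xs n)) / 2"
    using mid[OF xs(1) xs(1)] by blast
   have bd: "1 / real (Suc k) <= 1 / real N" if "k \<ge> N" for k using that N by (intro divide_left_mono) auto
   have "J (xs m) < ?I + 1 / real N" "J (xs n) < ?I + 1 / real N"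
    using xs(2)[of m] xs(2)[of n] bd[OF mn(1)] bd[OF mn(2)] by linarith+
   moreover have "Z < D" if "Jm < i + r" "Jn < i + r" "Jw + Z <= (Jm + Jn) / 2" "i <= Jw" "r < D"
    for Jm Jn Jw i r Z D :: real
   proof -
    have "(Jm + Jn) / 2 < ((i + r) + (i + r)) / 2" using that(1,2) by (intro divide_strict_right_mono add_strict_mono) auto
    then have "(Jm + Jn) / 2 < i + r" by simp
    then have "Jw + Z < i + r" using that(3) by simp
    then show ?thesis using that(4,5) by simp
   qed
   ultimately have "c * (LINT z|M. (norm (T (xs m) z - T (xs n) z))\<^sup>2) < c * e"
    using w(2) low[OF w(1)] N(2) by blast
   then show ?thesis using c by simp
  qed
  then show ?thesis by blast
 qed
 obtain s where s: "s \<in> borel_measurable M" "integrable M (%x. (norm (s x))\<^sup>2)"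
  "\<And>n. integrable M (%x. (norm (T (xs n) x - s x))\<^sup>2)"
  "(%n. (LINT x|M. (norm (T (xs n) x - s x))\<^sup>2)) \<longlonglongrightarrow> 0"
  by (rule L2_complete[OF M T(1)[OF xs(1)] T(2)[OF xs(1)] cauchy], assumption, rule that)
 show ?thesis by (rule that[OF xs(1) lim low s])
qed

section \<open>Positive functionals on test functions\<close>

lemma continuous_compact_support_integrable:
 fixes f :: "'a::euclidean_space => 'b::euclidean_space"
 assumes f: "continuous_on UNIV f" and K: "compact K" "\<And>x. x \<notin> K ==> f x = 0"
 shows "integrable lborel f"
proof -
 have "integrable lborel (%x. indicator K x *\<^sub>R f x)"
  by (rule borel_integrable_compact[OF K(1) continuous_on_subset[OF f]]) simp
 also have "(%x. indicator K x *\<^sub>R f x) = f" using K(2) by (auto simp: indicator_def fun_eq_iff)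
 finally show ?thesis .
qed

lemma quadratic_nonneg_imp_zero:
 fixes a c :: real
 assumes "\<And>t. 0 <= t * a + t\<^sup>2 * c" "c \<ge> 0"
 shows "a = 0"
proof (rule ccontr)
 assume a: "a \<noteq> 0"
 \<comment> \<open>For this t the expression equals - (a / (c + 1))^2, and c + 1 is positive even
   for c = 0.\<close>
 define t where "t = - a / (c + 1)"
 have c: "c + 1 > 0" using assms(2) by simp
 have t: "t * (c + 1) = - a" unfolding t_def using c by simp
 have "(t * a + t\<^sup>2 * c) * (c + 1)\<^sup>2 = (t * (c + 1)) * a * (c + 1) + (t * (c + 1))\<^sup>2 * c"
  by (simp add: power2_eq_square algebra_simps)
 also have "... = - a\<^sup>2" unfolding t by (simp add: power2_eq_square algebra_simps)
 also have "... < 0" using a by simp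
 finally have "(t * a + t\<^sup>2 * c) * (c + 1)\<^sup>2 < 0" .
 moreover have "(t * a + t\<^sup>2 * c) * (c + 1)\<^sup>2 \<ge> 0" using assms(1)[of t] by simp
 ultimately show False by simp
qed

text \<open>A linear functional on test functions, bounded in the sup norm and of no fixed sign. The
  measure constructed from it is its total variation; \<open>L\<close> itself is recovered as a
  density with respect to that measure.\<close>

locale test_functional =
 fixes \<Omega> :: "'a::euclidean_space set" and L :: "('a => real) => real" and C :: real
 assumes open_\<Omega>: "open \<Omega>"
  and L_add: "\<And>f g. f \<in> test_functions \<Omega> ==> g \<in> test_functions \<Omega> ==> L (%x. f x + g x) = L f + L g"
  and L_scale: "\<And>f c. f \<in> test_functions \<Omega> ==> L (%x. c * f x) = c * L f"
  and L_bound: "\<And>f. f \<in> test_functions \<Omega> ==> (\<And>x. \<bar>f x\<bar> <= 1) ==> L f <= C"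
begin

section \<open>The variation of the functional on open sets\<close>

lemma test_mult: "f \<in> test_functions V ==> (%x. c * f x) \<in> test_functions V" for f :: "'a => real"
 using test_scaleR[of f V c] by simp

lemma L_zero: "L (%x. 0) = 0"
 using L_scale[OF test_zero, of 0] by simp

lemma C_nonneg: "C \<ge> 0"
 using L_bound[OF test_zero] L_zero by simp

lemma L_sum:
 fixes n :: nat
 shows "(\<And>k. k < n ==> f k \<in> test_functions \<Omega>) ==> L (%x. \<Sum>k<n. f k x) = (\<Sum>k<n. L (f k))"
proof (induction n)
 case (Suc n)
 have "(%x. \<Sum>k<n. f k x) \<in> test_functions \<Omega>" using Suc.prems by (intro test_sum) auto
 then have "L (%x. (\<Sum>k<n. f k x) + f n x) = L (%x. \<Sum>k<n. f k x) + L (f n)"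
  using Suc.prems by (intro L_add) auto
 then show ?case using Suc by simp
qed (simp add: L_zero)

text \<open>On open sets this becomes the value of the total variation measure of \<open>L\<close>;
  arbitrary sets receive theirs through \<open>outer\<close>.\<close>

definition mass :: "'a set => real" where
 "mass V = Sup {L f |f. f \<in> test_functions (V \<inter> \<Omega>) \<and> (\<forall>x. \<bar>f x\<bar> <= 1)}"

lemma test_V: "f \<in> test_functions (V \<inter> \<Omega>) ==> f \<in> test_functions \<Omega>" for f :: "'a => real"
 by (rule test_mono) auto

lemma mass_upper: "f \<in> test_functions (V \<inter> \<Omega>) ==> (\<And>x. \<bar>f x\<bar> <= 1) ==> L f <= mass V"
 unfolding mass_def
 by (rule cSup_upper) (auto intro!: bdd_aboveI[of _ C] L_bound dest: test_V)

lemma mass_least: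
 assumes "\<And>f. f \<in> test_functions (V \<inter> \<Omega>) ==> (\<And>x. \<bar>f x\<bar> <= 1) ==> L f <= c"
 shows "mass V <= c"
 unfolding mass_def
proof (rule cSup_least)
 have "L (%x. 0) \<in> {L f |f. f \<in> test_functions (V \<inter> \<Omega>) \<and> (\<forall>x. \<bar>f x\<bar> <= 1)}"
  using test_zero by (intro CollectI exI[of _ "%x. 0"]) auto
 then show "{L f |f. f \<in> test_functions (V \<inter> \<Omega>) \<and> (\<forall>x. \<bar>f x\<bar> <= 1)} \<noteq> {}" by blast
qed (use assms in auto)

lemma mass_nonneg: "mass V \<ge> 0"
 using mass_upper[OF test_zero, of V] L_zero by simp

lemma mass_le: "mass V <= C"
 by (rule mass_least) (use L_bound test_V in auto)

lemma mass_mono: "V \<subseteq> W ==> mass V <= mass W"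
 by (rule mass_least, rule mass_upper) (auto elim: test_mono)

lemma mass_scaled:
 assumes f: "f \<in> test_functions (V \<inter> \<Omega>)" and b: "\<And>x. \<bar>f x\<bar> <= B" and B: "B > 0"
 shows "L f <= B * mass V"
proof -
 have "L (%x. (1 / B) * f x) <= mass V"
 proof (rule mass_upper[OF test_mult[OF f]])
  show "\<bar>(1 / B) * f x\<bar> <= 1" for x using b[of x] B by (simp add: abs_mult)
 qed
 then have "(1 / B) * L f <= mass V" using L_scale[OF test_V[OF f], of "1 / B"] by simp
 from mult_left_mono[OF this, of B] show ?thesis using B by simp
qed

lemma mass_empty: "mass {} = 0"
proof (rule antisym[OF mass_least mass_nonneg])
 fix f :: "'a => real" assume "f \<in> test_functions ({} \<inter> \<Omega>)"
 then have "f = (%x. 0)" using test_outside[of f "{}"] by auto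
 then show "L f <= 0" using L_zero by simp
qed

text \<open>A test function f on the union splits as \<open>\<eta>\<close> f + (1 -
  \<open>\<eta>\<close>) f, where \<open>\<eta>\<close> = 1 near the part of the support outside
  \<open>W\<close>. Because \<open>\<eta>\<close> is 1 on a whole neighbourhood, the second summand
  has compact support in \<open>W\<close>.\<close>

lemma mass_Un:
 assumes V: "open V" and W: "open W"
 shows "mass (V \<union> W) <= mass V + mass W"
proof (rule mass_least)
 fix f :: "'a => real" assume f: "f \<in> test_functions ((V \<union> W) \<inter> \<Omega>)" and f1: "\<And>x. \<bar>f x\<bar> <= 1"
 obtain K where K: "compact K" "K \<subseteq> (V \<union> W) \<inter> \<Omega>" "\<forall>x. x \<notin> K --> f x = 0"
  using test_support[OF f] by auto
 have KW: "compact (K - W)" "open (V \<inter> \<Omega>)" "K - W \<subseteq> V \<inter> \<Omega>"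
  using K V W open_\<Omega> by (auto intro: compact_diff)
 obtain \<eta> N where \<eta>: "\<eta> \<in> test_functions (V \<inter> \<Omega>)" "\<And>x. 0 <= \<eta> x" "\<And>x. \<eta> x <= (1::real)"
  "open N" "K - W \<subseteq> N" "\<And>x. x \<in> N ==> \<eta> x = 1"
  by (rule ex_cutoff[OF KW], rule that)
 have g: "(%x. \<eta> x * f x) \<in> test_functions (V \<inter> \<Omega>)"
  by (rule test_bilinear[OF bounded_bilinear_mult \<eta>(1) test_smooth[OF f]])
 have h0: "(%x. f x - \<eta> x * f x) \<in> test_functions \<Omega>"
  by (rule test_diff[OF test_V[OF f] test_V[OF g]])
 have h: "(%x. f x - \<eta> x * f x) \<in> test_functions (W \<inter> \<Omega>)"
 proof (rule test_functionsI[OF test_smooth[OF h0]])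
  show "compact (K - N)" by (rule compact_diff[OF K(1) \<eta>(4)])
  show "K - N \<subseteq> W \<inter> \<Omega>" using K(2) \<eta>(5) by auto
  show "f x - \<eta> x * f x = 0" if "x \<notin> K - N" for x using that K(3) \<eta>(6) by auto
 qed
 have g1: "\<bar>\<eta> x * f x\<bar> <= 1" for x
  using f1[of x] \<eta>(2,3)[of x] by (simp add: abs_mult mult_le_one)
 have h1: "\<bar>f x - \<eta> x * f x\<bar> <= 1" for x
 proof -
  have "\<bar>f x - \<eta> x * f x\<bar> = \<bar>1 - \<eta> x\<bar> * \<bar>f x\<bar>" by (simp flip: abs_mult) (simp add: algebra_simps)
  then show ?thesis using f1[of x] \<eta>(2,3)[of x] by (simp add: mult_le_one)
 qed
 have "L f = L (%x. \<eta> x * f x) + L (%x. f x - \<eta> x * f x)"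
  using L_add[OF test_V[OF g] h0] by simp
 then show "L f <= mass V + mass W" using mass_upper[OF g g1] mass_upper[OF h h1] by simp
qed

lemma mass_UN_finite:
 fixes n :: nat
 assumes "\<And>i. open (V i)"
 shows "mass (\<Union>i<n. V i) <= (\<Sum>i<n. mass (V i))"
proof (induction n)
 case (Suc n)
 have "mass ((\<Union>i<n. V i) \<union> V n) <= mass (\<Union>i<n. V i) + mass (V n)"
  using assms by (intro mass_Un) auto
 with Suc show ?case by (simp add: lessThan_Suc Un_commute)
qed (simp add: mass_empty)

text \<open>Compactness of supports reduces the countable union to a finite one. A bound on all
  partial sums expresses countable subadditivity for real values without a summability
  hypothesis.\<close>

lemma mass_UN_le:
 fixes V :: "nat => 'a set"
 assumes V: "\<And>i. open (V i)" and c: "\<And>n. (\<Sum>i<n. mass (V i)) <= c"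
 shows "mass (\<Union>i. V i) <= c"
proof (rule mass_least)
 fix f :: "'a => real" assume f: "f \<in> test_functions ((\<Union>i. V i) \<inter> \<Omega>)" and f1: "\<And>x. \<bar>f x\<bar> <= 1"
 obtain K where K: "compact K" "K \<subseteq> (\<Union>i. V i) \<inter> \<Omega>" "\<forall>x. x \<notin> K --> f x = 0"
  using test_support[OF f] by auto
 have "K \<subseteq> (\<Union>i\<in>UNIV. V i)" using K(2) by auto
 then obtain I where I: "I \<subseteq> UNIV" "finite I" "K \<subseteq> (\<Union>i\<in>I. V i)"
  by (rule compactE_image[OF K(1), rotated]) (use V in auto)
 obtain n where n: "I \<subseteq> {..<n}" using finite_nat_bounded[OF I(2)] by auto
 have "(\<Union>i\<in>I. V i) \<subseteq> (\<Union>i<n. V i)" using n by (intro UN_mono) auto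
 then have Kn: "K \<subseteq> (\<Union>i<n. V i) \<inter> \<Omega>" using K(2) I(3) by blast
 have "f \<in> test_functions ((\<Union>i<n. V i) \<inter> \<Omega>)"
  by (rule test_functionsI[OF test_smooth[OF f] K(1) Kn]) (use K(3) in auto)
 then have "L f <= mass (\<Union>i<n. V i)" by (rule mass_upper[OF _ f1])
 also have "... <= (\<Sum>i<n. mass (V i))" by (rule mass_UN_finite[OF V])
 also have "... <= c" by (rule c)
 finally show "L f <= c" .
qed

section \<open>The outer measure and the Borel measure it induces\<close>

definition outer :: "'a set => real" where
 "outer E = Inf (mass ` {V. open V \<and> E \<subseteq> V})"

lemma outer_le: "open V ==> E \<subseteq> V ==> outer E <= mass V"
 unfolding outer_def using mass_nonneg by (intro cInf_lower) (auto intro: bdd_belowI[of _ 0])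

lemma outer_greatest:
 assumes "\<And>V. open V ==> E \<subseteq> V ==> c <= mass V"
 shows "c <= outer E"
 unfolding outer_def
proof (rule cInf_greatest)
 have "UNIV \<in> {V. open V \<and> E \<subseteq> V}" by simp
 then show "mass ` {V. open V \<and> E \<subseteq> V} \<noteq> {}" by blast
qed (use assms in auto)

lemma outer_nonneg: "outer E \<ge> 0"
 by (rule outer_greatest) (rule mass_nonneg)

lemma outer_mono: "E \<subseteq> F ==> outer E <= outer F"
 by (rule outer_greatest) (auto intro: outer_le)

lemma outer_open: "open V ==> outer V = mass V"
 by (rule antisym[OF outer_le outer_greatest]) (auto intro: mass_mono)

lemma outer_approx:
 assumes "e > 0"
 shows "\<exists>V. open V \<and> E \<subseteq> V \<and> mass V < outer E + e"
proof (rule ccontr)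
 assume "\<not> ?thesis"
 then have "outer E + e <= outer E" by (intro outer_greatest) (auto simp: not_less)
 with assms show False by simp
qed

lemma outer_UN_le:
 fixes A :: "nat => 'a set"
 assumes c: "\<And>n. (\<Sum>i<n. outer (A i)) <= c"
 shows "outer (\<Union>i. A i) <= c"
proof (rule field_le_epsilon)
 fix e :: real assume e: "e > 0"
 have "\<forall>i. \<exists>V. open V \<and> A i \<subseteq> V \<and> mass V < outer (A i) + e * (1/2) ^ Suc i"
  using outer_approx e by simp
 from choice[OF this] obtain V where V: "\<forall>i. open (V i) \<and> A i \<subseteq> V i \<and> mass (V i) < outer (A i) + e * (1/2) ^ Suc i" ..
 have "(\<Sum>i<n. mass (V i)) <= c + e" for n
 proof -
  have half: "(\<Sum>i<n. (1/2::real) ^ Suc i) <= 1"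
   using sum_le_suminf[OF sums_summable[OF power_half_series], of "{..<n}"] sums_unique[OF power_half_series] by simp
  have "(\<Sum>i<n. mass (V i)) <= (\<Sum>i<n. outer (A i) + e * (1/2) ^ Suc i)"
   using V by (intro sum_mono) (simp add: less_imp_le)
  also have "... = (\<Sum>i<n. outer (A i)) + e * (\<Sum>i<n. (1/2) ^ Suc i)"
   by (simp only: sum.distrib sum_distrib_left)
  also have "... <= c + e * 1" using c half e by (intro add_mono mult_left_mono) auto
  finally show ?thesis by simp
 qed
 then have "mass (\<Union>i. V i) <= c + e" using V by (intro mass_UN_le) auto
 moreover have "outer (\<Union>i. A i) <= mass (\<Union>i. V i)" using V by (intro outer_le) auto
 ultimately show "outer (\<Union>i. A i) <= c + e" by simp
qed

lemma outer_Un: "outer (A \<union> B) <= outer A + outer B"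
proof -
 have "outer (\<Union>i. binaryset A B i) <= outer A + outer B"
 proof (rule outer_UN_le)
  fix n
  have "outer {} = 0" using outer_open[of "{}"] mass_empty by simp
  then have "(\<Sum>i<n. outer (binaryset A B i)) = (\<Sum>i\<in>{..<n} \<inter> {0,1}. outer (binaryset A B i))"
   by (intro sum.mono_neutral_right) (auto simp: binaryset_def)
  also have "... <= (\<Sum>i\<in>{0,1::nat}. outer (binaryset A B i))"
   by (rule sum_mono2) (auto simp: outer_nonneg)
  finally show "(\<Sum>i<n. outer (binaryset A B i)) <= outer A + outer B" by (simp add: binaryset_def)
 qed
 then show ?thesis by (simp add: UN_binaryset_eq)
qed

text \<open>A competitor \<open>f\<close> for \<open>V \<inter> A\<close> has compact support
  \<open>K\<close> inside \<open>A\<close>. A function \<open>g\<close> supported in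
  \<open>V - K\<close> can be added without raising the sup norm, because the supports are disjoint,
  and \<open>V - K\<close> still contains \<open>E - A\<close>. Hence the two masses add up.\<close>

lemma outer_caratheodory:
 assumes A: "open A"
 shows "outer (E \<inter> A) + outer (E - A) <= outer E"
proof (rule outer_greatest)
 fix V assume V: "open V" "E \<subseteq> V"
 have "mass (V \<inter> A) <= mass V - outer (E - A)"
 proof (rule mass_least)
  fix f :: "'a => real" assume f: "f \<in> test_functions (V \<inter> A \<inter> \<Omega>)" and f1: "\<And>x. \<bar>f x\<bar> <= 1"
  obtain K where K: "compact K" "K \<subseteq> V \<inter> A \<inter> \<Omega>" "\<forall>x. x \<notin> K --> f x = 0"
   using test_support[OF f] by auto
  have "mass (V - K) <= mass V - L f"
  proof (rule mass_least)
   fix g :: "'a => real" assume g: "g \<in> test_functions ((V - K) \<inter> \<Omega>)" and g1: "\<And>x. \<bar>g x\<bar> <= 1"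
   have f': "f \<in> test_functions (V \<inter> \<Omega>)" and g': "g \<in> test_functions (V \<inter> \<Omega>)"
    by (rule test_mono[OF f], blast, rule test_mono[OF g], blast)
   have "\<bar>f x + g x\<bar> <= 1" for x
    using f1[of x] g1[of x] K(3) test_outside[OF g, of x] by (cases "x \<in> K") auto
   then have "L (%x. f x + g x) <= mass V" by (rule mass_upper[OF test_add[OF f' g']])
   then show "L g <= mass V - L f" using L_add[OF test_V[OF f'] test_V[OF g']] by simp
  qed
  moreover have "outer (E - A) <= mass (V - K)"
   using V K by (intro outer_le open_Diff compact_imp_closed) auto
  ultimately show "L f <= mass V - outer (E - A)" by simp
 qed
 moreover have "outer (E \<inter> A) <= mass (V \<inter> A)" using V A by (intro outer_le) auto
 ultimately show "outer (E \<inter> A) + outer (E - A) <= mass V" by simp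
qed

definition radon :: "'a measure" where
 "radon = measure_of UNIV (sets borel) (%E. ennreal (outer E))"

lemma sets_radon [measurable_cong]: "sets radon = sets borel"
 unfolding radon_def by (subst sets_measure_of) (simp_all add: sets.sigma_sets_eq[of borel, simplified])

lemma space_radon [simp]: "space radon = UNIV"
 using sets_eq_imp_space_eq[OF sets_radon] by simp

text \<open>\<open>measure_of\<close> returns the given set function only where that is countably
  additive. Caratheodory's theorem provides this on the lambda system, which contains the open sets
  and therefore all Borel sets.\<close>

lemma emeasure_radon: "E \<in> sets borel ==> emeasure radon E = ennreal (outer E)"
proof -
 let ?f = "%E. ennreal (outer E)"
 let ?Lam = "lambda_system UNIV (Pow UNIV) ?f"
 have e0: "outer {} = 0" using outer_open[of "{}"] mass_empty by simp
 have oms: "outer_measure_space (Pow UNIV) ?f"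
  unfolding outer_measure_space_def
 proof (intro conjI)
  show "positive (Pow UNIV) ?f" by (simp add: positive_def e0)
  show "increasing (Pow UNIV) ?f" by (auto simp: increasing_def intro!: ennreal_leI outer_mono)
  show "countably_subadditive (Pow UNIV) ?f"
   unfolding countably_subadditive_def
  proof (intro allI impI)
   fix A :: "nat => 'a set"
   show "ennreal (outer (\<Union>i. A i)) <= (\<Sum>i. ennreal (outer (A i)))"
   proof (cases "(\<Sum>i. ennreal (outer (A i))) = top")
    case False
    then obtain t where t: "t \<ge> 0" "(\<Sum>i. ennreal (outer (A i))) = ennreal t"
     by (cases "\<Sum>i. ennreal (outer (A i))") auto
    have "(\<Sum>i<n. outer (A i)) <= t" for n
    proof -
     have "ennreal (\<Sum>i<n. outer (A i)) = (\<Sum>i<n. ennreal (outer (A i)))"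
      using outer_nonneg by (simp add: sum_ennreal)
     also have "... <= ennreal t" unfolding t(2)[symmetric] by (intro sum_le_suminf) auto
     finally show ?thesis using t(1) by (subst (asm) ennreal_le_iff) auto
    qed
    then have "outer (\<Union>i. A i) <= t" by (rule outer_UN_le)
    then show ?thesis unfolding t(2) by (rule ennreal_leI)
   qed simp
  qed
 qed
 have ms: "measure_space UNIV ?Lam ?f"
  using sigma_algebra.caratheodory_lemma[OF sigma_algebra_Pow oms] .
 then interpret Lam: sigma_algebra UNIV ?Lam unfolding measure_space_def by simp
 have opL: "A \<in> ?Lam" if A: "open A" for A
  unfolding lambda_system_def
 proof (intro CollectI conjI ballI)
  fix E :: "'a set"
  have "outer (A \<inter> E) + outer ((UNIV - A) \<inter> E) = outer E"
  proof (rule antisym)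
   show "outer (A \<inter> E) + outer ((UNIV - A) \<inter> E) <= outer E"
    using outer_caratheodory[OF A, of E] by (simp add: Int_commute Diff_eq Int_ac)
   show "outer E <= outer (A \<inter> E) + outer ((UNIV - A) \<inter> E)"
    using outer_Un[of "A \<inter> E" "(UNIV - A) \<inter> E"] by (simp flip: Int_Un_distrib2)
  qed
  then show "ennreal (outer (A \<inter> E)) + ennreal (outer ((UNIV - A) \<inter> E)) = ennreal (outer E)"
   using outer_nonneg by (simp flip: ennreal_plus)
 qed simp
 then have sub: "sets (borel :: 'a measure) \<subseteq> ?Lam"
 proof -
  have "sigma_sets UNIV (Collect open) \<subseteq> ?Lam" by (rule Lam.sigma_sets_subset) (use opL in auto)
  moreover have "sets (borel :: 'a measure) = sigma_sets UNIV (Collect open)"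
   unfolding borel_def by (rule sets_measure_of) simp
  ultimately show ?thesis by simp
 qed
 assume E: "E \<in> sets borel"
 show "emeasure radon E = ennreal (outer E)"
  unfolding radon_def
 proof (rule emeasure_measure_of[OF refl])
  show "positive (sets (measure_of UNIV (sets borel) ?f)) ?f" by (simp add: positive_def e0)
  have ca: "countably_additive ?Lam ?f" using ms unfolding measure_space_def by simp
  show "countably_additive (sets (measure_of UNIV (sets borel) ?f)) ?f"
   unfolding countably_additive_def sets_radon[unfolded radon_def]
  proof (intro allI impI)
   fix B :: "nat => 'a set"
   assume "range B \<subseteq> sets borel" "disjoint_family B" "\<Union>(range B) \<in> sets borel"
   then show "(\<Sum>i. ?f (B i)) = ?f (\<Union>(range B))"
    using ca sub unfolding countably_additive_def by (meson order_trans subsetD)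
  qed
  show "E \<in> sets (measure_of UNIV (sets borel) ?f)" using E sets_radon unfolding radon_def by simp
 qed simp
qed

lemma finite_radon: "finite_measure radon"
 by (rule finite_measureI) (simp add: emeasure_radon)

lemma measure_radon_open: "open V ==> measure radon V = mass V"
 using emeasure_radon[of V] outer_open[of V] mass_nonneg[of V] by (simp add: measure_def)

text \<open>The layers \<open>T k\<close> of height \<open>\<delta>\<close> cut \<open>h\<close> horizontally; \<open>L\<close> sees a mollified layer only on a
 neighbourhood of the level set on which it lives.\<close>

lemma L_mollify_le:
 fixes h :: "'a => real"
 assumes m: "mollifier \<rho> R" and h: "continuous_on UNIV h" "\<And>x. h x \<ge> 0"
  and K: "compact K" "K \<subseteq> \<Omega>" "\<And>x. x \<notin> K ==> h x = 0" and d: "\<delta> > 0" and s: "\<bar>s\<bar> = 1"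
 shows "\<forall>\<^sub>F \<epsilon> in at_right 0. mollify \<rho> \<epsilon> h \<in> test_functions \<Omega> \<and>
  L (%x. s * mollify \<rho> \<epsilon> h x) <= (LINT x|radon. h x) + 2 * \<delta> * C"
proof -
 interpret finite_measure radon by (rule finite_radon)
 have hm [measurable]: "h \<in> borel_measurable radon"
  using borel_measurable_continuous_onI[OF h(1)] by (simp cong: measurable_cong_sets add: sets_radon)
 have "bounded (h ` K)"
  by (intro compact_imp_bounded compact_continuous_image continuous_on_subset[OF h(1)] K(1)) auto
 then obtain B where B: "\<And>x. x \<in> K ==> norm (h x) <= B" unfolding bounded_iff by auto
 obtain n where n: "B <= real n * \<delta>" using reals_Archimedean3[OF d, rule_format, of B] less_imp_le by blast
 have hn: "h x <= real (Suc n) * \<delta>" for x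
  using B[of x] K(3)[of x] n d by (cases "x \<in> K") (auto simp: algebra_simps)
 have hi: "integrable radon h"
  by (rule integrable_const_bound[of _ "real (Suc n) * \<delta>"]) (use hn h(2) in auto)
 define T where "T k x = min (max (h x - real k * \<delta>) 0) \<delta>" for k x
 have T: "continuous_on UNIV (T k)" for k unfolding T_def by (intro continuous_intros h(1))
 have T0: "0 <= T k x" "T k x <= \<delta>" for k x unfolding T_def using d by auto
 have TK: "T k x = 0" if "x \<notin> K" for k x using K(3)[OF that] d unfolding T_def by simp
 have Tint: "integrable lborel (T k)" for k by (rule continuous_compact_support_integrable[OF T K(1) TK])
 have Tsum: "(\<Sum>k<N. T k x) = min (h x) (real N * \<delta>)" for N x
 proof (induction N)
  case (Suc N)
  have "min a b + min (max (a - b) 0) \<delta> = min a (b + \<delta>)" for a b :: real using d by (auto simp: min_def max_def)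
  from this[of "h x" "real N * \<delta>"] Suc show ?case by (simp add: T_def algebra_simps)
 qed (use h(2) in simp)
 have hT: "h x = (\<Sum>k<Suc n. T k x)" for x unfolding Tsum using hn[of x] by simp
 \<comment> \<open>One level lower than the layer: \<open>T k\<close> vanishes outside the closed
   set where h >= k \<open>\<delta>\<close>, and its mollification needs an open neighbourhood of
   that set. The shift costs one additional layer in the final sum.\<close>
 define V where "V k = (case k of 0 => UNIV | Suc j => {x. h x > real j * \<delta>})" for k
 have op: "open {x. h x > c}" for c
  by (intro open_Collect_less continuous_intros h(1))
 have "\<forall>\<^sub>F \<epsilon> in at_right 0. mollify \<rho> \<epsilon> (T k) \<in> test_functions (V k \<inter> \<Omega>)" for k
 proof -
  let ?K = "{x. h x \<ge> real k * \<delta>} \<inter> K"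
  have "closed {x. h x \<ge> real k * \<delta>}" by (intro closed_Collect_le continuous_intros h(1))
  then have cK: "compact ?K" using K(1) by (simp add: closed_Int_compact)
  have z: "T k x = 0" if "x \<notin> ?K" for x using that TK[of x k] d unfolding T_def by (cases "x \<in> K") auto
  have oV: "open (V k \<inter> \<Omega>)" unfolding V_def using op open_\<Omega> by (cases k) auto
  have KV: "?K \<subseteq> V k \<inter> \<Omega>"
  proof
   fix x assume x: "x \<in> ?K"
   have "h x > real j * \<delta>" if "k = Suc j" for j
   proof -
    have "real j * \<delta> < real k * \<delta>" using that d by simp
    then show ?thesis using x by simp
   qed
   then show "x \<in> V k \<inter> \<Omega>" using x K(2) unfolding V_def by (cases k) auto
  qed
  obtain e where "e > 0" "\<forall>\<epsilon>. 0 < \<epsilon> \<and> \<epsilon> < e --> mollify \<rho> \<epsilon> (T k) \<in> test_functions (V k \<inter> \<Omega>)"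
   using mollify_test_functions_eventually[OF m Tint cK z oV KV] by auto
  then show ?thesis unfolding eventually_at_right_field by (intro exI[of _ e]) auto
 qed
 then have "\<forall>\<^sub>F \<epsilon> in at_right 0. \<forall>k\<in>{..<Suc n}. mollify \<rho> \<epsilon> (T k) \<in> test_functions (V k \<inter> \<Omega>)"
  by (intro eventually_ball_finite) auto
 moreover have "\<forall>\<^sub>F \<epsilon> in at_right (0::real). \<epsilon> > 0" by (rule eventually_at_right_less)
 ultimately show ?thesis
 proof eventually_elim
  case (elim \<epsilon>)
  then have mV: "mollify \<rho> \<epsilon> (T k) \<in> test_functions (V k \<inter> \<Omega>)" if "k < Suc n" for k using that by blast
  have e: "\<epsilon> > 0" by (rule elim(2))
  have mh: "mollify \<rho> \<epsilon> h x = (\<Sum>k<Suc n. mollify \<rho> \<epsilon> (T k) x)" for x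
   unfolding mollify_def hT scaleR_sum_right
   by (rule Bochner_Integration.integral_sum) (rule mollify_integrable[OF mollifierD(1)[OF m] e Tint])
  have t1: "mollify \<rho> \<epsilon> h \<in> test_functions \<Omega>"
   unfolding mh[abs_def] using mV by (intro test_sum) (auto intro: test_V)
  have "L (%x. s * mollify \<rho> \<epsilon> h x) = L (%x. \<Sum>k<Suc n. s * mollify \<rho> \<epsilon> (T k) x)"
   unfolding mh sum_distrib_left ..
  also have "... = (\<Sum>k<Suc n. L (%x. s * mollify \<rho> \<epsilon> (T k) x))"
   by (rule L_sum) (rule test_mult[OF test_V[OF mV]])
  also have "... <= (\<Sum>k<Suc n. \<delta> * mass (V k))"
  proof (rule sum_mono)
   fix k assume "k \<in> {..<Suc n}"
   then have k: "k < Suc n" by simp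
   show "L (%x. s * mollify \<rho> \<epsilon> (T k) x) <= \<delta> * mass (V k)"
   proof (rule mass_scaled[OF test_mult[OF mV[OF k]] _ d])
    show "\<bar>s * mollify \<rho> \<epsilon> (T k) x\<bar> <= \<delta>" for x
     using mollify_norm_le[OF m Tint[of k] e, of \<delta> x] T0 s by (simp add: abs_mult)
   qed
  qed
  also have "... = \<delta> * mass UNIV + (\<Sum>j<n. \<delta> * mass {x. h x > real j * \<delta>})"
   unfolding sum.lessThan_Suc_shift by (simp add: V_def)
  also have "(\<Sum>j<n. \<delta> * mass {x. h x > real j * \<delta>}) = (\<Sum>j<n. (LINT x|radon. \<delta> * indicator {x. h x > real j * \<delta>} x))"
  proof (rule sum.cong[OF refl])
   fix j
   have "{x. h x > real j * \<delta>} \<in> sets radon" using op[of "real j * \<delta>"] by (simp add: sets_radon)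
   then show "\<delta> * mass {x. h x > real j * \<delta>} = (LINT x|radon. \<delta> * indicator {x. h x > real j * \<delta>} x)"
    using measure_radon_open[OF op, of "real j * \<delta>"] by simp
  qed
  also have "... = (LINT x|radon. (\<Sum>j<n. \<delta> * indicator {x. h x > real j * \<delta>} x))"
  proof (rule Bochner_Integration.integral_sum[symmetric])
   fix j
   have "{x. h x > real j * \<delta>} \<in> sets radon" using op[of "real j * \<delta>"] by (simp add: sets_radon)
   then show "integrable radon (%x. \<delta> * indicator {x. h x > real j * \<delta>} x)"
    by (intro integrable_mult_right integrable_real_indicator) (simp_all add: emeasure_eq_measure)
  qed
  also have "... <= (LINT x|radon. h x + \<delta>)"
  proof (rule integral_mono')
   show "integrable radon (%x. h x + \<delta>)" using hi by simp
   \<comment> \<open>\<open>\<delta>\<close> times the number of levels below \<open>h x\<close> is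
     \<open>h x\<close> rounded up to a multiple of \<open>\<delta>\<close>, at most.\<close>
   show "(\<Sum>j<n. \<delta> * indicator {x. h x > real j * \<delta>} x) <= h x + \<delta>" for x
   proof (induction n)
    case (Suc n)
    show ?case
    proof (cases "h x > real n * \<delta>")
     case True
     have "(\<Sum>j<Suc n. \<delta> * indicator {x. h x > real j * \<delta>} x) <= (\<Sum>j<Suc n. \<delta> * 1)"
      using d by (intro sum_mono mult_left_mono) (auto simp: indicator_def)
     also have "... = real n * \<delta> + \<delta>" by (simp add: algebra_simps)
     finally show ?thesis using True by simp
    qed (use Suc in simp)
   qed (use h(2) d in \<open>simp add: add_nonneg_pos less_imp_le\<close>)
   show "0 <= h x + \<delta>" for x using h(2)[of x] d by simp
  qed
  also have "(LINT x|radon. h x + \<delta>) = (LINT x|radon. h x) + \<delta> * mass UNIV"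
   using hi measure_radon_open[of UNIV] by simp
  finally have "L (%x. s * mollify \<rho> \<epsilon> h x) <= \<delta> * mass UNIV + ((LINT x|radon. h x) + \<delta> * mass UNIV)" by simp
  moreover have "\<delta> * mass UNIV <= \<delta> * C" using d mass_le by (intro mult_left_mono) auto
  ultimately show ?case using t1 by (simp add: algebra_simps)
 qed
qed

text \<open>The positive and negative parts of \<open>f\<close> are only continuous, so the layer
  estimate is applied to their mollifications. What remains is the mollification error of
  \<open>f\<close>, which is uniformly small and hence controlled by the sup norm bound on
  \<open>L\<close>.\<close>

lemma L_le_integral:
 assumes f: "f \<in> test_functions \<Omega>"
 shows "L f <= (LINT x|radon. \<bar>f x\<bar>)"
proof (rule field_le_epsilon)
 fix e :: real assume e: "e > 0"
 \<comment> \<open>The errors add up to 5 \<open>\<delta>\<close> C: one \<open>\<delta>\<close> C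
   from mollifying \<open>f\<close>, and 2 \<open>\<delta>\<close> C from each of its two
   parts.\<close>
 define \<delta> where "\<delta> = e / (5 * C + 1)"
 have C1: "5 * C + 1 > 0" using C_nonneg by simp
 have d: "\<delta> > 0" unfolding \<delta>_def using e C1 by simp
 have "\<delta> * (5 * C + 1) = e" unfolding \<delta>_def using C1 by simp
 then have dC: "\<delta> * (5 * C) <= e" using d by (simp add: algebra_simps)
 obtain \<rho> :: "'a => real" where m: "mollifier \<rho> 1" using ex_mollifier by blast
 obtain K where K: "compact K" "K \<subseteq> \<Omega>" "\<forall>x. x \<notin> K --> f x = 0" using test_support[OF f] by auto
 have fc: "continuous_on UNIV f" by (rule test_continuous[OF f])
 let ?p = "%x. max (f x) 0" and ?n = "%x. max (- f x) 0"
 have c: "continuous_on UNIV ?p" "continuous_on UNIV ?n" by (intro continuous_intros fc)+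
 have z: "?p x = 0" "?n x = 0" if "x \<notin> K" for x using K(3) that by auto
 have i: "integrable lborel ?p" "integrable lborel ?n"
  by (rule continuous_compact_support_integrable[OF c(1) K(1) z(1)], assumption,
    rule continuous_compact_support_integrable[OF c(2) K(1) z(2)], assumption)
 have "\<forall>\<^sub>F \<epsilon> in at_right 0. mollify \<rho> \<epsilon> ?p \<in> test_functions \<Omega> \<and>
  L (%x. 1 * mollify \<rho> \<epsilon> ?p x) <= (LINT x|radon. ?p x) + 2 * \<delta> * C"
  by (rule L_mollify_le[OF m c(1) _ K(1,2) z(1) d]) auto
 moreover have "\<forall>\<^sub>F \<epsilon> in at_right 0. mollify \<rho> \<epsilon> ?n \<in> test_functions \<Omega> \<and>
  L (%x. (-1) * mollify \<rho> \<epsilon> ?n x) <= (LINT x|radon. ?n x) + 2 * \<delta> * C"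
  by (rule L_mollify_le[OF m c(2) _ K(1,2) z(2) d]) auto
 moreover have "\<forall>\<^sub>F \<epsilon> in at_right 0. \<forall>x. norm (mollify \<rho> \<epsilon> f x - f x) <= \<delta>"
 proof -
  obtain r where "r > 0" "\<forall>\<epsilon> x. 0 < \<epsilon> \<and> \<epsilon> < r --> norm (mollify \<rho> \<epsilon> f x - f x) <= \<delta>"
   using mollify_uniform_limit[OF m fc K(1) _ d] K(3) by auto
  then show ?thesis unfolding eventually_at_right_field by (intro exI[of _ r]) auto
 qed
 moreover have "\<forall>\<^sub>F \<epsilon> in at_right (0::real). \<epsilon> > 0" by (rule eventually_at_right_less)
 ultimately have "\<forall>\<^sub>F \<epsilon> in at_right (0::real). L f <= (LINT x|radon. \<bar>f x\<bar>) + e"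
 proof eventually_elim
  case (elim \<epsilon>)
  let ?P = "mollify \<rho> \<epsilon> ?p" and ?N = "mollify \<rho> \<epsilon> ?n"
  have fpn: "f x = ?p x - ?n x" for x by auto
  have mf: "mollify \<rho> \<epsilon> f x = ?P x - ?N x" for x
  proof -
   have "mollify \<rho> \<epsilon> f x = mollify \<rho> \<epsilon> (%x. ?p x - ?n x) x" using fpn by (intro arg_cong[where f="%g. mollify \<rho> \<epsilon> g x"]) auto
   then show ?thesis using mollify_diff[OF m elim(4) i] by simp
  qed
  have t: "?P \<in> test_functions \<Omega>" "?N \<in> test_functions \<Omega>" using elim by auto
  have tn: "(%x. (-1) * ?N x) \<in> test_functions \<Omega>" by (rule test_mult[OF t(2)])
  have tf: "(%x. ?P x + (-1) * ?N x) \<in> test_functions \<Omega>" by (rule test_add[OF t(1) tn])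
  have td: "(%x. f x - (?P x + (-1) * ?N x)) \<in> test_functions \<Omega>" by (rule test_diff[OF f tf])
  have td': "(%x. f x - (?P x + (-1) * ?N x)) \<in> test_functions (UNIV \<inter> \<Omega>)" using td by simp
  have "L (%x. f x - (?P x + (-1) * ?N x)) <= \<delta> * mass UNIV"
  proof (rule mass_scaled[OF td' _ d])
   show "\<bar>f x - (?P x + (-1) * ?N x)\<bar> <= \<delta>" for x
    using elim(3)[rule_format, of x] mf[of x] by (simp add: abs_minus_commute)
  qed
  also have "... <= \<delta> * C" using d mass_le by (intro mult_left_mono) auto
  finally have 1: "L (%x. f x - (?P x + (-1) * ?N x)) <= \<delta> * C" .
  have Lf: "L f = L (%x. f x - (?P x + (-1) * ?N x)) + (L ?P + L (%x. (-1) * ?N x))"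
   using L_add[OF td tf] unfolding L_add[OF t(1) tn] by simp
  have 2: "L f <= \<delta> * C + ((LINT x|radon. ?p x) + 2 * \<delta> * C) + ((LINT x|radon. ?n x) + 2 * \<delta> * C)"
  proof -
   have "L ?P <= (LINT x|radon. ?p x) + 2 * \<delta> * C" using elim(1) by simp
   moreover have "L (%x. (-1) * ?N x) <= (LINT x|radon. ?n x) + 2 * \<delta> * C" by (rule conjunct2[OF elim(2)])
   moreover note 1
   ultimately show ?thesis unfolding Lf by linarith
  qed
  have fi: "integrable radon f" by (rule test_integrable_finite[OF finite_radon sets_radon f])
  have "(LINT x|radon. ?p x) + (LINT x|radon. ?n x) = (LINT x|radon. ?p x + ?n x)"
   using fi by (intro Bochner_Integration.integral_add[symmetric]) auto
  also have "... = (LINT x|radon. \<bar>f x\<bar>)" by (intro Bochner_Integration.integral_cong) auto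
  finally show ?case using 2 dC by (simp add: algebra_simps)
 qed
 then show "L f <= (LINT x|radon. \<bar>f x\<bar>) + e" by (simp add: eventually_const trivial_limit_at_right_real)
qed

text \<open>By \<open>L_le_integral\<close> the functional is bounded in L^1 and, the measure being
  finite, in L^2. Half the squared norm minus \<open>L\<close> is therefore bounded below, and the
  Euler-Lagrange equation of its minimiser s is the representation. As s is only a limit of test
  functions, minimality is first written along the minimising sequence.\<close>

lemma representation: "\<exists>s. integrable radon s \<and> (\<forall>\<phi>\<in>test_functions \<Omega>. L \<phi> = (LINT x|radon. \<phi> x * s x))"
proof -
 interpret finite_measure radon by (rule finite_radon)
 let ?X = "test_functions \<Omega> :: ('a => real) set"
 define J where "J f = (LINT x|radon. (norm (f x))\<^sup>2) / 2 - L f" for f :: "'a => real"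
 have ms: "f \<in> borel_measurable radon" if "f \<in> ?X" for f
  using test_measurable[OF that] by (simp cong: measurable_cong_sets add: sets_radon)
 have prod_int: "integrable radon (%x. f x * g x)" if "f \<in> ?X" "g \<in> ?X" for f g
  by (rule test_integrable_finite[OF finite_radon sets_radon
    test_bilinear[OF bounded_bilinear_mult that(1) test_smooth[OF that(2)]]])
 have int1: "integrable radon f" if "f \<in> ?X" for f
  by (rule test_integrable_finite[OF finite_radon sets_radon that])
 have int2: "integrable radon (%x. (norm (f x))\<^sup>2)" if "f \<in> ?X" for f
  using prod_int[OF that that] by (simp add: power2_eq_square)
 have low: "- (measure radon UNIV) / 2 <= J f" if f: "f \<in> ?X" for f
 proof -
  have "L f <= (LINT x|radon. \<bar>f x\<bar>)" by (rule L_le_integral[OF f])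
  also have "... <= (LINT x|radon. (norm (f x))\<^sup>2 / 2 + 1 / 2)"
  proof (rule integral_mono')
   show "\<bar>f x\<bar> <= (norm (f x))\<^sup>2 / 2 + 1 / 2" for x
    using zero_le_power2[of "\<bar>f x\<bar> - 1"] by (simp add: power2_eq_square algebra_simps)
  qed (use int2[OF f] in \<open>auto intro!: integrable_add\<close>)
  also have "... = (LINT x|radon. (norm (f x))\<^sup>2) / 2 + measure radon UNIV / 2"
   using int2[OF f] by simp
  finally show ?thesis unfolding J_def by simp
 qed
 \<comment> \<open>By the parallelogram law half the squared norm has the constant 1/8 at midpoints,
   and the linear part \<open>L\<close> does not affect it.\<close>
 have mid: "\<exists>w\<in>?X. J w + 1 / 8 * (LINT z|radon. (norm (f z - g z))\<^sup>2) <= (J f + J g) / 2"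
  if f: "f \<in> ?X" and g: "g \<in> ?X" for f g
 proof (rule bexI)
  let ?w = "%x. (1 / 2) * f x + (1 / 2) * g x"
  have hf: "(%x. (1 / 2) * f x) \<in> ?X" "(%x. (1 / 2) * g x) \<in> ?X" by (rule test_mult[OF f], rule test_mult[OF g])
  show w: "?w \<in> ?X" by (rule test_add[OF hf])
  have Lw: "L ?w = (1 / 2) * L f + (1 / 2) * L g"
   unfolding L_add[OF hf] using L_scale[OF f, of "1/2"] L_scale[OF g, of "1/2"] by simp
  have "(LINT x|radon. (norm (?w x))\<^sup>2) / 2 + 1 / 8 * (LINT z|radon. (norm (f z - g z))\<^sup>2)
    = (LINT x|radon. (norm (?w x))\<^sup>2 / 2 + 1 / 8 * (norm (f x - g x))\<^sup>2)"
   using int2[OF w] int2[OF test_diff[OF f g]] by simp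
  also have "... = (LINT x|radon. (norm (f x))\<^sup>2 / 4 + (norm (g x))\<^sup>2 / 4)"
   by (intro Bochner_Integration.integral_cong) (auto simp: power2_eq_square field_simps)
  also have "... = (LINT x|radon. (norm (f x))\<^sup>2) / 4 + (LINT x|radon. (norm (g x))\<^sup>2) / 4"
   using int2[OF f] int2[OF g] by simp
  finally show "J ?w + 1 / 8 * (LINT z|radon. (norm (f z - g z))\<^sup>2) <= (J f + J g) / 2"
   unfolding J_def Lw by simp
 qed
 have X: "?X \<noteq> {}" using test_zero by auto
 obtain fs s where s: "\<And>n. fs n \<in> ?X" "(%n. J (fs n)) \<longlonglongrightarrow> Inf (J ` ?X)" "\<And>f. f \<in> ?X ==> Inf (J ` ?X) <= J f"
  "s \<in> borel_measurable radon" "integrable radon (%x. (norm (s x))\<^sup>2)"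
  "\<And>n. integrable radon (%x. (norm (fs n x - s x))\<^sup>2)"
  "(%n. (LINT x|radon. (norm (fs n x - s x))\<^sup>2)) \<longlonglongrightarrow> 0"
  by (rule minimizing_sequence_L2[where T="%f. f" and J=J and X="?X" and c="1/8", OF finite_radon X ms int2 low mid],
    assumption+, simp, rule that)
 have si: "integrable radon s"
  using L1_le_Lq(1)[OF finite_radon s(4), of 2 1] s(5) by (simp add: norm_powr_2)
 have L1: "(%n. (LINT x|radon. norm (fs n x - s x))) \<longlonglongrightarrow> 0"
  by (rule Lq_tendsto_imp_L1[OF finite_radon, where q=2])
   (use s ms[OF s(1)] in \<open>auto simp: norm_powr_2\<close>)
 have "L \<phi> = (LINT x|radon. \<phi> x * s x)" if \<phi>: "\<phi> \<in> ?X" for \<phi>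
 proof -
  obtain B where B: "B > 0" "\<And>x. \<bar>\<phi> x\<bar> <= B" using test_bounded[OF \<phi>] by auto
  have \<phi>s: "integrable radon (%x. \<phi> x * s x)"
   using integrable_bounded_mult[OF si ms[OF \<phi>] B(2)] by simp
  have "(%n. (LINT x|radon. \<phi> x * fs n x) - (LINT x|radon. \<phi> x * s x)) \<longlonglongrightarrow> 0"
  proof (rule Lim_null_comparison)
   have "(%n. B * (LINT x|radon. norm (fs n x - s x))) \<longlonglongrightarrow> B * 0" by (intro tendsto_mult tendsto_const L1)
   then show "(%n. B * (LINT x|radon. norm (fs n x - s x))) \<longlonglongrightarrow> 0" by simp
   show "\<forall>\<^sub>F n in sequentially. norm ((LINT x|radon. \<phi> x * fs n x) - (LINT x|radon. \<phi> x * s x))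
     <= B * (LINT x|radon. norm (fs n x - s x))"
   proof (rule always_eventually, rule allI)
    fix n
    have "norm ((LINT x|radon. \<phi> x * fs n x) - (LINT x|radon. \<phi> x * s x)) = norm (LINT x|radon. \<phi> x * fs n x - \<phi> x * s x)"
     by (simp only: Bochner_Integration.integral_diff[OF prod_int[OF \<phi> s(1)] \<phi>s])
    also have "... <= (LINT x|radon. norm (\<phi> x * fs n x - \<phi> x * s x))" by (rule integral_norm_bound)
    also have "... <= (LINT x|radon. B * norm (fs n x - s x))"
    proof (rule integral_mono')
     show "integrable radon (%x. B * norm (fs n x - s x))" using int1[OF s(1)] si by simp
     show "norm (\<phi> x * fs n x - \<phi> x * s x) <= B * norm (fs n x - s x)" for x
      using B(2)[of x] by (simp flip: right_diff_distrib add: abs_mult mult_right_mono)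
     show "0 <= B * norm (fs n x - s x)" for x using B(1) by simp
    qed
    finally show "norm ((LINT x|radon. \<phi> x * fs n x) - (LINT x|radon. \<phi> x * s x)) <= B * (LINT x|radon. norm (fs n x - s x))" by simp
   qed
  qed
  then have lim: "(%n. (LINT x|radon. \<phi> x * fs n x)) \<longlonglongrightarrow> (LINT x|radon. \<phi> x * s x)" by (rule LIM_zero_cancel)
  have "0 <= t * ((LINT x|radon. \<phi> x * s x) - L \<phi>) + t\<^sup>2 * ((LINT x|radon. (norm (\<phi> x))\<^sup>2) / 2)" for t
  proof -
   have "Inf (J ` ?X) <= J (fs n) + (t * ((LINT x|radon. \<phi> x * fs n x) - L \<phi>) + t\<^sup>2 * ((LINT x|radon. (norm (\<phi> x))\<^sup>2) / 2))" for n
   proof -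
    let ?w = "%x. fs n x + t * \<phi> x"
    have w: "?w \<in> ?X" by (rule test_add[OF s(1) test_mult[OF \<phi>]])
    have Lw: "L ?w = L (fs n) + t * L \<phi>" unfolding L_add[OF s(1) test_mult[OF \<phi>]] L_scale[OF \<phi>] ..
    have "(LINT x|radon. (norm (?w x))\<^sup>2)
      = (LINT x|radon. (norm (fs n x))\<^sup>2 + (2 * t * (\<phi> x * fs n x) + t\<^sup>2 * (norm (\<phi> x))\<^sup>2))"
     by (intro Bochner_Integration.integral_cong) (auto simp: power2_eq_square algebra_simps)
    also have "... = (LINT x|radon. (norm (fs n x))\<^sup>2) + (2 * t * (LINT x|radon. \<phi> x * fs n x) + t\<^sup>2 * (LINT x|radon. (norm (\<phi> x))\<^sup>2))"
    proof -
     have "(LINT x|radon. (2 * t * (\<phi> x * fs n x) + t\<^sup>2 * (norm (\<phi> x))\<^sup>2)) = 2 * t * (LINT x|radon. \<phi> x * fs n x) + t\<^sup>2 * (LINT x|radon. (norm (\<phi> x))\<^sup>2)"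
      by (subst Bochner_Integration.integral_add[OF integrable_mult_right[OF prod_int[OF \<phi> s(1)]] integrable_mult_right[OF int2[OF \<phi>]]])
       (simp only: Bochner_Integration.integral_mult_right_zero)
     then show ?thesis
      by (subst Bochner_Integration.integral_add[OF int2[OF s(1)] Bochner_Integration.integrable_add[OF integrable_mult_right[OF prod_int[OF \<phi> s(1)]] integrable_mult_right[OF int2[OF \<phi>]]]])
       (simp only:)
    qed
    finally show ?thesis using s(3)[OF w] unfolding J_def Lw by (simp add: algebra_simps)
   qed
   moreover have "(%n. J (fs n) + (t * ((LINT x|radon. \<phi> x * fs n x) - L \<phi>) + t\<^sup>2 * ((LINT x|radon. (norm (\<phi> x))\<^sup>2) / 2)))
     \<longlonglongrightarrow> Inf (J ` ?X) + (t * ((LINT x|radon. \<phi> x * s x) - L \<phi>) + t\<^sup>2 * ((LINT x|radon. (norm (\<phi> x))\<^sup>2) / 2))"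
    by (intro tendsto_add tendsto_mult tendsto_diff tendsto_const s(2) lim)
   ultimately have "Inf (J ` ?X) <= Inf (J ` ?X) + (t * ((LINT x|radon. \<phi> x * s x) - L \<phi>) + t\<^sup>2 * ((LINT x|radon. (norm (\<phi> x))\<^sup>2) / 2))"
    by (intro LIMSEQ_le_const) auto
   then show ?thesis by simp
  qed
  from quadratic_nonneg_imp_zero[OF this] show ?thesis by simp
 qed
 with si show ?thesis by blast
qed

end

section \<open>Functions of bounded variation\<close>

lemma gradient_inner:
 assumes "f differentiable (at x)"
 shows "gradient f x \<bullet> w = frechet_derivative f (at x) w"
 unfolding gradient_def frechet_derivative_partial[OF assms] inner_sum_left
 by (intro sum.cong refl) (simp add: inner_commute mult.commute)

lemma gradient_inner_Basis: "b \<in> Basis ==> gradient f x \<bullet> b = partial_deriv f b x"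
 unfolding gradient_def by (rule inner_sum_left_Basis)

lemma partial_deriv_scaleR:
 fixes \<eta> :: "'a::euclidean_space => real" and \<phi> :: "'a => 'b::euclidean_space"
 assumes "\<eta> differentiable (at x)" "\<phi> differentiable (at x)"
 shows "partial_deriv (%x. \<eta> x *\<^sub>R \<phi> x) b x = \<eta> x *\<^sub>R partial_deriv \<phi> b x + partial_deriv \<eta> b x *\<^sub>R \<phi> x"
proof -
 have "((%x. \<eta> x *\<^sub>R \<phi> x) has_derivative (%h. \<eta> x *\<^sub>R frechet_derivative \<phi> (at x) h + frechet_derivative \<eta> (at x) h *\<^sub>R \<phi> x)) (at x)"
  by (rule has_derivative_scaleR) (use assms frechet_derivative_works in blast)+
 from partial_deriv_eqI[OF this] show ?thesis unfolding partial_deriv_def .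
qed

lemma divergence_scaleR:
 assumes "\<eta> differentiable (at x)" "\<phi> differentiable (at x)"
 shows "divergence (%x. \<eta> x *\<^sub>R \<phi> x) x = \<eta> x * divergence \<phi> x + gradient \<eta> x \<bullet> \<phi> x"
 unfolding divergence_def partial_deriv_scaleR[OF assms] gradient_def
 by (simp add: inner_add_left sum.distrib sum_distrib_left inner_sum_left) (simp add: inner_commute)

lemma partial_deriv_const: "partial_deriv (%x. c) b x = 0"
 by (rule partial_deriv_eqI) simp

lemma partial_deriv_linear:
 assumes "bounded_linear T" "f differentiable (at x)"
 shows "partial_deriv (%x. T (f x)) b x = T (partial_deriv f b x)"
proof -
 have "(f has_derivative frechet_derivative f (at x)) (at x)" using assms(2) frechet_derivative_works by blast
 from partial_deriv_eqI[OF bounded_linear.has_derivative[OF assms(1) this]] show ?thesis unfolding partial_deriv_def .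
qed

lemma divergence_const: "divergence (%x. c) x = 0"
 unfolding divergence_def partial_deriv_const by simp

lemma divergence_scaleR_Basis:
 assumes "f \<in> test_functions U" "b \<in> Basis"
 shows "divergence (%x. f x *\<^sub>R b) x = partial_deriv f b x"
 using divergence_scaleR[OF test_differentiable[OF assms(1)], of "%x. b" x]
 by (simp add: divergence_const gradient_inner_Basis assms(2))

lemma partial_deriv_add:
 assumes "f differentiable (at x)" "g differentiable (at x)"
 shows "partial_deriv (%x. f x + g x) b x = partial_deriv f b x + partial_deriv g b x"
proof -
 have "((%x. f x + g x) has_derivative (%h. frechet_derivative f (at x) h + frechet_derivative g (at x) h)) (at x)"
  by (rule has_derivative_add) (use assms frechet_derivative_works in blast)+
 from partial_deriv_eqI[OF this] show ?thesis unfolding partial_deriv_def .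
qed

lemma divergence_add:
 assumes "f differentiable (at x)" "g differentiable (at x)"
 shows "divergence (%x. f x + g x) x = divergence f x + divergence g x"
 unfolding divergence_def partial_deriv_add[OF assms] by (simp add: inner_add_left sum.distrib)

lemma divergence_linear_scaleR:
 assumes "f differentiable (at x)"
 shows "divergence (%x. c *\<^sub>R f x) x = c * divergence f x"
 unfolding divergence_def partial_deriv_linear[OF bounded_linear_scaleR_right assms]
 by (simp add: sum_distrib_left)

lemma divergence_test_function:
 assumes "f \<in> test_functions U"
 shows "divergence f \<in> test_functions U"
 unfolding divergence_def[abs_def]
 by (intro test_sum test_inner test_partial_deriv assms)

lemma gradient_test_function:
 assumes "f \<in> test_functions U"
 shows "gradient f \<in> test_functions U"
 unfolding gradient_def[abs_def]
 by (intro test_sum test_scaleR_const test_partial_deriv assms)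

lemma borel_measurable_lebesgue_on: "f \<in> borel_measurable borel ==> f \<in> borel_measurable (lebesgue_on S)"
 by (intro measurable_restrict_space1 measurable_completion) simp

lemmas test_measurable_on = borel_measurable_lebesgue_on[OF test_measurable]

lemma test_mult_integrable:
 fixes f :: "'a::euclidean_space => real" and u :: "'a => 'b::euclidean_space"
 assumes "f \<in> test_functions V" "integrable (lebesgue_on S) u"
 shows "integrable (lebesgue_on S) (%x. f x *\<^sub>R u x)"
proof -
 obtain B where "\<And>x. norm (f x) <= B" using test_bounded[OF assms(1)] by metis
 then show ?thesis using assms(2) test_measurable_on[OF assms(1)]
  by (intro integrable_bounded_mult[of _ _ _ B]) auto
qed

lemma test_inner_integrable:
 fixes f u :: "'a::euclidean_space => 'b::euclidean_space"
 assumes "f \<in> test_functions V" "integrable (lebesgue_on S) u"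
 shows "integrable (lebesgue_on S) (%x. f x \<bullet> u x)"
proof -
 obtain B where B: "\<And>x. norm (f x) <= B" using test_bounded[OF assms(1)] by metis
 have [measurable]: "u \<in> borel_measurable (lebesgue_on S)" "f \<in> borel_measurable (lebesgue_on S)"
  using assms(2) test_measurable_on[OF assms(1)] by auto
 have ib: "integrable (lebesgue_on S) (%x. B * norm (u x))" using assms(2) by simp
 show ?thesis
 proof (rule Bochner_Integration.integrable_bound[OF ib], measurable, rule AE_I2)
  fix x
  have "norm (f x \<bullet> u x) <= norm (f x) * norm (u x)" by (simp add: Cauchy_Schwarz_ineq2)
  also have "... <= B * norm (u x)" by (rule mult_right_mono[OF B]) simp
  finally show "norm (f x \<bullet> u x) <= norm (B * norm (u x))" by simp
 qed
qed

section \<open>Unit fields and the total variation\<close>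

definition unit_fields :: "'a::euclidean_space set => ('a => 'a) set" where
 "unit_fields U = {\<phi> \<in> test_functions U. \<forall>x. norm (\<phi> x) <= 1}"

lemma AE_le_continuous_imp_le:
 fixes f :: "'a::euclidean_space => real"
 assumes U: "open U" and f: "continuous_on UNIV f" and ae: "AE x in lebesgue_on U. f x <= c" and x: "x \<in> U"
 shows "f x <= c"
proof (rule ccontr)
 let ?S = "{x. f x > c} \<inter> U"
 assume "\<not> f x <= c"
 then have ne: "?S \<noteq> {}" using x by (auto simp: not_le)
 have op: "open ?S" using U f by (intro open_Int open_Collect_less continuous_intros)
 have Ul: "U \<in> sets lebesgue" using U by (simp add: lebesgue_openin)
 have "AE x in lebesgue. x \<in> U --> f x <= c" using ae Ul by (simp add: AE_restrict_space_iff)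
 then have "AE x in lebesgue. x \<notin> ?S" by eventually_elim auto
 moreover have "?S \<in> sets lebesgue" using op by (simp add: lebesgue_openin)
 ultimately have "?S \<in> null_sets lebesgue" using AE_iff_null_sets by blast
 then have "negligible ?S" by (simp add: negligible_iff_null_sets)
 then show False using open_not_negligible[OF op ne] by blast
qed

lemma Linf_norm_le_ennreal_iff:
 assumes U: "open U" and f: "f \<in> borel_measurable (lebesgue_on U)" and c: "c \<ge> 0"
 shows "Linf_norm U f <= ennreal c \<longleftrightarrow> (AE x in lebesgue_on U. norm (f x) <= c)"
proof
 assume le: "Linf_norm U f <= ennreal c"
 have "AE x in lebesgue_on U. ennreal (norm (f x)) <= Linf_norm U f"
  unfolding Linf_norm_def by (rule esssup_AE)
 then show "AE x in lebesgue_on U. norm (f x) <= c"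
 proof eventually_elim
  case (elim x)
  from order_trans[OF elim le] show ?case by (simp add: ennreal_le_iff[OF c])
 qed
next
 assume "AE x in lebesgue_on U. norm (f x) <= c"
 then have "AE x in lebesgue_on U. ennreal (norm (f x)) <= ennreal c"
  by eventually_elim (rule ennreal_leI)
 moreover have "(%x. ennreal (norm (f x))) \<in> borel_measurable (lebesgue_on U)" using f by measurable
 ultimately show "Linf_norm U f <= ennreal c" unfolding Linf_norm_def by (intro esssup_I)
qed

text \<open>A test field is continuous and vanishes off \<open>U\<close>, so the essential bound
  holds at every point.\<close>

lemma unit_fields_eq:
 assumes U: "open U"
 shows "{\<phi> \<in> test_functions U. Linf_norm U \<phi> <= 1} = unit_fields U"
proof -
 have "Linf_norm U \<phi> <= 1 \<longleftrightarrow> (\<forall>x. norm (\<phi> x) <= 1)" if t: "\<phi> \<in> test_functions U" for \<phi> :: "'a => 'a"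
 proof -
  have a: "Linf_norm U \<phi> <= 1 \<longleftrightarrow> (AE x in lebesgue_on U. norm (\<phi> x) <= 1)"
   using Linf_norm_le_ennreal_iff[OF U test_measurable_on[OF t], of 1] by simp
  have b: "norm (\<phi> x) <= 1" if ae: "AE x in lebesgue_on U. norm (\<phi> x) <= 1" for x
  proof (cases "x \<in> U")
   case True
   then show ?thesis
    by (rule AE_le_continuous_imp_le[OF U continuous_on_norm[OF test_continuous[OF t]] ae])
  qed (simp add: test_outside[OF t])
  show ?thesis
  proof
   assume "Linf_norm U \<phi> <= 1"
   with a have "AE x in lebesgue_on U. norm (\<phi> x) <= 1" by blast
   from b[OF this] show "\<forall>x. norm (\<phi> x) <= 1" by (rule allI)
  next
   assume "\<forall>x. norm (\<phi> x) <= 1"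
   then have "AE x in lebesgue_on U. norm (\<phi> x) <= 1" by simp
   with a show "Linf_norm U \<phi> <= 1" by blast
  qed
 qed
 then show ?thesis unfolding unit_fields_def by auto
qed

lemma TV_eq: "open U ==> TV U u = (SUP \<phi>\<in>unit_fields U. ereal (LINT x|lebesgue_on U. u x * divergence \<phi> x))"
 unfolding TV_def by (simp only: unit_fields_eq)

lemma TV_upper: "open U ==> \<phi> \<in> unit_fields U ==> ereal (LINT x|lebesgue_on U. u x * divergence \<phi> x) <= TV U u"
 unfolding TV_eq by (rule SUP_upper)

lemma TV_least:
 assumes "open U" "\<And>\<phi>. \<phi> \<in> unit_fields U ==> (LINT x|lebesgue_on U. u x * divergence \<phi> x) <= c"
 shows "TV U u <= ereal c"
 unfolding TV_eq[OF assms(1)] by (rule SUP_least) (use assms(2) in simp)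

lemma unit_fields_zero: "(%x. 0) \<in> unit_fields U"
 unfolding unit_fields_def using test_zero by auto

lemma TV_nonneg: "open U ==> TV U u \<ge> 0"
 using TV_upper[OF _ unit_fields_zero, of U u] by (simp add: divergence_const zero_ereal_def)

lemma unit_fields_minus: "\<phi> \<in> unit_fields U ==> (%x. - \<phi> x) \<in> unit_fields U"
 unfolding unit_fields_def using test_minus by auto

lemma restrict_borel_measure:
 fixes s :: "'a::euclidean_space => real"
 assumes U: "open U" and M: "finite_measure M" "sets M = sets borel" and s: "integrable M s"
 shows "finite_measure (restrict_space M U)" "sets (restrict_space M U) = borel_on U"
  "integrable (restrict_space M U) s" "vector_measure U (%E. LINT x:E|restrict_space M U. s x)"
proof -
 have UM: "U \<inter> space M \<in> sets M" "U \<in> sets M" using U M by auto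
 show "finite_measure (restrict_space M U)"
 proof (rule finite_measureI)
  interpret finite_measure M by (rule M(1))
  show "emeasure (restrict_space M U) (space (restrict_space M U)) \<noteq> \<infinity>"
   using UM by (simp add: emeasure_restrict_space space_restrict_space)
 qed
 show sN: "sets (restrict_space M U) = borel_on U" by (rule sets_restrict_space_cong[OF M(2)])
 show sI: "integrable (restrict_space M U) s"
  using integrable_mult_indicator[OF UM(2) s] by (simp add: integrable_restrict_space[OF UM(1)])
 show "vector_measure U (%E. LINT x:E|restrict_space M U. s x)"
 proof (rule vector_measureI)
  fix A :: "nat => 'a set" assume A: "range A \<subseteq> borel_on U" "disjoint_family A"
  let ?N = "restrict_space M U"
  have AN: "A n \<in> sets ?N" for n using A(1) sN by auto
  have si: "set_integrable ?N E s" if "E \<in> sets ?N" for E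
   unfolding set_integrable_def by (rule integrable_mult_indicator[OF that sI])
  have "(%n. LINT x:(\<Union>i<n. A i)|?N. s x) \<longlonglongrightarrow> (LINT x:(\<Union>n. \<Union>i<n. A i)|?N. s x)"
  proof (rule set_integral_cont_up)
   show "incseq (%n. \<Union>i<n. A i)" by (intro monoI UN_mono) auto
  qed (use AN si in auto)
  moreover have "(\<Union>n. \<Union>i<n. A i) = (\<Union>n. A n)" by auto
  moreover have "(LINT x:(\<Union>i<n. A i)|?N. s x) = (\<Sum>i<n. LINT x:A i|?N. s x)" for n
   by (rule set_integral_finite_Union) (use A(2) AN si in \<open>auto simp: disjoint_family_on_def\<close>)
  ultimately show "(%n. LINT x:A n|?N. s x) sums (LINT x:(\<Union>n. A n)|?N. s x)"
   unfolding sums_def by simp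
 qed
qed

text \<open>In each coordinate direction b the functional \<open>L b\<close> is bounded by TV,
  because - f b is a unit field whenever |f| <= 1. \<open>representation\<close> gives a density and
  a measure for each of these functionals; restricted to \<open>U\<close> they are the coordinates
  of the gradient measure.\<close>

lemma finite_TV_imp_gradient_measure:
 fixes u :: "'a::euclidean_space => real"
 assumes U: "open U" and u: "integrable (lebesgue_on U) u" and TV: "TV U u < \<infinity>"
 shows "\<exists>m. has_gradient_measure U u m"
proof -
 obtain C where C: "TV U u = ereal C"
  using TV TV_nonneg[OF U, of u] by (cases "TV U u") auto
 define L where "L b \<phi> = - (LINT x|lebesgue_on U. u x * partial_deriv \<phi> b x)" for b :: 'a and \<phi> :: "'a => real"
 have ui: "integrable (lebesgue_on U) (%x. u x * partial_deriv f b x)" if "f \<in> test_functions U" "b \<in> Basis" for f :: "'a => real" and b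
  using test_mult_integrable[OF test_partial_deriv[OF that] u] by (simp add: mult.commute)
 have tf: "test_functional U (L b) C" if b: "b \<in> Basis" for b
 proof
  fix f g :: "'a => real" and c :: real
  assume f: "f \<in> test_functions U"
  have "(LINT x|lebesgue_on U. u x * partial_deriv (%x. c *\<^sub>R f x) b x) = (LINT x|lebesgue_on U. c * (u x * partial_deriv f b x))"
   by (intro Bochner_Integration.integral_cong refl)
    (simp add: partial_deriv_linear[OF bounded_linear_scaleR_right test_differentiable[OF f], unfolded real_scaleR_def])
  then show "L b (%x. c * f x) = c * L b f" unfolding L_def by simp
  {
   assume g: "g \<in> test_functions U"
   have "(LINT x|lebesgue_on U. u x * partial_deriv (%x. f x + g x) b x)
     = (LINT x|lebesgue_on U. u x * partial_deriv f b x + u x * partial_deriv g b x)"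
    by (intro Bochner_Integration.integral_cong refl)
     (simp add: partial_deriv_add test_differentiable[OF f] test_differentiable[OF g] algebra_simps)
   then show "L b (%x. f x + g x) = L b f + L b g"
    unfolding L_def using ui[OF f b] ui[OF g b] by simp
  }
  assume f1: "\<And>x. \<bar>f x\<bar> <= 1"
  have fm: "(%x. - f x) \<in> test_functions U" by (rule test_minus[OF f])
  have "(%x. - f x *\<^sub>R b) \<in> unit_fields U"
   unfolding unit_fields_def using test_scaleR_const[OF fm, of b] f1 b by auto
  from TV_upper[OF U this, of u] have "(LINT x|lebesgue_on U. u x * partial_deriv (%x. - f x) b x) <= C"
   unfolding C divergence_scaleR_Basis[OF fm b] by simp
  moreover have "partial_deriv (%x. - f x) b x = - partial_deriv f b x" for x
   by (rule partial_deriv_linear[OF bounded_linear_minus[OF bounded_linear_ident] test_differentiable[OF f]])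
  ultimately show "L b f <= C" unfolding L_def by simp
 qed (rule U)
 have "\<forall>b\<in>Basis. \<exists>N s. finite_measure N \<and> sets N = sets borel \<and> integrable N s \<and>
   (\<forall>\<phi>\<in>test_functions U. L b \<phi> = (LINT x|N. \<phi> x * s x))"
 proof
  fix b :: 'a assume b: "b \<in> Basis"
  interpret test_functional U "L b" C by (rule tf[OF b])
  obtain s where "integrable radon s" "\<forall>\<phi>\<in>test_functions U. L b \<phi> = (LINT x|radon. \<phi> x * s x)"
   using representation by blast
  then show "\<exists>N s. finite_measure N \<and> sets N = sets borel \<and> integrable N s \<and> (\<forall>\<phi>\<in>test_functions U. L b \<phi> = (LINT x|N. \<phi> x * s x))"
   using finite_radon sets_radon by (intro exI[of _ radon] exI[of _ s]) simp
 qed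
 from bchoice[OF this] obtain N where "\<forall>b\<in>Basis. \<exists>s. finite_measure (N b) \<and> sets (N b) = sets borel \<and> integrable (N b) s \<and>
   (\<forall>\<phi>\<in>test_functions U. L b \<phi> = (LINT x|N b. \<phi> x * s x))" ..
 from bchoice[OF this] obtain s where Ns: "\<forall>b\<in>Basis. finite_measure (N b) \<and> sets (N b) = sets borel \<and> integrable (N b) (s b) \<and>
   (\<forall>\<phi>\<in>test_functions U. L b \<phi> = (LINT x|N b. \<phi> x * s b x))" ..
 define n where "n b E = (LINT x:E|restrict_space (N b) U. s b x)" for b E
 define m where "m E = (\<Sum>b\<in>Basis. n b E *\<^sub>R b)" for E
 have mb: "m E \<bullet> b = n b E" if "b \<in> Basis" for b E unfolding m_def by (rule inner_sum_left_Basis[OF that])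
 have r: "finite_measure (restrict_space (N b) U)" "sets (restrict_space (N b) U) = borel_on U"
  "integrable (restrict_space (N b) U) (s b)" "vector_measure U (n b)" if "b \<in> Basis" for b
  using restrict_borel_measure[OF U, of "N b" "s b"] Ns that unfolding n_def[abs_def] by simp_all
 have "vector_measure U m"
  unfolding m_def[abs_def]
 proof (rule vector_measure_sum)
  fix b :: 'a assume b: "b \<in> Basis"
  show "vector_measure U (%E. n b E *\<^sub>R b)"
   by (rule vector_measureI) (rule sums_scaleR_left; rule vector_measureD[OF r(4)[OF b]])
 qed
 moreover have "(LINT x|lebesgue_on U. u x * partial_deriv \<phi> b x) = - signed_integral U (%E. m E \<bullet> b) \<phi>"
  if \<phi>: "\<phi> \<in> test_functions U" and b: "b \<in> Basis" for \<phi> b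
 proof -
  have Nb: "finite_measure (N b)" "sets (N b) = sets borel" "integrable (N b) (s b)"
   "L b \<phi> = (LINT x|N b. \<phi> x * s b x)" using Ns b \<phi> by auto
  have UN: "U \<inter> space (N b) \<in> sets (N b)" using U Nb(2) by auto
  obtain B where B: "\<And>x. \<bar>\<phi> x\<bar> <= B" using test_bounded[OF \<phi>] by (metis real_norm_def)
  have ms: "\<phi> \<in> borel_measurable (restrict_space (N b) U)"
   using test_measurable[OF \<phi>] Nb(2) by (intro measurable_restrict_space1) (simp cong: measurable_cong_sets)
  have "signed_integral U (%E. m E \<bullet> b) \<phi> = (LINT x|restrict_space (N b) U. \<phi> x * s b x)"
   by (rule signed_integral_density[OF r(1-3)[OF b] _ ms B]) (simp add: mb[OF b] n_def)
  also have "... = (LINT x|N b. indicator U x *\<^sub>R (\<phi> x * s b x))" by (rule integral_restrict_space[OF UN])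
  also have "... = (LINT x|N b. \<phi> x * s b x)"
   using test_outside[OF \<phi>] by (intro Bochner_Integration.integral_cong refl) (auto simp: indicator_def)
  also have "... = L b \<phi>" by (rule Nb(4)[symmetric])
  finally show ?thesis unfolding L_def by simp
 qed
 ultimately show ?thesis unfolding has_gradient_measure_def by (intro exI[of _ m]) simp
qed

text \<open>The density result for Borel measures on the whole space is transported by pushing
  \<open>M\<close> forward along the inclusion of \<open>U\<close>, which makes the complement of
  \<open>U\<close> a null set.\<close>

lemma test_dense_L1_on:
 fixes f :: "'a::euclidean_space => 'b::euclidean_space"
 assumes U: "open U" and M: "finite_measure M" "sets M = borel_on U"
  and f: "integrable M f" "AE x in M. norm (f x) <= c" "c \<ge> 0" and e: "e > 0"
 shows "\<exists>\<phi>\<in>test_functions U. (\<forall>x. norm (\<phi> x) <= c) \<and> (LINT x|M. norm (\<phi> x - f x)) < e"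
proof -
 interpret finite_measure M by (rule M(1))
 have sp: "space M = U" by (rule space_borel_on[OF M(2)])
 have id: "(%x. x) \<in> measurable M borel"
  using measurable_restrict_space1[OF measurable_ident, of borel U] M(2) by (simp add: id_def cong: measurable_cong_sets)
 let ?D = "distr M borel (%x. x)"
 let ?f = "%x. indicator U x *\<^sub>R f x"
 have D: "finite_measure ?D" by (rule finite_measure_distr[OF id])
 have "f \<in> borel_measurable (restrict_space borel U)"
  using borel_measurable_integrable[OF f(1)] M(2) by (simp cong: measurable_cong_sets)
 then have fm: "?f \<in> borel_measurable borel"
  using U by (subst (asm) borel_measurable_restrict_space_iff) auto
 have fi: "integrable M ?f"
  by (rule Bochner_Integration.integrable_cong[THEN iffD1, OF refl _ f(1)]) (simp add: sp)
 have fD: "integrable ?D ?f" using fi by (subst integrable_distr_eq[OF id fm])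
 have fc: "AE x in ?D. norm (?f x) <= c"
 proof -
  have "{x \<in> space borel. norm (?f x) <= c} \<in> sets borel" using fm by measurable
  from AE_distr_iff[OF id this] show ?thesis
   using f(2,3) by (auto elim!: eventually_mono simp: indicator_def)
 qed
 have "emeasure ?D (- U) = 0" using U by (subst emeasure_distr[OF id]) (auto simp: sp)
 then obtain \<phi> where p: "\<phi> \<in> test_functions U" "\<forall>x. norm (\<phi> x) <= c" "(LINT x|?D. norm (\<phi> x - ?f x)) < e"
  using test_dense_L1_bounded[OF D _ U _ fD fc f(3) e] by auto
 have "(LINT x|?D. norm (\<phi> x - ?f x)) = (LINT x|M. norm (\<phi> x - ?f x))"
  using fm test_measurable[OF p(1)] by (intro integral_distr[OF id]) auto
 also have "... = (LINT x|M. norm (\<phi> x - f x))"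
  by (intro Bochner_Integration.integral_cong refl) (simp add: sp)
 finally show ?thesis using p by auto
qed

lemma gradient_measure_divergence:
 fixes u :: "'a::euclidean_space => real" and \<phi> :: "'a => 'a"
 assumes U: "open U" and u: "integrable (lebesgue_on U) u" and m: "has_gradient_measure U u m"
  and \<sigma>: "integrable (variation_measure U m) \<sigma>"
   "\<And>E. E \<in> borel_on U ==> m E = (LINT x:E|variation_measure U m. \<sigma> x)"
  and \<phi>: "\<phi> \<in> test_functions U"
 shows "(LINT x|lebesgue_on U. u x * divergence \<phi> x) = - (LINT x|variation_measure U m. \<phi> x \<bullet> \<sigma> x)"
proof -
 let ?\<mu> = "variation_measure U m"
 have vm: "vector_measure U m" using m unfolding has_gradient_measure_def by simp
 note \<mu> = vector_measure_variation(1,2)[OF vm]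
 have \<phi>b: "(%x. \<phi> x \<bullet> b) \<in> test_functions U" for b by (rule test_inner[OF \<phi>])
 have ms: "f \<in> borel_measurable ?\<mu>" if "f \<in> borel_measurable borel" for f :: "'a => real"
  using measurable_restrict_space1[OF that, of U] \<mu>(2) by (simp cong: measurable_cong_sets)
 have ui: "integrable (lebesgue_on U) (%x. u x * partial_deriv (%x. \<phi> x \<bullet> b) b x)" if "b \<in> Basis" for b
  using test_mult_integrable[OF test_partial_deriv[OF \<phi>b that] u] by (simp add: mult.commute)
 have sb: "integrable ?\<mu> (%x. \<sigma> x \<bullet> b)" for b using \<sigma>(1) by simp
 have si: "integrable ?\<mu> (%x. (\<phi> x \<bullet> b) * (\<sigma> x \<bullet> b))" for b
 proof -
  obtain B where "B > 0" and B: "\<And>x. norm (\<phi> x \<bullet> b) <= B" by (rule test_bounded[OF \<phi>b[of b]], rule that)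
  then show ?thesis
   using integrable_bounded_mult[OF sb ms[OF test_measurable[OF \<phi>b[of b]]], of B b] by simp
 qed
 have part: "(LINT x|lebesgue_on U. u x * partial_deriv (%x. \<phi> x \<bullet> b) b x) = - (LINT x|?\<mu>. (\<phi> x \<bullet> b) * (\<sigma> x \<bullet> b))" if b: "b \<in> Basis" for b
 proof -
  obtain B where "B > 0" and B': "\<And>x. norm (\<phi> x \<bullet> b) <= B" by (rule test_bounded[OF \<phi>b[of b]], rule that)
  have B: "\<bar>\<phi> x \<bullet> b\<bar> <= B" for x using B'[of x] by simp
  have mb: "m E \<bullet> b = (LINT x:E|?\<mu>. \<sigma> x \<bullet> b)" if E: "E \<in> borel_on U" for E
  proof -
   have iE: "integrable ?\<mu> (%x. indicator E x *\<^sub>R \<sigma> x)"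
    by (rule integrable_mult_indicator[OF _ \<sigma>(1)]) (use E \<mu>(2) in simp)
   show ?thesis
   proof -
    have "(LINT x|?\<mu>. (indicator E x *\<^sub>R \<sigma> x) \<bullet> b) = (LINT x|?\<mu>. indicator E x *\<^sub>R \<sigma> x) \<bullet> b"
     by (rule integral_inner_left) (rule iE)
    then show ?thesis unfolding \<sigma>(2)[OF E] set_lebesgue_integral_def by simp
   qed
  qed
  have "signed_integral U (%E. m E \<bullet> b) (%x. \<phi> x \<bullet> b) = (LINT x|?\<mu>. (\<phi> x \<bullet> b) * (\<sigma> x \<bullet> b))"
   by (rule signed_integral_density[OF \<mu> sb mb ms[OF test_measurable[OF \<phi>b]] B])
  then show ?thesis using m \<phi>b[of b] b unfolding has_gradient_measure_def by simp
 qed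
 have "divergence \<phi> x = (\<Sum>b\<in>Basis. partial_deriv (%x. \<phi> x \<bullet> b) b x)" for x
  unfolding divergence_def
  by (simp only: partial_deriv_linear[OF bounded_linear_inner_left test_differentiable[OF \<phi>]])
 then have "(LINT x|lebesgue_on U. u x * divergence \<phi> x) = (LINT x|lebesgue_on U. (\<Sum>b\<in>Basis. u x * partial_deriv (%x. \<phi> x \<bullet> b) b x))"
  by (simp only: sum_distrib_left)
 also have "... = (\<Sum>b\<in>Basis. LINT x|lebesgue_on U. u x * partial_deriv (%x. \<phi> x \<bullet> b) b x)"
  by (rule Bochner_Integration.integral_sum[OF ui])
 also have "... = (\<Sum>b\<in>Basis. - (LINT x|?\<mu>. (\<phi> x \<bullet> b) * (\<sigma> x \<bullet> b)))" by (intro sum.cong refl part)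
 also have "... = - (LINT x|?\<mu>. (\<Sum>b\<in>Basis. (\<phi> x \<bullet> b) * (\<sigma> x \<bullet> b)))"
  unfolding sum_negf by (subst Bochner_Integration.integral_sum[OF si]) simp
 also have "... = - (LINT x|?\<mu>. \<phi> x \<bullet> \<sigma> x)" by (simp only: euclidean_inner[of "\<phi> _" "\<sigma> _"])
 finally show ?thesis .
qed

lemma inner_density_integrable:
 fixes \<sigma> :: "'a::euclidean_space => 'b::euclidean_space"
 assumes \<sigma>: "integrable M \<sigma>" and f: "f \<in> borel_measurable M" "\<And>x. x \<in> space M ==> norm (f x) <= B"
 shows "integrable M (%x. f x \<bullet> \<sigma> x)"
proof (rule Bochner_Integration.integrable_bound[of M "%x. B * norm (\<sigma> x)"])
 have [measurable]: "\<sigma> \<in> borel_measurable M" using \<sigma> by auto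
 show "(%x. f x \<bullet> \<sigma> x) \<in> borel_measurable M" using f(1) by measurable
 show "AE x in M. norm (f x \<bullet> \<sigma> x) <= norm (B * norm (\<sigma> x))"
 proof (rule AE_I2)
  fix x assume x: "x \<in> space M"
  have "norm (f x \<bullet> \<sigma> x) <= norm (f x) * norm (\<sigma> x)" by (simp add: Cauchy_Schwarz_ineq2)
  also have "... <= B * norm (\<sigma> x)" by (rule mult_right_mono[OF f(2)[OF x]]) simp
  finally show "norm (f x \<bullet> \<sigma> x) <= norm (B * norm (\<sigma> x))" by simp
 qed
qed (use \<sigma> in simp)

text \<open>\<open>gradient_measure\<close> and \<open>gradient_density\<close> are choices;
  existence is turned here into properties of the chosen objects. The last claim rests on
  |\<open>\<sigma>\<close>| = 1: no unit field pairs with \<open>\<sigma>\<close> to more than the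
  total mass, and unit fields close to \<open>\<sigma>\<close> in L^1 nearly reach it.\<close>

lemma BV_polar:
 fixes u :: "'a::euclidean_space => real"
 assumes U: "open U" and u: "u \<in> BV U"
 defines "\<mu> \<equiv> total_variation_measure U u" and "\<sigma> \<equiv> gradient_density U u"
 shows "finite_measure \<mu>" "sets \<mu> = borel_on U" "space \<mu> = U" "integrable \<mu> \<sigma>" "AE x in \<mu>. norm (\<sigma> x) = 1"
  "\<And>\<phi>. \<phi> \<in> test_functions U ==> (LINT x|lebesgue_on U. u x * divergence \<phi> x) = - (LINT x|\<mu>. \<phi> x \<bullet> \<sigma> x)"
  "TV U u = ereal (measure \<mu> U)"
proof -
 define m where "m = gradient_measure U u"
 have "\<exists>m. has_gradient_measure U u m" using u unfolding BV_def by simp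
 then have m: "has_gradient_measure U u m" unfolding m_def gradient_measure_def by (rule someI_ex)
 have vm: "vector_measure U m" using m unfolding has_gradient_measure_def by simp
 have \<mu>: "\<mu> = variation_measure U m" unfolding \<mu>_def total_variation_measure_def m_def ..
 show fin: "finite_measure \<mu>" and sets: "sets \<mu> = borel_on U" unfolding \<mu> by (rule vector_measure_variation[OF vm])+
 show sp: "space \<mu> = U" by (rule space_borel_on[OF sets])
 interpret finite_measure \<mu> by (rule fin)
 have "\<exists>\<sigma>. integrable (total_variation_measure U u) \<sigma> \<and>
   (\<forall>E\<in>borel_on U. gradient_measure U u E = (LINT x:E|total_variation_measure U u. \<sigma> x))"
  using vector_measure_variation(3)[OF vm] unfolding total_variation_measure_def m_def .
 from someI_ex[OF this, folded gradient_density_def]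
 have "integrable \<mu> \<sigma> \<and> (\<forall>E\<in>borel_on U. gradient_measure U u E = (LINT x:E|\<mu>. \<sigma> x))"
  unfolding \<mu>_def \<sigma>_def .
 then have \<sigma>: "integrable \<mu> \<sigma>" "\<And>E. E \<in> borel_on U ==> m E = (LINT x:E|\<mu>. \<sigma> x)" unfolding m_def by simp_all
 show "integrable \<mu> \<sigma>" by (rule \<sigma>)
 show n1: "AE x in \<mu>. norm (\<sigma> x) = 1" unfolding \<mu> by (rule polar_density_norm[OF vm \<sigma>[unfolded \<mu>]])
 have ui: "integrable (lebesgue_on U) u"
 proof -
  have "u \<in> borel_measurable (lebesgue_on U)" "integrable (lebesgue_on U) (%x. norm (u x))"
   using u unfolding BV_def Lp_def by simp_all
  then show ?thesis using integrable_norm_cancel by blast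
 qed
 show f: "(LINT x|lebesgue_on U. u x * divergence \<phi> x) = - (LINT x|\<mu>. \<phi> x \<bullet> \<sigma> x)" if "\<phi> \<in> test_functions U" for \<phi>
  unfolding \<mu> by (rule gradient_measure_divergence[OF U ui m \<sigma>[unfolded \<mu>] that])
 have ms: "f \<in> borel_measurable \<mu>" if "f \<in> borel_measurable borel" for f :: "'a => 'a"
  using measurable_restrict_space1[OF that, of U] sets by (simp cong: measurable_cong_sets)
 have one: "(LINT x|\<mu>. 1) = measure \<mu> U" using sp by simp
 have le: "TV U u <= ereal (measure \<mu> U)"
 proof (rule TV_least[OF U])
  fix \<phi> :: "'a => 'a" assume "\<phi> \<in> unit_fields U"
  then have t: "\<phi> \<in> test_functions U" "\<And>x. norm (\<phi> x) <= 1" unfolding unit_fields_def by auto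
  have i: "integrable \<mu> (%x. \<phi> x \<bullet> \<sigma> x)"
   by (rule inner_density_integrable[OF \<sigma>(1) ms[OF test_measurable[OF t(1)]] t(2)])
  have "- (LINT x|\<mu>. \<phi> x \<bullet> \<sigma> x) = (LINT x|\<mu>. - (\<phi> x \<bullet> \<sigma> x))" by simp
  also have "... <= (LINT x|\<mu>. 1)"
  proof (rule integral_mono_AE)
   show "AE x in \<mu>. - (\<phi> x \<bullet> \<sigma> x) <= 1"
    using n1
   proof eventually_elim
    case (elim x)
    have "\<bar>\<phi> x \<bullet> \<sigma> x\<bar> <= norm (\<phi> x) * norm (\<sigma> x)" by (rule Cauchy_Schwarz_ineq2)
    then show ?case using t(2)[of x] elim by simp
   qed
  qed (use i in auto)
  finally show "(LINT x|lebesgue_on U. u x * divergence \<phi> x) <= measure \<mu> U" using f[OF t(1)] one by simp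
 qed
 have key: "ereal (measure \<mu> U) <= TV U u + ereal e" if e: "e > 0" for e
 proof -
  obtain \<phi> where p: "\<phi> \<in> test_functions U" "\<forall>x. norm (\<phi> x) <= 1" "(LINT x|\<mu>. norm (\<phi> x - \<sigma> x)) < e"
  proof -
   have "AE x in \<mu>. norm (\<sigma> x) <= 1" using n1 by eventually_elim simp
   from test_dense_L1_on[OF U fin sets \<sigma>(1) this zero_le_one e]
   obtain \<phi> where "\<phi> \<in> test_functions U" "\<forall>x. norm (\<phi> x) <= 1" "(LINT x|\<mu>. norm (\<phi> x - \<sigma> x)) < e" by (elim bexE conjE)
   then show ?thesis by (rule that)
  qed
  have pm: "(%x. - \<phi> x) \<in> unit_fields U" using p unfolding unit_fields_def by (simp add: test_minus)
  have i: "integrable \<mu> (%x. \<phi> x \<bullet> \<sigma> x)"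
   by (rule inner_density_integrable[OF \<sigma>(1) ms[OF test_measurable[OF p(1)]] p(2)[rule_format]])
  have i2: "integrable \<mu> (%x. norm (\<phi> x - \<sigma> x))"
   using \<sigma>(1) ms[OF test_measurable[OF p(1)]] p(2)
   by (intro integrable_norm Bochner_Integration.integrable_diff integrable_const_bound[of \<phi> 1]) auto
  have "measure \<mu> U = (LINT x|\<mu>. 1)" by (rule one[symmetric])
  also have "... <= (LINT x|\<mu>. \<phi> x \<bullet> \<sigma> x + norm (\<phi> x - \<sigma> x))"
  proof (rule integral_mono_AE)
   show "AE x in \<mu>. 1 <= \<phi> x \<bullet> \<sigma> x + norm (\<phi> x - \<sigma> x)"
    using n1
   proof eventually_elim
    case (elim x)
    have "\<bar>(\<sigma> x - \<phi> x) \<bullet> \<sigma> x\<bar> <= norm (\<sigma> x - \<phi> x) * norm (\<sigma> x)" by (rule Cauchy_Schwarz_ineq2)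
    moreover have "\<sigma> x \<bullet> \<sigma> x = 1" using elim by (simp add: norm_eq_1)
    ultimately show ?case using elim by (simp add: inner_diff_left norm_minus_commute)
   qed
  qed (use i i2 in auto)
  also have "... = (LINT x|\<mu>. \<phi> x \<bullet> \<sigma> x) + (LINT x|\<mu>. norm (\<phi> x - \<sigma> x))" using i i2 by simp
  finally have "measure \<mu> U <= (LINT x|\<mu>. \<phi> x \<bullet> \<sigma> x) + e" using p(3) by simp
  moreover have "(LINT x|lebesgue_on U. u x * divergence (%x. - \<phi> x) x) = (LINT x|\<mu>. \<phi> x \<bullet> \<sigma> x)"
   using f[OF test_minus[OF p(1)]] by (simp only: inner_minus_left Bochner_Integration.integral_minus minus_minus)
  ultimately have "ereal (measure \<mu> U) <= ereal (LINT x|lebesgue_on U. u x * divergence (%x. - \<phi> x) x) + ereal e" by simp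
  also have "... <= TV U u + ereal e" by (intro add_right_mono TV_upper[OF U pm])
  finally show ?thesis .
 qed
 have "ereal (measure \<mu> U) <= TV U u" by (rule ereal_le_epsilon2[OF key])
 with le show "TV U u = ereal (measure \<mu> U)" by (rule antisym)
qed

section \<open>Lebesgue spaces on bounded sets\<close>

lemma bounded_finite_lebesgue_on:
 fixes U :: "'a::euclidean_space set"
 assumes "open U" "bounded U"
 shows "finite_measure (lebesgue_on U)"
proof (rule finite_measureI)
 have "U \<in> lmeasurable" using assms by (intro bounded_set_imp_lmeasurable) (auto simp: lebesgue_openin)
 then have l: "U \<in> sets lebesgue" "emeasure lebesgue U \<noteq> \<infinity>"
  unfolding infinity_ennreal_def by (rule fmeasurableD, rule fmeasurableD2)
 have sp: "space (lebesgue_on U) = U" by (simp add: space_restrict_space)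
 have "emeasure (lebesgue_on U) U = emeasure lebesgue U" using l(1) by (intro emeasure_restrict_space) auto
 with l(2) show "emeasure (lebesgue_on U) (space (lebesgue_on U)) \<noteq> \<infinity>" unfolding sp by (simp only: not_False_eq_True)
qed

lemma Lp_D: "f \<in> Lp q U ==> f \<in> borel_measurable (lebesgue_on U)"
 "f \<in> Lp q U ==> integrable (lebesgue_on U) (%x. norm (f x) powr q)"
 unfolding Lp_def by auto

lemma Lp_add:
 fixes f g :: "'a::euclidean_space => 'b::euclidean_space"
 assumes "f \<in> Lp q U" "g \<in> Lp q U" "q > 0"
 shows "(%x. f x + g x) \<in> Lp q U"
proof -
 have [measurable]: "f \<in> borel_measurable (lebesgue_on U)" "g \<in> borel_measurable (lebesgue_on U)"
  using assms Lp_D by blast+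
 have i: "integrable (lebesgue_on U) (%x. 2 powr q * (norm (f x) powr q + norm (g x) powr q))"
  using Lp_D(2)[OF assms(1)] Lp_D(2)[OF assms(2)] by simp
 have "integrable (lebesgue_on U) (%x. norm (f x + g x) powr q)"
 proof (rule Bochner_Integration.integrable_bound[OF i])
  show "AE x in lebesgue_on U. norm (norm (f x + g x) powr q) <= norm (2 powr q * (norm (f x) powr q + norm (g x) powr q))"
   using norm_add_powr_le[OF assms(3)] by (intro AE_I2) simp
 qed measurable
 then show ?thesis unfolding Lp_def by simp
qed

lemma Lp_minus: "f \<in> Lp q U ==> (%x. - f x) \<in> Lp q U"
 unfolding Lp_def by simp

lemma Lp_diff:
 fixes f g :: "'a::euclidean_space => 'b::euclidean_space"
 shows "f \<in> Lp q U ==> g \<in> Lp q U ==> q > 0 ==> (%x. f x - g x) \<in> Lp q U"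
 using Lp_add[OF _ Lp_minus, of f q U g] by simp

lemma Lp_bounded:
 fixes f :: "'a::euclidean_space => 'b::euclidean_space"
 assumes fin: "finite_measure (lebesgue_on U)" and f: "f \<in> borel_measurable (lebesgue_on U)"
  "AE x in lebesgue_on U. norm (f x) <= B" and q: "q \<ge> 0"
 shows "f \<in> Lp q U"
proof -
 interpret finite_measure "lebesgue_on U" by (rule fin)
 have "integrable (lebesgue_on U) (%x. norm (f x) powr q)"
 proof (rule integrable_const_bound)
  show "AE x in lebesgue_on U. norm (norm (f x) powr q) <= B powr q"
   using f(2) by eventually_elim (use q in \<open>simp add: powr_mono2\<close>)
 qed (use f in measurable)
 then show ?thesis using f unfolding Lp_def by simp
qed

lemma Lp_test_function:
 fixes f :: "'a::euclidean_space => 'b::euclidean_space"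
 assumes "finite_measure (lebesgue_on U)" "f \<in> test_functions V" "q \<ge> 0"
 shows "f \<in> Lp q U"
proof -
 obtain B where "\<And>x. norm (f x) <= B" using test_bounded[OF assms(2)] by metis
 then show ?thesis by (intro Lp_bounded[OF assms(1) test_measurable_on[OF assms(2)] _ assms(3), of B]) simp
qed

lemma Lp_integrable:
 fixes f :: "'a::euclidean_space => 'b::euclidean_space"
 assumes "finite_measure (lebesgue_on U)" "f \<in> Lp q U" "q > 1"
 shows "integrable (lebesgue_on U) f"
 using L1_le_Lq(1)[OF assms(1) Lp_D[OF assms(2)] assms(3), of 1] by simp

text \<open>Young's inequality for r |u| and |k| / r, with the factors 1/p and 1/q estimated by 1.
  The weight \<open>r\<close> takes the place of normalisation in Hoelder's inequality: it makes the
  term with \<open>u\<close> small before the term with \<open>k\<close> tends to 0.\<close>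

lemma Holder_integrable:
 fixes u :: "'a::euclidean_space => real" and k :: "'a => real"
 assumes u: "u \<in> Lp p U" and k: "k \<in> Lp q U" and p: "p > 1" "q = p / (p - 1)" and d: "r > 0"
 shows "integrable (lebesgue_on U) (%x. u x * k x)"
  "(LINT x|lebesgue_on U. \<bar>u x * k x\<bar>) <= r powr p * (LINT x|lebesgue_on U. norm (u x) powr p)
    + r powr (- q) * (LINT x|lebesgue_on U. norm (k x) powr q)"
proof -
 have q: "q > 1" "1 / p + 1 / q = 1" unfolding p(2) using p(1) by (simp_all add: field_simps)
 have [measurable]: "u \<in> borel_measurable (lebesgue_on U)" "k \<in> borel_measurable (lebesgue_on U)"
  using Lp_D(1) u k by blast+
 have b: "\<bar>u x * k x\<bar> <= r powr p * norm (u x) powr p + r powr (- q) * norm (k x) powr q" for x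
 proof -
  have "\<bar>u x * k x\<bar> = (r * \<bar>u x\<bar>) * (\<bar>k x\<bar> / r)" using d by (simp add: abs_mult)
  also have "... <= (r * \<bar>u x\<bar>) powr p / p + (\<bar>k x\<bar> / r) powr q / q"
   by (rule Youngs_inequality) (use p(1) q d in auto)
  also have "... <= (r * \<bar>u x\<bar>) powr p + (\<bar>k x\<bar> / r) powr q"
  proof (rule add_mono)
   have "a / c <= a" if "a \<ge> 0" "c > 1" for a c :: real using that by (simp add: divide_le_eq mult_le_cancel_left1)
   then show "(r * \<bar>u x\<bar>) powr p / p <= (r * \<bar>u x\<bar>) powr p" "(\<bar>k x\<bar> / r) powr q / q <= (\<bar>k x\<bar> / r) powr q"
    using p(1) q(1) by simp_all
  qed
  also have "(r * \<bar>u x\<bar>) powr p = r powr p * norm (u x) powr p" by (simp add: powr_mult)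
  also have "(\<bar>k x\<bar> / r) powr q = r powr (- q) * norm (k x) powr q"
   using d by (simp add: powr_divide powr_minus_divide)
  finally show ?thesis .
 qed
 have i: "integrable (lebesgue_on U) (%x. r powr p * norm (u x) powr p + r powr (- q) * norm (k x) powr q)"
  using Lp_D(2)[OF u] Lp_D(2)[OF k] by simp
 show i2: "integrable (lebesgue_on U) (%x. u x * k x)"
 proof (rule Bochner_Integration.integrable_bound[OF i])
  show "AE x in lebesgue_on U. norm (u x * k x) <= norm (r powr p * norm (u x) powr p + r powr (- q) * norm (k x) powr q)"
   using b by (intro AE_I2) simp
 qed measurable
 have "(LINT x|lebesgue_on U. \<bar>u x * k x\<bar>) <= (LINT x|lebesgue_on U. r powr p * norm (u x) powr p + r powr (- q) * norm (k x) powr q)"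
  by (rule integral_mono[OF integrable_abs[OF i2] i b])
 then show "(LINT x|lebesgue_on U. \<bar>u x * k x\<bar>) <= r powr p * (LINT x|lebesgue_on U. norm (u x) powr p)
    + r powr (- q) * (LINT x|lebesgue_on U. norm (k x) powr q)"
  using Lp_D(2)[OF u] Lp_D(2)[OF k] by simp
qed

lemma Holder_tendsto:
 fixes u :: "'a::euclidean_space => real" and k :: "nat => 'a => real"
 assumes u: "u \<in> Lp p U" and k: "\<And>n. k n \<in> Lp q U" and k0: "k0 \<in> Lp q U" and p: "p > 1" "q = p / (p - 1)"
  and lim: "(%n. LINT x|lebesgue_on U. norm (k n x - k0 x) powr q) \<longlonglongrightarrow> 0"
 shows "(%n. LINT x|lebesgue_on U. u x * k n x) \<longlonglongrightarrow> (LINT x|lebesgue_on U. u x * k0 x)"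
proof (rule tendstoI)
 fix e :: real assume e: "e > 0"
 have q: "q > 1" unfolding p(2) using p(1) by (simp add: field_simps)
 define P where "P = (LINT x|lebesgue_on U. norm (u x) powr p)"
 have P: "P \<ge> 0" unfolding P_def by simp
 define r where "r = (e / (2 * (P + 1))) powr (1 / p)"
 have d: "r > 0" unfolding r_def using e P by simp
 have "r powr p = e / (2 * (P + 1))" unfolding r_def using e P p(1) by (simp add: powr_powr)
 moreover have "2 * (P + 1) \<noteq> 0" using P by simp
 ultimately have "r powr p * (2 * (P + 1)) = e" using nonzero_eq_divide_eq[of _ "r powr p" e] by blast
 then have "2 * (r powr p * P) + 2 * r powr p = e" by (simp add: algebra_simps)
 moreover have "r powr p > 0" using d by simp
 ultimately have dP: "r powr p * P < e / 2" by linarith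
 have "(%n. r powr (- q) * (LINT x|lebesgue_on U. norm (k n x - k0 x) powr q)) \<longlonglongrightarrow> r powr (- q) * 0"
  by (intro tendsto_mult tendsto_const lim)
 then have "\<forall>\<^sub>F n in sequentially. r powr (- q) * (LINT x|lebesgue_on U. norm (k n x - k0 x) powr q) < e / 2"
  using e by (intro order_tendstoD(2)[where y="r powr (- q) * 0"]) auto
 then show "\<forall>\<^sub>F n in sequentially. dist (LINT x|lebesgue_on U. u x * k n x) (LINT x|lebesgue_on U. u x * k0 x) < e"
 proof eventually_elim
  case (elim n)
  have kd: "(%x. k n x - k0 x) \<in> Lp q U" using q by (intro Lp_diff k k0) simp
  have "(LINT x|lebesgue_on U. u x * k n x) - (LINT x|lebesgue_on U. u x * k0 x) = (LINT x|lebesgue_on U. u x * k n x - u x * k0 x)"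
   by (rule Bochner_Integration.integral_diff[symmetric, OF Holder_integrable(1)[OF u k p d] Holder_integrable(1)[OF u k0 p d]])
  also have "... = (LINT x|lebesgue_on U. u x * (k n x - k0 x))" by (simp only: right_diff_distrib)
  finally have eq: "(LINT x|lebesgue_on U. u x * k n x) - (LINT x|lebesgue_on U. u x * k0 x) = (LINT x|lebesgue_on U. u x * (k n x - k0 x))" .
  have "\<bar>LINT x|lebesgue_on U. u x * (k n x - k0 x)\<bar> <= (LINT x|lebesgue_on U. \<bar>u x * (k n x - k0 x)\<bar>)"
   by (rule integral_abs_bound)
  also have "... <= r powr p * P + r powr (- q) * (LINT x|lebesgue_on U. norm (k n x - k0 x) powr q)"
   unfolding P_def by (rule Holder_integrable(2)[OF u kd p d])
  also have "... < e" using dP elim by linarith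
  finally show ?case unfolding dist_real_def eq .
 qed
qed

section \<open>Weak divergence\<close>

lemma lebesgue_on_integral:
 fixes f :: "'a::euclidean_space => 'b::euclidean_space"
 assumes f: "f \<in> borel_measurable borel" "\<And>x. x \<notin> S ==> f x = 0" and S: "S \<in> sets lebesgue"
 shows "(LINT x|lebesgue_on S. f x) = (LBINT x. f x)"
  "integrable (lebesgue_on S) f \<longleftrightarrow> integrable lborel f"
proof -
 have S': "S \<inter> space lebesgue \<in> sets lebesgue" using S by simp
 have eq: "(%x. indicator S x *\<^sub>R f x) = f" using f(2) by (auto simp: indicator_def fun_eq_iff)
 have fl: "f \<in> lborel \<rightarrow>\<^sub>M borel" using f(1) by simp
 have "(LINT x|lebesgue_on S. f x) = (LINT x|lebesgue. f x)"
  unfolding integral_restrict_space[OF S'] eq ..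
 then show "(LINT x|lebesgue_on S. f x) = (LBINT x. f x)" using integral_completion[OF fl] by simp
 have "integrable (lebesgue_on S) f \<longleftrightarrow> integrable lebesgue f"
  unfolding integrable_restrict_space[OF S'] eq ..
 then show "integrable (lebesgue_on S) f \<longleftrightarrow> integrable lborel f" using integrable_completion[OF fl] by simp
qed

text \<open>Difference quotients have integral 0 by translation invariance, and they converge to the
  partial derivative uniformly on a fixed ball that contains all supports.\<close>

lemma test_integral_partial_deriv:
 fixes f :: "'a::euclidean_space => real"
 assumes f: "f \<in> test_functions UNIV" and b: "b \<in> Basis"
 shows "(LBINT x. partial_deriv f b x) = 0"
proof -
 obtain S where S: "compact S" "\<forall>x. x \<notin> S --> f x = 0" using test_support[OF f] by auto
 obtain S2 where S2: "compact S2" "\<forall>x. x \<notin> S2 --> partial_deriv f b x = 0"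
  using test_support[OF test_partial_deriv[OF f b]] by auto
 obtain r where r: "\<And>x. x \<in> S ==> norm x <= r" using compact_imp_bounded[OF S(1)] unfolding bounded_iff by blast
 obtain r2 where r2: "\<And>x. x \<in> S2 ==> norm x <= r2" using compact_imp_bounded[OF S2(1)] unfolding bounded_iff by blast
 let ?R = "max r r2 + 1"
 let ?B = "cball (0::'a) ?R"
 have Bfin: "emeasure lborel ?B < \<infinity>" by (rule emeasure_bounded_finite) simp
 define V where "V = measure lborel ?B"
 have if_: "integrable lborel f" by (rule test_integrable[OF f])
 have ip: "integrable lborel (partial_deriv f b)" by (rule test_integrable[OF test_partial_deriv[OF f b]])
 have bound: "\<bar>(LBINT x. partial_deriv f b x)\<bar> <= e * V" if e: "e > 0" for e
 proof -
  obtain d where d: "d > 0" "\<forall>z h. norm h < d --> norm (f (z + h) - f z - frechet_derivative f (at z) h) <= e * norm h"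
   using test_uniform_derivative[OF f e] by blast
  define t where "t = min d 1 / 2"
  have t: "t > 0" "t < d" "t < 1" unfolding t_def using d(1) by auto
  have nb: "norm b = 1" using b by simp
  have it: "integrable lborel (%x. f (t *\<^sub>R b + 1 *\<^sub>R x))" by (rule lborel_integrable_affine[OF if_]) simp
  have eqt: "(LBINT x. f (t *\<^sub>R b + 1 *\<^sub>R x)) = (LBINT x. f x)"
   using lborel_integral_affine[OF test_measurable[OF f], of 1 "t *\<^sub>R b"] by simp
  have fd: "frechet_derivative f (at x) (t *\<^sub>R b) = t * partial_deriv f b x" for x
   using linear_scale[OF has_derivative_linear[OF test_has_derivative[OF f]]] unfolding partial_deriv_def by simp
  let ?g = "%x. t * partial_deriv f b x - (f (t *\<^sub>R b + 1 *\<^sub>R x) - f x)"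
  have ig: "integrable lborel ?g" using ip it if_ by (intro Bochner_Integration.integrable_diff integrable_mult_right)
  have gb: "\<bar>?g x\<bar> <= indicator ?B x * (e * t)" for x
  proof (cases "x \<in> ?B")
   case True
   have "norm (f (x + t *\<^sub>R b) - f x - frechet_derivative f (at x) (t *\<^sub>R b)) <= e * norm (t *\<^sub>R b)"
    using d(2)[rule_format, of "t *\<^sub>R b" x] t nb by simp
   then show ?thesis using True t nb by (simp add: fd add.commute abs_minus_commute)
  next
   case False
   then have x: "norm x > max r r2 + 1" by simp
   have "norm (t *\<^sub>R b + x) \<ge> norm x - norm (t *\<^sub>R b)" using norm_triangle_ineq2[of x "- (t *\<^sub>R b)"] by (simp add: add.commute)
   then have "norm (t *\<^sub>R b + x) > r" using x t nb by simp
   then have "f (t *\<^sub>R b + x) = 0" using r[of "t *\<^sub>R b + x"] S(2) by (meson not_le)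
   moreover have "f x = 0" using r[of x] S(2) x by (meson not_le le_less_trans less_add_one max.cobounded1 less_trans)
   moreover have "partial_deriv f b x = 0" using r2[of x] S2(2) x by (meson not_le le_less_trans less_add_one max.cobounded2 less_trans)
   ultimately show ?thesis using False by simp
  qed
  have "(LBINT x. ?g x) = t * (LBINT x. partial_deriv f b x) - ((LBINT x. f (t *\<^sub>R b + 1 *\<^sub>R x)) - (LBINT x. f x))"
   using ip it if_ by simp
  also have "... = t * (LBINT x. partial_deriv f b x)" unfolding eqt by simp
  finally have eq: "(LBINT x. ?g x) = t * (LBINT x. partial_deriv f b x)" .
  have "\<bar>(LBINT x. ?g x)\<bar> <= (LBINT x. \<bar>?g x\<bar>)" by (rule integral_abs_bound)
  also have "... <= (LBINT x. indicator ?B x * (e * t))"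
   by (rule integral_mono[OF integrable_abs[OF ig] _ gb]) (use Bfin in simp)
  also have "... = t * (e * V)" unfolding V_def using Bfin by simp
  finally have "t * \<bar>(LBINT x. partial_deriv f b x)\<bar> <= t * (e * V)" unfolding eq using t by (simp add: abs_mult)
  then show ?thesis using t by simp
 qed
 have V0: "V \<ge> 0" unfolding V_def by simp
 show ?thesis
 proof (rule ccontr)
  assume n: "\<not> ?thesis"
  let ?a = "\<bar>(LBINT x. partial_deriv f b x)\<bar>"
  have a: "?a > 0" using n by simp
  have "?a <= ?a / (2 * (V + 1)) * V" using V0 a by (intro bound) auto
  also have "... = ?a * (V / (2 * (V + 1)))" by simp
  also have "... < ?a * 1" using V0 a by (intro mult_strict_left_mono) auto
  finally show False by simp
 qed
qed

lemma test_integral_divergence: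
 fixes \<phi> :: "'a::euclidean_space => 'a"
 assumes \<phi>: "\<phi> \<in> test_functions UNIV"
 shows "(LBINT x. divergence \<phi> x) = 0"
proof -
 have \<phi>b: "(%x. \<phi> x \<bullet> b) \<in> test_functions UNIV" for b by (rule test_inner[OF \<phi>])
 have "divergence \<phi> x = (\<Sum>b\<in>Basis. partial_deriv (%x. \<phi> x \<bullet> b) b x)" for x
  unfolding divergence_def
  by (simp only: partial_deriv_linear[OF bounded_linear_inner_left test_differentiable[OF \<phi>]])
 then have "(LBINT x. divergence \<phi> x) = (LBINT x. (\<Sum>b\<in>Basis. partial_deriv (%x. \<phi> x \<bullet> b) b x))" by simp
 also have "... = (\<Sum>b\<in>Basis. (LBINT x. partial_deriv (%x. \<phi> x \<bullet> b) b x))"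
  by (rule Bochner_Integration.integral_sum) (rule test_integrable[OF test_partial_deriv[OF \<phi>b]])
 also have "... = 0" using test_integral_partial_deriv[OF \<phi>b] by simp
 finally show ?thesis .
qed

text \<open>The divergence of the product v F integrates to 0 over the whole space, and one support
  inside \<open>V\<close> confines both integrands to \<open>V\<close>. The other factor may be
  nonzero on the boundary.\<close>

lemma integration_by_parts:
 fixes v :: "'a::euclidean_space => real" and F :: "'a => 'a"
 assumes v: "v \<in> test_functions U" and F: "F \<in> test_functions W" and V: "open V" "U \<subseteq> V \<or> W \<subseteq> V"
 shows "(LINT x|lebesgue_on V. gradient v x \<bullet> F x) = - (LINT x|lebesgue_on V. v x * divergence F x)"
proof -
 have Vl: "V \<in> sets lebesgue" using V(1) by (simp add: lebesgue_openin)
 have vF: "(%x. v x *\<^sub>R F x) \<in> test_functions UNIV"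
  by (rule test_mono[OF test_bilinear[OF bounded_bilinear_scaleR v test_smooth[OF F]]]) simp
 have t1: "(%x. gradient v x \<bullet> F x) \<in> test_functions U"
  by (rule test_bilinear[OF bounded_bilinear_inner gradient_test_function[OF v] test_smooth[OF F]])
 have t2: "(%x. v x * divergence F x) \<in> test_functions U"
  by (rule test_bilinear[OF bounded_bilinear_mult v test_smooth[OF divergence_test_function[OF F]]])
 have z: "gradient v x \<bullet> F x = 0" "v x * divergence F x = 0" if "x \<notin> V" for x
 proof -
  from V(2) that have "x \<notin> U \<or> x \<notin> W" by blast
  then show "gradient v x \<bullet> F x = 0" "v x * divergence F x = 0"
   using test_outside[OF t1, of x] test_outside[OF t2, of x]
    test_outside[OF F, of x] test_outside[OF divergence_test_function[OF F], of x] by auto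
 qed
 have "(LBINT x. gradient v x \<bullet> F x) + (LBINT x. v x * divergence F x) = (LBINT x. gradient v x \<bullet> F x + v x * divergence F x)"
  by (rule Bochner_Integration.integral_add[symmetric, OF test_integrable[OF t1] test_integrable[OF t2]])
 also have "... = (LBINT x. divergence (%x. v x *\<^sub>R F x) x)"
  by (simp only: divergence_scaleR[OF test_differentiable[OF v] test_differentiable[OF F]] add.commute)
 also have "... = 0" by (rule test_integral_divergence[OF vF])
 finally have sum0: "(LBINT x. gradient v x \<bullet> F x) + (LBINT x. v x * divergence F x) = 0" .
 have "(LINT x|lebesgue_on V. gradient v x \<bullet> F x) = (LBINT x. gradient v x \<bullet> F x)"
  by (rule lebesgue_on_integral(1)[OF test_measurable[OF t1] z(1) Vl])
 moreover have "(LINT x|lebesgue_on V. v x * divergence F x) = (LBINT x. v x * divergence F x)"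
  by (rule lebesgue_on_integral(1)[OF test_measurable[OF t2] z(2) Vl])
 ultimately show ?thesis using sum0 by simp
qed

lemma compact_lebesgue_subset: "compact K ==> K \<in> sets lebesgue"
 by (simp add: compact_imp_closed)

lemma smooth_field_locally_integrable:
 fixes f :: "'a::euclidean_space => 'b::euclidean_space"
 assumes F: "F \<in> test_functions W" and eq: "\<And>x. x \<in> U ==> f x = F x"
 shows "locally_integrable U f"
 unfolding locally_integrable_def
proof (intro allI impI, elim conjE)
 fix K assume K: "compact K" "K \<subseteq> U"
 have "integrable (lebesgue_on K) F"
 proof -
  have "integrable lebesgue F" using test_integrable[OF F] integrable_completion[of F lborel] test_measurable[OF F] by simp
  then have "integrable lebesgue (%x. indicator K x *\<^sub>R F x)"
   by (rule integrable_mult_indicator[OF compact_lebesgue_subset[OF K(1)]])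
  then show ?thesis using compact_lebesgue_subset[OF K(1)] by (subst integrable_restrict_space) auto
 qed
 then show "integrable (lebesgue_on K) f"
  by (rule Bochner_Integration.integrable_cong[THEN iffD1, OF refl, rotated]) (use K eq in auto)
qed

lemma has_weak_div_smooth:
 assumes F: "F \<in> test_functions W" and U: "open U" and eq: "\<And>x. x \<in> U ==> g x = F x"
 shows "has_weak_div U g (divergence F)"
 unfolding has_weak_div_def
proof (intro conjI ballI)
 show "locally_integrable U g" by (rule smooth_field_locally_integrable[OF F eq])
 show "locally_integrable U (divergence F)" by (rule smooth_field_locally_integrable[OF divergence_test_function[OF F] refl])
 fix v :: "'a => real" assume v: "v \<in> test_functions U"
 have "(LINT x|lebesgue_on U. gradient v x \<bullet> g x) = (LINT x|lebesgue_on U. gradient v x \<bullet> F x)"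
  by (intro Bochner_Integration.integral_cong) (auto simp: eq)
 then show "(LINT x|lebesgue_on U. gradient v x \<bullet> g x) = - (LINT x|lebesgue_on U. v x * divergence F x)"
  using integration_by_parts[OF v F U] by simp
qed

section \<open>Uniqueness of the weak divergence\<close>

lemma locally_integrable_subset_integrable:
 fixes k :: "'a::euclidean_space => 'b::euclidean_space"
 assumes "locally_integrable U k" "compact K" "K \<subseteq> U"
 shows "integrable lebesgue (%x. indicator K x *\<^sub>R k x)"
 using assms compact_lebesgue_subset[OF assms(2)] integrable_restrict_space[of K lebesgue k]
 unfolding locally_integrable_def by simp

text \<open>Cutoff functions supported in neighbourhoods of \<open>C\<close> of radius 1/(n+1)
  converge pointwise to its indicator. Intersecting these neighbourhoods with one \<open>V\<close>
  inside a compact set provides the dominating function.\<close>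

lemma integral_compact_eq_0:
 fixes k :: "'a::euclidean_space => real"
 assumes D: "open D" and k: "locally_integrable D k"
  and z: "\<And>v. v \<in> test_functions D ==> (LINT x|lebesgue_on D. v x * k x) = 0"
  and C: "compact C" "C \<subseteq> D"
 shows "(LINT x|lebesgue. indicator C x * k x) = 0"
proof (cases "C = {}")
 case False
 have Dl: "D \<in> sets lebesgue" using D by (simp add: lebesgue_openin)
 obtain \<eta>0 V where \<eta>0: "\<eta>0 \<in> test_functions D" "\<And>x. 0 <= \<eta>0 x" "\<And>x. \<eta>0 x <= (1::real)" "open V" "C \<subseteq> V" "\<And>x. x \<in> V ==> \<eta>0 x = 1"
  by (rule ex_cutoff[OF C(1) D C(2)], rule that)
 obtain K where K: "compact K" "K \<subseteq> D" "\<forall>x. x \<notin> K --> \<eta>0 x = 0" using test_support[OF \<eta>0(1)] by auto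
 have VK: "V \<subseteq> K"
 proof
  fix x assume "x \<in> V"
  then have "\<eta>0 x \<noteq> 0" using \<eta>0(6) by simp
  then show "x \<in> K" using K(3) by blast
 qed
 define U where "U n = V \<inter> (\<Union>c\<in>C. ball c (1 / real (Suc n)))" for n
 have U: "open (U n)" "C \<subseteq> U n" for n unfolding U_def using \<eta>0(4,5) by auto
 have "\<exists>\<eta>. \<eta> \<in> test_functions (U n) \<and> (\<forall>x. 0 <= \<eta> x) \<and> (\<forall>x. \<eta> x <= (1::real)) \<and> (\<forall>x\<in>C. \<eta> x = 1)" for n
 proof -
  obtain \<eta> W where "\<eta> \<in> test_functions (U n)" "\<And>x. 0 <= \<eta> x" "\<And>x. \<eta> x <= (1::real)" "open W" "C \<subseteq> W" "\<And>x. x \<in> W ==> \<eta> x = 1"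
   by (rule ex_cutoff[OF C(1) U], rule that)
  then show ?thesis by (intro exI[of _ \<eta>]) auto
 qed
 then have "\<forall>n. \<exists>\<eta>. \<eta> \<in> test_functions (U n) \<and> (\<forall>x. 0 <= \<eta> x) \<and> (\<forall>x. \<eta> x <= (1::real)) \<and> (\<forall>x\<in>C. \<eta> x = 1)" ..
 from choice[OF this] obtain \<eta> where \<eta>: "\<forall>n. \<eta> n \<in> test_functions (U n) \<and> (\<forall>x. 0 <= \<eta> n x) \<and> (\<forall>x. \<eta> n x <= (1::real)) \<and> (\<forall>x\<in>C. \<eta> n x = 1)" ..
 have ki: "integrable lebesgue (%x. indicator K x *\<^sub>R k x)" by (rule locally_integrable_subset_integrable[OF k K(1,2)])
 then have km: "(%x. indicator K x * k x) \<in> borel_measurable lebesgue" by auto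
 have eqK: "\<eta> n x * k x = \<eta> n x * (indicator K x * k x)" for n x
 proof (cases "x \<in> K")
  case False
  then have "x \<notin> U n" using VK unfolding U_def by auto
  then have "\<eta> n x = 0" using \<eta> test_outside by blast
  then show ?thesis by simp
 qed simp
 have m: "(%x. \<eta> n x * k x) \<in> borel_measurable lebesgue" for n
 proof -
  have "\<eta> n \<in> borel_measurable lebesgue"
   by (rule measurable_completion) (use test_measurable[of "\<eta> n" "U n"] \<eta> in simp)
  from borel_measurable_times[OF this km] show ?thesis unfolding eqK[abs_def] .
 qed
 have lim: "(%n. \<eta> n x) \<longlonglongrightarrow> indicator C x" for x
 proof (cases "x \<in> C")
  case True
  then show ?thesis using \<eta> by simp
 next
  case False
  have cl: "closed C" using C(1) by (rule compact_imp_closed)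
  have pos: "infdist x C > 0" using False cl \<open>C \<noteq> {}\<close> in_closed_iff_infdist_zero[OF cl] infdist_nonneg[of x C] by (simp add: order_less_le)
  obtain N where N: "1 / real (Suc N) < infdist x C" using pos nat_approx_posE by blast
  have "\<eta> n x = 0" if n: "n \<ge> N" for n
  proof -
   have "x \<notin> U n"
   proof
    assume "x \<in> U n"
    then obtain c where c: "c \<in> C" "dist c x < 1 / real (Suc n)" unfolding U_def by auto
    have "infdist x C <= dist x c" by (rule infdist_le[OF c(1)])
    also have "... < 1 / real (Suc n)" using c(2) by (simp add: dist_commute)
    also have "... <= 1 / real (Suc N)" using n by (simp add: frac_le)
    finally show False using N by simp
   qed
   then show ?thesis using \<eta> test_outside by blast
  qed
  then have "\<forall>\<^sub>F n in sequentially. \<eta> n x = 0" unfolding eventually_sequentially by blast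
  then show ?thesis using False by (simp add: tendsto_eventually)
 qed
 have L: "(%n. (LINT x|lebesgue. \<eta> n x * k x)) \<longlonglongrightarrow> (LINT x|lebesgue. indicator C x * k x)"
 proof (rule integral_dominated_convergence[where w="%x. norm (indicator K x *\<^sub>R k x)"])
  have "(%x. indicator C x * k x) = (%x. indicator C x * (indicator K x * k x))"
   using \<eta>0(5) VK by (auto simp: indicator_def fun_eq_iff)
  moreover have "(%x. indicator C x * (indicator K x * k x)) \<in> borel_measurable lebesgue"
   by (rule borel_measurable_times[OF borel_measurable_indicator[OF compact_lebesgue_subset[OF C(1)]] km])
  ultimately show "(%x. indicator C x * k x) \<in> borel_measurable lebesgue" by simp
  show "AE x in lebesgue. (%n. \<eta> n x * k x) \<longlonglongrightarrow> indicator C x * k x"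
   by (intro AE_I2 tendsto_mult lim tendsto_const)
  show "AE x in lebesgue. norm (\<eta> n x * k x) <= norm (indicator K x *\<^sub>R k x)" for n
  proof (rule AE_I2)
   fix x
   have "\<bar>\<eta> n x\<bar> <= 1" using \<eta> by simp
   then show "norm (\<eta> n x * k x) <= norm (indicator K x *\<^sub>R k x)"
    unfolding eqK using mult_right_mono[of "\<bar>\<eta> n x\<bar>" 1 "\<bar>indicator K x * k x\<bar>"] by (simp add: abs_mult)
  qed
 qed (use ki m in auto)
 have Z: "(LINT x|lebesgue. \<eta> n x * k x) = 0" for n
 proof -
  have t: "\<eta> n \<in> test_functions D"
   by (rule test_mono[of _ "U n"]) (use \<eta> VK K(2) in \<open>auto simp: U_def\<close>)
  have "(LINT x|lebesgue_on D. \<eta> n x * k x) = (LINT x|lebesgue. indicator D x *\<^sub>R (\<eta> n x * k x))"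
   using Dl by (intro integral_restrict_space) auto
  also have "... = (LINT x|lebesgue. \<eta> n x * k x)"
   using test_outside[OF t] by (intro Bochner_Integration.integral_cong refl) (auto simp: indicator_def)
  finally show ?thesis using z[OF t] by simp
 qed
 from L have "(%n. 0) \<longlonglongrightarrow> (LINT x|lebesgue. indicator C x * k x)" unfolding Z .
 from LIMSEQ_unique[OF this tendsto_const] show ?thesis .
qed simp

text \<open>The set where k > 0 is approximated from inside by compact sets. On each of them the
  positive function \<open>k\<close> has integral 0, so they are null sets, and so is the whole. The
  opposite sign is obtained by symmetry in \<open>has_weak_div_unique\<close>.\<close>

lemma AE_eq_0_of_test_integrals_compact:
 fixes k :: "'a::euclidean_space => real"
 assumes U: "open U" and k: "locally_integrable U k"
  and z: "\<And>v. v \<in> test_functions U ==> (LINT x|lebesgue_on U. v x * k x) = 0"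
  and K: "compact K" "K \<subseteq> U"
 shows "AE x in lebesgue. x \<in> K --> k x <= 0"
proof -
 define A where "A = {x. indicator K x * k x > 0}"
 have "integrable lebesgue (%x. indicator K x *\<^sub>R k x)" by (rule locally_integrable_subset_integrable[OF k K])
 then have km: "(%x. indicator K x * k x) \<in> borel_measurable lebesgue" by auto
 then have A: "A \<in> sets lebesgue" unfolding A_def by (simp add: borel_measurable_lebesgue_preimage_borel borel_measurable_iff_greater)
 have AK: "A \<subseteq> K" unfolding A_def by (auto simp: indicator_def split: if_splits)
 have "emeasure lebesgue A <= 0 + ennreal e" if e: "e > 0" for e
 proof -
  obtain T where T: "closed T" "T \<subseteq> A" "emeasure lebesgue (A - T) < ennreal e"
   by (rule sets_lebesgue_inner_closed[OF A e], rule that)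
  have Tc: "compact T"
  proof -
   have "T \<inter> K = T" using T(2) AK by blast
   then show ?thesis using closed_Int_compact[OF T(1) K(1)] by simp
  qed
  have TS: "T \<in> sets lebesgue" by (rule compact_lebesgue_subset[OF Tc])
  have TU: "T \<subseteq> U" using T(2) AK K(2) by blast
  have Ti: "integrable lebesgue (%x. indicator T x *\<^sub>R k x)" by (rule locally_integrable_subset_integrable[OF k Tc TU])
  have pos: "k x > 0" if "x \<in> T" for x
  proof -
   have "indicator K x * k x > 0" using T(2) that unfolding A_def by blast
   then show ?thesis by (cases "x \<in> K") auto
  qed
  have "AE x in lebesgue. indicator T x * k x = 0"
  proof -
   have "(LINT x|lebesgue. indicator T x * k x) = 0" by (rule integral_compact_eq_0[OF U k z Tc TU])
   moreover have "0 <= indicator T x * k x" for x using pos[of x] by (auto simp: indicator_def)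
   ultimately show ?thesis using Ti integral_nonneg_eq_0_iff_AE[of lebesgue "%x. indicator T x * k x"] by simp
  qed
  then have "AE x in lebesgue. x \<notin> T"
  proof eventually_elim
   case (elim x)
   show "x \<notin> T"
   proof
    assume "x \<in> T"
    with elim pos[OF this] show False by simp
   qed
  qed
  then have T0: "T \<in> null_sets lebesgue" using AE_iff_null_sets[OF TS] by simp
  have "A = (A - T) \<union> T" using T(2) by auto
  then have "emeasure lebesgue A <= emeasure lebesgue (A - T) + emeasure lebesgue T"
   using emeasure_subadditive[of "A - T" lebesgue T] A TS by simp
  moreover have "emeasure lebesgue T = 0" using T0 by (simp add: null_sets_def)
  ultimately have "emeasure lebesgue A <= emeasure lebesgue (A - T)" by simp
  also have "... <= ennreal e" using T(3) by (rule less_imp_le)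
  finally show ?thesis by simp
 qed
 note key = this
 have "emeasure lebesgue A <= 0" by (rule ennreal_le_epsilon) (rule key)
 then have "A \<in> null_sets lebesgue" using A by (simp add: null_sets_def)
 then have "AE x in lebesgue. x \<notin> A" using AE_iff_null_sets[OF A] by simp
 then show ?thesis by eventually_elim (auto simp: A_def indicator_def not_less)
qed

lemma locally_integrable_diff:
 fixes f g :: "'a::euclidean_space => 'b::euclidean_space"
 shows "locally_integrable U f ==> locally_integrable U g ==> locally_integrable U (%x. f x - g x)"
 unfolding locally_integrable_def by (simp add: Bochner_Integration.integrable_diff)

lemma locally_integrable_test_mult:
 fixes k :: "'a::euclidean_space => real"
 assumes U: "open U" and k: "locally_integrable U k" and v: "v \<in> test_functions U"
 shows "integrable (lebesgue_on U) (%x. v x * k x)"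
proof -
 have Ul: "U \<inter> space lebesgue \<in> sets lebesgue" using U by (simp add: lebesgue_openin)
 obtain K where K: "compact K" "K \<subseteq> U" "\<forall>x. x \<notin> K --> v x = 0" using test_support[OF v] by auto
 obtain B where "B > 0" and B: "\<And>x. norm (v x) <= B" by (rule test_bounded[OF v], rule that)
 have vm: "v \<in> borel_measurable lebesgue" by (rule measurable_completion) (use test_measurable[OF v] in simp)
 have "integrable lebesgue (%x. v x *\<^sub>R (indicator K x *\<^sub>R k x))"
  by (rule integrable_bounded_mult[OF locally_integrable_subset_integrable[OF k K(1,2)] vm]) (use B in auto)
 also have "(%x. v x *\<^sub>R (indicator K x *\<^sub>R k x)) = (%x. indicator U x *\<^sub>R (v x * k x))"
  using K(2,3) by (auto simp: indicator_def fun_eq_iff)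
 finally show ?thesis by (subst integrable_restrict_space[OF Ul])
qed

text \<open>An open set is a countable union of closed boxes, so the exceptional sets add up to a
  null set.\<close>

lemma AE_lebesgue_on_of_compacts:
 fixes U :: "'a::euclidean_space set"
 assumes U: "open U" and K: "\<And>K. compact K ==> K \<subseteq> U ==> AE x in lebesgue. x \<in> K --> P x"
 shows "AE x in lebesgue_on U. P x"
proof -
 obtain \<D> where D: "countable \<D>" "\<D> \<subseteq> Pow U" "\<And>X. X \<in> \<D> ==> \<exists>a b. X = cbox a b" "\<Union>\<D> = U"
  by (rule open_countable_Union_open_cbox[OF U], rule that)
 have "AE x in lebesgue. x \<in> X --> P x" if X: "X \<in> \<D>" for X
 proof (rule K)
  show "compact X" using D(3)[OF X] by auto
  show "X \<subseteq> U" using D(2) X by auto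
 qed
 then have "AE x in lebesgue. \<forall>X\<in>\<D>. x \<in> X --> P x" by (subst AE_ball_countable[OF D(1)]) simp
 then have "AE x in lebesgue. x \<in> U --> P x" by eventually_elim (use D(4) in blast)
 moreover have "U \<inter> space lebesgue \<in> sets lebesgue" using U by (simp add: lebesgue_openin)
 ultimately show ?thesis by (subst AE_restrict_space_iff) auto
qed

lemma has_weak_div_unique:
 fixes g :: "'a::euclidean_space => 'a"
 assumes U: "open U" and h: "has_weak_div U g h" and h': "has_weak_div U g h'"
 shows "AE x in lebesgue_on U. h x = h' x"
proof -
 have le: "AE x in lebesgue_on U. h x - h' x <= 0" if h: "has_weak_div U g h" and h': "has_weak_div U g h'" for h h'
 proof (rule AE_lebesgue_on_of_compacts[OF U])
  fix K assume K: "compact K" "K \<subseteq> U"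
  have l: "locally_integrable U h" "locally_integrable U h'" using h h' unfolding has_weak_div_def by auto
  show "AE x in lebesgue. x \<in> K --> h x - h' x <= 0"
  proof (rule AE_eq_0_of_test_integrals_compact[OF U locally_integrable_diff[OF l] _ K])
   fix v :: "'a => real" assume v: "v \<in> test_functions U"
   have "(LINT x|lebesgue_on U. v x * h x) = (LINT x|lebesgue_on U. v x * h' x)"
    using h h' v unfolding has_weak_div_def by force
   then show "(LINT x|lebesgue_on U. v x * (h x - h' x)) = 0"
    unfolding right_diff_distrib
    using Bochner_Integration.integral_diff[OF locally_integrable_test_mult[OF U l(1) v] locally_integrable_test_mult[OF U l(2) v]] by simp
  qed
 qed
 show ?thesis using le[OF h h'] le[OF h' h] by eventually_elim simp
qed

section \<open>Borel representatives and the norm of W^q(div)\<close>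

lemma borel_measurable_lebesgue_on_AE:
 fixes f g :: "'a::euclidean_space => 'b::euclidean_space"
 assumes U: "U \<in> sets lebesgue" and f: "f \<in> borel_measurable (lebesgue_on U)" and ae: "AE x in lebesgue_on U. f x = g x"
 shows "g \<in> borel_measurable (lebesgue_on U)"
proof -
 have U': "U \<inter> space lebesgue \<in> sets lebesgue" using U by simp
 have "AE x in lebesgue. x \<in> U --> f x = g x" using ae AE_restrict_space_iff[OF U'] by simp
 then have "AE x in lebesgue. indicator U x *\<^sub>R f x = indicator U x *\<^sub>R g x" by eventually_elim (auto simp: indicator_def)
 moreover have "(%x. indicator U x *\<^sub>R f x) \<in> borel_measurable lebesgue"
  using f borel_measurable_restrict_space_iff[OF U', of f] by simp
 ultimately have "(%x. indicator U x *\<^sub>R g x) \<in> borel_measurable lebesgue" by (rule borel_measurable_AE[rotated])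
 then show ?thesis using borel_measurable_restrict_space_iff[OF U', of g] by simp
qed

text \<open>Mollification is carried out with respect to \<open>lborel\<close> on the whole space,
  so a class on \<open>U\<close> has to be represented by a Borel function extended by 0.\<close>

lemma borel_representative:
 fixes f :: "'a::euclidean_space => 'b::euclidean_space"
 assumes U: "open U" and f: "f \<in> borel_measurable (lebesgue_on U)"
 obtains F where "F \<in> borel_measurable borel" "AE x in lebesgue_on U. F x = f x" "\<And>x. x \<notin> U ==> F x = 0"
proof -
 have U': "U \<inter> space lebesgue \<in> sets lebesgue" using U by (simp add: lebesgue_openin)
 have fm: "(%x. indicator U x *\<^sub>R f x) \<in> borel_measurable lebesgue"
  using f borel_measurable_restrict_space_iff[OF U', of f] by simp
 have "\<exists>G\<in>borel_measurable lborel. AE x in lborel. (indicator U x *\<^sub>R f x) \<bullet> b = G x" for b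
  by (rule completion_ex_borel_measurable_real) (use fm in measurable)
 then have "\<forall>b. \<exists>G. G \<in> borel_measurable lborel \<and> (AE x in lborel. (indicator U x *\<^sub>R f x) \<bullet> b = G x)" by blast
 from choice[OF this] obtain G where G: "\<forall>b. G b \<in> borel_measurable lborel \<and> (AE x in lborel. (indicator U x *\<^sub>R f x) \<bullet> b = G b x)" ..
 define F where "F x = indicator U x *\<^sub>R (\<Sum>b\<in>Basis. G b x *\<^sub>R b)" for x
 have Gm [measurable]: "G b \<in> borel_measurable borel" for b using G by simp
 have Ub [measurable]: "U \<in> sets borel" using U by simp
 have "F \<in> borel_measurable borel" unfolding F_def by measurable
 moreover have "AE x in lebesgue_on U. F x = f x"
 proof -
  have "AE x in lborel. \<forall>b\<in>Basis. (indicator U x *\<^sub>R f x) \<bullet> b = G b x" using G by (intro AE_finite_allI) auto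
  then have "AE x in lebesgue. \<forall>b\<in>Basis. (indicator U x *\<^sub>R f x) \<bullet> b = G b x" by (rule AE_completion)
  then have "AE x in lebesgue. x \<in> U --> F x = f x"
  proof eventually_elim
   case (elim x)
   show ?case
   proof
    assume x: "x \<in> U"
    have "(\<Sum>b\<in>Basis. G b x *\<^sub>R b) = (\<Sum>b\<in>Basis. (f x \<bullet> b) *\<^sub>R b)" using elim x by (intro sum.cong) auto
    then show "F x = f x" unfolding F_def using x by (simp add: euclidean_representation)
   qed
  qed
  then show ?thesis using AE_restrict_space_iff[OF U'] by simp
 qed
 moreover have "F x = 0" if "x \<notin> U" for x using that unfolding F_def by simp
 ultimately show ?thesis by (rule that)
qed

lemma Lp_locally_integrable:
 fixes f :: "'a::euclidean_space => 'b::euclidean_space"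
 assumes U: "open U" "bounded U" and f: "f \<in> Lp q U" and q: "q > 1"
 shows "locally_integrable U f"
 unfolding locally_integrable_def
proof (intro allI impI, elim conjE)
 fix K assume K: "compact K" "K \<subseteq> U"
 have U': "U \<inter> space lebesgue \<in> sets lebesgue" using U by (simp add: lebesgue_openin)
 have K': "K \<in> sets lebesgue" by (rule compact_lebesgue_subset[OF K(1)])
 have "integrable lebesgue (%x. indicator U x *\<^sub>R f x)"
  using Lp_integrable[OF bounded_finite_lebesgue_on[OF U] f q] integrable_restrict_space[OF U', of f] by simp
 then have "integrable lebesgue (%x. indicator K x *\<^sub>R (indicator U x *\<^sub>R f x))" by (rule integrable_mult_indicator[OF K'])
 also have "(%x. indicator K x *\<^sub>R (indicator U x *\<^sub>R f x)) = (%x. indicator K x *\<^sub>R f x)"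
  using K(2) by (auto simp: indicator_def fun_eq_iff)
 finally show "integrable (lebesgue_on K) f" using K' by (subst integrable_restrict_space) auto
qed

text \<open>\<open>weak_div\<close> chooses some weak divergence; by uniqueness a known one can
  replace it in the norm.\<close>

lemma Wdiv_norm_eq:
 assumes U: "open U" and h: "h \<in> Lp q U" "has_weak_div U f h" and q: "q > 0"
 shows "Wdiv_norm q U f =
  ((LINT x|lebesgue_on U. norm (f x) powr q) + (LINT x|lebesgue_on U. norm (h x) powr q)) powr (1 / q)"
proof -
 have Ul: "U \<in> sets lebesgue" using U by (simp add: lebesgue_openin)
 have w: "has_weak_div U f (weak_div U f)" unfolding weak_div_def by (rule someI[of _ h]) (rule h(2))
 have ae: "AE x in lebesgue_on U. h x = weak_div U f x" by (rule has_weak_div_unique[OF U h(2) w])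
 have hm: "h \<in> borel_measurable (lebesgue_on U)" by (rule Lp_D(1)[OF h(1)])
 have [measurable]: "weak_div U f \<in> borel_measurable (lebesgue_on U)" by (rule borel_measurable_lebesgue_on_AE[OF Ul hm ae])
 have "(LINT x|lebesgue_on U. norm (h x) powr q) = (LINT x|lebesgue_on U. norm (weak_div U f x) powr q)"
  using ae hm by (intro integral_cong_AE) (auto elim!: eventually_mono)
 moreover have "(a powr (1 / q)) powr q = a" if "a \<ge> 0" for a :: real using that q by (simp add: powr_powr)
 ultimately show ?thesis unfolding Wdiv_norm_def Lp_norm_def by simp
qed

lemma Wdiv_norm_tendsto_iff:
 assumes U: "open U" and h: "\<And>n. h n \<in> Lp q U" "\<And>n. has_weak_div U (f n) (h n)" and q: "q > 0"
 shows "(%n. Wdiv_norm q U (f n)) \<longlonglongrightarrow> 0 \<longleftrightarrow>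
  (%n. LINT x|lebesgue_on U. norm (f n x) powr q) \<longlonglongrightarrow> 0 \<and> (%n. LINT x|lebesgue_on U. norm (h n x) powr q) \<longlonglongrightarrow> 0"
  (is "?W \<longlonglongrightarrow> 0 \<longleftrightarrow> ?A \<longlonglongrightarrow> 0 \<and> ?B \<longlonglongrightarrow> 0")
proof -
 have W: "?W n = (?A n + ?B n) powr (1 / q)" for n by (rule Wdiv_norm_eq[OF U h q])
 have A: "?A n \<ge> 0" and B: "?B n \<ge> 0" for n by simp_all
 have Wq: "?W n powr q = ?A n + ?B n" for n unfolding W using A[of n] B[of n] q by (simp add: powr_powr)
 show ?thesis
 proof
  assume "?W \<longlonglongrightarrow> 0"
  then have "(%n. ?W n powr q) \<longlonglongrightarrow> 0"
   using q by (intro tendsto_zero_powrI[where b=q]) (auto simp: W)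
  then have S: "(%n. ?A n + ?B n) \<longlonglongrightarrow> 0" unfolding Wq .
  have "?A \<longlonglongrightarrow> 0"
   by (rule tendsto_sandwich[OF _ _ tendsto_const S]) (use A B in \<open>auto intro!: always_eventually\<close>)
  moreover have "?B \<longlonglongrightarrow> 0"
   by (rule tendsto_sandwich[OF _ _ tendsto_const S]) (use A B in \<open>auto intro!: always_eventually\<close>)
  ultimately show "?A \<longlonglongrightarrow> 0 \<and> ?B \<longlonglongrightarrow> 0" ..
 next
  assume "?A \<longlonglongrightarrow> 0 \<and> ?B \<longlonglongrightarrow> 0"
  then have "(%n. ?A n + ?B n) \<longlonglongrightarrow> 0 + 0" by (intro tendsto_add) auto
  then have "(%n. (?A n + ?B n) powr (1 / q)) \<longlonglongrightarrow> 0"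
   using q by (intro tendsto_zero_powrI[where b="1/q"]) auto
  then show "?W \<longlonglongrightarrow> 0" unfolding W .
 qed
qed

lemma has_weak_div_diff:
 assumes U: "open U" and 1: "has_weak_div U f h" and 2: "has_weak_div U g k"
 shows "has_weak_div U (%x. f x - g x) (%x. h x - k x)"
 unfolding has_weak_div_def
proof (intro conjI ballI)
 have l: "locally_integrable U f" "locally_integrable U g" "locally_integrable U h" "locally_integrable U k"
  using 1 2 unfolding has_weak_div_def by auto
 show "locally_integrable U (%x. f x - g x)" "locally_integrable U (%x. h x - k x)"
  by (rule locally_integrable_diff[OF l(1,2)], rule locally_integrable_diff[OF l(3,4)])
 fix v :: "'a => real" assume v: "v \<in> test_functions U"
 have gi: "integrable (lebesgue_on U) (%x. gradient v x \<bullet> f x)" if f: "locally_integrable U f" for f :: "'a => 'a"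
 proof -
  have "integrable (lebesgue_on U) (%x. (gradient v x \<bullet> b) * (f x \<bullet> b))" for b
  proof (rule locally_integrable_test_mult[OF U _ test_inner[OF gradient_test_function[OF v]]])
   show "locally_integrable U (%x. f x \<bullet> b)" using f unfolding locally_integrable_def by (simp add: integrable_inner_left)
  qed
  then show ?thesis by (subst euclidean_inner) (intro Bochner_Integration.integrable_sum)
 qed
 show "(LINT x|lebesgue_on U. gradient v x \<bullet> (f x - g x)) = - (LINT x|lebesgue_on U. v x * (h x - k x))"
  unfolding inner_diff_right right_diff_distrib
  using 1 2 v Bochner_Integration.integral_diff[OF gi[OF l(1)] gi[OF l(2)]]
   Bochner_Integration.integral_diff[OF locally_integrable_test_mult[OF U l(3) v] locally_integrable_test_mult[OF U l(4) v]]
  unfolding has_weak_div_def by simp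
qed

section \<open>Approximation on Lipschitz domains\<close>

text \<open>\<open>\<zeta> j\<close> takes from \<open>\<eta> j\<close> what the earlier functions
  have left over. The sums telescope to 1 minus the product of the 1 - \<open>\<eta> j\<close>,
  which is 1 as soon as one \<open>\<eta> j\<close> is 1.\<close>

lemma smooth_partition:
 fixes \<eta> :: "nat => 'a::euclidean_space => real"
 assumes \<eta>: "\<And>j. j < n ==> \<eta> j \<in> test_functions (U j)" "\<And>j x. 0 <= \<eta> j x" "\<And>j x. \<eta> j x <= 1"
 defines "\<zeta> \<equiv> %j x. \<eta> j x * (\<Prod>i<j. 1 - \<eta> i x)"
 shows "\<And>j. j < n ==> \<zeta> j \<in> test_functions (U j)" "\<And>j x. 0 <= \<zeta> j x"
  "\<And>x. (\<Sum>j<n. \<zeta> j x) <= 1" "\<And>x j. j < n ==> \<eta> j x = 1 ==> (\<Sum>j<n. \<zeta> j x) = 1"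
proof -
 have sm: "k_smooth k (%x. 1 - \<eta> i x)" if "i < n" for i k
  using k_smooth_add[OF k_smooth_const test_smooth[OF test_minus[OF \<eta>(1)[OF that]]], of k 1] by simp
 show "\<zeta> j \<in> test_functions (U j)" if j: "j < n" for j
  unfolding \<zeta>_def
  by (rule test_bilinear[OF bounded_bilinear_mult \<eta>(1)[OF j]]) (rule k_smooth_prod, use sm j in auto)
 show "0 <= \<zeta> j x" for j x unfolding \<zeta>_def using \<eta>(2,3) by (intro mult_nonneg_nonneg prod_nonneg) auto
 have s: "(\<Sum>j<m. \<zeta> j x) = 1 - (\<Prod>j<m. 1 - \<eta> j x)" for m x
  by (induction m) (auto simp: \<zeta>_def algebra_simps)
 show "(\<Sum>j<n. \<zeta> j x) <= 1" for x unfolding s using \<eta>(3) prod_nonneg[of "{..<n}" "%j. 1 - \<eta> j x"] by simp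
 show "(\<Sum>j<n. \<zeta> j x) = 1" if "j < n" "\<eta> j x = 1" for x j
  unfolding s using that by (auto simp: prod_zero_iff)
qed

lemma norm_minus_projection_le:
 fixes e v :: "'a::euclidean_space"
 assumes "norm e = 1"
 shows "norm (v - (v \<bullet> e) *\<^sub>R e) <= norm v"
proof -
 have "e \<bullet> e = 1" using assms by (simp add: norm_eq_1)
 then have "(v - (v \<bullet> e) *\<^sub>R e) \<bullet> (v - (v \<bullet> e) *\<^sub>R e) = v \<bullet> v - (v \<bullet> e)\<^sup>2"
  by (simp add: inner_diff_left inner_diff_right inner_commute power2_eq_square)
 then have "(norm (v - (v \<bullet> e) *\<^sub>R e))\<^sup>2 = (norm v)\<^sup>2 - (v \<bullet> e)\<^sup>2"
  by (simp only: power2_norm_eq_inner)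
 then have "(norm (v - (v \<bullet> e) *\<^sub>R e))\<^sup>2 <= (norm v)\<^sup>2" by simp
 then show ?thesis by (rule power2_le_imp_le) simp
qed

text \<open>Where this holds, mollification with a kernel centred at \<open>a\<close> of a field vanishing off the domain vanishes near \<open>y\<close>.\<close>

definition outward :: "'a::euclidean_space set => 'a set => 'a => real => bool" where
 "outward U S a e \<longleftrightarrow> (\<forall>y x z. y \<in> S \<and> y \<notin> U \<and> dist x y < e \<and> norm z <= e --> x - e *\<^sub>R a - z \<notin> U)"

text \<open>The domain lies above the graph in direction \<open>e\<close>. A displacement of norm at
  most 2s raises the height by at most 2s and changes the graph function by at most 2 L s, so
  lowering by 2 (L + 1) s leads back to the graph or below it. The bound on s keeps the moved point
  inside the chart.\<close>

lemma lipschitz_outward: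
 fixes U :: "'a::euclidean_space set"
 assumes e: "norm e = 1" and L: "L-lipschitz_on {z. z \<bullet> e = 0} \<gamma>"
  and g: "\<And>y. y \<in> ball p r ==> y \<in> U \<longleftrightarrow> \<gamma> (y - (y \<bullet> e) *\<^sub>R e) < y \<bullet> e"
  and S: "compact S" "S \<subseteq> ball p r"
 shows "\<exists>d>0. \<forall>s. 0 < s \<and> s < d --> outward U S ((2 * (L + 1)) *\<^sub>R e) s"
proof -
 obtain m where m: "m > 0" "(\<Union>x\<in>S. ball x m) \<subseteq> ball p r"
  using compact_subset_open_imp_ball_epsilon_subset[OF S(1) open_ball S(2)] by blast
 have L0: "L \<ge> 0" by (rule lipschitz_on_nonneg[OF L])
 define t where "t = 2 * (L + 1)"
 have t: "t > 0" unfolding t_def using L0 by simp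
 have ee: "e \<bullet> e = 1" using e by (simp add: norm_eq_1)
 have "outward U S (t *\<^sub>R e) s" if s: "0 < s" "s < m / (2 + t)" for s
  unfolding outward_def
 proof (intro allI impI, elim conjE)
  fix y x z :: 'a assume y: "y \<in> S" "y \<notin> U" and x: "dist x y < s" and z: "norm z <= s"
  define v where "v = x - y - z"
  define w where "w = x - s *\<^sub>R t *\<^sub>R e - z"
  have w: "w = y + v - (s * t) *\<^sub>R e" unfolding w_def v_def by simp
  have v: "norm v <= 2 * s" using norm_triangle_ineq4[of "x - y" z] x z unfolding v_def by (simp add: dist_norm)
  have em: "2 * s + s * t < m" using s t by (simp add: field_simps)
  have "norm (w - y) <= norm v + norm ((s * t) *\<^sub>R e)" unfolding w using norm_triangle_ineq4[of v "(s * t) *\<^sub>R e"] by (simp add: algebra_simps)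
  also have "... < m" using v em s t e by simp
  finally have "w \<in> ball y m" by (simp add: dist_norm norm_minus_commute)
  then have wb: "w \<in> ball p r" using m(2) y(1) by blast
  have yb: "y \<in> ball p r" using y(1) S(2) by blast
  let ?P = "%v. v - (v \<bullet> e) *\<^sub>R e"
  have P0: "?P v \<bullet> e = 0" for v using ee by (simp add: inner_diff_left)
  have "?P w - ?P y = ?P v" unfolding w using ee by (simp add: algebra_simps inner_diff_left inner_add_left)
  then have "dist (?P w) (?P y) <= 2 * s" using norm_minus_projection_le[OF e, of v] v by (simp add: dist_norm)
  then have "dist (\<gamma> (?P w)) (\<gamma> (?P y)) <= L * (2 * s)"
   using lipschitz_onD[OF L, of "?P w" "?P y"] P0 L0 by (auto intro: order_trans mult_left_mono)
  then have 1: "\<gamma> (?P y) <= \<gamma> (?P w) + L * (2 * s)" by (simp add: dist_real_def)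
  have 2: "y \<bullet> e <= \<gamma> (?P y)" using g[OF yb] y(2) by simp
  have "v \<bullet> e <= norm v" using Cauchy_Schwarz_ineq2[of v e] e by simp
  then have "w \<bullet> e <= y \<bullet> e + 2 * s - s * t" unfolding w using v ee by (simp add: inner_diff_left inner_add_left)
  then have "w \<bullet> e <= \<gamma> (?P w)" using 1 2 unfolding t_def by (simp add: algebra_simps)
  then have "w \<notin> U" using g[OF wb] by simp
  then show "x - s *\<^sub>R t *\<^sub>R e - z \<notin> U" unfolding w_def .
 qed
 then show ?thesis using m(1) t unfolding t_def by (intro exI[of _ "m / (2 + 2 * (L + 1))"]) auto
qed

text \<open>Finitely many charts cover the boundary, each with its own direction of displacement.
  What they leave of the closure is compact inside \<open>V\<close> and is handled by one additional
  index \<open>M\<close> with displacement 0.\<close>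

lemma lipschitz_partition:
 fixes V :: "'a::euclidean_space set"
 assumes V: "bounded_lipschitz_domain V"
 shows "\<exists>(N::nat) (\<zeta> :: nat => 'a => real) S a d. d > 0 \<and>
  (\<forall>i<N. \<zeta> i \<in> test_functions UNIV \<and> compact (S i) \<and> (\<forall>x. x \<notin> S i --> \<zeta> i x = 0)) \<and>
  (\<forall>i x. 0 <= \<zeta> i x) \<and> (\<forall>x. (\<Sum>i<N. \<zeta> i x) <= 1) \<and> (\<forall>x\<in>V. (\<Sum>i<N. \<zeta> i x) = 1) \<and>
  (\<forall>i<N. \<forall>s. 0 < s \<and> s < d --> outward V (S i) (a i) s)"
proof -
 have op: "open V" and bd: "bounded V" using V unfolding bounded_lipschitz_domain_def by auto
 have "\<forall>x\<in>frontier V. \<exists>r. 0 < r \<and> (\<forall>S. compact S \<and> S \<subseteq> ball x r -->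
   (\<exists>a d. d > 0 \<and> (\<forall>s. 0 < s \<and> s < d --> outward V S a s)))"
 proof
  fix x assume "x \<in> frontier V"
  then obtain e r L \<gamma> where *: "norm e = 1" "0 < r" "L-lipschitz_on {z. z \<bullet> e = 0} \<gamma>"
   "\<forall>y\<in>ball x r. y \<in> V \<longleftrightarrow> \<gamma> (y - (y \<bullet> e) *\<^sub>R e) < y \<bullet> e"
   using V unfolding bounded_lipschitz_domain_def by blast
  show "\<exists>r. 0 < r \<and> (\<forall>S. compact S \<and> S \<subseteq> ball x r --> (\<exists>a d. d > 0 \<and> (\<forall>s. 0 < s \<and> s < d --> outward V S a s)))"
  proof (intro exI[of _ r] conjI allI impI)
   fix S assume S: "compact S \<and> S \<subseteq> ball x r"
   show "\<exists>a d. d > 0 \<and> (\<forall>s. 0 < s \<and> s < d --> outward V S a s)"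
    by (rule exI) (rule lipschitz_outward[OF *(1,3) *(4)[rule_format] conjunct1[OF S] conjunct2[OF S]])
  qed (rule *(2))
 qed
 from bchoice[OF this] obtain r where r: "\<forall>x\<in>frontier V. 0 < r x \<and> (\<forall>S. compact S \<and> S \<subseteq> ball x (r x) -->
   (\<exists>a d. d > 0 \<and> (\<forall>s. 0 < s \<and> s < d --> outward V S a s)))" ..
 have fc: "compact (frontier V)" using bd by (rule compact_frontier_bounded)
 \<comment> \<open>Halving the radii leaves room for functions that are 1 on the smaller ball and
   supported in the chart.\<close>
 have cov: "frontier V \<subseteq> (\<Union>x\<in>frontier V. ball x (r x / 2))"
 proof
  fix x assume x: "x \<in> frontier V"
  then have "r x > 0" using r by blast
  then show "x \<in> (\<Union>x\<in>frontier V. ball x (r x / 2))" using x by (intro UN_I[of x]) auto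
 qed
 obtain F where F: "F \<subseteq> frontier V" "finite F" "frontier V \<subseteq> (\<Union>x\<in>F. ball x (r x / 2))"
  by (rule compactE_image[OF fc _ cov]) auto
 obtain f where f: "bij_betw f {0..<card F} F" using ex_bij_betw_nat_finite[OF F(2)] by blast
 define M where "M = card F"
 have fF: "f j \<in> F" if "j < M" for j using f that unfolding M_def bij_betw_def by auto
 have Ff: "\<exists>j<M. f j = x" if "x \<in> F" for x using f that unfolding M_def bij_betw_def by force
 define K where "K = closure V - (\<Union>x\<in>F. ball x (r x / 2))"
 have K: "compact K" "K \<subseteq> V"
 proof -
  have "compact (closure V)" using bd by (simp add: compact_closure)
  then show "compact K" unfolding K_def by (intro compact_diff) auto
  have "closure V \<subseteq> V \<union> frontier V" using op by (auto simp: frontier_def interior_open)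
  then show "K \<subseteq> V" unfolding K_def using F(3) by blast
 qed
 define U where "U j = (if j < M then ball (f j) (r (f j)) else V)" for j
 define C where "C j = (if j < M then cball (f j) (r (f j) / 2) else K)" for j
 have rf: "r (f j) > 0" if "j < M" for j using r F(1) fF[OF that] by blast
 have UC: "compact (C j)" "open (U j)" "C j \<subseteq> U j" for j
  unfolding U_def C_def using K op rf[of j] by (auto simp: subset_iff)
 have "\<exists>\<eta>. \<eta> \<in> test_functions (U j) \<and> (\<forall>x. 0 <= \<eta> x) \<and> (\<forall>x. \<eta> x <= (1::real)) \<and> (\<forall>x\<in>C j. \<eta> x = 1)" for j
 proof -
  obtain \<eta> W where "\<eta> \<in> test_functions (U j)" "\<And>x. 0 <= \<eta> x" "\<And>x. \<eta> x <= (1::real)" "open W" "C j \<subseteq> W" "\<And>x. x \<in> W ==> \<eta> x = 1"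
   by (rule ex_cutoff[OF UC], rule that)
  then show ?thesis by (intro exI[of _ \<eta>]) auto
 qed
 then have "\<forall>j. \<exists>\<eta>. \<eta> \<in> test_functions (U j) \<and> (\<forall>x. 0 <= \<eta> x) \<and> (\<forall>x. \<eta> x <= (1::real)) \<and> (\<forall>x\<in>C j. \<eta> x = 1)" ..
 from choice[OF this] obtain \<eta> where \<eta>: "\<forall>j. \<eta> j \<in> test_functions (U j) \<and> (\<forall>x. 0 <= \<eta> j x) \<and> (\<forall>x. \<eta> j x <= (1::real)) \<and> (\<forall>x\<in>C j. \<eta> j x = 1)" ..
 have \<eta>1: "\<eta> j \<in> test_functions (U j)" "0 <= \<eta> j x" "\<eta> j x <= 1" for j x using \<eta> by simp_all
 define \<zeta> where "\<zeta> j x = \<eta> j x * (\<Prod>i<j. 1 - \<eta> i x)" for j x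
 note \<zeta> = smooth_partition[of "Suc M" \<eta> U, OF \<eta>1, folded \<zeta>_def]
 have one: "(\<Sum>j<Suc M. \<zeta> j x) = 1" if x: "x \<in> V" for x
 proof (cases "x \<in> K")
  case True
  then have "\<eta> M x = 1" using \<eta> unfolding C_def by simp
  then show ?thesis by (intro \<zeta>(4)[of M]) auto
 next
  case False
  then obtain y where y: "y \<in> F" "x \<in> ball y (r y / 2)" using x closure_subset[of V] unfolding K_def by blast
  obtain j where j: "j < M" "f j = y" using Ff[OF y(1)] by blast
  then have "x \<in> C j" using y(2) unfolding C_def by auto
  then have "\<eta> j x = 1" using \<eta> by blast
  then show ?thesis using j(1) by (intro \<zeta>(4)[of j]) auto
 qed
 have "\<forall>j. \<exists>S. j < Suc M --> compact S \<and> S \<subseteq> U j \<and> (\<forall>x. x \<notin> S --> \<zeta> j x = 0)"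
  using test_support[OF \<zeta>(1)] by blast
 from choice[OF this] obtain S where S: "\<forall>j. j < Suc M --> compact (S j) \<and> S j \<subseteq> U j \<and> (\<forall>x. x \<notin> S j --> \<zeta> j x = 0)" ..
 have "\<exists>a d. d > 0 \<and> (\<forall>s. 0 < s \<and> s < d --> outward V (S j) a s)" if j: "j < Suc M" for j
 proof (cases "j < M")
  case True
  then have "compact (S j) \<and> S j \<subseteq> ball (f j) (r (f j))" using S[rule_format, OF j] U_def[of j] by simp
  moreover have "f j \<in> frontier V" using fF[OF True] F(1) by blast
  ultimately show ?thesis using r by blast
 next
  case False
  then have "S j \<subseteq> V" using S[rule_format, OF j] U_def[of j] by simp
  \<comment> \<open>Vacuous, since \<open>S j\<close> has no point outside \<open>V\<close>.\<close>
  then have "outward V (S j) 0 s" for s unfolding outward_def by blast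
  then show ?thesis by (intro exI[of _ 0] exI[of _ 1]) simp
 qed
 then have "\<forall>j. \<exists>a. \<exists>d. j < Suc M --> d > 0 \<and> (\<forall>s. 0 < s \<and> s < d --> outward V (S j) a s)" by blast
 from choice[OF this] obtain a where "\<forall>j. \<exists>d. j < Suc M --> d > 0 \<and> (\<forall>s. 0 < s \<and> s < d --> outward V (S j) (a j) s)" ..
 from choice[OF this] obtain d where d: "\<forall>j. j < Suc M --> d j > 0 \<and> (\<forall>s. 0 < s \<and> s < d j --> outward V (S j) (a j) s)" ..
 define d0 where "d0 = Min (d ` {..<Suc M})"
 have "d0 \<in> d ` {..<Suc M}" unfolding d0_def by (rule Min_in) auto
 then have d0: "d0 > 0" "\<And>j. j < Suc M ==> d0 <= d j" using d unfolding d0_def by (auto intro: Min_le)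
 have out: "outward V (S j) (a j) s" if "j < Suc M" "0 < s" "s < d0" for j s
  using d that d0(2)[OF that(1)] by auto
 have tU: "\<zeta> j \<in> test_functions UNIV" if "j < Suc M" for j by (rule test_mono[OF \<zeta>(1)[OF that]]) simp
 show ?thesis
  by (rule exI[of _ "Suc M"], rule exI[of _ \<zeta>], rule exI[of _ S], rule exI[of _ a], rule exI[of _ d0])
   (use d0(1) tU S \<zeta>(2,3) one out in simp)
qed

section \<open>Local mollification of a field and its divergence\<close>

lemma sum_powr_le:
 fixes t :: "nat => real"
 assumes t: "\<And>i. i < N ==> 0 <= t i" and q: "q > 0"
 shows "(\<Sum>i<N. t i) powr q <= real N powr q * (\<Sum>i<N. t i powr q)"
proof (cases "N = 0")
 case False
 define m where "m = Max (t ` {..<N})"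
 have fin: "finite (t ` {..<N})" "t ` {..<N} \<noteq> {}" using False by auto
 obtain k where k: "k < N" "m = t k" using Max_in[OF fin] unfolding m_def by auto
 have "t i <= m" if "i < N" for i unfolding m_def using that by (intro Max_ge) auto
 then have "(\<Sum>i<N. t i) <= (\<Sum>i<N. m)" by (intro sum_mono) auto
 then have "(\<Sum>i<N. t i) <= real N * m" by simp
 then have "(\<Sum>i<N. t i) powr q <= (real N * m) powr q" using q t by (intro powr_mono2 sum_nonneg) auto
 also have "... = real N powr q * m powr q" by (rule powr_mult)
 also have "m powr q <= (\<Sum>i<N. t i powr q)" unfolding k(2) by (rule member_le_sum) (use k in auto)
 finally show ?thesis by (simp add: mult_left_mono)
qed simp

text \<open>The weak identity is applied to the reflected and translated kernel y -> k(x - y). When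
  \<open>g\<close> is the zero extension of a field, the support of this function may cross the
  boundary of the domain; hence the identity is asked for all test functions on the whole
  space.\<close>

lemma conv_divergence:
 fixes g :: "'a::euclidean_space => 'a" and h :: "'a => real"
 assumes g: "integrable lborel g" and h: "integrable lborel h" and k: "k \<in> test_functions UNIV"
  and wd: "\<And>v. v \<in> test_functions UNIV ==> (LBINT x. gradient v x \<bullet> g x) = - (LBINT x. v x * h x)"
 shows "divergence (conv k g) x = conv k h x"
proof -
 define v where "v y = k ((-1) *\<^sub>R y + x)" for y
 have v: "v \<in> test_functions UNIV" unfolding v_def[abs_def] by (rule test_affine[OF k]) simp
 have dv: "partial_deriv v b y = - partial_deriv k b (x - y)" for b y
 proof -
  have "(v has_derivative (%h. frechet_derivative k (at ((-1) *\<^sub>R y + x)) ((-1) *\<^sub>R h))) (at y)"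
   unfolding v_def[abs_def]
   by (rule has_derivative_compose[OF _ test_has_derivative[OF k]]) (auto intro!: derivative_eq_intros)
  from partial_deriv_eqI[OF this, of b] have "partial_deriv v b y = frechet_derivative k (at (x - y)) (- b)" by simp
  also have "... = - frechet_derivative k (at (x - y)) b"
   by (rule linear_neg[OF has_derivative_linear[OF test_has_derivative[OF k]]])
  finally show ?thesis unfolding partial_deriv_def .
 qed
 have ib: "integrable lborel (%y. partial_deriv k b (x - y) *\<^sub>R g y)" if "b \<in> Basis" for b
  by (rule conv_integrable[OF test_partial_deriv[OF k that] g])
 have "divergence (conv k g) x = (\<Sum>b\<in>Basis. conv (partial_deriv k b) g x \<bullet> b)"
  unfolding divergence_def by (intro sum.cong refl) (simp add: conv_partial_deriv[OF k g])
 also have "... = (\<Sum>b\<in>Basis. (LBINT y. (partial_deriv k b (x - y) *\<^sub>R g y) \<bullet> b))"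
  unfolding conv_def by (intro sum.cong refl integral_inner_left[symmetric] ib)
 also have "... = (LBINT y. (\<Sum>b\<in>Basis. (partial_deriv k b (x - y) *\<^sub>R g y) \<bullet> b))"
  by (rule Bochner_Integration.integral_sum[symmetric]) (rule integrable_inner_left, rule ib)
 also have "... = (LBINT y. - (gradient v y \<bullet> g y))"
  unfolding gradient_def dv inner_sum_left by (intro Bochner_Integration.integral_cong refl)
   (simp add: sum_negf inner_commute)
 also have "... = - (LBINT y. gradient v y \<bullet> g y)" by simp
 also have "... = (LBINT y. v y * h y)" unfolding wd[OF v] by simp
 also have "... = conv k h x" unfolding conv_def v_def by simp
 finally show ?thesis .
qed

text \<open>Even an off-centre kernel lives in a ball about the origin, so the error at
  \<open>x\<close> is at most a constant times the mean oscillation over a ball centred at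
  \<open>x\<close>. The limit is the value of the representative \<open>G\<close>, which agrees with
  \<open>g\<close> only almost everywhere.\<close>

lemma mollify_tendsto_lebesgue_point:
 fixes g G :: "'a::euclidean_space => 'a"
 assumes m: "mollifier \<rho> R" and U: "open U" and g: "integrable lborel g"
  and G: "AE y in lebesgue_on U. G y = g y" and x: "x \<in> U" and lp: "lebesgue_point G x"
 shows "((%e. mollify \<rho> e g x) \<longlongrightarrow> G x) (at_right 0)"
proof -
 have gm [measurable]: "g \<in> borel_measurable borel" using g by auto
 have \<rho>m [measurable]: "\<rho> \<in> borel_measurable borel" by (rule mollifierD(7)[OF m])
 obtain B where B: "B > 0" "\<And>z. norm (\<rho> z) <= B" using test_bounded[OF mollifierD(1)[OF m]] by metis
 \<comment> \<open>Larger than the radius of the kernel, so that the points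
   \<open>x - e *\<^sub>R z\<close> fall into the open ball of radius Q e.\<close>
 define Q where "Q = R + 1"
 have Q: "Q > 0" using mollifierD(5)[OF m] unfolding Q_def by simp
 obtain r0 where r0: "r0 > 0" "ball x r0 \<subseteq> U" using U x openE by blast
 define A where "A r = (1 / measure lebesgue (ball x r)) * (LINT y|lebesgue_on (ball x r). norm (G y - G x))" for r
 have A: "(A \<longlongrightarrow> 0) (at_right 0)" using lp unfolding lebesgue_point_def A_def .
 define \<omega> where "\<omega> = measure lebesgue (ball (0::'a) 1)"
 have vol: "measure lebesgue (ball x r) = \<omega> * r ^ DIM('a)" if "r > 0" for r
  using content_ball[of r x] content_ball[of 1 "0::'a"] that unfolding \<omega>_def by simp
 have \<omega>: "\<omega> > 0" unfolding \<omega>_def using content_ball_pos[of 1 "0::'a"] by simp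
 have bound: "norm (mollify \<rho> e g x - G x) <= B * \<omega> * Q ^ DIM('a) * A (Q * e)" if e: "0 < e" "e < r0 / Q" for e
 proof -
  define r where "r = Q * e"
  have r: "r > 0" "r < r0" unfolding r_def using e Q by (auto simp: field_simps)
  have bl: "ball x r \<subseteq> U" using r0 r by (auto simp: subset_iff)
  have bs: "ball x r \<in> sets lebesgue" by simp
  let ?k = "%y. indicator (ball x r) y * norm (g y - G x)"
  have km: "?k \<in> borel_measurable borel"
   by (intro borel_measurable_times borel_measurable_indicator borel_measurable_norm borel_measurable_diff gm) simp_all
  have ik: "integrable lborel ?k"
  proof -
   have "integrable lborel (%y. indicator (ball x r) y *\<^sub>R (g y - G x))"
   proof -
    have fin: "emeasure lborel (ball x r) < \<infinity>" by (rule emeasure_bounded_finite) simp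
    have "integrable lborel (%y. indicator (ball x r) y *\<^sub>R g y)" by (rule integrable_mult_indicator[OF _ g]) simp
    moreover have "integrable lborel (%y. indicator (ball x r) y *\<^sub>R G x)"
     by (intro integrable_scaleR_left integrable_real_indicator fin) simp
    ultimately show ?thesis unfolding scaleR_diff_right by (rule Bochner_Integration.integrable_diff)
   qed
   from integrable_norm[OF this] show ?thesis by (simp add: abs_mult)
  qed
  have kA: "(LBINT y. ?k y) = (LINT y|lebesgue_on (ball x r). norm (G y - G x))"
  proof -
   have "(LBINT y. ?k y) = (LINT y|lebesgue_on (ball x r). ?k y)"
    by (rule lebesgue_on_integral(1)[symmetric]) (auto simp: indicator_def)
   also have "... = (LINT y|lebesgue_on (ball x r). norm (g y - G x))"
    by (intro Bochner_Integration.integral_cong refl) simp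
   also have "... = (LINT y|lebesgue_on (ball x r). norm (G y - G x))"
   proof (rule integral_cong_AE)
    have "AE y in lebesgue. y \<in> U --> G y = g y"
     using G U by (subst (asm) AE_restrict_space_iff) (auto simp: lebesgue_openin)
    then have "AE y in lebesgue. y \<in> ball x r --> G y = g y" by eventually_elim (use bl in blast)
    then have ae: "AE y in lebesgue_on (ball x r). g y = G y" by (subst AE_restrict_space_iff) (auto elim!: eventually_mono)
    have gl: "g \<in> borel_measurable (lebesgue_on (ball x r))" by (rule borel_measurable_lebesgue_on[OF gm])
    then show "(%y. norm (g y - G x)) \<in> borel_measurable (lebesgue_on (ball x r))" by measurable
    have "G \<in> borel_measurable (lebesgue_on (ball x r))" by (rule borel_measurable_lebesgue_on_AE[OF bs gl ae])
    then show "(%y. norm (G y - G x)) \<in> borel_measurable (lebesgue_on (ball x r))" by measurable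
    show "AE y in lebesgue_on (ball x r). norm (g y - G x) = norm (G y - G x)" using ae by eventually_elim simp
   qed
   finally show ?thesis .
  qed
  have i1: "integrable lborel (%z. \<rho> z *\<^sub>R g (x - e *\<^sub>R z))" by (rule mollify_integrable[OF mollifierD(1)[OF m] e(1) g])
  have i2: "integrable lborel (%z. \<rho> z *\<^sub>R G x)" using mollifierD(6)[OF m] by simp
  have ik2: "integrable lborel (%z. ?k (x + (- e) *\<^sub>R z))" by (rule lborel_integrable_affine[OF ik]) (use e in simp)
  have "mollify \<rho> e g x - G x = (LBINT z. \<rho> z *\<^sub>R g (x - e *\<^sub>R z) - \<rho> z *\<^sub>R G x)"
   unfolding mollify_def using Bochner_Integration.integral_diff[OF i1 i2] mollifierD(3,6)[OF m] by simp
  then have "norm (mollify \<rho> e g x - G x) <= (LBINT z. norm (\<rho> z *\<^sub>R g (x - e *\<^sub>R z) - \<rho> z *\<^sub>R G x))"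
   by (simp only: integral_norm_bound)
  also have "... <= (LBINT z. B * ?k (x + (- e) *\<^sub>R z))"
  proof (rule integral_mono)
   show "integrable lborel (%z. norm (\<rho> z *\<^sub>R g (x - e *\<^sub>R z) - \<rho> z *\<^sub>R G x))"
    by (intro integrable_norm Bochner_Integration.integrable_diff i1 i2)
   show "integrable lborel (%z. B * ?k (x + (- e) *\<^sub>R z))" using ik2 by (rule integrable_mult_right)
   fix z
   have eq: "norm (\<rho> z *\<^sub>R g (x - e *\<^sub>R z) - \<rho> z *\<^sub>R G x) = norm (\<rho> z) * norm (g (x - e *\<^sub>R z) - G x)"
    by (simp flip: scaleR_diff_right)
   show "norm (\<rho> z *\<^sub>R g (x - e *\<^sub>R z) - \<rho> z *\<^sub>R G x) <= B * ?k (x + (- e) *\<^sub>R z)"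
   proof (cases "\<rho> z = 0")
    case True
    then show ?thesis using B(1) by (simp add: eq)
   next
    case False
    then have "norm z <= R" by (rule mollifierD(4)[OF m])
    then have "e * norm z <= e * R" using e by (intro mult_left_mono) auto
    also have "e * R < r" unfolding r_def Q_def using e by (simp add: algebra_simps)
    finally have "norm (e *\<^sub>R z) < r" using e by simp
    then have "x + (- e) *\<^sub>R z \<in> ball x r" by (simp add: dist_norm del: norm_scaleR)
    then show ?thesis unfolding eq using mult_right_mono[OF B(2)[of z] norm_ge_zero[of "g (x - e *\<^sub>R z) - G x"]] by simp
   qed
  qed
  also have "... = B * (LBINT z. ?k (x + (- e) *\<^sub>R z))" by simp
  also have "(LBINT z. ?k (x + (- e) *\<^sub>R z)) = (1 / e ^ DIM('a)) * (LBINT y. ?k y)"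
   using lborel_integral_affine[OF km, of "- e" x] e by simp
  also have "B * ((1 / e ^ DIM('a)) * (LBINT y. ?k y)) = B * \<omega> * Q ^ DIM('a) * A r"
   unfolding A_def kA vol[OF r(1)] unfolding r_def using \<omega> Q e by (simp add: power_mult_distrib)
  finally show ?thesis unfolding r_def .
 qed
 have "((%e. A (Q * e)) \<longlongrightarrow> 0) (at_right 0)"
 proof (rule filterlim_compose[OF A])
  show "filterlim ((*) Q) (at_right 0) (at_right 0)"
   unfolding filterlim_at
   using Q by (auto intro!: tendsto_eq_intros simp: eventually_at_right_field intro: exI[of _ 1])
 qed
 then have "((%e. B * \<omega> * Q ^ DIM('a) * A (Q * e)) \<longlongrightarrow> B * \<omega> * Q ^ DIM('a) * 0) (at_right 0)"
  by (intro tendsto_mult tendsto_const)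
 then have lim0: "((%e. B * \<omega> * Q ^ DIM('a) * A (Q * e)) \<longlongrightarrow> 0) (at_right 0)" by simp
 have "((%e. mollify \<rho> e g x - G x) \<longlongrightarrow> 0) (at_right 0)"
 proof (rule Lim_null_comparison[OF _ lim0])
  show "\<forall>\<^sub>F e in at_right 0. norm (mollify \<rho> e g x - G x) <= B * \<omega> * Q ^ DIM('a) * A (Q * e)"
   unfolding eventually_at_right_field using bound r0(1) Q by (intro exI[of _ "r0 / Q"]) auto
 qed
 then show ?thesis by (rule LIM_zero_cancel)
qed

lemma divergence_sum:
 fixes f :: "'i => 'a::euclidean_space => 'a"
 assumes "\<And>i. i \<in> I ==> f i differentiable (at x)"
 shows "divergence (%x. \<Sum>i\<in>I. f i x) x = (\<Sum>i\<in>I. divergence (f i) x)"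
 using assms
proof (induction I rule: infinite_finite_induct)
 case (insert i I)
 have "(%x. \<Sum>i\<in>I. f i x) differentiable (at x)" by (rule differentiable_sum) (use insert in auto)
 then show ?case using insert by (simp add: divergence_add)
qed (simp_all add: divergence_const)

text \<open>In the divergence of the glued field the terms with \<open>gradient (\<zeta> i)\<close>
  do not tend to 0 one by one; they do so together because the gradients of a partition of unity
  cancel.\<close>

lemma sum_gradient_partition:
 fixes \<zeta> :: "nat => 'a::euclidean_space => real"
 assumes \<zeta>: "\<And>i. i < N ==> \<zeta> i \<in> test_functions UNIV" and U: "open U" "x \<in> U" "\<And>x. x \<in> U ==> (\<Sum>i<N. \<zeta> i x) = 1"
 shows "(\<Sum>i<N. gradient (\<zeta> i) x \<bullet> w) = 0"
proof -
 have 1: "((%x. \<Sum>i<N. \<zeta> i x) has_derivative (%h. \<Sum>i<N. frechet_derivative (\<zeta> i) (at x) h)) (at x)"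
  by (rule has_derivative_sum) (rule test_has_derivative[OF \<zeta>], simp)
 have 2: "((%x. \<Sum>i<N. \<zeta> i x) has_derivative (%h. 0)) (at x)"
  by (rule has_derivative_transform_within_open[OF has_derivative_const[of 1] U(1,2)]) (use U(3) in simp)
 have "(\<Sum>i<N. frechet_derivative (\<zeta> i) (at x) w) = 0"
  using fun_cong[OF has_derivative_unique[OF 1 2], of w] .
 then show ?thesis using gradient_inner[OF test_differentiable[OF \<zeta>]] by simp
qed

text \<open>\<open>g\<close> and \<open>h\<close> are extensions by 0, and \<open>wd\<close>,
  imposed for test functions on the whole space, says that the extended field has the extended
  divergence: its normal trace is zero. The kernel \<open>\<rho> i\<close> sits around
  \<open>a i\<close>, so near points of \<open>S i\<close> outside the domain the mollification
  reads only values outside it.\<close>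

locale lipschitz_mollification =
 fixes \<Omega> :: "'a::euclidean_space set" and N :: nat and \<zeta> :: "nat => 'a => real" and S a d and \<rho> and g :: "'a => 'a" and h :: "'a => real" and c q :: real
 assumes \<Omega>: "open \<Omega>" "bounded \<Omega>" and d: "d > 0"
  and \<zeta>: "\<And>i. i < N ==> \<zeta> i \<in> test_functions UNIV" "\<And>i. i < N ==> compact (S i)" "\<And>i x. i < N ==> x \<notin> S i ==> \<zeta> i x = 0"
   "\<And>i x. 0 <= \<zeta> i x" "\<And>x. (\<Sum>i<N. \<zeta> i x) <= 1" "\<And>x. x \<in> \<Omega> ==> (\<Sum>i<N. \<zeta> i x) = 1"
  and out: "\<And>i \<epsilon>. i < N ==> 0 < \<epsilon> ==> \<epsilon> < d ==> outward \<Omega> (S i) (a i) \<epsilon>"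
  and \<rho>: "\<And>i. mollifier (\<rho> i) (norm (a i) + 1)" "\<And>i z. \<rho> i z \<noteq> 0 ==> norm (z - a i) <= 1"
  and g: "integrable lborel g" "\<And>x. norm (g x) <= c" "\<And>x. x \<notin> \<Omega> ==> g x = 0" "integrable lborel (%x. norm (g x) powr q)"
  and h: "integrable lborel h" "\<And>x. x \<notin> \<Omega> ==> h x = 0" "integrable lborel (%x. norm (h x) powr q)"
  and q: "q > 1"
  and wd: "\<And>v. v \<in> test_functions UNIV ==> (LBINT x. gradient v x \<bullet> g x) = - (LBINT x. v x * h x)"
begin

definition \<Phi> :: "real => 'a => 'a" where "\<Phi> \<epsilon> x = (\<Sum>i<N. \<zeta> i x *\<^sub>R mollify (\<rho> i) \<epsilon> g x)"

lemma c_nonneg: "0 <= c" using g(2)[of 0] norm_ge_zero[of "g 0"] by linarith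

lemma \<zeta>_le_1: "i < N ==> \<zeta> i x <= 1"
proof -
 assume i: "i < N"
 have "\<zeta> i x <= (\<Sum>i<N. \<zeta> i x)" by (rule member_le_sum) (use i \<zeta>(4) in auto)
 then show ?thesis using \<zeta>(5)[of x] by simp
qed

lemma smooth_mollify: "0 < \<epsilon> ==> k_smooth k (mollify (\<rho> i) \<epsilon> g)"
 by (rule mollify_k_smooth[OF mollifierD(1)[OF \<rho>(1)] _ g(1)])

lemma term_test: "0 < \<epsilon> ==> i < N ==> (%x. \<zeta> i x *\<^sub>R mollify (\<rho> i) \<epsilon> g x) \<in> test_functions UNIV"
 by (rule test_bilinear[OF bounded_bilinear_scaleR \<zeta>(1)]) (auto intro: smooth_mollify)

text \<open>Each point outside the domain needs a whole neighbourhood on which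
  \<open>\<Phi> \<epsilon>\<close> vanishes, since the closure of the nonzero set has to stay
  inside. At points of \<open>S i\<close> the displaced kernel sees only the zero extension; at the
  others \<open>\<zeta> i\<close> vanishes nearby.\<close>

lemma \<Phi>_test: assumes \<epsilon>: "0 < \<epsilon>" "\<epsilon> < d" shows "\<Phi> \<epsilon> \<in> test_functions \<Omega>"
proof -
 have T: "\<Phi> \<epsilon> \<in> test_functions UNIV" unfolding \<Phi>_def[abs_def] by (rule test_sum) (use term_test \<epsilon> in auto)
 have "\<exists>\<delta>>0. \<forall>x. dist y x < \<delta> --> \<Phi> \<epsilon> x = 0" if y: "y \<notin> \<Omega>" for y
 proof -
  have "\<exists>\<delta>>0. \<forall>x. dist y x < \<delta> --> \<zeta> i x *\<^sub>R mollify (\<rho> i) \<epsilon> g x = 0" if i: "i < N" for i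
  proof (cases "y \<in> S i")
   case True
   have "mollify (\<rho> i) \<epsilon> g x = 0" if x: "dist y x < \<epsilon>" for x
   proof (rule mollify_eq_0[OF \<rho>(1)], rule g(3))
    fix z assume "\<rho> i z \<noteq> 0"
    then have "norm (\<epsilon> *\<^sub>R (z - a i)) <= \<epsilon>" using \<rho>(2)[of i z] \<epsilon> by (simp add: mult_left_le)
    then have "x - \<epsilon> *\<^sub>R a i - \<epsilon> *\<^sub>R (z - a i) \<notin> \<Omega>"
     using out[OF i \<epsilon>] True y x unfolding outward_def by (auto simp: dist_commute)
    then show "x - \<epsilon> *\<^sub>R z \<notin> \<Omega>" by (simp add: algebra_simps)
   qed
   then show ?thesis using \<epsilon> by (intro exI[of _ \<epsilon>]) simp
  next
   case False
   have op: "open (- S i)" by (rule open_Compl[OF compact_imp_closed[OF \<zeta>(2)[OF i]]])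
   obtain \<delta> where \<delta>: "\<delta> > 0" "ball y \<delta> \<subseteq> - S i" by (rule openE[OF op, of y]) (use False in simp)
   have "\<zeta> i x *\<^sub>R mollify (\<rho> i) \<epsilon> g x = 0" if "dist y x < \<delta>" for x
   proof -
    have "x \<in> ball y \<delta>" using that by simp
    then have "x \<notin> S i" using \<delta>(2) by blast
    then show ?thesis using \<zeta>(3)[OF i] by simp
   qed
   then show ?thesis using \<delta>(1) by blast
  qed
  then have "\<forall>i. \<exists>\<delta>. i < N --> \<delta> > 0 \<and> (\<forall>x. dist y x < \<delta> --> \<zeta> i x *\<^sub>R mollify (\<rho> i) \<epsilon> g x = 0)" by auto
  from choice[OF this] obtain \<delta> where \<delta>: "\<forall>i. i < N --> \<delta> i > 0 \<and> (\<forall>x. dist y x < \<delta> i --> \<zeta> i x *\<^sub>R mollify (\<rho> i) \<epsilon> g x = 0)" ..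
  define D where "D = Min (insert 1 (\<delta> ` {..<N}))"
  have D: "D > 0" "\<And>i. i < N ==> D <= \<delta> i" unfolding D_def using \<delta> by (auto simp: Min_gr_iff)
  have "\<Phi> \<epsilon> x = 0" if x: "dist y x < D" for x
   unfolding \<Phi>_def
  proof (rule sum.neutral, rule ballI)
   fix i assume "i \<in> {..<N}"
   then have i: "i < N" by simp
   have "dist y x < \<delta> i" using D(2)[OF i] x by simp
   then show "\<zeta> i x *\<^sub>R mollify (\<rho> i) \<epsilon> g x = 0" using \<delta> i by blast
  qed
  then show ?thesis using D(1) by blast
 qed
 note near = this
 have "y \<notin> closure {x. \<Phi> \<epsilon> x \<noteq> 0}" if y: "y \<notin> \<Omega>" for y
 proof
  assume y': "y \<in> closure {x. \<Phi> \<epsilon> x \<noteq> 0}"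
  obtain \<delta> where \<delta>: "\<delta> > 0" "\<forall>x. dist y x < \<delta> --> \<Phi> \<epsilon> x = 0" using near[OF y] by blast
  obtain x where x: "x \<in> {x. \<Phi> \<epsilon> x \<noteq> 0}" "dist x y < \<delta>" using y' \<delta>(1) unfolding closure_approachable by blast
  have "\<Phi> \<epsilon> x = 0" using \<delta>(2) x(2) by (simp add: dist_commute)
  then show False using x(1) by simp
 qed
 then have "closure {x. \<Phi> \<epsilon> x \<noteq> 0} \<subseteq> \<Omega>" by blast
 then show ?thesis using T unfolding test_functions_def by simp
qed

lemma \<Phi>_bound: assumes \<epsilon>: "0 < \<epsilon>" shows "norm (\<Phi> \<epsilon> x) <= c"
proof -
 have "norm (\<Phi> \<epsilon> x) <= (\<Sum>i<N. \<zeta> i x * c)" unfolding \<Phi>_def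
  by (rule order_trans[OF norm_sum], rule sum_mono)
   (use mollify_norm_le[OF \<rho>(1) g(1) \<epsilon> g(2)] \<zeta>(4) in \<open>simp add: mult_left_mono\<close>)
 also have "... = (\<Sum>i<N. \<zeta> i x) * c" by (rule sum_distrib_right[symmetric])
 also have "... <= c" using mult_right_mono[OF \<zeta>(5)[of x] c_nonneg] by simp
 finally show ?thesis .
qed

lemma divergence_\<Phi>:
 assumes \<epsilon>: "0 < \<epsilon>"
 shows "divergence (\<Phi> \<epsilon>) x = (\<Sum>i<N. \<zeta> i x * mollify (\<rho> i) \<epsilon> h x + gradient (\<zeta> i) x \<bullet> mollify (\<rho> i) \<epsilon> g x)"
proof -
 have dm: "divergence (mollify (\<rho> i) \<epsilon> g) x = mollify (\<rho> i) \<epsilon> h x" for i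
 proof -
  have 1: "mollify (\<rho> i) \<epsilon> g = conv (scaled (\<rho> i) \<epsilon>) g"
   by (rule mollify_eq_conv[OF mollifierD(7)[OF \<rho>(1)] _ \<epsilon>]) (use g(1) in auto)
  have 2: "mollify (\<rho> i) \<epsilon> h = conv (scaled (\<rho> i) \<epsilon>) h"
   by (rule mollify_eq_conv[OF mollifierD(7)[OF \<rho>(1)] _ \<epsilon>]) (use h(1) in auto)
  show ?thesis unfolding 1 2
   by (rule conv_divergence[OF g(1) h(1) scaled_test[OF mollifierD(1)[OF \<rho>(1)] \<epsilon>] wd])
 qed
 have diff: "mollify (\<rho> i) \<epsilon> g differentiable (at x)" for i using smooth_mollify[OF \<epsilon>, of "Suc 0" i] by simp
 have "divergence (\<Phi> \<epsilon>) x = (\<Sum>i<N. divergence (%x. \<zeta> i x *\<^sub>R mollify (\<rho> i) \<epsilon> g x) x)"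
  unfolding \<Phi>_def[abs_def] by (rule divergence_sum) (use test_differentiable[OF term_test[OF \<epsilon>]] in auto)
 also have "... = (\<Sum>i<N. \<zeta> i x * mollify (\<rho> i) \<epsilon> h x + gradient (\<zeta> i) x \<bullet> mollify (\<rho> i) \<epsilon> g x)"
  by (intro sum.cong refl) (simp add: divergence_scaleR[OF test_differentiable[OF \<zeta>(1)] diff] dm)
 finally show ?thesis .
qed

lemma mollify_diff_Lq:
 fixes f :: "'a => 'b::euclidean_space"
 assumes f: "integrable lborel f" "\<And>x. x \<notin> \<Omega> ==> f x = 0" "integrable lborel (%x. norm (f x) powr q)"
 shows "0 < \<epsilon> ==> integrable lborel (%x. norm (mollify (\<rho> i) \<epsilon> f x - f x) powr q)"
  "((%\<epsilon>. (LBINT x. norm (mollify (\<rho> i) \<epsilon> f x - f x) powr q)) \<longlongrightarrow> 0) (at_right 0)"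
proof -
 show "((%\<epsilon>. (LBINT x. norm (mollify (\<rho> i) \<epsilon> f x - f x) powr q)) \<longlongrightarrow> 0) (at_right 0)"
  by (rule mollify_tendsto_Lq[OF \<rho>(1) \<Omega> f q])
 assume e: "0 < \<epsilon>"
 have fm [measurable]: "f \<in> borel_measurable borel" using f(1) by auto
 have mm [measurable]: "mollify (\<rho> i) \<epsilon> f \<in> borel_measurable borel"
  by (rule borel_measurable_continuous_onI[OF k_smooth_continuous[OF mollify_k_smooth[OF mollifierD(1)[OF \<rho>(1)] e f(1), of 0]]])
 show "integrable lborel (%x. norm (mollify (\<rho> i) \<epsilon> f x - f x) powr q)"
 proof (rule Bochner_Integration.integrable_bound)
  show "integrable lborel (%x. 2 powr q * (norm (mollify (\<rho> i) \<epsilon> f x) powr q + norm (f x) powr q))"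
   by (intro integrable_mult_right Bochner_Integration.integrable_add mollify_Lq_bound[OF \<rho>(1) f(1,3) e q] f(3))
  show "AE x in lborel. norm (norm (mollify (\<rho> i) \<epsilon> f x - f x) powr q) <= norm (2 powr q * (norm (mollify (\<rho> i) \<epsilon> f x) powr q + norm (f x) powr q))"
   using norm_add_powr_le[of q "mollify (\<rho> i) \<epsilon> f x" "- f x" for x] q by (intro AE_I2) simp
 qed measurable
qed

text \<open>The common form of the two error terms \<open>\<Phi> - g\<close> and \<open>div \<Phi> - h\<close>.\<close>

lemma error_tendsto:
 fixes E :: "real => 'a => 'b::euclidean_space"
 assumes E: "\<And>\<epsilon> x. 0 < \<epsilon> ==> \<epsilon> < d ==> norm (E \<epsilon> x) <= (\<Sum>i<N. norm (mollify (\<rho> i) \<epsilon> h x - h x) + B i * norm (mollify (\<rho> i) \<epsilon> g x - g x))"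
  and B: "\<And>i. i < N ==> B i \<ge> 0"
 shows "((%\<epsilon>. (LBINT x. norm (E \<epsilon> x) powr q)) \<longlongrightarrow> 0) (at_right 0)"
proof -
 let ?h = "%i \<epsilon> x. norm (mollify (\<rho> i) \<epsilon> h x - h x) powr q"
 let ?g = "%i \<epsilon> x. norm (mollify (\<rho> i) \<epsilon> g x - g x) powr q"
 let ?D = "%\<epsilon>. real N powr q * (\<Sum>i<N. 2 powr q * ((LBINT x. ?h i \<epsilon> x) + B i powr q * (LBINT x. ?g i \<epsilon> x)))"
 have mh1: "integrable lborel (?h i \<epsilon>)" if "0 < \<epsilon>" for i \<epsilon>
  by (rule mollify_diff_Lq(1)[OF h that])
 have mg1: "integrable lborel (?g i \<epsilon>)" if "0 < \<epsilon>" for i \<epsilon>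
  by (rule mollify_diff_Lq(1)[OF g(1,3,4) that])
 have lim: "(?D \<longlongrightarrow> real N powr q * (\<Sum>i<N. 2 powr q * (0 + B i powr q * 0))) (at_right 0)"
  by (intro tendsto_mult tendsto_const tendsto_sum tendsto_add mollify_diff_Lq(2)[OF h] mollify_diff_Lq(2)[OF g(1,3,4)])
 have bound: "(LBINT x. norm (E \<epsilon> x) powr q) <= ?D \<epsilon>" if \<epsilon>: "0 < \<epsilon>" "\<epsilon> < d" for \<epsilon>
 proof -
  have i1: "integrable lborel (%x. 2 powr q * (?h i \<epsilon> x + B i powr q * ?g i \<epsilon> x))" for i
   by (intro integrable_mult_right Bochner_Integration.integrable_add mh1 mg1 \<epsilon>)
  have "(LBINT x. norm (E \<epsilon> x) powr q) <= (LBINT x. real N powr q * (\<Sum>i<N. 2 powr q * (?h i \<epsilon> x + B i powr q * ?g i \<epsilon> x)))"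
  proof (rule integral_mono')
   show "integrable lborel (%x. real N powr q * (\<Sum>i<N. 2 powr q * (?h i \<epsilon> x + B i powr q * ?g i \<epsilon> x)))"
    by (intro integrable_mult_right Bochner_Integration.integrable_sum i1)
   fix x
   let ?t = "%i. norm (mollify (\<rho> i) \<epsilon> h x - h x) + B i * norm (mollify (\<rho> i) \<epsilon> g x - g x)"
   have t: "0 <= ?t i" if "i < N" for i using B[OF that] by simp
   have "norm (E \<epsilon> x) powr q <= (\<Sum>i<N. ?t i) powr q" by (rule powr_mono2) (use q E[OF \<epsilon>] in auto)
   also have "... <= real N powr q * (\<Sum>i<N. ?t i powr q)" by (rule sum_powr_le[OF t]) (use q in auto)
   also have "... <= real N powr q * (\<Sum>i<N. 2 powr q * (?h i \<epsilon> x + B i powr q * ?g i \<epsilon> x))"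
   proof (intro mult_left_mono sum_mono)
    fix i assume "i \<in> {..<N}"
    then have Bi: "B i \<ge> 0" using B by simp
    have "?t i powr q <= 2 powr q * (?h i \<epsilon> x + (B i * norm (mollify (\<rho> i) \<epsilon> g x - g x)) powr q)"
     using norm_add_powr_le[of q "norm (mollify (\<rho> i) \<epsilon> h x - h x)" "B i * norm (mollify (\<rho> i) \<epsilon> g x - g x)"] q Bi by simp
    also have "(B i * norm (mollify (\<rho> i) \<epsilon> g x - g x)) powr q = B i powr q * ?g i \<epsilon> x" by (rule powr_mult)
    finally show "?t i powr q <= 2 powr q * (?h i \<epsilon> x + B i powr q * ?g i \<epsilon> x)" .
   qed simp
   finally show "norm (E \<epsilon> x) powr q <= real N powr q * (\<Sum>i<N. 2 powr q * (?h i \<epsilon> x + B i powr q * ?g i \<epsilon> x))" .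
  qed (intro mult_nonneg_nonneg sum_nonneg add_nonneg_nonneg powr_ge_zero)
  also have "... = ?D \<epsilon>"
   using i1 mh1[OF \<epsilon>(1)] mg1[OF \<epsilon>(1)] by simp
  finally show ?thesis .
 qed
 have ev: "\<forall>\<^sub>F \<epsilon> in at_right 0. 0 < \<epsilon> \<and> \<epsilon> < d" unfolding eventually_at_right_field using d by auto
 have lim0: "(?D \<longlongrightarrow> 0) (at_right 0)" using lim by simp
 show ?thesis
 proof (rule tendsto_sandwich[OF _ _ tendsto_const lim0])
  show "\<forall>\<^sub>F \<epsilon> in at_right 0. 0 <= (LBINT x. norm (E \<epsilon> x) powr q)" by simp
  show "\<forall>\<^sub>F \<epsilon> in at_right 0. (LBINT x. norm (E \<epsilon> x) powr q) <= ?D \<epsilon>" using ev by (rule eventually_mono) (use bound in auto)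
 qed
qed

lemma \<Phi>_tendsto: "((%\<epsilon>. (LBINT x. norm (\<Phi> \<epsilon> x - g x) powr q)) \<longlongrightarrow> 0) (at_right 0)"
proof (rule error_tendsto[where B="%i. 1"])
 fix \<epsilon> x assume \<epsilon>: "0 < \<epsilon>" "\<epsilon> < d"
 show "norm (\<Phi> \<epsilon> x - g x) <= (\<Sum>i<N. norm (mollify (\<rho> i) \<epsilon> h x - h x) + 1 * norm (mollify (\<rho> i) \<epsilon> g x - g x))"
 proof (cases "x \<in> \<Omega>")
  case True
  have "g x = (\<Sum>i<N. \<zeta> i x) *\<^sub>R g x" using \<zeta>(6)[OF True] by simp
  then have "\<Phi> \<epsilon> x - g x = (\<Sum>i<N. \<zeta> i x *\<^sub>R mollify (\<rho> i) \<epsilon> g x) - (\<Sum>i<N. \<zeta> i x) *\<^sub>R g x" unfolding \<Phi>_def by simp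
  also have "... = (\<Sum>i<N. \<zeta> i x *\<^sub>R (mollify (\<rho> i) \<epsilon> g x - g x))"
   by (simp add: scaleR_sum_left sum_subtractf scaleR_diff_right)
  finally have "norm (\<Phi> \<epsilon> x - g x) <= (\<Sum>i<N. norm (\<zeta> i x *\<^sub>R (mollify (\<rho> i) \<epsilon> g x - g x)))"
   by (simp only: norm_sum)
  also have "... <= (\<Sum>i<N. norm (mollify (\<rho> i) \<epsilon> h x - h x) + 1 * norm (mollify (\<rho> i) \<epsilon> g x - g x))"
  proof (rule sum_mono)
   fix i assume "i \<in> {..<N}"
   then show "norm (\<zeta> i x *\<^sub>R (mollify (\<rho> i) \<epsilon> g x - g x)) <= norm (mollify (\<rho> i) \<epsilon> h x - h x) + 1 * norm (mollify (\<rho> i) \<epsilon> g x - g x)"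
    using mult_right_mono[OF \<zeta>_le_1[of i x] norm_ge_zero[of "mollify (\<rho> i) \<epsilon> g x - g x"]] \<zeta>(4)[of i x] by (simp add: add_increasing)
  qed
  finally show ?thesis .
 next
  case False
  then have "norm (\<Phi> \<epsilon> x - g x) = 0" using test_outside[OF \<Phi>_test[OF \<epsilon>]] g(3) by simp
  then show ?thesis by (simp add: sum_nonneg)
 qed
qed simp

lemma divergence_\<Phi>_tendsto: "((%\<epsilon>. (LBINT x. norm (divergence (\<Phi> \<epsilon>) x - h x) powr q)) \<longlongrightarrow> 0) (at_right 0)"
proof -
 have "\<forall>i. \<exists>B. i < N --> B > 0 \<and> (\<forall>x. norm (gradient (\<zeta> i) x) <= B)"
  using test_bounded[OF gradient_test_function[OF \<zeta>(1)]] by metis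
 from choice[OF this] obtain B where B: "\<forall>i. i < N --> B i > 0 \<and> (\<forall>x. norm (gradient (\<zeta> i) x) <= B i)" ..
 show ?thesis
 proof (rule error_tendsto[where B=B])
  fix \<epsilon> x assume \<epsilon>: "0 < \<epsilon>" "\<epsilon> < d"
  let ?h = "%i. mollify (\<rho> i) \<epsilon> h x - h x" and ?g = "%i. mollify (\<rho> i) \<epsilon> g x - g x"
  show "norm (divergence (\<Phi> \<epsilon>) x - h x) <= (\<Sum>i<N. norm (?h i) + B i * norm (?g i))"
  proof (cases "x \<in> \<Omega>")
   case True
   have 1: "h x = (\<Sum>i<N. \<zeta> i x) * h x" using \<zeta>(6)[OF True] by simp
   \<comment> \<open>Subtracting this zero sum pairs each gradient with the mollification error of
     \<open>g\<close> instead of the mollified field.\<close>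
   have 2: "(\<Sum>i<N. gradient (\<zeta> i) x \<bullet> g x) = 0" by (rule sum_gradient_partition[OF \<zeta>(1) \<Omega>(1) True \<zeta>(6)])
   have "divergence (\<Phi> \<epsilon>) x - h x = (\<Sum>i<N. \<zeta> i x * mollify (\<rho> i) \<epsilon> h x + gradient (\<zeta> i) x \<bullet> mollify (\<rho> i) \<epsilon> g x)
     - (\<Sum>i<N. \<zeta> i x) * h x - (\<Sum>i<N. gradient (\<zeta> i) x \<bullet> g x)"
    unfolding divergence_\<Phi>[OF \<epsilon>(1)] 2 using 1 by simp
   also have "... = (\<Sum>i<N. \<zeta> i x * ?h i + gradient (\<zeta> i) x \<bullet> ?g i)"
    unfolding sum_distrib_right by (simp add: algebra_simps sum.distrib sum_subtractf)
   finally have "norm (divergence (\<Phi> \<epsilon>) x - h x) <= (\<Sum>i<N. norm (\<zeta> i x * ?h i + gradient (\<zeta> i) x \<bullet> ?g i))"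
    by (simp only: norm_sum)
   also have "... <= (\<Sum>i<N. norm (?h i) + B i * norm (?g i))"
   proof (rule sum_mono)
    fix i assume "i \<in> {..<N}"
    then have i: "i < N" by simp
    have "norm (\<zeta> i x * ?h i) <= norm (?h i)"
     using mult_right_mono[OF \<zeta>_le_1[OF i, of x] norm_ge_zero[of "?h i"]] \<zeta>(4)[of i x] by (simp add: abs_mult)
    moreover have "norm (gradient (\<zeta> i) x \<bullet> ?g i) <= B i * norm (?g i)"
     using Cauchy_Schwarz_ineq2[of "gradient (\<zeta> i) x" "?g i"] mult_right_mono[of "norm (gradient (\<zeta> i) x)" "B i" "norm (?g i)"] B i by auto
    ultimately show "norm (\<zeta> i x * ?h i + gradient (\<zeta> i) x \<bullet> ?g i) <= norm (?h i) + B i * norm (?g i)"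
     by (rule norm_triangle_mono)
   qed
   finally show ?thesis .
  next
   case False
   then have 0: "norm (divergence (\<Phi> \<epsilon>) x - h x) = 0"
    using test_outside[OF divergence_test_function[OF \<Phi>_test[OF \<epsilon>]]] h(2) by simp
   show ?thesis unfolding 0 by (rule sum_nonneg) (use B in \<open>simp add: less_imp_le\<close>)
  qed
 qed (use B in \<open>simp add: less_imp_le\<close>)
qed

lemma \<Phi>_lebesgue_point:
 assumes G: "AE y in lebesgue_on \<Omega>. G y = g y" and x: "x \<in> \<Omega>" and lp: "lebesgue_point G x"
 shows "((%\<epsilon>. \<Phi> \<epsilon> x) \<longlongrightarrow> G x) (at_right 0)"
proof -
 have "((%\<epsilon>. \<Phi> \<epsilon> x) \<longlongrightarrow> (\<Sum>i<N. \<zeta> i x *\<^sub>R G x)) (at_right 0)" unfolding \<Phi>_def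
  by (intro tendsto_sum tendsto_scaleR tendsto_const mollify_tendsto_lebesgue_point[OF \<rho>(1) \<Omega>(1) g(1) G x lp])
 then show ?thesis using \<zeta>(6)[OF x] by (simp flip: scaleR_sum_left)
qed

end

text \<open>Hypotheses on classes of functions are transferred to Borel representatives extended by
  0. The last clause covers every representative \<open>G\<close>, because the one fixed in the
  notion of convergence is arbitrary.\<close>

lemma lipschitz_approximation:
 fixes U :: "'a::euclidean_space set" and g :: "'a => 'a" and h :: "'a => real"
 assumes U: "bounded_lipschitz_domain U" and q: "q > 1"
  and g: "g \<in> borel_measurable (lebesgue_on U)" "AE x in lebesgue_on U. norm (g x) <= c" "c \<ge> 0" and h: "h \<in> Lp q U"
  and wd: "\<And>v. v \<in> test_functions UNIV ==>
   (LINT x|lebesgue_on U. gradient v x \<bullet> g x) = - (LINT x|lebesgue_on U. v x * h x)"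
 shows "\<exists>\<phi> :: nat => 'a => 'a. (\<forall>n. \<phi> n \<in> test_functions U) \<and> (\<forall>n x. norm (\<phi> n x) <= c) \<and>
  (%n. LINT x|lebesgue_on U. norm (\<phi> n x - g x) powr q) \<longlonglongrightarrow> 0 \<and>
  (%n. LINT x|lebesgue_on U. norm (divergence (\<phi> n) x - h x) powr q) \<longlonglongrightarrow> 0 \<and>
  (\<forall>G x. (AE y in lebesgue_on U. G y = g y) --> x \<in> U --> lebesgue_point G x --> (%n. \<phi> n x) \<longlonglongrightarrow> G x)"
proof -
 have op: "open U" and bd: "bounded U" using U unfolding bounded_lipschitz_domain_def by auto
 have Ul: "U \<in> sets lebesgue" using op by (simp add: lebesgue_openin)
 note fin = bounded_finite_lebesgue_on[OF op bd]
 obtain G0 where G0 [measurable]: "G0 \<in> borel_measurable borel" and G0': "AE x in lebesgue_on U. G0 x = g x" "\<And>x. x \<notin> U ==> G0 x = 0"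
  by (rule borel_representative[OF op g(1)], rule that)
 obtain H where H: "H \<in> borel_measurable borel" "AE x in lebesgue_on U. H x = h x" "\<And>x. x \<notin> U ==> H x = 0"
  by (rule borel_representative[OF op Lp_D(1)[OF h]], rule that)
 \<comment> \<open>The bound by \<open>c\<close> is known only almost everywhere; resetting the
   exceptional values to 0 makes it hold at every point.\<close>
 define G1 where "G1 x = (if norm (G0 x) <= c then G0 x else 0)" for x
 have G1m: "G1 \<in> borel_measurable borel" unfolding G1_def[abs_def] by measurable
 have G1ae: "AE x in lebesgue_on U. G1 x = g x" using G0'(1) g(2) unfolding G1_def by eventually_elim simp
 have G1b: "norm (G1 x) <= c" for x unfolding G1_def using g(3) by simp
 have G10: "G1 x = 0" if "x \<notin> U" for x unfolding G1_def using G0'(2)[OF that] by simp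
 have G1L: "G1 \<in> Lp q U" by (rule Lp_bounded[OF fin borel_measurable_lebesgue_on[OF G1m], of c]) (use G1b q in auto)
 have HL: "H \<in> Lp q U"
 proof -
  have "integrable (lebesgue_on U) (%x. norm (H x) powr q)"
   by (rule integrable_cong_AE_imp[OF Lp_D(2)[OF h]])
    (use borel_measurable_lebesgue_on[OF H(1)] H(2) in \<open>auto elim!: eventually_mono\<close>)
  then show ?thesis unfolding Lp_def using borel_measurable_lebesgue_on[OF H(1)] by blast
 qed
 have int: "integrable lborel F" "integrable lborel (%x. norm (F x) powr q)"
  if F: "F \<in> Lp q U" "F \<in> borel_measurable borel" "\<And>x. x \<notin> U ==> F x = 0" for F :: "'a => 'b::euclidean_space"
 proof -
  show "integrable lborel F" using lebesgue_on_integral(2)[OF F(2,3) Ul] Lp_integrable[OF fin F(1) q] by blast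
  have "(%x. norm (F x) powr q) \<in> borel_measurable borel" using F(2) by measurable
  from lebesgue_on_integral(2)[OF this _ Ul] show "integrable lborel (%x. norm (F x) powr q)"
   using Lp_D(2)[OF F(1)] F(3) by simp
 qed
 have wd': "(LBINT x. gradient v x \<bullet> G1 x) = - (LBINT x. v x * H x)" if v: "v \<in> test_functions UNIV" for v
 proof -
  have m [measurable]: "v \<in> borel_measurable borel" "gradient v \<in> borel_measurable borel"
   using test_measurable[OF v] test_measurable[OF gradient_test_function[OF v]] .
  have m1: "(%x. gradient v x \<bullet> G1 x) \<in> borel_measurable borel" "(%x. v x * H x) \<in> borel_measurable borel"
   using G1m H(1) by measurable
  have m2: "(%x. gradient v x \<bullet> g x) \<in> borel_measurable (lebesgue_on U)" "(%x. v x * h x) \<in> borel_measurable (lebesgue_on U)"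
   by (intro borel_measurable_inner borel_measurable_times borel_measurable_lebesgue_on m g(1) Lp_D(1)[OF h])+
  have "(LBINT x. gradient v x \<bullet> G1 x) = (LINT x|lebesgue_on U. gradient v x \<bullet> G1 x)"
   by (rule lebesgue_on_integral(1)[OF m1(1) _ Ul, symmetric]) (simp add: G10)
  also have "... = (LINT x|lebesgue_on U. gradient v x \<bullet> g x)"
   by (rule integral_cong_AE[OF borel_measurable_lebesgue_on[OF m1(1)] m2(1)]) (use G1ae in \<open>auto elim!: eventually_mono\<close>)
  also have "... = - (LINT x|lebesgue_on U. v x * h x)" by (rule wd[OF v])
  also have "(LINT x|lebesgue_on U. v x * h x) = (LINT x|lebesgue_on U. v x * H x)"
   by (rule integral_cong_AE[OF m2(2) borel_measurable_lebesgue_on[OF m1(2)]]) (use H(2) in \<open>auto elim!: eventually_mono\<close>)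
  also have "... = (LBINT x. v x * H x)"
   by (rule lebesgue_on_integral(1)[OF m1(2) _ Ul]) (simp add: H(3))
  finally show ?thesis .
 qed
 obtain N and \<zeta> :: "nat => 'a => real" and S a d where part: "d > 0 \<and>
  (\<forall>i<N. \<zeta> i \<in> test_functions UNIV \<and> compact (S i) \<and> (\<forall>x. x \<notin> S i --> \<zeta> i x = 0)) \<and>
  (\<forall>i x. 0 <= \<zeta> i x) \<and> (\<forall>x. (\<Sum>i<N. \<zeta> i x) <= 1) \<and> (\<forall>x\<in>U. (\<Sum>i<N. \<zeta> i x) = 1) \<and>
  (\<forall>i<N. \<forall>r. 0 < r \<and> r < d --> outward U (S i) (a i) r)"
  using lipschitz_partition[OF U] by (elim exE)
 have "\<exists>\<rho>. mollifier \<rho> (norm (a i) + 1) \<and> (\<forall>z. \<rho> z \<noteq> 0 --> norm (z - a i) <= 1)" for i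
 proof -
  obtain \<rho> :: "'a => real" where \<rho>: "\<rho> \<in> test_functions UNIV" "\<And>x. \<rho> x \<ge> 0" "(LBINT x. \<rho> x) = 1" "\<And>x. \<rho> x \<noteq> 0 ==> norm (x - a i) <= 1"
   by (rule ex_bump[of "a i"], rule that)
  have "norm z <= norm (a i) + 1" if "\<rho> z \<noteq> 0" for z
   using \<rho>(4)[OF that] norm_triangle_ineq2[of z "a i"] by simp
  moreover have "0 < norm (a i) + 1" using norm_ge_zero[of "a i"] by linarith
  ultimately show ?thesis using \<rho> unfolding mollifier_def by (intro exI[of _ \<rho>]) simp
 qed
 then have "\<forall>i. \<exists>\<rho>. mollifier \<rho> (norm (a i) + 1) \<and> (\<forall>z. \<rho> z \<noteq> 0 --> norm (z - a i) <= 1)" ..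
 from choice[OF this] obtain \<rho> where \<rho>: "\<forall>i. mollifier (\<rho> i) (norm (a i) + 1) \<and> (\<forall>z. \<rho> i z \<noteq> 0 --> norm (z - a i) <= 1)" ..
 note meas = g(1) Lp_D(1)[OF h]
 interpret lipschitz_mollification U N \<zeta> S a d \<rho> G1 H c q
  by unfold_locales (use op bd part \<rho> int[OF G1L G1m G10] int[OF HL H(1,3)] G1b G10 H(3) q wd' in simp_all)
 \<comment> \<open>The summand 2 in the denominator keeps every scale strictly below
   \<open>d\<close>.\<close>
 define e where "e n = d / (real n + 2)" for n :: nat
 have e: "0 < e n" "e n < d" for n unfolding e_def using d by (auto simp: field_simps add_pos_nonneg)
 have elim: "filterlim e (at_right 0) sequentially"
 proof -
  have "e \<longlonglongrightarrow> 0" unfolding e_def[abs_def] by real_asymp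
  moreover have "e n \<noteq> 0" for n using e(1)[of n] by simp
  ultimately show ?thesis unfolding filterlim_at using e(1) by (auto intro!: always_eventually)
 qed
 have lim: "(%n. LINT x|lebesgue_on U. norm (\<psi> n x - f x) powr q) \<longlonglongrightarrow> 0"
  if "(%n. (LBINT x. norm (\<psi> n x - F x) powr q)) \<longlonglongrightarrow> 0" and \<psi>: "\<And>n. \<psi> n \<in> borel_measurable borel" "\<And>n x. x \<notin> U ==> \<psi> n x = 0"
   and F: "F \<in> borel_measurable borel" "AE x in lebesgue_on U. F x = f x" "\<And>x. x \<notin> U ==> F x = 0" and f: "f \<in> borel_measurable (lebesgue_on U)"
  for \<psi> :: "nat => 'a => 'b::euclidean_space" and f F
 proof -
  have "(LBINT x. norm (\<psi> n x - F x) powr q) = (LINT x|lebesgue_on U. norm (\<psi> n x - f x) powr q)" for n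
  proof -
   have m: "(%x. norm (\<psi> n x - F x) powr q) \<in> borel_measurable borel" using \<psi>(1)[of n] F(1) by measurable
   have m': "(%x. norm (\<psi> n x - f x) powr q) \<in> borel_measurable (lebesgue_on U)"
    using borel_measurable_lebesgue_on[OF \<psi>(1)[of n]] f by measurable
   have "(LBINT x. norm (\<psi> n x - F x) powr q) = (LINT x|lebesgue_on U. norm (\<psi> n x - F x) powr q)"
    by (rule lebesgue_on_integral(1)[OF m _ Ul, symmetric]) (simp add: \<psi>(2) F(3))
   also have "... = (LINT x|lebesgue_on U. norm (\<psi> n x - f x) powr q)"
    by (rule integral_cong_AE[OF borel_measurable_lebesgue_on[OF m] m']) (use F(2) in \<open>auto elim!: eventually_mono\<close>)
   finally show ?thesis .
  qed
  then show ?thesis using that(1) by simp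
 qed
 have T: "\<Phi> (e n) \<in> test_functions U" for n by (rule \<Phi>_test[OF e])
 note D = divergence_test_function[OF T]
 show ?thesis
 proof (intro exI[of _ "%n. \<Phi> (e n)"] conjI allI impI)
  show "\<Phi> (e n) \<in> test_functions U" for n by (rule T)
  show "norm (\<Phi> (e n) x) <= c" for n x by (rule \<Phi>_bound[OF e(1)])
  show "(%n. LINT x|lebesgue_on U. norm (\<Phi> (e n) x - g x) powr q) \<longlonglongrightarrow> 0"
   by (rule lim[OF filterlim_compose[OF \<Phi>_tendsto elim] test_measurable[OF T] test_outside[OF T] G1m G1ae G10 meas(1)])
  show "(%n. LINT x|lebesgue_on U. norm (divergence (\<Phi> (e n)) x - h x) powr q) \<longlonglongrightarrow> 0"
   by (rule lim[OF filterlim_compose[OF divergence_\<Phi>_tendsto elim] test_measurable[OF D] test_outside[OF D] H meas(2)])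
  fix G x assume G: "AE y in lebesgue_on U. G y = g y" and x: "x \<in> U" "lebesgue_point G x"
  have "AE y in lebesgue_on U. G y = G1 y" using G G1ae by eventually_elim simp
  from filterlim_compose[OF \<Phi>_lebesgue_point[OF this x] elim] show "(%n. \<Phi> (e n) x) \<longlonglongrightarrow> G x" .
 qed
qed

section \<open>Convergence of traces\<close>

lemma Lq_null_inner:
 fixes f :: "nat => 'a::euclidean_space => 'b::euclidean_space"
 assumes fin: "finite_measure (lebesgue_on U)" and k: "k \<in> test_functions V" and f: "\<And>n. f n \<in> Lp q U" and q: "q > 1"
  and lim: "(%n. LINT x|lebesgue_on U. norm (f n x) powr q) \<longlonglongrightarrow> 0"
 shows "(%n. LINT x|lebesgue_on U. k x \<bullet> f n x) \<longlonglongrightarrow> 0"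
proof -
 obtain B where B: "B > 0" "\<And>x. norm (k x) <= B" by (rule test_bounded[OF k], rule that)
 have 1: "(%n. LINT x|lebesgue_on U. norm (f n x)) \<longlonglongrightarrow> 0"
  by (rule Lq_tendsto_imp_L1[OF fin Lp_D(1)[OF f] Lp_D(2)[OF f] q lim])
 have 2: "(%n. B * (LINT x|lebesgue_on U. norm (f n x))) \<longlonglongrightarrow> 0" using tendsto_mult[OF tendsto_const[of B] 1] by simp
 show ?thesis
 proof (rule Lim_null_comparison[OF always_eventually 2], rule allI)
  fix n
  have i: "integrable (lebesgue_on U) (f n)" by (rule Lp_integrable[OF fin f q])
  have "norm (LINT x|lebesgue_on U. k x \<bullet> f n x) <= (LINT x|lebesgue_on U. norm (k x \<bullet> f n x))"
   by (rule integral_norm_bound)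
  also have "... <= (LINT x|lebesgue_on U. B * norm (f n x))"
  proof (rule integral_mono)
   show "integrable (lebesgue_on U) (%x. norm (k x \<bullet> f n x))"
    by (rule integrable_norm[OF test_inner_integrable[OF k i]])
   show "integrable (lebesgue_on U) (%x. B * norm (f n x))" by (rule integrable_mult_right[OF integrable_norm[OF i]])
   show "norm (k x \<bullet> f n x) <= B * norm (f n x)" for x
    using order_trans[OF Cauchy_Schwarz_ineq2[of "k x" "f n x"] mult_right_mono[OF B(2)[of x] norm_ge_zero]] by simp
  qed
  also have "... = B * (LINT x|lebesgue_on U. norm (f n x))" by simp
  finally show "norm (LINT x|lebesgue_on U. k x \<bullet> f n x) <= B * (LINT x|lebesgue_on U. norm (f n x))" .
 qed
qed

text \<open>Zero normal trace: for test fields the identity holds against any \<open>v\<close>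
  without a boundary term, and both sides are continuous in the norm of W^q(div).\<close>

lemma Wdiv0_integration_by_parts:
 fixes U :: "'a::euclidean_space set"
 assumes U: "open U" "bounded U" and q: "q > 1" and g: "g \<in> Wdiv0 q U" and h: "h \<in> Lp q U" "has_weak_div U g h"
  and v: "v \<in> test_functions UNIV"
 shows "(LINT x|lebesgue_on U. gradient v x \<bullet> g x) = - (LINT x|lebesgue_on U. v x * h x)"
proof -
 note fin = bounded_finite_lebesgue_on[OF U]
 have q0: "q > 0" using q by simp
 have gL: "g \<in> Lp q U" using g unfolding Wdiv0_def Wdiv_def by simp
 have "\<forall>n::nat. \<exists>\<phi>. \<phi> \<in> test_functions U \<and> Wdiv_norm q U (%x. g x - \<phi> x) < 1 / (real n + 1)"
 proof
  fix n :: nat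
  have "1 / (real n + 1) > 0" by simp
  then show "\<exists>\<phi>. \<phi> \<in> test_functions U \<and> Wdiv_norm q U (%x. g x - \<phi> x) < 1 / (real n + 1)"
   using g unfolding Wdiv0_def by blast
 qed
 from choice[OF this] obtain \<phi> where \<phi>: "\<forall>n. \<phi> n \<in> test_functions U \<and> Wdiv_norm q U (%x. g x - \<phi> n x) < 1 / (real n + 1)" ..
 have T: "\<phi> n \<in> test_functions U" for n using \<phi> by simp
 have dL: "(%x. h x - divergence (\<phi> n) x) \<in> Lp q U" "(%x. g x - \<phi> n x) \<in> Lp q U" for n
  by (intro Lp_diff h(1) gL Lp_test_function[OF fin divergence_test_function[OF T]] Lp_test_function[OF fin T] q0 less_imp_le[OF q0])+
 have wd: "has_weak_div U (%x. g x - \<phi> n x) (%x. h x - divergence (\<phi> n) x)" for n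
  by (rule has_weak_div_diff[OF U(1) h(2) has_weak_div_smooth[OF T U(1) refl]])
 have W: "(%n. Wdiv_norm q U (%x. g x - \<phi> n x)) \<longlonglongrightarrow> 0"
 proof (rule tendsto_sandwich[OF always_eventually always_eventually tendsto_const])
  show "\<forall>n. 0 <= Wdiv_norm q U (%x. g x - \<phi> n x)" unfolding Wdiv_norm_def by simp
  show "\<forall>n. Wdiv_norm q U (%x. g x - \<phi> n x) <= 1 / (real n + 1)" using \<phi> by (simp add: less_imp_le)
  show "(%n. 1 / (real n + 1)) \<longlonglongrightarrow> 0" by real_asymp
 qed
 note lim = Wdiv_norm_tendsto_iff[OF U(1) dL(1) wd q0, THEN iffD1, OF W]
 have 1: "(%n. LINT x|lebesgue_on U. gradient v x \<bullet> (g x - \<phi> n x)) \<longlonglongrightarrow> 0"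
  by (rule Lq_null_inner[OF fin gradient_test_function[OF v] dL(2) q conjunct1[OF lim]])
 have 2: "(%n. LINT x|lebesgue_on U. v x \<bullet> (h x - divergence (\<phi> n) x)) \<longlonglongrightarrow> 0"
  by (rule Lq_null_inner[OF fin v dL(1) q conjunct2[OF lim]])
 have "(LINT x|lebesgue_on U. gradient v x \<bullet> (g x - \<phi> n x)) + (LINT x|lebesgue_on U. v x \<bullet> (h x - divergence (\<phi> n) x))
   = (LINT x|lebesgue_on U. gradient v x \<bullet> g x) + (LINT x|lebesgue_on U. v x * h x)" for n
 proof -
  have i: "integrable (lebesgue_on U) (%x. gradient v x \<bullet> g x)" "integrable (lebesgue_on U) (%x. gradient v x \<bullet> \<phi> n x)"
   "integrable (lebesgue_on U) (%x. v x \<bullet> h x)" "integrable (lebesgue_on U) (%x. v x \<bullet> divergence (\<phi> n) x)"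
   by (intro test_inner_integrable[OF gradient_test_function[OF v]] test_inner_integrable[OF v] Lp_integrable[OF fin _ q]
     gL h(1) Lp_test_function[OF fin T] Lp_test_function[OF fin divergence_test_function[OF T]] less_imp_le[OF q0])+
  have "(LINT x|lebesgue_on U. gradient v x \<bullet> \<phi> n x) = - (LINT x|lebesgue_on U. v x \<bullet> divergence (\<phi> n) x)"
   unfolding inner_real_def by (rule integration_by_parts[OF v T U(1)]) simp
  then show ?thesis unfolding inner_diff_right Bochner_Integration.integral_diff[OF i(1,2)] Bochner_Integration.integral_diff[OF i(3,4)]
   by (simp add: inner_real_def)
 qed
 with tendsto_add[OF 1 2] have "(%n::nat. (LINT x|lebesgue_on U. gradient v x \<bullet> g x) + (LINT x|lebesgue_on U. v x * h x)) \<longlonglongrightarrow> 0" by simp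
 from LIMSEQ_unique[OF this tendsto_const] show ?thesis by simp
qed

lemma Wdiv0I:
 fixes U :: "'a::euclidean_space set"
 assumes U: "open U" "bounded U" and q: "q > 1" and g: "g \<in> Lp q U" and h: "h \<in> Lp q U" "has_weak_div U g h"
  and \<phi>: "\<And>n. \<phi> n \<in> test_functions U"
  and lim: "(%n. LINT x|lebesgue_on U. norm (\<phi> n x - g x) powr q) \<longlonglongrightarrow> 0"
   "(%n. LINT x|lebesgue_on U. norm (divergence (\<phi> n) x - h x) powr q) \<longlonglongrightarrow> 0"
 shows "g \<in> Wdiv0 q U"
proof -
 note fin = bounded_finite_lebesgue_on[OF U]
 have q0: "q > 0" using q by simp
 have dL: "(%x. h x - divergence (\<phi> n) x) \<in> Lp q U" for n
  by (intro Lp_diff h(1) Lp_test_function[OF fin divergence_test_function[OF \<phi>]] q0 less_imp_le[OF q0])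
 have wd: "has_weak_div U (%x. g x - \<phi> n x) (%x. h x - divergence (\<phi> n) x)" for n
  by (rule has_weak_div_diff[OF U(1) h(2) has_weak_div_smooth[OF \<phi> U(1) refl]])
 have W: "(%n. Wdiv_norm q U (%x. g x - \<phi> n x)) \<longlonglongrightarrow> 0"
  by (rule Wdiv_norm_tendsto_iff[OF U(1) dL wd q0, THEN iffD2]) (use lim in \<open>simp add: norm_minus_commute abs_minus_commute\<close>)
 have "\<exists>\<psi>\<in>test_functions U. Wdiv_norm q U (%x. g x - \<psi> x) < e" if e: "e > 0" for e
 proof -
  from order_tendstoD(2)[OF W e] obtain n where "Wdiv_norm q U (%x. g x - \<phi> n x) < e"
   unfolding eventually_sequentially by blast
  then show ?thesis by (intro bexI[OF _ \<phi>[of n]])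
 qed
 then show ?thesis using g h unfolding Wdiv0_def Wdiv_def by blast
qed

text \<open>Du is accessible through the pairing \<open>polar\<close> with fields of compact support
  in the domain; fields that reach the boundary are treated by means of cutoffs.\<close>

locale polar_decomposition =
 fixes \<Omega> :: "'a::euclidean_space set" and p q :: real and u :: "'a => real" and \<mu> :: "'a measure" and \<sigma> :: "'a => 'a"
  and g :: "'a => 'a" and h :: "'a => real"
 assumes \<Omega>: "open \<Omega>" "bounded \<Omega>" and p: "p > 1" "q = p / (p - 1)" and u: "u \<in> Lp p \<Omega>"
  and \<mu>: "finite_measure \<mu>" "sets \<mu> = borel_on \<Omega>" and \<sigma>: "integrable \<mu> \<sigma>" "AE x in \<mu>. norm (\<sigma> x) = 1"
  and polar: "\<And>\<phi>. \<phi> \<in> test_functions \<Omega> ==> (LINT x|lebesgue_on \<Omega>. u x * divergence \<phi> x) = - (LINT x|\<mu>. \<phi> x \<bullet> \<sigma> x)"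
  and gh: "g \<in> Lp q \<Omega>" "h \<in> Lp q \<Omega>"
begin

lemma q: "q > 1" unfolding p(2) using p(1) by (simp add: less_divide_eq)

lemma space_\<mu>: "space \<mu> = \<Omega>" by (rule space_borel_on[OF \<mu>(2)])

lemma measurable_\<mu>: "f \<in> borel_measurable borel ==> f \<in> borel_measurable \<mu>"
 unfolding measurable_cong_sets[OF \<mu>(2) refl] by (rule measurable_restrict_space1)

text \<open>The fields live on the whole space and are bounded by 1 only on the domain, so that
  smooth fields up to the boundary, represented by an extension, are included along with test
  fields.\<close>

definition converges_to :: "(nat => 'a => 'a) => bool" where
 "converges_to F \<longleftrightarrow> (\<forall>n. F n \<in> test_functions UNIV) \<and> (\<forall>n. \<forall>x\<in>\<Omega>. norm (F n x) <= 1) \<and>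
  (%n. LINT x|lebesgue_on \<Omega>. norm (F n x - g x) powr q) \<longlonglongrightarrow> 0 \<and>
  (%n. LINT x|lebesgue_on \<Omega>. norm (divergence (F n) x - h x) powr q) \<longlonglongrightarrow> 0"

lemma converges_toD:
 assumes "converges_to F"
 shows "F n \<in> test_functions UNIV" "x \<in> \<Omega> ==> norm (F n x) <= 1"
  "(%n. LINT x|lebesgue_on \<Omega>. norm (F n x - g x) powr q) \<longlonglongrightarrow> 0"
  "(%n. LINT x|lebesgue_on \<Omega>. norm (divergence (F n) x - h x) powr q) \<longlonglongrightarrow> 0"
 using assms unfolding converges_to_def by auto

text \<open>The cutoff makes \<open>polar\<close> applicable, and the product rule followed by
  Hoelder's inequality gives a limit in which the sequence no longer occurs. Two sequences
  converging to \<open>g\<close> can be compared in this way.\<close>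

lemma cutoff_pairing:
 assumes F: "converges_to F" and \<theta>: "\<theta> \<in> test_functions \<Omega>"
 shows "(%n. (LINT x|\<mu>. (\<theta> x *\<^sub>R F n x) \<bullet> \<sigma> x)) \<longlonglongrightarrow> - (LINT x|lebesgue_on \<Omega>. u x * (\<theta> x * h x + gradient \<theta> x \<bullet> g x))"
proof -
 note fin = bounded_finite_lebesgue_on[OF \<Omega>]
 note T = converges_toD(1)[OF F]
 have q0: "q > 0" using q by simp
 let ?k = "%n x. \<theta> x * divergence (F n) x + gradient \<theta> x \<bullet> F n x" and ?l = "%x. \<theta> x * h x + gradient \<theta> x \<bullet> g x"
 obtain B1 where B1: "B1 > 0" "\<And>x. norm (\<theta> x) <= B1" by (rule test_bounded[OF \<theta>], rule that)
 obtain B2 where B2: "B2 > 0" "\<And>x. norm (gradient \<theta> x) <= B2"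
  by (rule test_bounded[OF gradient_test_function[OF \<theta>]], rule that)
 have bound: "norm (\<theta> x * b + gradient \<theta> x \<bullet> a) powr q <= 2 powr q * (B1 powr q * norm b powr q + B2 powr q * norm a powr q)" for a b x
 proof -
  have "norm (\<theta> x * b) powr q <= (B1 * norm b) powr q" using B1(2)[of x] q0
   by (intro powr_mono2) (auto simp: abs_mult intro: mult_right_mono)
  moreover have "norm (gradient \<theta> x \<bullet> a) powr q <= (B2 * norm a) powr q"
   using order_trans[OF Cauchy_Schwarz_ineq2[of "gradient \<theta> x" a] mult_right_mono[OF B2(2)[of x] norm_ge_zero]] q0
   by (intro powr_mono2) auto
  ultimately have "2 powr q * (norm (\<theta> x * b) powr q + norm (gradient \<theta> x \<bullet> a) powr q) <= 2 powr q * (B1 powr q * norm b powr q + B2 powr q * norm a powr q)"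
   unfolding powr_mult by (intro mult_left_mono add_mono) auto
  with norm_add_powr_le[OF q0, of "\<theta> x * b" "gradient \<theta> x \<bullet> a"] show ?thesis by linarith
 qed
 have kL: "(%x. \<theta> x * b x + gradient \<theta> x \<bullet> a x) \<in> Lp q \<Omega>" if a: "a \<in> Lp q \<Omega>" and b: "b \<in> Lp q \<Omega>" for a b
 proof -
  have [measurable]: "\<theta> \<in> borel_measurable (lebesgue_on \<Omega>)" "gradient \<theta> \<in> borel_measurable (lebesgue_on \<Omega>)"
   "a \<in> borel_measurable (lebesgue_on \<Omega>)" "b \<in> borel_measurable (lebesgue_on \<Omega>)"
   using test_measurable_on[OF \<theta>] test_measurable_on[OF gradient_test_function[OF \<theta>]] Lp_D(1)[OF a] Lp_D(1)[OF b] .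
  have m: "(%x. \<theta> x * b x + gradient \<theta> x \<bullet> a x) \<in> borel_measurable (lebesgue_on \<Omega>)" by measurable
  have "integrable (lebesgue_on \<Omega>) (%x. norm (\<theta> x * b x + gradient \<theta> x \<bullet> a x) powr q)"
  proof (rule Bochner_Integration.integrable_bound)
   show "integrable (lebesgue_on \<Omega>) (%x. 2 powr q * (B1 powr q * norm (b x) powr q + B2 powr q * norm (a x) powr q))"
    by (intro integrable_mult_right Bochner_Integration.integrable_add Lp_D(2) a b)
   show "(%x. norm (\<theta> x * b x + gradient \<theta> x \<bullet> a x) powr q) \<in> borel_measurable (lebesgue_on \<Omega>)" using m by measurable
   show "AE x in lebesgue_on \<Omega>. norm (norm (\<theta> x * b x + gradient \<theta> x \<bullet> a x) powr q)
     <= norm (2 powr q * (B1 powr q * norm (b x) powr q + B2 powr q * norm (a x) powr q))"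
    using bound[of _ "b _" "a _"] by (intro AE_I2) (auto intro: order_trans[OF _ abs_ge_self])
  qed
  then show ?thesis using m unfolding Lp_def by blast
 qed
 have FL: "F n \<in> Lp q \<Omega>" "divergence (F n) \<in> Lp q \<Omega>" for n
  by (intro Lp_test_function[OF fin T] Lp_test_function[OF fin divergence_test_function[OF T]] less_imp_le[OF q0])+
 have lim: "(%n. LINT x|lebesgue_on \<Omega>. norm (?k n x - ?l x) powr q) \<longlonglongrightarrow> 0"
 proof (rule tendsto_sandwich[OF always_eventually always_eventually tendsto_const])
  let ?D = "%n. 2 powr q * (B1 powr q * (LINT x|lebesgue_on \<Omega>. norm (divergence (F n) x - h x) powr q) + B2 powr q * (LINT x|lebesgue_on \<Omega>. norm (F n x - g x) powr q))"
  have "?D \<longlonglongrightarrow> 2 powr q * (B1 powr q * 0 + B2 powr q * 0)"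
   by (intro tendsto_mult tendsto_add tendsto_const converges_toD(3,4)[OF F])
  then show "?D \<longlonglongrightarrow> 0" by simp
  show "\<forall>n. 0 <= (LINT x|lebesgue_on \<Omega>. norm (?k n x - ?l x) powr q)" by simp
  show "\<forall>n. (LINT x|lebesgue_on \<Omega>. norm (?k n x - ?l x) powr q) <= ?D n"
  proof
   fix n
   have i: "integrable (lebesgue_on \<Omega>) (%x. norm (divergence (F n) x - h x) powr q)" "integrable (lebesgue_on \<Omega>) (%x. norm (F n x - g x) powr q)"
    by (rule Lp_D(2)[OF Lp_diff[OF FL(2) gh(2) q0]], rule Lp_D(2)[OF Lp_diff[OF FL(1) gh(1) q0]])
   have "(LINT x|lebesgue_on \<Omega>. norm (?k n x - ?l x) powr q)
     <= (LINT x|lebesgue_on \<Omega>. 2 powr q * (B1 powr q * norm (divergence (F n) x - h x) powr q + B2 powr q * norm (F n x - g x) powr q))"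
   proof (rule integral_mono')
    show "integrable (lebesgue_on \<Omega>) (%x. 2 powr q * (B1 powr q * norm (divergence (F n) x - h x) powr q + B2 powr q * norm (F n x - g x) powr q))"
     by (intro integrable_mult_right Bochner_Integration.integrable_add i)
    fix x
    have "?k n x - ?l x = \<theta> x * (divergence (F n) x - h x) + gradient \<theta> x \<bullet> (F n x - g x)"
     by (simp add: algebra_simps inner_diff_right)
    then show "norm (?k n x - ?l x) powr q <= 2 powr q * (B1 powr q * norm (divergence (F n) x - h x) powr q + B2 powr q * norm (F n x - g x) powr q)"
     by (simp only: bound)
   qed (intro mult_nonneg_nonneg add_nonneg_nonneg powr_ge_zero)
   also have "... = ?D n" using i by simp
   finally show "(LINT x|lebesgue_on \<Omega>. norm (?k n x - ?l x) powr q) <= ?D n" .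
  qed
 qed
 have "(%n. LINT x|lebesgue_on \<Omega>. u x * ?k n x) \<longlonglongrightarrow> (LINT x|lebesgue_on \<Omega>. u x * ?l x)"
  by (rule Holder_tendsto[OF u kL[OF FL] kL[OF gh] p lim])
 moreover have "(LINT x|\<mu>. (\<theta> x *\<^sub>R F n x) \<bullet> \<sigma> x) = - (LINT x|lebesgue_on \<Omega>. u x * ?k n x)" for n
 proof -
  have "(%x. \<theta> x *\<^sub>R F n x) \<in> test_functions \<Omega>"
   by (rule test_bilinear[OF bounded_bilinear_scaleR \<theta> test_smooth[OF T]])
  from polar[OF this] show ?thesis
   unfolding divergence_scaleR[OF test_differentiable[OF \<theta>] test_differentiable[OF T]] by simp
 qed
 ultimately show ?thesis by (simp add: tendsto_minus)
qed

lemma inner_\<sigma>_le_1: "norm (a::'a) <= 1 ==> norm (\<sigma> x) = 1 ==> \<bar>a \<bullet> \<sigma> x\<bar> <= 1"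
 using Cauchy_Schwarz_ineq2[of a "\<sigma> x"] by simp

lemma pairing_integrable:
 assumes "f \<in> borel_measurable borel" "\<And>x. x \<in> \<Omega> ==> norm (f x) <= B"
 shows "integrable \<mu> (%x. f x \<bullet> \<sigma> x)"
 by (rule inner_density_integrable[OF \<sigma>(1) measurable_\<mu>[OF assms(1)]]) (use assms(2) space_\<mu> in auto)

text \<open>\<open>\<theta>\<close> is the square of a test function \<open>\<phi>\<close> close to
  1 in L^1: squaring brings the values from [-1, 1] into [0, 1], and 1 - \<open>\<phi>\<close>^2 <=
  2 |1 - \<open>\<phi>\<close>|.\<close>

lemma ex_cutoff_measure:
 assumes e: "e > 0"
 shows "\<exists>\<theta>\<in>test_functions \<Omega>. (\<forall>x. 0 <= \<theta> x \<and> \<theta> x <= (1::real)) \<and> (LINT x|\<mu>. 1 - \<theta> x) < e"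
proof -
 interpret finite_measure \<mu> by (rule \<mu>(1))
 have "\<exists>\<phi>\<in>test_functions \<Omega>. (\<forall>x. norm (\<phi> x) <= 1) \<and> (LINT x|\<mu>. norm (\<phi> x - (1::real))) < e / 2"
  by (rule test_dense_L1_on[OF \<Omega>(1) \<mu>]) (use e in auto)
 then obtain \<phi> where \<phi>: "\<phi> \<in> test_functions \<Omega>" "\<forall>x. norm (\<phi> x) <= 1" "(LINT x|\<mu>. norm (\<phi> x - (1::real))) < e / 2" by blast
 have m: "\<phi> \<in> borel_measurable \<mu>" by (rule measurable_\<mu>[OF test_measurable[OF \<phi>(1)]])
 have b: "\<bar>\<phi> x\<bar> <= 1" for x using \<phi>(2) by simp
 have sq: "\<phi> x * \<phi> x <= 1" for x using b[of x] mult_mono[OF b[of x] b[of x]] by (simp flip: abs_mult)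
 have i1: "integrable \<mu> (%x. norm (\<phi> x - 1))"
  by (rule integrable_const_bound[of _ 2]) (use m b in \<open>auto intro!: AE_I2 order_trans[OF abs_triangle_ineq4]\<close>)
 have "(LINT x|\<mu>. 1 - \<phi> x * \<phi> x) <= (LINT x|\<mu>. 2 * norm (\<phi> x - 1))"
 proof (rule integral_mono')
  show "integrable \<mu> (%x. 2 * norm (\<phi> x - 1))" using i1 by simp
  fix x
  have "1 - \<phi> x * \<phi> x = (1 - \<phi> x) * (1 + \<phi> x)" by (simp add: algebra_simps)
  also have "... <= \<bar>1 - \<phi> x\<bar> * \<bar>1 + \<phi> x\<bar>" by (simp flip: abs_mult)
  also have "... <= \<bar>1 - \<phi> x\<bar> * 2" using b[of x] by (intro mult_left_mono) auto
  finally show "1 - \<phi> x * \<phi> x <= 2 * norm (\<phi> x - 1)" by (simp add: abs_minus_commute)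
 qed simp
 also have "... < e" using \<phi>(3) by simp
 finally show ?thesis
  using test_bilinear[OF bounded_bilinear_mult \<phi>(1) test_smooth[OF \<phi>(1)]] sq
  by (intro bexI[of _ "%x. \<phi> x * \<phi> x"]) auto
qed

text \<open>The defect 1 - \<open>F n x \<bullet> \<sigma> x\<close>, weighted by a cutoff, has the
  same limiting integral for both sequences. For \<open>\<phi>\<close> this limit is at most 0,
  because the unweighted defect tends to 0. For \<open>F\<close> the part left out by the cutoff is
  at most 2 (1 - \<open>\<theta>\<close>), which is small in the mean.\<close>

lemma defect_tendsto:
 assumes \<phi>: "converges_to \<phi>" "(%n. (LINT x|\<mu>. \<phi> n x \<bullet> \<sigma> x)) \<longlonglongrightarrow> measure \<mu> \<Omega>" and F: "converges_to F"
 shows "(%n. (LINT x|\<mu>. 1 - F n x \<bullet> \<sigma> x)) \<longlonglongrightarrow> 0"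
proof (rule LIMSEQ_I)
 interpret finite_measure \<mu> by (rule \<mu>(1))
 fix e :: real assume e: "e > 0"
 then have e': "e / 4 > 0" by simp
 \<comment> \<open>One quarter of \<open>e\<close> is for the weighted defect, and twice a quarter
   bounds what the cutoff leaves out.\<close>
 obtain \<theta> where \<theta>: "\<theta> \<in> test_functions \<Omega>" "\<forall>x. 0 <= \<theta> x \<and> \<theta> x <= (1::real)" "(LINT x|\<mu>. 1 - \<theta> x) < e / 4"
  using ex_cutoff_measure[OF e'] by blast
 have \<theta>m: "\<theta> \<in> borel_measurable borel" by (rule test_measurable[OF \<theta>(1)])
 have \<theta>i: "integrable \<mu> \<theta>" by (rule integrable_const_bound[of _ 1]) (use \<theta>(2) measurable_\<mu>[OF \<theta>m] in auto)
 have i: "integrable \<mu> (%x. G n x \<bullet> \<sigma> x)" "integrable \<mu> (%x. (\<theta> x *\<^sub>R G n x) \<bullet> \<sigma> x)" if G: "converges_to G" for G n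
 proof -
  have m: "G n \<in> borel_measurable borel" by (rule test_measurable[OF converges_toD(1)[OF G]])
  show "integrable \<mu> (%x. G n x \<bullet> \<sigma> x)" by (rule pairing_integrable[OF m converges_toD(2)[OF G]])
  have "norm (\<theta> x *\<^sub>R G n x) <= 1" if "x \<in> \<Omega>" for x
   using \<theta>(2) mult_mono[of "\<theta> x" 1 "norm (G n x)" 1] converges_toD(2)[OF G that, of n] by simp
  moreover have "(%x. \<theta> x *\<^sub>R G n x) \<in> borel_measurable borel" using \<theta>m m by measurable
  ultimately show "integrable \<mu> (%x. (\<theta> x *\<^sub>R G n x) \<bullet> \<sigma> x)" by (intro pairing_integrable)
 qed
 have nn: "AE x in \<mu>. \<bar>G n x \<bullet> \<sigma> x\<bar> <= 1" if G: "converges_to G" for G n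
  using \<sigma>(2) AE_space
 proof eventually_elim
  case (elim x)
  then show ?case using inner_\<sigma>_le_1 converges_toD(2)[OF G] space_\<mu> by simp
 qed
 define X where "X = - (LINT x|lebesgue_on \<Omega>. u x * (\<theta> x * h x + gradient \<theta> x \<bullet> g x))"
 define I where "I = (LINT x|\<mu>. \<theta> x)"
 have "I - X <= 0"
 proof (rule LIMSEQ_le)
  show "(%n. I - (LINT x|\<mu>. (\<theta> x *\<^sub>R \<phi> n x) \<bullet> \<sigma> x)) \<longlonglongrightarrow> I - X"
   unfolding X_def by (intro tendsto_diff tendsto_const cutoff_pairing[OF \<phi>(1) \<theta>(1)])
  show "(%n. measure \<mu> \<Omega> - (LINT x|\<mu>. \<phi> n x \<bullet> \<sigma> x)) \<longlonglongrightarrow> 0"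
   using tendsto_diff[OF tendsto_const[of "measure \<mu> \<Omega>"] \<phi>(2)] by simp
  have "I - (LINT x|\<mu>. (\<theta> x *\<^sub>R \<phi> n x) \<bullet> \<sigma> x) <= measure \<mu> \<Omega> - (LINT x|\<mu>. \<phi> n x \<bullet> \<sigma> x)" for n
  proof -
   have "I - (LINT x|\<mu>. (\<theta> x *\<^sub>R \<phi> n x) \<bullet> \<sigma> x) = (LINT x|\<mu>. \<theta> x - (\<theta> x *\<^sub>R \<phi> n x) \<bullet> \<sigma> x)"
    unfolding I_def by (rule Bochner_Integration.integral_diff[OF \<theta>i i(2)[OF \<phi>(1)], symmetric])
   also have "... <= (LINT x|\<mu>. 1 - \<phi> n x \<bullet> \<sigma> x)"
   proof (rule integral_mono_AE)
    show "AE x in \<mu>. \<theta> x - (\<theta> x *\<^sub>R \<phi> n x) \<bullet> \<sigma> x <= 1 - \<phi> n x \<bullet> \<sigma> x"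
     using nn[OF \<phi>(1), of n]
    proof eventually_elim
     case (elim x)
     have "\<theta> x * (1 - \<phi> n x \<bullet> \<sigma> x) <= 1 * (1 - \<phi> n x \<bullet> \<sigma> x)" using \<theta>(2) elim by (intro mult_right_mono) auto
     then show ?case by (simp add: algebra_simps)
    qed
   qed (intro Bochner_Integration.integrable_diff \<theta>i i[OF \<phi>(1)] integrable_const)+
   also have "... = measure \<mu> \<Omega> - (LINT x|\<mu>. \<phi> n x \<bullet> \<sigma> x)"
    using i(1)[OF \<phi>(1)] by (simp add: space_\<mu>)
   finally show ?thesis .
  qed
  then show "\<exists>N. \<forall>n\<ge>N. I - (LINT x|\<mu>. (\<theta> x *\<^sub>R \<phi> n x) \<bullet> \<sigma> x) <= measure \<mu> \<Omega> - (LINT x|\<mu>. \<phi> n x \<bullet> \<sigma> x)" by blast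
 qed
 then have "I - X < e / 4" using e by simp
 moreover have "(%n. I - (LINT x|\<mu>. (\<theta> x *\<^sub>R F n x) \<bullet> \<sigma> x)) \<longlonglongrightarrow> I - X"
  unfolding X_def by (intro tendsto_diff tendsto_const cutoff_pairing[OF F \<theta>(1)])
 ultimately have "\<forall>\<^sub>F n in sequentially. I - (LINT x|\<mu>. (\<theta> x *\<^sub>R F n x) \<bullet> \<sigma> x) < e / 4" by (intro order_tendstoD(2))
 then obtain N where N: "\<forall>n\<ge>N. I - (LINT x|\<mu>. (\<theta> x *\<^sub>R F n x) \<bullet> \<sigma> x) < e / 4" unfolding eventually_sequentially by blast
 have "norm ((LINT x|\<mu>. 1 - F n x \<bullet> \<sigma> x) - 0) < e" if n: "n \<ge> N" for n
 proof -
  have "0 <= (LINT x|\<mu>. 1 - F n x \<bullet> \<sigma> x)" by (rule integral_nonneg_AE) (use nn[OF F, of n] in \<open>eventually_elim, simp\<close>)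
  moreover have "(LINT x|\<mu>. 1 - F n x \<bullet> \<sigma> x) <= (LINT x|\<mu>. (\<theta> x - (\<theta> x *\<^sub>R F n x) \<bullet> \<sigma> x) + 2 * (1 - \<theta> x))"
  proof (rule integral_mono_AE)
   show "AE x in \<mu>. 1 - F n x \<bullet> \<sigma> x <= (\<theta> x - (\<theta> x *\<^sub>R F n x) \<bullet> \<sigma> x) + 2 * (1 - \<theta> x)"
    using nn[OF F, of n]
   proof eventually_elim
    case (elim x)
    have "(1 - \<theta> x) * (1 - F n x \<bullet> \<sigma> x) <= (1 - \<theta> x) * 2" using \<theta>(2) elim by (intro mult_left_mono) auto
    then show ?case by (simp add: algebra_simps)
   qed
  qed (intro Bochner_Integration.integrable_add integrable_mult_right Bochner_Integration.integrable_diff \<theta>i i[OF F] integrable_const)+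
  moreover have "(LINT x|\<mu>. (\<theta> x - (\<theta> x *\<^sub>R F n x) \<bullet> \<sigma> x) + 2 * (1 - \<theta> x)) = (I - (LINT x|\<mu>. (\<theta> x *\<^sub>R F n x) \<bullet> \<sigma> x)) + 2 * (LINT x|\<mu>. 1 - \<theta> x)"
  proof -
   have "(LINT x|\<mu>. (\<theta> x - (\<theta> x *\<^sub>R F n x) \<bullet> \<sigma> x) + 2 * (1 - \<theta> x)) = (LINT x|\<mu>. \<theta> x - (\<theta> x *\<^sub>R F n x) \<bullet> \<sigma> x) + (LINT x|\<mu>. 2 * (1 - \<theta> x))"
    by (rule Bochner_Integration.integral_add)
     (intro integrable_mult_right Bochner_Integration.integrable_diff \<theta>i i[OF F] integrable_const)+
   also have "(LINT x|\<mu>. \<theta> x - (\<theta> x *\<^sub>R F n x) \<bullet> \<sigma> x) = I - (LINT x|\<mu>. (\<theta> x *\<^sub>R F n x) \<bullet> \<sigma> x)"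
    unfolding I_def by (rule Bochner_Integration.integral_diff[OF \<theta>i i(2)[OF F]])
   also have "(LINT x|\<mu>. 2 * (1 - \<theta> x)) = 2 * (LINT x|\<mu>. 1 - \<theta> x)" by (rule integral_mult_right_zero)
   finally show ?thesis .
  qed
  ultimately show ?thesis using N[rule_format, OF n] \<theta>(3) by simp
 qed
 then show "\<exists>N. \<forall>n\<ge>N. norm ((LINT x|\<mu>. 1 - F n x \<bullet> \<sigma> x) - 0) < e" by blast
qed

lemma trace_convergence:
 assumes \<phi>: "converges_to \<phi>" "(%n. (LINT x|\<mu>. \<phi> n x \<bullet> \<sigma> x)) \<longlonglongrightarrow> measure \<mu> \<Omega>" and F: "converges_to F"
 shows "(%n. (LINT x|\<mu>. norm (F n x - \<sigma> x))) \<longlonglongrightarrow> 0"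
proof -
 interpret finite_measure \<mu> by (rule \<mu>(1))
 note lim = defect_tendsto[OF assms]
 have Fm: "F n \<in> borel_measurable borel" for n by (rule test_measurable[OF converges_toD(1)[OF F]])
 have m: "(%x. F n x - \<sigma> x) \<in> borel_measurable \<mu>" for n
  using measurable_\<mu>[OF Fm] borel_measurable_integrable[OF \<sigma>(1)] by measurable
 have i: "integrable \<mu> (%x. 2 * (1 - F n x \<bullet> \<sigma> x))" for n
  by (intro integrable_mult_right Bochner_Integration.integrable_diff integrable_const pairing_integrable[OF Fm converges_toD(2)[OF F]])
 have le: "AE x in \<mu>. norm (F n x - \<sigma> x) powr 2 <= 2 * (1 - F n x \<bullet> \<sigma> x)" for n
  using \<sigma>(2) AE_space
 proof eventually_elim
  case (elim x)
  have "norm (F n x - \<sigma> x) powr 2 = (norm (F n x))\<^sup>2 - 2 * (F n x \<bullet> \<sigma> x) + (norm (\<sigma> x))\<^sup>2"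
   unfolding norm_powr_2 power2_norm_eq_inner by (simp add: inner_diff_left inner_diff_right inner_commute)
  moreover have "(norm (F n x))\<^sup>2 <= 1" using converges_toD(2)[OF F, of x n] elim(2) space_\<mu> by (simp add: power_le_one)
  ultimately show ?case using elim(1) by simp
 qed
 have i2: "integrable \<mu> (%x. norm (F n x - \<sigma> x) powr 2)" for n
  by (rule Bochner_Integration.integrable_bound[OF i[of n]]) (use m[of n] le[of n] in \<open>auto elim!: eventually_mono\<close>)
 show ?thesis
 proof (rule Lq_tendsto_imp_L1[OF \<mu>(1) m i2])
  show "(%n. (LINT x|\<mu>. norm (F n x - \<sigma> x) powr 2)) \<longlonglongrightarrow> 0"
  proof (rule tendsto_sandwich[OF always_eventually always_eventually tendsto_const])
   show "\<forall>n. 0 <= (LINT x|\<mu>. norm (F n x - \<sigma> x) powr 2)" by simp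
   show "\<forall>n. (LINT x|\<mu>. norm (F n x - \<sigma> x) powr 2) <= 2 * (LINT x|\<mu>. 1 - F n x \<bullet> \<sigma> x)"
    using integral_mono_AE[OF i2 i le] unfolding integral_mult_right_zero by blast
   show "(%n. 2 * (LINT x|\<mu>. 1 - F n x \<bullet> \<sigma> x)) \<longlonglongrightarrow> 0" using tendsto_mult[OF tendsto_const[of 2] lim] by simp
  qed
 qed simp
qed

end

section \<open>The calibrating field\<close>

lemma Lp_mono:
 fixes f :: "'a::euclidean_space => 'b::euclidean_space"
 assumes fin: "finite_measure (lebesgue_on U)" and f: "f \<in> Lp q U" and p: "0 < p" "p <= q"
 shows "f \<in> Lp p U"
proof -
 interpret finite_measure "lebesgue_on U" by (rule fin)
 have [measurable]: "f \<in> borel_measurable (lebesgue_on U)" by (rule Lp_D(1)[OF f])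
 have le: "norm (f x) powr p <= 1 + norm (f x) powr q" for x
 proof (cases "norm (f x) <= 1")
  case True
  then have "norm (f x) powr p <= 1" using p by (intro powr_le1) auto
  then show ?thesis using powr_ge_zero[of "norm (f x)" q] by linarith
 next
  case False
  then have "norm (f x) powr p <= norm (f x) powr q" using p by (intro powr_mono) auto
  then show ?thesis by linarith
 qed
 have "integrable (lebesgue_on U) (%x. norm (f x) powr p)"
 proof (rule Bochner_Integration.integrable_bound)
  show "integrable (lebesgue_on U) (%x. 1 + norm (f x) powr q)"
   by (intro Bochner_Integration.integrable_add integrable_const Lp_D(2)[OF f])
  show "AE x in lebesgue_on U. norm (norm (f x) powr p) <= norm (1 + norm (f x) powr q)"
   using le by (intro AE_I2) (simp add: add_nonneg_nonneg)
 qed measurable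
 then show ?thesis unfolding Lp_def by simp
qed

text \<open>Expanding |a|^2 around b leaves twice the inner product of b and a - b, which the
  weighted inequality 2xy <= d x^2 + y^2 / d splits. Integrated, it gives the convergence of L^2
  norms.\<close>

lemma norm_square_diff_le:
 fixes a b :: "'b::real_inner"
 assumes "d > 0"
 shows "\<bar>(norm a)\<^sup>2 - (norm b)\<^sup>2\<bar> <= (1 + 1 / d) * (norm (a - b))\<^sup>2 + d * (norm b)\<^sup>2"
proof -
 have eq: "(norm a)\<^sup>2 - (norm b)\<^sup>2 = 2 * (b \<bullet> (a - b)) + (norm (a - b))\<^sup>2"
  unfolding power2_norm_eq_inner by (simp add: inner_diff_left inner_diff_right inner_commute)
 have "0 <= (d * norm b - norm (a - b))\<^sup>2" by simp
 then have "2 * (norm b * norm (a - b)) * d <= (d * (norm b)\<^sup>2 + (1 / d) * (norm (a - b))\<^sup>2) * d"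
  using assms by (simp add: power2_diff power2_eq_square algebra_simps)
 then have 1: "2 * (norm b * norm (a - b)) <= d * (norm b)\<^sup>2 + (1 / d) * (norm (a - b))\<^sup>2"
  using assms by (rule mult_right_le_imp_le)
 have "\<bar>(norm a)\<^sup>2 - (norm b)\<^sup>2\<bar> <= 2 * \<bar>b \<bullet> (a - b)\<bar> + (norm (a - b))\<^sup>2" unfolding eq by (rule order_trans[OF abs_triangle_ineq]) simp
 also have "... <= 2 * (norm b * norm (a - b)) + (norm (a - b))\<^sup>2" using Cauchy_Schwarz_ineq2[of b "a - b"] by simp
 also have "... <= (1 + 1 / d) * (norm (a - b))\<^sup>2 + d * (norm b)\<^sup>2" using 1 by (simp add: algebra_simps)
 finally show ?thesis .
qed

lemma L2_norm_tendsto: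
 fixes f :: "nat => 'a => 'b::euclidean_space"
 assumes f: "\<And>n. f n \<in> borel_measurable M" "\<And>n. integrable M (%x. (norm (f n x))\<^sup>2)"
  and s: "s \<in> borel_measurable M" "integrable M (%x. (norm (s x))\<^sup>2)"
  and lim: "(%n. (LINT x|M. (norm (f n x - s x))\<^sup>2)) \<longlonglongrightarrow> 0"
 shows "(%n. (LINT x|M. (norm (f n x))\<^sup>2)) \<longlonglongrightarrow> (LINT x|M. (norm (s x))\<^sup>2)"
proof (rule LIMSEQ_I)
 fix e :: real assume e: "e > 0"
 let ?S = "(LINT x|M. (norm (s x))\<^sup>2)"
 have S: "?S \<ge> 0" by simp
 define d where "d = e / (2 * (?S + 1))"
 have d: "d > 0" unfolding d_def by (intro divide_pos_pos mult_pos_pos add_nonneg_pos e S) simp_all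
 have dS: "d * ?S <= e / 2"
 proof -
  have "d * ?S <= d * (?S + 1)" using d by simp
  also have "... = e / 2" unfolding d_def using S by (simp add: field_simps add_nonneg_eq_0_iff)
  finally show ?thesis .
 qed
 have "(%n. (1 + 1 / d) * (LINT x|M. (norm (f n x - s x))\<^sup>2)) \<longlonglongrightarrow> 0"
  using tendsto_mult[OF tendsto_const[of "1 + 1 / d"] lim] by simp
 from order_tendstoD(2)[OF this, of "e / 2"] e obtain N where N: "\<forall>n\<ge>N. (1 + 1 / d) * (LINT x|M. (norm (f n x - s x))\<^sup>2) < e / 2"
  unfolding eventually_sequentially by auto
 have "norm ((LINT x|M. (norm (f n x))\<^sup>2) - ?S) < e" if n: "n \<ge> N" for n
 proof -
  have id: "integrable M (%x. (norm (f n x - s x))\<^sup>2)" by (rule integrable_square_diff[OF f(1) s(1) f(2) s(2)])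
  have "norm ((LINT x|M. (norm (f n x))\<^sup>2) - ?S) = norm (LINT x|M. (norm (f n x))\<^sup>2 - (norm (s x))\<^sup>2)"
   by (simp only: Bochner_Integration.integral_diff[OF f(2) s(2)])
  also have "... <= (LINT x|M. (1 + 1 / d) * (norm (f n x - s x))\<^sup>2 + d * (norm (s x))\<^sup>2)"
  proof (rule order_trans[OF integral_norm_bound], rule integral_mono)
   show "integrable M (%x. norm ((norm (f n x))\<^sup>2 - (norm (s x))\<^sup>2))"
    by (intro integrable_norm Bochner_Integration.integrable_diff f s)
   show "integrable M (%x. (1 + 1 / d) * (norm (f n x - s x))\<^sup>2 + d * (norm (s x))\<^sup>2)"
    by (intro Bochner_Integration.integrable_add integrable_mult_right id s)
   show "norm ((norm (f n x))\<^sup>2 - (norm (s x))\<^sup>2) <= (1 + 1 / d) * (norm (f n x - s x))\<^sup>2 + d * (norm (s x))\<^sup>2" for x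
    unfolding real_norm_def by (rule norm_square_diff_le[OF d])
  qed
  also have "... = (1 + 1 / d) * (LINT x|M. (norm (f n x - s x))\<^sup>2) + d * ?S"
   using Bochner_Integration.integral_add[OF integrable_mult_right[OF id, of "1 + 1 / d"] integrable_mult_right[OF s(2), of d]]
   unfolding integral_mult_right_zero .
  also have "... < e" using N[rule_format, OF n] dS by linarith
  finally show ?thesis .
 qed
 then show "\<exists>N. \<forall>n\<ge>N. norm ((LINT x|M. (norm (f n x))\<^sup>2) - ?S) < e" by blast
qed

lemma parallelogram_integral:
 fixes a b :: "'a => 'b::euclidean_space"
 assumes a: "a \<in> borel_measurable M" "integrable M (%x. (norm (a x))\<^sup>2)" and b: "b \<in> borel_measurable M" "integrable M (%x. (norm (b x))\<^sup>2)"
 shows "(LINT x|M. (norm ((1/2) *\<^sub>R a x + (1/2) *\<^sub>R b x))\<^sup>2) + (1/4) * (LINT x|M. (norm (a x - b x))\<^sup>2)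
  = ((LINT x|M. (norm (a x))\<^sup>2) + (LINT x|M. (norm (b x))\<^sup>2)) / 2"
proof -
 have d: "integrable M (%x. (norm (a x - b x))\<^sup>2)" by (rule integrable_square_diff[OF a(1) b(1) a(2) b(2)])
 have "(norm ((1/2) *\<^sub>R a x + (1/2) *\<^sub>R b x))\<^sup>2 = (1/2) * (norm (a x))\<^sup>2 + (1/2) * (norm (b x))\<^sup>2 - (1/4) * (norm (a x - b x))\<^sup>2" for x
  unfolding power2_norm_eq_inner
  by (simp add: inner_diff_left inner_diff_right inner_add_left inner_add_right inner_commute algebra_simps)
 then show ?thesis using a(2) b(2) d by simp
qed

text \<open>A strong substitute for weak compactness. The infima over the shrinking sets increase
  and stay below \<open>b\<close>, so they converge; the sets contain midpoints, and the
  parallelogram law makes almost minimal elements a Cauchy sequence. For a constant family this is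
  the projection onto a convex set.\<close>

lemma nested_minimizing_sequence_L2:
 fixes T :: "'i => 'a => 'b::euclidean_space" and X :: "nat => 'i set"
 assumes M: "finite_measure M" and X: "\<And>n. \<exists>x\<in>X n. (LINT y|M. (norm (T x y))\<^sup>2) <= b" "\<And>m n. m <= n ==> X n \<subseteq> X m"
  and T: "\<And>x. x \<in> X 0 ==> T x \<in> borel_measurable M" "\<And>x. x \<in> X 0 ==> integrable M (%y. (norm (T x y))\<^sup>2)"
  and mid: "\<And>n x y. x \<in> X n ==> y \<in> X n ==> \<exists>w\<in>X n. \<forall>z. T w z = (1/2) *\<^sub>R T x z + (1/2) *\<^sub>R T y z"
 shows "\<exists>xs s. (\<forall>n. xs n \<in> X n \<and> (LINT y|M. (norm (T (xs n) y))\<^sup>2) < Inf ((%x. (LINT y|M. (norm (T x y))\<^sup>2)) ` X n) + 1 / (real n + 1)) \<and> s \<in> borel_measurable M \<and> integrable M (%x. (norm (s x))\<^sup>2) \<and>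
  (%n. (LINT x|M. (norm (T (xs n) x - s x))\<^sup>2)) \<longlonglongrightarrow> 0 \<and>
  (\<exists>r::nat => nat. strict_mono r \<and> (AE x in M. (%k. T (xs (r k)) x) \<longlonglongrightarrow> s x))"
proof -
 define N where "N x = (LINT y|M. (norm (T x y))\<^sup>2)" for x
 define m where "m n = Inf (N ` X n)" for n
 have ne: "X n \<noteq> {}" for n using X(1) by blast
 have X0: "x \<in> X 0" if "x \<in> X n" for x n using X(2)[of 0 n] that by blast
 have N0: "0 <= N x" for x unfolding N_def by simp
 have bd: "bdd_below (N ` X n)" for n by (rule bdd_belowI[of _ 0]) (use N0 in auto)
 have ml: "m n <= N x" if "x \<in> X n" for n x unfolding m_def by (rule cInf_lower[OF imageI[OF that] bd])
 have mb: "m n <= b" for n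
 proof -
  obtain x where x: "x \<in> X n" "N x <= b" using X(1)[of n] unfolding N_def by blast
  show ?thesis using ml[OF x(1)] x(2) by linarith
 qed
 have inc: "incseq m"
  unfolding incseq_def m_def
 proof (intro allI impI)
  fix i j :: nat assume "i <= j"
  then have "N ` X j \<subseteq> N ` X i" using X(2) by (intro image_mono)
  then show "Inf (N ` X i) <= Inf (N ` X j)" using ne bd by (intro cInf_superset_mono) auto
 qed
 obtain ms where ms: "m \<longlonglongrightarrow> ms" "\<And>i. m i <= ms" using incseq_convergent[OF inc, of b] mb by blast
 have "\<forall>n. \<exists>x. x \<in> X n \<and> N x < m n + 1 / (real n + 1)"
 proof
  fix n
  have "Inf (N ` X n) < m n + 1 / (real n + 1)" unfolding m_def by (simp add: add_pos_nonneg)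
  from cInf_lessD[OF _ this] ne[of n] show "\<exists>x. x \<in> X n \<and> N x < m n + 1 / (real n + 1)" by blast
 qed
 from choice[OF this] obtain xs where xs: "\<forall>n. xs n \<in> X n \<and> N (xs n) < m n + 1 / (real n + 1)" ..
 have xsX: "xs n \<in> X n" for n using xs by blast
 \<comment> \<open>By the parallelogram law a squared distance is at most four times the gap between
   an upper bound for both squared norms and a lower bound for that of the midpoint; the latter is
   the infimum \<open>m n\<close>.\<close>
 define E where "E n = 4 * (ms + 1 / (real n + 1) - m n)" for n
 have E: "E \<longlonglongrightarrow> 0"
 proof -
  have "(%n. 1 / (real n + 1)) \<longlonglongrightarrow> 0" by real_asymp
  from tendsto_mult[OF tendsto_const[of 4] tendsto_diff[OF tendsto_add[OF tendsto_const[of ms] this] ms(1)]]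
  show ?thesis unfolding E_def by simp
 qed
 have close: "(LINT z|M. (norm (T (xs i) z - T (xs j) z))\<^sup>2) <= E n" if "n <= i" "n <= j" for i j n
 proof -
  have x: "xs i \<in> X n" "xs j \<in> X n" using xsX X(2) that by blast+
  obtain w where w: "w \<in> X n" "\<forall>z. T w z = (1/2) *\<^sub>R T (xs i) z + (1/2) *\<^sub>R T (xs j) z" using mid[OF x] by blast
  note par = parallelogram_integral[OF T(1,2)[OF X0[OF x(1)]] T(1,2)[OF X0[OF x(2)]]]
  have "(LINT z|M. (norm ((1/2) *\<^sub>R T (xs i) z + (1/2) *\<^sub>R T (xs j) z))\<^sup>2) = N w" unfolding N_def using w(2) by simp
  then have le: "m n <= (LINT z|M. (norm ((1/2) *\<^sub>R T (xs i) z + (1/2) *\<^sub>R T (xs j) z))\<^sup>2)" using ml[OF w(1)] by simp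
  have u: "N (xs k) <= ms + 1 / (real n + 1)" if "n <= k" for k
  proof -
   have "1 / (real k + 1) <= 1 / (real n + 1)" using that by (intro divide_left_mono) auto
   then show ?thesis using xs[rule_format, of k] ms(2)[of k] by linarith
  qed
  have "D <= 4 * (c - k)" if "P + (1/4) * D = (A + B) / 2" "k <= P" "A <= c" "B <= c" for P D A B c k :: real
  proof -
   have "D = 2 * A + 2 * B - 4 * P" using that(1) by (simp add: field_simps)
   then show ?thesis using that(2-4) by simp
  qed
  from this[OF par le u[OF that(1), unfolded N_def] u[OF that(2), unfolded N_def]] show ?thesis unfolding E_def .
 qed
 obtain s where s: "s \<in> borel_measurable M" "integrable M (%x. (norm (s x))\<^sup>2)"
  "\<And>n. integrable M (%x. (norm (T (xs n) x - s x))\<^sup>2)"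
  "(%n. (LINT x|M. (norm (T (xs n) x - s x))\<^sup>2)) \<longlonglongrightarrow> 0"
  "\<exists>r::nat => nat. strict_mono r \<and> (AE x in M. (%k. T (xs (r k)) x) \<longlonglongrightarrow> s x)"
 proof (rule L2_complete[OF M T(1)[OF X0[OF xsX]] T(2)[OF X0[OF xsX]]])
  fix e :: real assume "e > 0"
  from order_tendstoD(2)[OF E this] obtain n where "E n < e" unfolding eventually_sequentially by blast
  then show "\<exists>K. \<forall>i\<ge>K. \<forall>j\<ge>K. (LINT x|M. (norm (T (xs i) x - T (xs j) x))\<^sup>2) < e"
   using close[of n] by (intro exI[of _ n]) (auto intro: le_less_trans)
 qed (rule that)
 show ?thesis by (rule exI[of _ xs], rule exI[of _ s]) (use xs s in \<open>simp add: m_def N_def\<close>)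
qed

lemma TV_add_le:
 fixes U :: "'a::euclidean_space set"
 assumes U: "open U" and u: "integrable (lebesgue_on U) u" and w: "integrable (lebesgue_on U) w"
 shows "TV U (%x. u x + w x) <= TV U u + TV U w"
 unfolding TV_eq[OF U, of "%x. u x + w x"]
proof (rule SUP_least)
 fix \<phi> assume \<phi>: "\<phi> \<in> unit_fields U"
 then have d: "divergence \<phi> \<in> test_functions U" unfolding unit_fields_def by (simp add: divergence_test_function)
 have i: "integrable (lebesgue_on U) (%x. f x * divergence \<phi> x)" if "integrable (lebesgue_on U) f" for f
  using test_mult_integrable[OF d that] by (simp add: mult.commute)
 have "(LINT x|lebesgue_on U. (u x + w x) * divergence \<phi> x) = (LINT x|lebesgue_on U. u x * divergence \<phi> x) + (LINT x|lebesgue_on U. w x * divergence \<phi> x)"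
  unfolding distrib_right by (rule Bochner_Integration.integral_add[OF i[OF u] i[OF w]])
 then show "ereal (LINT x|lebesgue_on U. (u x + w x) * divergence \<phi> x) <= TV U u + TV U w"
  using add_mono[OF TV_upper[OF U \<phi>, of u] TV_upper[OF U \<phi>, of w]] by simp
qed

text \<open>The competitor 0 gives the first inequality. The competitor u + v and the subadditivity
  of TV give the second, after cancelling the finite value TV(u).\<close>

lemma subdifferential_TV_D:
 fixes U :: "'a::euclidean_space set"
 assumes U: "open U" "bounded U" and p: "p > 1" and u: "u \<in> Lp p U" and s: "w \<in> subdifferential p q U (TV U) u"
 shows "TV U u <= ereal (LINT x|lebesgue_on U. u x * w x)"
  "\<And>v. v \<in> Lp p U ==> ereal (LINT x|lebesgue_on U. v x * w x) <= TV U v"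
proof -
 note fin = bounded_finite_lebesgue_on[OF U]
 have p0: "p > 0" using p by simp
 have fi: "TV U u < \<infinity>" and sub: "\<And>v. v \<in> Lp p U ==> ereal (LINT x|lebesgue_on U. (v x - u x) * w x) + TV U u <= TV U v"
  using s unfolding subdifferential_def by auto
 have "TV U u \<ge> 0" by (rule TV_nonneg[OF U(1)])
 then obtain r where r: "TV U u = ereal r" using fi by (cases "TV U u") auto
 have "TV U (%x. 0) <= ereal 0" by (rule TV_least[OF U(1)]) simp
 moreover have "(%x. 0::real) \<in> Lp p U" by (rule Lp_test_function[OF fin test_zero less_imp_le[OF p0]])
 from sub[OF this] have "ereal (- (LINT x|lebesgue_on U. u x * w x)) + TV U u <= TV U (%x. 0)" by simp
 ultimately have "ereal (- (LINT x|lebesgue_on U. u x * w x) + r) <= ereal 0" unfolding r plus_ereal.simps(1) by (rule order_trans[rotated])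
 then show "TV U u <= ereal (LINT x|lebesgue_on U. u x * w x)" unfolding r by simp
 fix v :: "'a => real" assume v: "v \<in> Lp p U"
 have "ereal (LINT x|lebesgue_on U. v x * w x) + TV U u <= TV U (%x. u x + v x)" using sub[OF Lp_add[OF u v p0]] by simp
 also have "... <= TV U u + TV U v" by (rule TV_add_le[OF U(1) Lp_integrable[OF fin u p] Lp_integrable[OF fin v p]])
 finally show "ereal (LINT x|lebesgue_on U. v x * w x) <= TV U v" unfolding r by (cases "TV U v") auto
qed

lemma unit_fields_convex:
 assumes \<phi>: "\<phi> \<in> unit_fields U" and \<psi>: "\<psi> \<in> unit_fields U" and t: "0 <= t" "t <= 1"
 shows "(%x. (1 - t) *\<^sub>R \<phi> x + t *\<^sub>R \<psi> x) \<in> unit_fields U"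
  "divergence (%x. (1 - t) *\<^sub>R \<phi> x + t *\<^sub>R \<psi> x) x = (1 - t) * divergence \<phi> x + t * divergence \<psi> x"
proof -
 have T: "\<phi> \<in> test_functions U" "\<psi> \<in> test_functions U" and b: "\<And>x. norm (\<phi> x) <= 1" "\<And>x. norm (\<psi> x) <= 1"
  using \<phi> \<psi> unfolding unit_fields_def by auto
 have T': "(%x. (1 - t) *\<^sub>R \<phi> x) \<in> test_functions U" "(%x. t *\<^sub>R \<psi> x) \<in> test_functions U"
  by (intro test_linear[OF bounded_linear_scaleR_right] T)+
 have "norm ((1 - t) *\<^sub>R \<phi> x + t *\<^sub>R \<psi> x) <= 1" for x
 proof -
  have "norm ((1 - t) *\<^sub>R \<phi> x + t *\<^sub>R \<psi> x) <= (1 - t) * 1 + t * 1"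
   using t b by (intro norm_triangle_le add_mono) (auto intro!: mult_left_mono simp del: mult_1_right)
  then show ?thesis by simp
 qed
 then show "(%x. (1 - t) *\<^sub>R \<phi> x + t *\<^sub>R \<psi> x) \<in> unit_fields U" using test_add[OF T'] unfolding unit_fields_def by simp
 show "divergence (%x. (1 - t) *\<^sub>R \<phi> x + t *\<^sub>R \<psi> x) x = (1 - t) * divergence \<phi> x + t * divergence \<psi> x"
  by (simp add: divergence_add test_differentiable[OF T'(1)] test_differentiable[OF T'(2)]
    divergence_linear_scaleR test_differentiable[OF T(1)] test_differentiable[OF T(2)])
qed

lemma nonneg_of_quadratic:
 fixes a b :: real
 assumes "\<And>t. 0 < t ==> t <= 1 ==> 0 <= 2 * t * a + t\<^sup>2 * b"
 shows "0 <= a"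
proof (rule ccontr)
 assume "\<not> 0 <= a"
 then have a: "a < 0" by simp
 \<comment> \<open>So small that t |b| <= - a, whence 2 a + t b is at most a and thus
   negative.\<close>
 define t where "t = min 1 (- a / (\<bar>b\<bar> + 1))"
 have t: "0 < t" "t <= 1" "t <= - a / (\<bar>b\<bar> + 1)" unfolding t_def using a by (auto simp: divide_neg_pos)
 have "t * (\<bar>b\<bar> + 1) <= - a"
 proof -
  have "0 < \<bar>b\<bar> + 1" by linarith
  from pos_le_divide_eq[OF this, THEN iffD1, OF t(3)] show ?thesis .
 qed
 moreover have "t * b <= t * (\<bar>b\<bar> + 1)" using t(1) by (intro mult_left_mono) auto
 ultimately have "2 * a + t * b < 0" using a by linarith
 then have "t * (2 * a + t * b) < 0" using t(1) by (simp add: mult_pos_neg)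
 then show False using assms[OF t(1,2)] by (simp add: power2_eq_square algebra_simps)
qed

lemma Lp_2_iff: "f \<in> Lp 2 U \<longleftrightarrow> f \<in> borel_measurable (lebesgue_on U) \<and> integrable (lebesgue_on U) (%x. (norm (f x))\<^sup>2)"
 unfolding Lp_def norm_powr_2 by simp

text \<open>\<open>s\<close> is the element of least norm in the closure of the convex set of all w
  + div \<open>\<phi>\<close>, and the inequality is its first-order condition along the segment
  towards w + div \<open>\<psi>\<close>. As \<open>s\<close> itself need not be of this form,
  minimality is used on segments that start from the \<open>xs n\<close> and then passed to the
  limit.\<close>

lemma projection_variational_inequality:
 fixes U :: "'a::euclidean_space set" and w :: "'a => real"
 assumes U: "open U" "bounded U" and w: "w \<in> Lp 2 U"
 shows "\<exists>xs s. (\<forall>n. xs n \<in> unit_fields U) \<and> s \<in> Lp 2 U \<and>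
  (%n. LINT x|lebesgue_on U. (norm (w x + divergence (xs n) x))\<^sup>2) \<longlonglongrightarrow> (LINT x|lebesgue_on U. (norm (s x))\<^sup>2) \<and>
  (\<forall>\<psi>\<in>unit_fields U. 0 <= (LINT x|lebesgue_on U. s x * (w x + divergence \<psi> x - s x)))"
proof -
 let ?M = "lebesgue_on U"
 note fin = bounded_finite_lebesgue_on[OF U]
 define T where "T \<phi> x = w x + divergence \<phi> x" for \<phi> :: "'a => 'a" and x
 define J where "J \<phi> = (LINT x|?M. (norm (T \<phi> x))\<^sup>2)" for \<phi>
 have TL: "T \<phi> \<in> Lp 2 U" if "\<phi> \<in> unit_fields U" for \<phi>
 proof -
  have "\<phi> \<in> test_functions U" using that unfolding unit_fields_def by simp
  then have "divergence \<phi> \<in> Lp 2 U" by (intro Lp_test_function[OF fin divergence_test_function]) auto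
  then show ?thesis unfolding T_def[abs_def] by (intro Lp_add w) auto
 qed
 have T: "T \<phi> \<in> borel_measurable ?M" "integrable ?M (%x. (norm (T \<phi> x))\<^sup>2)" if "\<phi> \<in> unit_fields U" for \<phi>
  using TL[OF that] unfolding Lp_2_iff by blast+
 have conv: "(%x. (1 - t) *\<^sub>R \<phi> x + t *\<^sub>R \<psi> x) \<in> unit_fields U"
   "T (%x. (1 - t) *\<^sub>R \<phi> x + t *\<^sub>R \<psi> x) x = (1 - t) *\<^sub>R T \<phi> x + t *\<^sub>R T \<psi> x"
  if "\<phi> \<in> unit_fields U" "\<psi> \<in> unit_fields U" "0 <= t" "t <= 1" for \<phi> \<psi> t x
  unfolding T_def unit_fields_convex(2)[OF that] by (rule unit_fields_convex(1)[OF that]) (simp add: algebra_simps)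
 let ?I = "Inf (J ` unit_fields U)"
 have "\<exists>xs s. (\<forall>n. xs n \<in> unit_fields U \<and> (LINT y|?M. (norm (T (xs n) y))\<^sup>2) < Inf ((%x. LINT y|?M. (norm (T x y))\<^sup>2) ` unit_fields U) + 1 / (real n + 1)) \<and>
  s \<in> borel_measurable ?M \<and> integrable ?M (%x. (norm (s x))\<^sup>2) \<and> (%n. LINT x|?M. (norm (T (xs n) x - s x))\<^sup>2) \<longlonglongrightarrow> 0 \<and>
  (\<exists>r::nat => nat. strict_mono r \<and> (AE x in ?M. (%k. T (xs (r k)) x) \<longlonglongrightarrow> s x))"
 proof (rule nested_minimizing_sequence_L2[where X="%n. unit_fields U" and T=T and b="J (%x. 0)", OF fin _ _ T])
  show "\<exists>\<phi>\<in>unit_fields U. (LINT y|?M. (norm (T \<phi> y))\<^sup>2) <= J (%x. 0)"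
   unfolding J_def by (rule bexI[OF order_refl unit_fields_zero])
  show "\<exists>w\<in>unit_fields U. \<forall>z. T w z = (1/2) *\<^sub>R T x z + (1/2) *\<^sub>R T y z"
   if xy: "x \<in> unit_fields U" "y \<in> unit_fields U" for x y
  proof (rule bexI)
   show "(%z. (1 - 1/2) *\<^sub>R x z + (1/2) *\<^sub>R y z) \<in> unit_fields U" by (rule conv(1)[OF xy]) auto
   show "\<forall>z. T (%z. (1 - 1/2) *\<^sub>R x z + (1/2) *\<^sub>R y z) z = (1/2) *\<^sub>R T x z + (1/2) *\<^sub>R T y z"
    using conv(2)[OF xy, of "1/2"] by simp
  qed
 qed simp_all
 then obtain xs s where xs': "\<forall>n. xs n \<in> unit_fields U \<and> J (xs n) < ?I + 1 / (real n + 1)"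
  and s: "s \<in> borel_measurable ?M" "integrable ?M (%x. (norm (s x))\<^sup>2)"
  and sl: "(%n. LINT x|?M. (norm (T (xs n) x - s x))\<^sup>2) \<longlonglongrightarrow> 0"
  unfolding J_def[abs_def] by (elim exE conjE)
 have xs: "xs n \<in> unit_fields U" for n using xs' by simp
 have Inf: "?I <= J x" if "x \<in> unit_fields U" for x
  by (rule cInf_lower[OF imageI[OF that]], rule bdd_belowI[of _ 0]) (auto simp: J_def)
 have lim: "(%n. J (xs n)) \<longlonglongrightarrow> ?I"
 proof (rule tendsto_sandwich[OF always_eventually always_eventually tendsto_const])
  show "\<forall>n. ?I <= J (xs n)" using Inf xs by blast
  show "\<forall>n. J (xs n) <= ?I + 1 / (real n + 1)" using xs' less_imp_le by blast
  have "(%n. 1 / (real n + 1)) \<longlonglongrightarrow> 0" by real_asymp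
  from tendsto_add[OF tendsto_const[of ?I] this] show "(%n. ?I + 1 / (real n + 1)) \<longlonglongrightarrow> ?I" by simp
 qed
 have sL: "s \<in> Lp 2 U" unfolding Lp_2_iff using s by blast
 have J: "(%n. J (xs n)) \<longlonglongrightarrow> (LINT x|?M. (norm (s x))\<^sup>2)"
  unfolding J_def by (rule L2_norm_tendsto[OF T[OF xs] s sl])
 have I: "?I = (LINT x|?M. (norm (s x))\<^sup>2)" by (rule LIMSEQ_unique[OF lim J])
 have "0 <= (LINT x|?M. s x * (T \<psi> x - s x))" if \<psi>: "\<psi> \<in> unit_fields U" for \<psi>
 proof (rule nonneg_of_quadratic)
  fix t :: real assume t: "0 < t" "t <= 1"
  let ?s = "%x. (1 - t) *\<^sub>R s x + t *\<^sub>R T \<psi> x" and ?f = "%n x. (1 - t) *\<^sub>R T (xs n) x + t *\<^sub>R T \<psi> x"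
  have cL: "(%x. (1 - t) *\<^sub>R f x + t *\<^sub>R T \<psi> x) \<in> Lp 2 U" if f: "f \<in> Lp 2 U" for f
  proof (rule Lp_add)
   have sc: "(%x. c *\<^sub>R k x) \<in> Lp 2 U" if "k \<in> Lp 2 U" for c and k :: "'a => real"
    using that unfolding Lp_2_iff by (auto simp: power_mult_distrib abs_mult)
   show "(%x. (1 - t) *\<^sub>R f x) \<in> Lp 2 U" "(%x. t *\<^sub>R T \<psi> x) \<in> Lp 2 U" by (rule sc[OF f], rule sc[OF TL[OF \<psi>]])
  qed simp
  have "?f n x = T (%x. (1 - t) *\<^sub>R xs n x + t *\<^sub>R \<psi> x) x" for n x using conv(2)[OF xs \<psi>, of t] t by simp
  then have fI: "?I <= (LINT x|?M. (norm (?f n x))\<^sup>2)" for n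
   using Inf[OF conv(1)[OF xs \<psi>, of t n]] t unfolding J_def by simp
  have "(%n. LINT x|?M. (norm (?f n x - ?s x))\<^sup>2) \<longlonglongrightarrow> 0"
  proof -
   have "(norm (?f n x - ?s x))\<^sup>2 = (1 - t)\<^sup>2 * (norm (T (xs n) x - s x))\<^sup>2" for n x
    by (simp add: power_mult_distrib flip: right_diff_distrib)
   then show ?thesis using tendsto_mult[OF tendsto_const[of "(1 - t)\<^sup>2"] sl] by simp
  qed
  then have "(%n. LINT x|?M. (norm (?f n x))\<^sup>2) \<longlonglongrightarrow> (LINT x|?M. (norm (?s x))\<^sup>2)"
   using cL[OF TL[OF xs]] cL[OF sL] unfolding Lp_2_iff by (intro L2_norm_tendsto) blast+
  then have le: "?I <= (LINT x|?M. (norm (?s x))\<^sup>2)" by (rule LIMSEQ_le_const) (use fI in blast)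
  have dL: "(%x. T \<psi> x - s x) \<in> Lp 2 U" by (rule Lp_diff[OF TL[OF \<psi>] sL]) simp
  have i: "integrable ?M (%x. s x * (T \<psi> x - s x))" by (rule Holder_integrable(1)[OF sL dL, of 1]) auto
  have id: "integrable ?M (%x. (norm (T \<psi> x - s x))\<^sup>2)" using dL unfolding Lp_2_iff by blast
  have "(norm (?s x))\<^sup>2 = (norm (s x))\<^sup>2 + (2 * t * (s x * (T \<psi> x - s x)) + t\<^sup>2 * (norm (T \<psi> x - s x))\<^sup>2)" for x
   by (simp add: power2_eq_square algebra_simps)
  then have "(LINT x|?M. (norm (?s x))\<^sup>2) = (LINT x|?M. (norm (s x))\<^sup>2 + (2 * t * (s x * (T \<psi> x - s x)) + t\<^sup>2 * (norm (T \<psi> x - s x))\<^sup>2))"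
   by (simp only:)
  also have "... = (LINT x|?M. (norm (s x))\<^sup>2) + ((LINT x|?M. 2 * t * (s x * (T \<psi> x - s x))) + (LINT x|?M. t\<^sup>2 * (norm (T \<psi> x - s x))\<^sup>2))"
   by (simp only: Bochner_Integration.integral_add[OF s(2) Bochner_Integration.integrable_add[OF integrable_mult_right[OF i] integrable_mult_right[OF id]]]
     Bochner_Integration.integral_add[OF integrable_mult_right[OF i] integrable_mult_right[OF id]])
  finally show "0 <= 2 * t * (LINT x|?M. s x * (T \<psi> x - s x)) + t\<^sup>2 * (LINT x|?M. (norm (T \<psi> x - s x))\<^sup>2)"
   using le unfolding I integral_mult_right_zero by linarith
 qed
 then show ?thesis using xs sL J unfolding J_def T_def by blast
qed

lemma divergence_approximation:
 fixes U :: "'a::euclidean_space set" and w :: "'a => real"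
 assumes U: "open U" "bounded U" and p: "1 < p" "p <= 2" and w: "w \<in> Lp 2 U"
  and TV: "\<And>v. v \<in> Lp p U ==> ereal (LINT x|lebesgue_on U. v x * w x) <= TV U v"
 shows "\<exists>xs. (\<forall>n. xs n \<in> unit_fields U) \<and> (%n. LINT x|lebesgue_on U. (norm (w x + divergence (xs n) x))\<^sup>2) \<longlonglongrightarrow> 0"
proof -
 let ?M = "lebesgue_on U"
 note fin = bounded_finite_lebesgue_on[OF U]
 obtain xs s where xs: "\<forall>n. xs n \<in> unit_fields U" and sL: "s \<in> Lp 2 U"
  and lim: "(%n. LINT x|?M. (norm (w x + divergence (xs n) x))\<^sup>2) \<longlonglongrightarrow> (LINT x|?M. (norm (s x))\<^sup>2)"
  and var: "\<forall>\<psi>\<in>unit_fields U. 0 <= (LINT x|?M. s x * (w x + divergence \<psi> x - s x))"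
  using projection_variational_inequality[OF U w] by blast
 have H: "integrable ?M (%x. s x * k x)" if "k \<in> Lp 2 U" for k
  by (rule Holder_integrable(1)[OF sL that, of 1]) auto
 have "TV U s <= ereal ((LINT x|?M. s x * w x) - (LINT x|?M. (norm (s x))\<^sup>2))"
 proof (rule TV_least[OF U(1)])
  fix \<psi> assume \<psi>: "\<psi> \<in> unit_fields U"
  then have \<psi>T: "\<psi> \<in> test_functions U" unfolding unit_fields_def by simp
  have dm: "divergence (%x. - \<psi> x) x = - divergence \<psi> x" for x
   using divergence_linear_scaleR[OF test_differentiable[OF \<psi>T], of "-1" x] by simp
  have dL: "divergence \<psi> \<in> Lp 2 U" by (rule Lp_test_function[OF fin divergence_test_function[OF \<psi>T]]) simp
  have "s x * (w x + divergence (%x. - \<psi> x) x - s x) = s x * w x - s x * divergence \<psi> x - (norm (s x))\<^sup>2" for x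
   unfolding dm by (simp add: algebra_simps power2_eq_square)
  \<comment> \<open>The variational inequality for the field - \<open>\<psi>\<close> becomes an
    upper bound for the pairing in the supremum that defines TV.\<close>
  then have "0 <= (LINT x|?M. s x * w x - s x * divergence \<psi> x - (norm (s x))\<^sup>2)"
   using var[rule_format, OF unit_fields_minus[OF \<psi>]] by simp
  also have "... = (LINT x|?M. s x * w x) - (LINT x|?M. s x * divergence \<psi> x) - (LINT x|?M. (norm (s x))\<^sup>2)"
   using H[OF w] H[OF dL] sL unfolding Lp_2_iff by simp
  finally show "(LINT x|?M. s x * divergence \<psi> x) <= (LINT x|?M. s x * w x) - (LINT x|?M. (norm (s x))\<^sup>2)" by simp
 qed
 \<comment> \<open>The residual is known to be square integrable; p <= 2 admits it as a competitor
   in the hypothesis on TV.\<close>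
 moreover have "s \<in> Lp p U" by (rule Lp_mono[OF fin sL]) (use p in auto)
 ultimately have "ereal (LINT x|?M. s x * w x) <= ereal ((LINT x|?M. s x * w x) - (LINT x|?M. (norm (s x))\<^sup>2))"
  using TV order_trans by blast
 moreover have "0 <= (LINT x|?M. (norm (s x))\<^sup>2)" by (rule Bochner_Integration.integral_nonneg) simp
 ultimately have "(LINT x|?M. (norm (s x))\<^sup>2) = 0" unfolding ereal_less_eq by linarith
 then show ?thesis using xs lim by auto
qed

text \<open>The approximating fields have compact support in \<open>W\<close>, so the identity
  survives for functions that do not vanish on the boundary. The bound on |g| is inherited pointwise
  along an almost everywhere convergent subsequence, which strong convergence provides.\<close>

lemma calibrating_field:
 fixes W :: "'a::euclidean_space set" and w :: "'a => real"
 assumes W: "open W" "bounded W" and p: "1 < p" "p <= 2" and w: "w \<in> Lp 2 W"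
  and TV: "\<And>v. v \<in> Lp p W ==> ereal (LINT x|lebesgue_on W. v x * w x) <= TV W v"
 shows "\<exists>g\<in>borel_measurable (lebesgue_on W). (AE x in lebesgue_on W. norm (g x) <= 1) \<and>
  (\<forall>v\<in>test_functions UNIV. (LINT x|lebesgue_on W. gradient v x \<bullet> g x) = (LINT x|lebesgue_on W. v x * w x))"
proof -
 let ?M = "lebesgue_on W"
 note fin = bounded_finite_lebesgue_on[OF W]
 interpret finite_measure ?M by (rule fin)
 define J where "J \<phi> = (LINT x|?M. (norm (w x + divergence \<phi> x))\<^sup>2)" for \<phi>
 \<comment> \<open>On \<open>X n\<close> the divergence is within 1/(n+1) of - \<open>w\<close> in
   the squared norm, so every choice of elements has the right divergence in the limit, and the
   choice can be spent on making the fields converge.\<close>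
 define X where "X n = {\<phi> \<in> unit_fields W. J \<phi> <= 1 / (real n + 1)}" for n :: nat
 obtain xs where xs: "\<forall>n. xs n \<in> unit_fields W" "(%n. J (xs n)) \<longlonglongrightarrow> 0"
  using divergence_approximation[OF assms] unfolding J_def by blast
 have TF: "\<phi> \<in> test_functions W" "\<And>x. norm (\<phi> x) <= 1" if "\<phi> \<in> unit_fields W" for \<phi>
  using that unfolding unit_fields_def by auto
 have DL: "(%x. w x + divergence \<phi> x) \<in> Lp 2 W" if "\<phi> \<in> unit_fields W" for \<phi>
  by (intro Lp_add w Lp_test_function[OF fin divergence_test_function[OF TF(1)[OF that]]]) auto
 have L2: "\<phi> \<in> Lp 2 W" if "\<phi> \<in> unit_fields W" for \<phi>
  by (rule Lp_test_function[OF fin TF(1)[OF that]]) simp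
 have XU: "\<phi> \<in> unit_fields W" if "\<phi> \<in> X n" for \<phi> n using that unfolding X_def by simp
 have "\<exists>ys g. (\<forall>n. ys n \<in> X n \<and> (LINT y|?M. (norm (ys n y))\<^sup>2) < Inf ((%\<phi>. LINT y|?M. (norm (\<phi> y))\<^sup>2) ` X n) + 1 / (real n + 1)) \<and> g \<in> borel_measurable ?M \<and> integrable ?M (%x. (norm (g x))\<^sup>2) \<and>
  (%n. LINT x|?M. (norm (ys n x - g x))\<^sup>2) \<longlonglongrightarrow> 0 \<and>
  (\<exists>r::nat => nat. strict_mono r \<and> (AE x in ?M. (%k. ys (r k) x) \<longlonglongrightarrow> g x))"
 proof (rule nested_minimizing_sequence_L2[where T="%\<phi>. \<phi>" and X=X and b="measure ?M (space ?M)", OF fin])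
  show "\<exists>\<phi>\<in>X n. (LINT y|?M. (norm (\<phi> y))\<^sup>2) <= measure ?M (space ?M)" for n
  proof -
   have "0 < 1 / (real n + 1)" by simp
   from order_tendstoD(2)[OF xs(2) this] obtain k where "J (xs k) < 1 / (real n + 1)" unfolding eventually_sequentially by blast
   then have "xs k \<in> X n" unfolding X_def using xs(1) by simp
   moreover have "(LINT y|?M. (norm (xs k y))\<^sup>2) <= (LINT y|?M. 1)"
    by (rule integral_mono') (use TF(2)[OF xs(1)[rule_format]] in \<open>simp_all add: power_le_one\<close>)
   ultimately show ?thesis by (intro bexI[of _ "xs k"]) simp_all
  qed
  show "X n \<subseteq> X m" if "m <= n" for m n
  proof -
   have "1 / (real n + 1) <= 1 / (real m + 1)" using that by (intro divide_left_mono) auto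
   then show ?thesis unfolding X_def by auto
  qed
  show "\<phi> \<in> borel_measurable ?M" "integrable ?M (%x. (norm (\<phi> x))\<^sup>2)" if "\<phi> \<in> X 0" for \<phi>
   using L2[OF XU[OF that]] unfolding Lp_2_iff by blast+
  show "\<exists>w\<in>X n. \<forall>z. w z = (1/2) *\<^sub>R x z + (1/2) *\<^sub>R y z" if xy: "x \<in> X n" "y \<in> X n" for n x y
  proof (rule bexI)
   note U = XU[OF xy(1)] XU[OF xy(2)]
   have dv: "divergence (%z. (1 - 1/2) *\<^sub>R x z + (1/2) *\<^sub>R y z) z = (1 - 1/2) * divergence x z + (1/2) * divergence y z" for z
    by (rule unit_fields_convex(2)[OF U]) auto
   have "w z + divergence (%z. (1 - 1/2) *\<^sub>R x z + (1/2) *\<^sub>R y z) z = (1/2) *\<^sub>R (w z + divergence x z) + (1/2) *\<^sub>R (w z + divergence y z)" for z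
    by (simp only: dv) (simp add: field_simps)
   then have 1: "J (%z. (1 - 1/2) *\<^sub>R x z + (1/2) *\<^sub>R y z)
     = (LINT z|?M. (norm ((1/2) *\<^sub>R (w z + divergence x z) + (1/2) *\<^sub>R (w z + divergence y z)))\<^sup>2)"
    unfolding J_def by (simp only:)
   note L = DL[OF U(1), unfolded Lp_2_iff] DL[OF U(2), unfolded Lp_2_iff]
   note par = parallelogram_integral[OF conjunct1[OF L(1)] conjunct2[OF L(1)] conjunct1[OF L(2)] conjunct2[OF L(2)], folded J_def]
   have arith: "P <= c" if "P + 1/4 * D = (A + B) / 2" "0 <= D" "A <= c" "B <= c" for P D A B c :: real
   proof -
    have "4 * P = 2 * A + 2 * B - D" using that(1) by (simp add: field_simps)
    then show ?thesis using that(2-4) by simp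
   qed
   have "0 <= (LINT z|?M. (norm ((w z + divergence x z) - (w z + divergence y z)))\<^sup>2)"
    by (rule Bochner_Integration.integral_nonneg) simp
   moreover have "J x <= 1 / (real n + 1)" "J y <= 1 / (real n + 1)" using xy unfolding X_def by auto
   ultimately have "J (%z. (1 - 1/2) *\<^sub>R x z + (1/2) *\<^sub>R y z) <= 1 / (real n + 1)" unfolding 1 by (rule arith[OF par])
   moreover have "(%z. (1 - 1/2) *\<^sub>R x z + (1/2) *\<^sub>R y z) \<in> unit_fields W" by (rule unit_fields_convex(1)[OF U]) auto
   ultimately show "(%z. (1 - 1/2) *\<^sub>R x z + (1/2) *\<^sub>R y z) \<in> X n" unfolding X_def by blast
   show "\<forall>z. (1 - 1/2) *\<^sub>R x z + (1/2) *\<^sub>R y z = (1/2) *\<^sub>R x z + (1/2) *\<^sub>R y z" by simp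
  qed
 qed
 then obtain ys g r where ys: "\<forall>n. ys n \<in> X n \<and> (LINT y|?M. (norm (ys n y))\<^sup>2) < Inf ((%\<phi>. LINT y|?M. (norm (\<phi> y))\<^sup>2) ` X n) + 1 / (real n + 1)" and g: "g \<in> borel_measurable ?M" "integrable ?M (%x. (norm (g x))\<^sup>2)"
  and lim: "(%n. LINT x|?M. (norm (ys n x - g x))\<^sup>2) \<longlonglongrightarrow> 0" and r: "AE x in ?M. (%k. ys (r k) x) \<longlonglongrightarrow> g x"
  by (elim exE conjE)
 have U: "ys n \<in> unit_fields W" for n using ys XU by blast
 have "AE x in ?M. norm (g x) <= 1"
  using r
 proof eventually_elim
  case (elim x)
  show ?case by (rule LIMSEQ_le_const2[OF tendsto_norm[OF elim]]) (use TF(2)[OF U] in blast)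
 qed
 moreover have "(LINT x|?M. gradient v x \<bullet> g x) = (LINT x|?M. v x * w x)" if v: "v \<in> test_functions UNIV" for v
 proof -
  note Gv = gradient_test_function[OF v]
  have gL: "g \<in> Lp 2 W" unfolding Lp_2_iff using g by blast
  have dL: "(%x. ys n x - g x) \<in> Lp 2 W" for n by (rule Lp_diff[OF L2[OF U] gL]) simp
  have 1: "(%n. LINT x|?M. gradient v x \<bullet> (ys n x - g x)) \<longlonglongrightarrow> 0"
   by (rule Lq_null_inner[OF fin Gv dL]) (use lim in \<open>simp_all only: norm_powr_2 one_less_numeral_iff semiring_norm\<close>)
  have Jy: "(%n. LINT x|?M. (norm (w x + divergence (ys n) x))\<^sup>2) \<longlonglongrightarrow> 0"
  proof (rule tendsto_sandwich[OF always_eventually always_eventually tendsto_const])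
   show "\<forall>n. 0 <= (LINT x|?M. (norm (w x + divergence (ys n) x))\<^sup>2)" by simp
   show "\<forall>n. (LINT x|?M. (norm (w x + divergence (ys n) x))\<^sup>2) <= 1 / (real n + 1)" using ys unfolding X_def J_def by simp
   show "(%n. 1 / (real n + 1)) \<longlonglongrightarrow> 0" by real_asymp
  qed
  have 2: "(%n. LINT x|?M. v x \<bullet> (w x + divergence (ys n) x)) \<longlonglongrightarrow> 0"
   by (rule Lq_null_inner[OF fin v DL[OF U]]) (use Jy in \<open>simp_all only: norm_powr_2 one_less_numeral_iff semiring_norm\<close>)
  have eq: "(LINT x|?M. gradient v x \<bullet> (ys n x - g x)) + (LINT x|?M. v x \<bullet> (w x + divergence (ys n) x))
    = (LINT x|?M. v x * w x) - (LINT x|?M. gradient v x \<bullet> g x)" for n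
  proof -
   note T = TF(1)[OF U[of n]]
   have i: "integrable ?M (%x. gradient v x \<bullet> ys n x)" "integrable ?M (%x. gradient v x \<bullet> g x)"
    "integrable ?M (%x. v x \<bullet> w x)" "integrable ?M (%x. v x \<bullet> divergence (ys n) x)"
    by (intro test_inner_integrable[OF Gv] test_inner_integrable[OF v] Lp_integrable[OF fin, where q=2] L2[OF U] gL w
      Lp_test_function[OF fin divergence_test_function[OF T]]; simp)+
   have "(LINT x|?M. gradient v x \<bullet> ys n x) = - (LINT x|?M. v x \<bullet> divergence (ys n) x)"
    unfolding inner_real_def by (rule integration_by_parts[OF v T W(1)]) simp
   then show ?thesis unfolding inner_diff_right inner_add_right Bochner_Integration.integral_diff[OF i(1,2)] Bochner_Integration.integral_add[OF i(3,4)]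
    by (simp add: inner_real_def)
  qed
  from tendsto_add[OF 1 2] have "(%n::nat. (LINT x|?M. v x * w x) - (LINT x|?M. gradient v x \<bullet> g x)) \<longlonglongrightarrow> 0" unfolding eq by simp
  from LIMSEQ_unique[OF this tendsto_const] show ?thesis by simp
 qed
 ultimately show ?thesis using g(1) by blast
qed

section \<open>The subdifferential\<close>

text \<open>One sequence of test fields serves two purposes: it is admissible in the definition of
  the trace, and its divergences converge in L^q, which controls the integrals against
  \<open>u\<close>. Membership in the closure \<open>Wdiv0\<close> follows from the same
  sequence.\<close>

lemma ex_tilde_approximation:
 fixes U :: "'a::euclidean_space set"
 assumes U: "bounded_lipschitz_domain U" and q: "q > 1" and R: "representative_choice U R"
  and g: "g \<in> borel_measurable (lebesgue_on U)" "Linf_norm U g <= 1" and h: "h \<in> Lp q U"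
  and wd: "\<forall>v\<in>test_functions UNIV. (LINT x|lebesgue_on U. gradient v x \<bullet> g x) = - (LINT x|lebesgue_on U. v x * h x)"
 shows "g \<in> Wdiv0 q U \<inter> Linf U" "has_weak_div U g h"
  "\<exists>\<phi>. (\<forall>n. \<phi> n \<in> unit_fields U) \<and>
   (%n. LINT x|lebesgue_on U. norm (\<phi> n x - g x) powr q) \<longlonglongrightarrow> 0 \<and>
   (%n. LINT x|lebesgue_on U. norm (divergence (\<phi> n) x - h x) powr q) \<longlonglongrightarrow> 0 \<and>
   tilde_converges R q U \<phi> g"
proof -
 have op: "open U" and bd: "bounded U" using U unfolding bounded_lipschitz_domain_def by auto
 note fin = bounded_finite_lebesgue_on[OF op bd]
 have q0: "q > 0" using q by simp
 \<comment> \<open>The actual supremum of |g| and not the bound 1, because an admissible sequence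
   must not exceed the norm of \<open>g\<close>.\<close>
 define c where "c = enn2real (Linf_norm U g)"
 have lt: "Linf_norm U g < \<infinity>" using le_less_trans[OF g(2)] by simp
 have c: "c \<ge> 0" "Linf_norm U g = ennreal c" unfolding c_def using lt by (auto simp: ennreal_enn2real)
 have c1: "c <= 1" using g(2) unfolding c(2) by simp
 have ae: "AE x in lebesgue_on U. norm (g x) <= c" using Linf_norm_le_ennreal_iff[OF op g(1) c(1)] c(2) by simp
 have gL: "g \<in> Lp q U" by (rule Lp_bounded[OF fin g(1) ae less_imp_le[OF q0]])
 show wdiv: "has_weak_div U g h"
  unfolding has_weak_div_def
 proof (intro conjI ballI)
  show "locally_integrable U g" "locally_integrable U h"
   by (rule Lp_locally_integrable[OF op bd gL q], rule Lp_locally_integrable[OF op bd h q])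
  show "(LINT x|lebesgue_on U. gradient v x \<bullet> g x) = - (LINT x|lebesgue_on U. v x * h x)" if "v \<in> test_functions U" for v
   by (rule wd[rule_format, OF test_mono[OF that]]) simp
 qed
 obtain \<phi> :: "nat => 'a => 'a" where \<phi>: "\<forall>n. \<phi> n \<in> test_functions U" "\<forall>n x. norm (\<phi> n x) <= c"
  and lim: "(%n. LINT x|lebesgue_on U. norm (\<phi> n x - g x) powr q) \<longlonglongrightarrow> 0"
   "(%n. LINT x|lebesgue_on U. norm (divergence (\<phi> n) x - h x) powr q) \<longlonglongrightarrow> 0"
  and pt: "\<forall>G x. (AE y in lebesgue_on U. G y = g y) --> x \<in> U --> lebesgue_point G x --> (%n. \<phi> n x) \<longlonglongrightarrow> G x"
  by (rule exE[OF lipschitz_approximation[OF U q g(1) ae c(1) h wd[rule_format]]], assumption, elim conjE, rule that)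
 have T: "\<phi> n \<in> test_functions U" for n using \<phi>(1) by simp
 show g0: "g \<in> Wdiv0 q U \<inter> Linf U"
  using Wdiv0I[OF op bd q gL h wdiv T lim] g(1) lt unfolding Linf_def by simp
 have unit: "\<phi> n \<in> unit_fields U" for n unfolding unit_fields_def using T \<phi>(2) c1 by (auto intro: order_trans)
 have phL: "\<phi> n \<in> Lp q U" "divergence (\<phi> n) \<in> Lp q U" for n
  using Lp_test_function[OF fin T less_imp_le[OF q0]] Lp_test_function[OF fin divergence_test_function[OF T] less_imp_le[OF q0]] .
 have phW: "has_weak_div U (\<phi> n) (divergence (\<phi> n))" for n by (rule has_weak_div_smooth[OF T op refl])
 have "tilde_converges R q U \<phi> g"
  unfolding tilde_converges_def
 proof (intro conjI allI ballI impI)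
  show "g \<in> Wdiv q U \<inter> Linf U" using g0 unfolding Wdiv0_def by simp
  show "continuous_on (closure U) (\<phi> n)" for n by (rule test_continuous[OF T])
  show "\<phi> n \<in> Wdiv q U" for n unfolding Wdiv_def using phL phW by blast
  show "(%n. Wdiv_norm q U (%x. \<phi> n x - g x)) \<longlonglongrightarrow> 0"
   by (rule Wdiv_norm_tendsto_iff[OF op Lp_diff[OF phL(2) h q0] has_weak_div_diff[OF op phW wdiv] q0, THEN iffD2]) (use lim in simp)
  show "Linf_norm U (\<phi> n) <= Linf_norm U g" for n
   unfolding c(2) by (rule Linf_norm_le_ennreal_iff[OF op test_measurable_on[OF T] c(1), THEN iffD2]) (use \<phi>(2) in simp)
  fix x assume x: "x \<in> U" "lebesgue_point (R g) x"
  \<comment> \<open>Hence \<open>R g\<close> is among the representatives \<open>G\<close> for which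
    pointwise convergence was obtained.\<close>
  have "AE y in lebesgue_on U. R g y = g y" using R g(1) unfolding representative_choice_def by blast
  then show "(%n. \<phi> n x) \<longlonglongrightarrow> R g x" using pt x by blast
 qed
 then show "\<exists>\<phi>. (\<forall>n. \<phi> n \<in> unit_fields U) \<and>
   (%n. LINT x|lebesgue_on U. norm (\<phi> n x - g x) powr q) \<longlonglongrightarrow> 0 \<and>
   (%n. LINT x|lebesgue_on U. norm (divergence (\<phi> n) x - h x) powr q) \<longlonglongrightarrow> 0 \<and>
   tilde_converges R q U \<phi> g"
  using unit lim by blast
qed

lemma test_smooth_up_to_boundary: "f \<in> test_functions V ==> f \<in> smooth_up_to_boundary U"
 unfolding smooth_up_to_boundary_def using test_mono[of f V UNIV] by blast

text \<open>The essential bound on the sequence has to be upgraded by continuity to a bound at every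
  point of the domain, because |Du| may charge Lebesgue null sets.\<close>

lemma (in polar_decomposition) tilde_converges_extension:
 assumes wd: "has_weak_div \<Omega> g h" and g: "Linf_norm \<Omega> g <= 1"
  and gs: "\<And>n. gs n \<in> smooth_up_to_boundary \<Omega>" "tilde_converges R q \<Omega> gs g"
 shows "\<exists>F. converges_to F \<and> (\<forall>n. \<forall>x\<in>\<Omega>. gs n x = F n x)"
proof -
 note fin = bounded_finite_lebesgue_on[OF \<Omega>]
 have q0: "q > 0" using q by simp
 have "\<forall>n. \<exists>F. F \<in> test_functions UNIV \<and> (\<forall>x\<in>closure \<Omega>. gs n x = F x)"
  using gs(1) unfolding smooth_up_to_boundary_def by blast
 from choice[OF this] obtain F where F: "\<forall>n. F n \<in> test_functions UNIV \<and> (\<forall>x\<in>closure \<Omega>. gs n x = F n x)" ..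
 have T: "F n \<in> test_functions UNIV" for n using F by blast
 have eq: "gs n x = F n x" if "x \<in> \<Omega>" for n x using F that closure_subset[of \<Omega>] by blast
 have FL: "F n \<in> Lp q \<Omega>" "divergence (F n) \<in> Lp q \<Omega>" for n
  using Lp_test_function[OF fin T less_imp_le[OF q0]] Lp_test_function[OF fin divergence_test_function[OF T] less_imp_le[OF q0]] .
 have W: "has_weak_div \<Omega> (gs n) (divergence (F n))" for n by (rule has_weak_div_smooth[OF T \<Omega>(1) eq])
 have "(%n. Wdiv_norm q \<Omega> (%x. gs n x - g x)) \<longlonglongrightarrow> 0" using gs(2) unfolding tilde_converges_def by blast
 note lim = Wdiv_norm_tendsto_iff[OF \<Omega>(1) Lp_diff[OF FL(2) gh(2) q0] has_weak_div_diff[OF \<Omega>(1) W wd] q0, THEN iffD1, OF this]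
 have "(LINT x|lebesgue_on \<Omega>. norm (gs n x - g x) powr q) = (LINT x|lebesgue_on \<Omega>. norm (F n x - g x) powr q)" for n
  by (rule Bochner_Integration.integral_cong) (auto simp: eq)
 then have lim1: "(%n. LINT x|lebesgue_on \<Omega>. norm (F n x - g x) powr q) \<longlonglongrightarrow> 0" using lim by simp
 have b: "norm (F n x) <= 1" if x: "x \<in> \<Omega>" for n x
 proof (rule AE_le_continuous_imp_le[OF \<Omega>(1) _ _ x])
  show "continuous_on UNIV (%x. norm (F n x))" by (intro continuous_on_norm test_continuous[OF T])
  have m: "gs n \<in> borel_measurable (lebesgue_on \<Omega>)"
   using test_measurable_on[OF T, of n \<Omega>] by (subst measurable_cong[where g="F n"]) (auto simp: eq)
  have "Linf_norm \<Omega> (gs n) <= 1" using gs(2) g unfolding tilde_converges_def by (blast intro: order_trans)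
  then have "AE x in lebesgue_on \<Omega>. norm (gs n x) <= 1" using Linf_norm_le_ennreal_iff[OF \<Omega>(1) m, of 1] by simp
  then show "AE x in lebesgue_on \<Omega>. norm (F n x) <= 1" using AE_space by eventually_elim (simp add: eq)
 qed
 have "converges_to F" unfolding converges_to_def using T b lim1 lim by blast
 then show ?thesis using eq by blast
qed

text \<open>\<open>full_trace\<close> is a choice among all traces, so it has to be identified with
  the one found; both are L^1 limits of the same sequence.\<close>

lemma (in polar_decomposition) L1_trace_unique:
 assumes v: "integrable \<mu> v" "integrable \<mu> v'" and \<phi>: "\<And>n. \<phi> n \<in> unit_fields \<Omega>"
  and lim: "(%n. (LINT x|\<mu>. norm (\<phi> n x - v x))) \<longlonglongrightarrow> 0" "(%n. (LINT x|\<mu>. norm (\<phi> n x - v' x))) \<longlonglongrightarrow> 0"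
 shows "AE x in \<mu>. v x = v' x"
proof -
 interpret finite_measure \<mu> by (rule \<mu>(1))
 have i: "integrable \<mu> (\<phi> n)" for n
 proof (rule integrable_const_bound[of _ 1])
  show "AE x in \<mu>. norm (\<phi> n x) <= 1" "\<phi> n \<in> borel_measurable \<mu>"
   using \<phi>[of n] measurable_\<mu>[OF test_measurable[of "\<phi> n" \<Omega>]] unfolding unit_fields_def by auto
 qed
 have le: "(LINT x|\<mu>. norm (v x - v' x)) <= (LINT x|\<mu>. norm (\<phi> n x - v x)) + (LINT x|\<mu>. norm (\<phi> n x - v' x))" for n
 proof -
  have i': "integrable \<mu> (%x. norm (\<phi> n x - v x))" "integrable \<mu> (%x. norm (\<phi> n x - v' x))"
   by (intro integrable_norm Bochner_Integration.integrable_diff i v)+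
  have "(LINT x|\<mu>. norm (v x - v' x)) <= (LINT x|\<mu>. norm (\<phi> n x - v x) + norm (\<phi> n x - v' x))"
  proof (rule integral_mono)
   show "integrable \<mu> (%x. norm (v x - v' x))" by (intro integrable_norm Bochner_Integration.integrable_diff v)
   show "integrable \<mu> (%x. norm (\<phi> n x - v x) + norm (\<phi> n x - v' x))" by (intro Bochner_Integration.integrable_add i')
   show "norm (v x - v' x) <= norm (\<phi> n x - v x) + norm (\<phi> n x - v' x)" for x
    using norm_triangle_ineq4[of "\<phi> n x - v' x" "\<phi> n x - v x"] by simp
  qed
  also have "... = (LINT x|\<mu>. norm (\<phi> n x - v x)) + (LINT x|\<mu>. norm (\<phi> n x - v' x))"
   by (rule Bochner_Integration.integral_add[OF i'])
  finally show ?thesis .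
 qed
 have "(%n. (LINT x|\<mu>. norm (\<phi> n x - v x)) + (LINT x|\<mu>. norm (\<phi> n x - v' x))) \<longlonglongrightarrow> 0" using tendsto_add[OF lim] by simp
 then have "(LINT x|\<mu>. norm (v x - v' x)) <= 0" by (rule LIMSEQ_le_const) (use le in blast)
 moreover have "0 <= (LINT x|\<mu>. norm (v x - v' x))" by (rule Bochner_Integration.integral_nonneg) simp
 ultimately have "(LINT x|\<mu>. norm (v x - v' x)) = 0" by linarith
 moreover have "integrable \<mu> (%x. norm (v x - v' x))" by (intro integrable_norm Bochner_Integration.integrable_diff v)
 ultimately have "AE x in \<mu>. norm (v x - v' x) = 0" by (subst (asm) integral_nonneg_eq_0_iff_AE) auto
 then show ?thesis by eventually_elim simp
qed

text \<open>As |\<open>\<sigma>\<close>| = 1, the number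
  \<open>\<phi> n x \<bullet> \<sigma> x - 1\<close> is the inner product of
  \<open>\<phi> n x - \<sigma> x\<close> with \<open>\<sigma> x\<close>, so L^1 convergence controls
  its integral.\<close>

lemma (in polar_decomposition) pairing_tendsto:
 assumes \<phi>: "\<And>n. \<phi> n \<in> unit_fields \<Omega>" and v: "integrable \<mu> v" "AE x in \<mu>. v x = \<sigma> x"
  and lim: "(%n. (LINT x|\<mu>. norm (\<phi> n x - v x))) \<longlonglongrightarrow> 0"
 shows "(%n. (LINT x|\<mu>. \<phi> n x \<bullet> \<sigma> x)) \<longlonglongrightarrow> measure \<mu> \<Omega>"
proof -
 interpret finite_measure \<mu> by (rule \<mu>(1))
 have le: "norm ((LINT x|\<mu>. \<phi> n x \<bullet> \<sigma> x) - measure \<mu> \<Omega>) <= (LINT x|\<mu>. norm (\<phi> n x - v x))" for n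
 proof -
  have T: "\<phi> n \<in> test_functions \<Omega>" and b: "norm (\<phi> n x) <= 1" for x using \<phi>[of n] unfolding unit_fields_def by auto
  have m: "\<phi> n \<in> borel_measurable \<mu>" by (rule measurable_\<mu>[OF test_measurable[OF T]])
  have i: "integrable \<mu> (%x. \<phi> n x \<bullet> \<sigma> x)" by (rule pairing_integrable[OF test_measurable[OF T] b])
  have \<phi>i: "integrable \<mu> (\<phi> n)" by (rule integrable_const_bound[OF AE_I2 m]) (rule b)
  have "(LINT x|\<mu>. \<phi> n x \<bullet> \<sigma> x) - measure \<mu> \<Omega> = (LINT x|\<mu>. \<phi> n x \<bullet> \<sigma> x - 1)"
   using Bochner_Integration.integral_diff[OF i integrable_const[of 1]] by (simp add: space_\<mu>)
  also have "norm ... <= (LINT x|\<mu>. norm (\<phi> n x - v x))"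
  proof (rule order_trans[OF integral_norm_bound], rule integral_mono_AE)
   show "integrable \<mu> (%x. norm (\<phi> n x \<bullet> \<sigma> x - 1))" by (intro integrable_norm Bochner_Integration.integrable_diff i integrable_const)
   show "integrable \<mu> (%x. norm (\<phi> n x - v x))" by (intro integrable_norm Bochner_Integration.integrable_diff \<phi>i v(1))
   show "AE x in \<mu>. norm (\<phi> n x \<bullet> \<sigma> x - 1) <= norm (\<phi> n x - v x)"
    using \<sigma>(2) v(2)
   proof eventually_elim
    case (elim x)
    then have "\<sigma> x \<bullet> \<sigma> x = 1" by (simp add: norm_eq_1)
    then have "\<phi> n x \<bullet> \<sigma> x - 1 = (\<phi> n x - \<sigma> x) \<bullet> \<sigma> x" by (simp add: inner_diff_left)
    then show ?case using Cauchy_Schwarz_ineq2[of "\<phi> n x - \<sigma> x" "\<sigma> x"] elim by simp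
   qed
  qed
  finally show ?thesis .
 qed
 show ?thesis by (rule LIM_zero_cancel, rule Lim_null_comparison[OF always_eventually lim]) (use le in blast)
qed

theorem theorem1:
  fixes \<Omega> :: "'a::euclidean_space set"
    and p q :: real
    and u ustar :: "'a \<Rightarrow> real"
    and R :: "('a \<Rightarrow> 'a) \<Rightarrow> 'a \<Rightarrow> 'a"
  assumes "DIM('a) \<ge> 2"
    and "bounded_lipschitz_domain \<Omega>"
    and "1 < p" and "p \<le> real DIM('a) / (real DIM('a) - 1)"
    and "q = p / (p - 1)"
    and "u \<in> Lp p \<Omega>" and "ustar \<in> Lp q \<Omega>"
    and "representative_choice \<Omega> R"
  shows "ustar \<in> subdifferential p q \<Omega> (TV \<Omega>) u \<longleftrightarrow>
    u \<in> BV \<Omega> \<and>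
    (\<exists>g\<in>Wdiv0 q \<Omega>.
       Linf_norm \<Omega> g \<le> 1 \<and>
       (AE x in lebesgue_on \<Omega>. ustar x = - weak_div \<Omega> g x) \<and>
       g \<in> full_trace_domain R q \<Omega> u \<and>
       (AE x in total_variation_measure \<Omega> u. full_trace R q \<Omega> u g x = gradient_density \<Omega> u x))"
    (is "?sub \<longleftrightarrow> ?cond")
proof -
 let ?M = "lebesgue_on \<Omega>"
 let ?\<mu> = "total_variation_measure \<Omega> u" and ?\<sigma> = "gradient_density \<Omega> u"
 have op: "open \<Omega>" and bd: "bounded \<Omega>" using assms(2) unfolding bounded_lipschitz_domain_def by auto
 note fin = bounded_finite_lebesgue_on[OF op bd] and p = assms(3) and u = assms(6) and us = assms(7)
 have p0: "p > 0" using p by simp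
 \<comment> \<open>From d >= 2 follows d / (d - 1) <= 2; this places L^2 between L^q and
   L^p.\<close>
 have p2: "p <= 2"
 proof -
  have "2 <= real DIM('a)" using assms(1) by simp
  then have "real DIM('a) / (real DIM('a) - 1) <= 2" by (simp add: divide_le_eq)
  then show ?thesis using assms(4) by simp
 qed
 have q: "q > 1" "q \<ge> 2" unfolding assms(5) using p p2 by (simp_all add: less_divide_eq le_divide_eq)
 have q0: "q > 0" using q by simp
 have H: "integrable ?M (%x. f x * k x)" if "f \<in> Lp p \<Omega>" "k \<in> Lp q \<Omega>" for f k :: "'a => real"
  by (rule Holder_integrable(1)[OF that p assms(5), of 1]) simp
 have pd: "polar_decomposition \<Omega> p q u ?\<mu> ?\<sigma> g h" if "u \<in> BV \<Omega>" "g \<in> Lp q \<Omega>" "h \<in> Lp q \<Omega>" for g h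
  by (rule polar_decomposition.intro[OF op bd p assms(5) u BV_polar(1,2,4,5,6)[OF op that(1)] that(2,3)])
 show ?thesis
 proof
  assume sub: ?sub
  note D = subdifferential_TV_D[OF op bd p u sub]
  have TVu: "TV \<Omega> u = ereal (LINT x|?M. u x * ustar x)" by (rule antisym[OF D(1) D(2)[OF u]])
  have ui: "integrable ?M u" by (rule Lp_integrable[OF fin u p])
  have "u \<in> Lp 1 \<Omega>" by (rule Lp_mono[OF fin u]) (use p in auto)
  moreover have "\<exists>m. has_gradient_measure \<Omega> u m" by (rule finite_TV_imp_gradient_measure[OF op ui]) (simp add: TVu)
  ultimately have BV: "u \<in> BV \<Omega>" unfolding BV_def by simp
  have us2: "ustar \<in> Lp 2 \<Omega>" by (rule Lp_mono[OF fin us _ q(2)]) simp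
  obtain g where g: "g \<in> borel_measurable ?M" "AE x in ?M. norm (g x) <= 1"
   and wd0: "\<forall>v\<in>test_functions UNIV. (LINT x|?M. gradient v x \<bullet> g x) = (LINT x|?M. v x * ustar x)"
   using calibrating_field[OF op bd p p2 us2 D(2)] by blast
  \<comment> \<open>The divergence of \<open>g\<close>, because the field from
    \<open>calibrating_field\<close> has divergence - \<open>ustar\<close>.\<close>
  define h where "h x = - ustar x" for x
  have hL: "h \<in> Lp q \<Omega>" unfolding h_def[abs_def] by (rule Lp_minus[OF us])
  have gL: "g \<in> Lp q \<Omega>" by (rule Lp_bounded[OF fin g less_imp_le[OF q0]])
  have Linf: "Linf_norm \<Omega> g <= 1" using Linf_norm_le_ennreal_iff[OF op g(1), of 1] g(2) by simp
  have wd: "\<forall>v\<in>test_functions UNIV. (LINT x|?M. gradient v x \<bullet> g x) = - (LINT x|?M. v x * h x)"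
   using wd0 unfolding h_def by simp
  note A = ex_tilde_approximation[OF assms(2) q(1) assms(8) g(1) Linf hL wd]
  obtain \<phi> where \<phi>: "\<forall>n. \<phi> n \<in> unit_fields \<Omega>" "(%n. LINT x|?M. norm (\<phi> n x - g x) powr q) \<longlonglongrightarrow> 0"
   "(%n. LINT x|?M. norm (divergence (\<phi> n) x - h x) powr q) \<longlonglongrightarrow> 0" "tilde_converges R q \<Omega> \<phi> g"
   using A(3) by (elim exE conjE)
  have \<phi>T: "\<phi> n \<in> test_functions \<Omega>" "norm (\<phi> n x) <= 1" for n x using \<phi>(1) unfolding unit_fields_def by auto
  interpret polar_decomposition \<Omega> p q u ?\<mu> ?\<sigma> g h by (rule pd[OF BV gL hL])
  have c\<phi>: "converges_to \<phi>"
   unfolding converges_to_def using \<phi>(2,3) \<phi>T(2) test_mono[OF \<phi>T(1), of UNIV] by auto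
  \<comment> \<open>The pairing with Du equals minus the integral of u div \<open>\<phi> n\<close>,
    which tends to the integral of u \<open>ustar\<close>. That is TV(u), the total mass of |Du|, so
    the defect vanishes along this sequence.\<close>
  have pair: "(%n. (LINT x|?\<mu>. \<phi> n x \<bullet> ?\<sigma> x)) \<longlonglongrightarrow> measure ?\<mu> \<Omega>"
  proof -
   have "(%n. LINT x|?M. u x * divergence (\<phi> n) x) \<longlonglongrightarrow> (LINT x|?M. u x * h x)"
    by (rule Holder_tendsto[OF u Lp_test_function[OF fin divergence_test_function[OF \<phi>T(1)] less_imp_le[OF q0]] hL p \<phi>(3)])
   from tendsto_minus[OF this] have "(%n. (LINT x|?\<mu>. \<phi> n x \<bullet> ?\<sigma> x)) \<longlonglongrightarrow> (LINT x|?M. u x * ustar x)"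
    unfolding polar[OF \<phi>T(1)] h_def by simp
   moreover have "(LINT x|?M. u x * ustar x) = measure ?\<mu> \<Omega>" using TVu BV_polar(7)[OF op BV] by simp
   ultimately show ?thesis by simp
  qed
  \<comment> \<open>A trace has to be the limit along every admissible sequence;
    \<open>\<phi>\<close> is the reference sequence with vanishing defect to which the others are
    compared.\<close>
  have tr: "is_full_trace R q \<Omega> u g ?\<sigma>"
   unfolding is_full_trace_def
  proof (intro conjI allI impI)
   show "integrable ?\<mu> ?\<sigma>" by (rule \<sigma>(1))
   fix gs assume "(\<forall>n. gs n \<in> smooth_up_to_boundary \<Omega>) \<and> tilde_converges R q \<Omega> gs g"
   then obtain F where F: "converges_to F" "\<forall>n. \<forall>x\<in>\<Omega>. gs n x = F n x"
    using tilde_converges_extension[OF A(2) Linf, of gs R] by blast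
   have "(LINT x|?\<mu>. norm (gs n x - ?\<sigma> x)) = (LINT x|?\<mu>. norm (F n x - ?\<sigma> x))" for n
    by (rule Bochner_Integration.integral_cong) (use F(2) space_\<mu> in auto)
   then show "(%n. (LINT x|?\<mu>. norm (gs n x - ?\<sigma> x))) \<longlonglongrightarrow> 0"
    using trace_convergence[OF c\<phi> pair F(1)] by simp
  qed
  have tr': "is_full_trace R q \<Omega> u g (full_trace R q \<Omega> u g)" unfolding full_trace_def by (rule someI[of _ ?\<sigma>], rule tr)
  have sm: "\<forall>n. \<phi> n \<in> smooth_up_to_boundary \<Omega>" using test_smooth_up_to_boundary[OF \<phi>T(1)] by blast
  have "AE x in ?\<mu>. full_trace R q \<Omega> u g x = ?\<sigma> x"
  proof (rule L1_trace_unique[where \<phi>=\<phi>])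
   have conv: "integrable ?\<mu> v \<and> (%n. (LINT x|?\<mu>. norm (\<phi> n x - v x))) \<longlonglongrightarrow> 0" if "is_full_trace R q \<Omega> u g v" for v
    using conjunct1[OF that[unfolded is_full_trace_def]] conjunct2[OF that[unfolded is_full_trace_def], rule_format, of \<phi>] sm \<phi>(4) by simp
   show "integrable ?\<mu> (full_trace R q \<Omega> u g)" "(%n. (LINT x|?\<mu>. norm (\<phi> n x - full_trace R q \<Omega> u g x))) \<longlonglongrightarrow> 0"
    by (rule conjunct1[OF conv[OF tr']], rule conjunct2[OF conv[OF tr']])
   show "integrable ?\<mu> ?\<sigma>" "(%n. (LINT x|?\<mu>. norm (\<phi> n x - ?\<sigma> x))) \<longlonglongrightarrow> 0"
    by (rule conjunct1[OF conv[OF tr]], rule conjunct2[OF conv[OF tr]])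
  qed (use \<phi>(1) in simp)
  moreover have "g \<in> full_trace_domain R q \<Omega> u" using A(1) tr unfolding full_trace_domain_def Wdiv0_def by auto
  moreover have "has_weak_div \<Omega> g (weak_div \<Omega> g)" unfolding weak_div_def by (rule someI[of _ h], rule A(2))
  from has_weak_div_unique[OF op A(2) this] have "AE x in ?M. ustar x = - weak_div \<Omega> g x"
   by eventually_elim (simp add: h_def)
  ultimately have "Linf_norm \<Omega> g <= 1 \<and> (AE x in ?M. ustar x = - weak_div \<Omega> g x) \<and> g \<in> full_trace_domain R q \<Omega> u \<and>
    (AE x in ?\<mu>. full_trace R q \<Omega> u g x = ?\<sigma> x)" using Linf by (intro conjI)
  with A(1) show ?cond by (intro conjI[OF BV] bexI[of _ g]) (auto simp only: Int_iff)
 next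
  assume c: ?cond
  then have BV: "u \<in> BV \<Omega>" by (rule conjunct1)
  from c obtain g where g: "g \<in> Wdiv0 q \<Omega>" "Linf_norm \<Omega> g <= 1" "AE x in ?M. ustar x = - weak_div \<Omega> g x"
   "g \<in> full_trace_domain R q \<Omega> u" "AE x in ?\<mu>. full_trace R q \<Omega> u g x = ?\<sigma> x" by (elim conjE bexE)
  have gL: "g \<in> Lp q \<Omega>" using g(1) unfolding Wdiv0_def Wdiv_def by simp
  obtain h where h: "h \<in> Lp q \<Omega>" "has_weak_div \<Omega> g h" using g(1) unfolding Wdiv0_def Wdiv_def by blast
  have "has_weak_div \<Omega> g (weak_div \<Omega> g)" unfolding weak_div_def by (rule someI[of _ h], rule h(2))
  from has_weak_div_unique[OF op h(2) this] g(3) have ush: "AE x in ?M. ustar x = - h x" by eventually_elim simp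
  have intus: "(LINT x|?M. v x * ustar x) = - (LINT x|?M. v x * h x)" if v: "v \<in> Lp p \<Omega>" for v
  proof -
   have "(LINT x|?M. v x * ustar x) = (LINT x|?M. - (v x * h x))"
    by (rule integral_cong_AE)
     (use Lp_D(1)[OF v] Lp_D(1)[OF us] Lp_D(1)[OF h(1)] ush in \<open>auto elim!: eventually_mono intro!: borel_measurable_times borel_measurable_uminus\<close>)
   then show ?thesis by simp
  qed
  \<comment> \<open>Membership in the closure of test fields provides fields without a sup bound.
    The identity up to the boundary is extracted from it, and bounded test fields are then built
    anew from that identity.\<close>
  have wd: "\<forall>v\<in>test_functions UNIV. (LINT x|?M. gradient v x \<bullet> g x) = - (LINT x|?M. v x * h x)"
   by (rule ballI, rule Wdiv0_integration_by_parts[OF op bd q(1) g(1) h])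
  note A = ex_tilde_approximation[OF assms(2) q(1) assms(8) Lp_D(1)[OF gL] g(2) h(1) wd]
  obtain \<phi> where \<phi>: "\<forall>n. \<phi> n \<in> unit_fields \<Omega>" "(%n. LINT x|?M. norm (\<phi> n x - g x) powr q) \<longlonglongrightarrow> 0"
   "(%n. LINT x|?M. norm (divergence (\<phi> n) x - h x) powr q) \<longlonglongrightarrow> 0" "tilde_converges R q \<Omega> \<phi> g"
   using A(3) by (elim exE conjE)
  have \<phi>T: "\<phi> n \<in> test_functions \<Omega>" "norm (\<phi> n x) <= 1" for n x using \<phi>(1) unfolding unit_fields_def by auto
  interpret polar_decomposition \<Omega> p q u ?\<mu> ?\<sigma> g h by (rule pd[OF BV gL h(1)])
  have tr: "is_full_trace R q \<Omega> u g (full_trace R q \<Omega> u g)"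
  proof -
   obtain v where "is_full_trace R q \<Omega> u g v" using g(4) unfolding full_trace_domain_def by blast
   then show ?thesis unfolding full_trace_def by (rule someI[of "is_full_trace R q \<Omega> u g"])
  qed
  have sm: "\<forall>n. \<phi> n \<in> smooth_up_to_boundary \<Omega>" using test_smooth_up_to_boundary[OF \<phi>T(1)] by blast
  \<comment> \<open>Here the trace condition enters: L^1 convergence to a field equal to
    \<open>?\<sigma>\<close> almost everywhere gives the full mass in the limit.\<close>
  have pair: "(%n. (LINT x|?\<mu>. \<phi> n x \<bullet> ?\<sigma> x)) \<longlonglongrightarrow> measure ?\<mu> \<Omega>"
  proof (rule pairing_tendsto[OF \<phi>(1)[rule_format] conjunct1[OF tr[unfolded is_full_trace_def]] g(5)])
   show "(%n. (LINT x|?\<mu>. norm (\<phi> n x - full_trace R q \<Omega> u g x))) \<longlonglongrightarrow> 0"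
    by (rule conjunct2[OF tr[unfolded is_full_trace_def], rule_format]) (use sm \<phi>(4) in blast)
  qed
  have dL: "divergence (\<phi> n) \<in> Lp q \<Omega>" for n
   by (rule Lp_test_function[OF fin divergence_test_function[OF \<phi>T(1)] less_imp_le[OF q0]])
  have conv: "(%n. - (LINT x|?M. v x * divergence (\<phi> n) x)) \<longlonglongrightarrow> (LINT x|?M. v x * ustar x)" if v: "v \<in> Lp p \<Omega>" for v
   unfolding intus[OF v] by (rule tendsto_minus, rule Holder_tendsto[OF v dL h(1) p \<phi>(3)])
  \<comment> \<open>Two limits of the same numbers: by \<open>polar\<close>, minus the integral of u
    div \<open>\<phi> n\<close> is the pairing with \<open>?\<sigma>\<close>.\<close>
  have "(LINT x|?M. u x * ustar x) = measure ?\<mu> \<Omega>"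
   using LIMSEQ_unique[OF conv[OF u]] pair unfolding polar[OF \<phi>T(1)] by simp
  then have TVu: "TV \<Omega> u = ereal (LINT x|?M. u x * ustar x)" using BV_polar(7)[OF op BV] by simp
  \<comment> \<open>Each - \<open>\<phi> n\<close> competes in the supremum that defines TV, and the
    inequality passes to the limit.\<close>
  have upper: "ereal (LINT x|?M. v x * ustar x) <= TV \<Omega> v" if v: "v \<in> Lp p \<Omega>" for v
  proof (rule LIMSEQ_le_const2[OF tendsto_ereal[OF conv[OF v]]])
   have "ereal (- (LINT x|?M. v x * divergence (\<phi> n) x)) <= TV \<Omega> v" for n
   proof -
    have "divergence (%x. - \<phi> n x) x = - divergence (\<phi> n) x" for x
     using divergence_linear_scaleR[OF test_differentiable[OF \<phi>T(1)], of "-1" n x] by simp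
    then show ?thesis using TV_upper[OF op unit_fields_minus[OF \<phi>(1)[rule_format]], of v n] by simp
   qed
   then show "\<exists>N. \<forall>n\<ge>N. ereal (- (LINT x|?M. v x * divergence (\<phi> n) x)) <= TV \<Omega> v" by blast
  qed
  have "ereal (LINT x|?M. (v x - u x) * ustar x) + TV \<Omega> u <= TV \<Omega> v" if v: "v \<in> Lp p \<Omega>" for v
  proof -
   have "(LINT x|?M. (v x - u x) * ustar x) = (LINT x|?M. v x * ustar x) - (LINT x|?M. u x * ustar x)"
    unfolding left_diff_distrib by (rule Bochner_Integration.integral_diff[OF H[OF v us] H[OF u us]])
   then show ?thesis using upper[OF v] unfolding TVu by simp
  qed
  then show ?sub unfolding subdifferential_def using us TVu by simp
 qed
qed

end
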